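(* Let $\mathcal O$ be a cyclic operad, let $f_*$ be the modular envelope construction, and let $f_!$ be extension by zero. Then there is an isomorphism of ($\mathfrak K$-twisted) modular operads $$f_*(D(\mathcal O))\cong D(f_!(\mathcal O)).$$
   Context: All objects are over $dgVect_k$, $k$ a field of characteristic $0$, and are considered without units. A cyclic operad $\mathcal O=\{\mathcal O((n))\}$ has dg $S_n$-modules $\mathcal O((n))$ and compositions indexed by trees with labeled leaves; a modular operad $\mathcal M=\{\mathcal M(g,n)\}$ (in the sense of Getzler–Kapranov, so $2g-2+n>0$) has dg $S_n$-modules and compositions indexed by connected graphs with genus-labeled vertices, where the total genus of a graph is its first Betti number plus the sum of the vertex labels. Cyclic operads are considered in the arities corresponding to genus $0$, so that there is an inclusion $f$ of the category encoding cyclic operads (trees) into the one encoding modular operads (as genus $0$ graphs). The odd cyclic operads and $\mathfrak K$-twisted modular operads are the variants in which the composition along a graph $\Gamma$ is twisted by $\det(k^{Edges(\Gamma)})$ placed in degree $|Edges(\Gamma)|$. The functor $f^*$ restricts a (twisted) modular operad to genus $0$; the modular envelope $f_*$ is the left adjoint of $f^*$ (left Kan extension), on untwisted and on twisted objects. Extension by zero: $f_!(\mathcal O)(0,n)=\mathcal O((n))$ and $f_!(\mathcal O)(g,n)=0$ for $g\ge1$. The Feynman transform $D$ sends cyclic operads to odd cyclic operads and modular operads to $\mathfrak K$-twisted modular operads (and conversely): $D(\mathcal O)$ is the free object of the other parity on the level-wise linear dual $\mathcal O^*$, i.e. spanned by graphs (trees in the cyclic case) with vertices labeled by $\mathcal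 O^*$, with differential the sum of the differential induced by that of $\mathcal O$ and the derivation given on generators by the sum over all one-edge graphs of the duals of the corresponding compositions in $\mathcal O$. As usual, $\mathcal O$ is taken so that linear duality is compatible with $\otimes$ on the spaces involved. *)

theory Defs
  imports Complex_Main "HOL-Library.Poly_Mapping" "HOL-Library.Function_Algebras"
begin

section \<open>Graphs\<close>

text \<open>
  A graph has ordered vertices, each labelled by its genus and its valence; the flag
  \<open>(i, k)\<close> is the \<open>k\<close>-th flag at the \<open>i\<close>-th vertex.
  Edges are pairs of flags, and the \<open>j\<close>-th leg is the flag \<open>legs \<Gamma> ! j\<close>.
  The orderings of vertices, of edges and of the two flags of an edge are
  presentation only: compositions are required below to be (anti)symmetric under changing them.
\<close>

type_synonym flag = "nat \<times> nat"

datatype graph = Graph (verts: "(nat \<times> nat) list") (edges: "(flag \<times> flag) list") (legs: "flag list")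

definition flags :: "graph \<Rightarrow> flag set" where
  "flags \<Gamma> = {(i, k). i < length (verts \<Gamma>) \<and> k < snd (verts \<Gamma> ! i)}"

definition flag_list :: "graph \<Rightarrow> flag list" where
  "flag_list \<Gamma> = map fst (edges \<Gamma>) @ map snd (edges \<Gamma>) @ legs \<Gamma>"

definition adjacent :: "graph \<Rightarrow> (nat \<times> nat) set" where
  "adjacent \<Gamma> = {(fst a, fst b) | a b. (a, b) \<in> set (edges \<Gamma>) \<or> (b, a) \<in> set (edges \<Gamma>)}"

definition connected_graph :: "graph \<Rightarrow> bool" where
  "connected_graph \<Gamma> \<longleftrightarrow> verts \<Gamma> \<noteq> [] \<and>
     (\<forall>i < length (verts \<Gamma>). \<forall>j < length (verts \<Gamma>). (i, j) \<in> (adjacent \<Gamma>)\<^sup>*)"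

definition stable :: "nat \<Rightarrow> nat \<Rightarrow> bool" where
  "stable g n \<longleftrightarrow> 2 * g + n > 2"

definition stable_graph :: "graph \<Rightarrow> bool" where
  "stable_graph \<Gamma> \<longleftrightarrow> distinct (flag_list \<Gamma>) \<and> set (flag_list \<Gamma>) = flags \<Gamma> \<and>
     connected_graph \<Gamma> \<and> (\<forall>(g, n) \<in> set (verts \<Gamma>). stable g n)"

text \<open>The first Betti number of a connected graph is \<open>|E| - |V| + 1\<close>.\<close>

definition genus :: "graph \<Rightarrow> nat" where
  "genus \<Gamma> = sum_list (map fst (verts \<Gamma>)) + (length (edges \<Gamma>) + 1 - length (verts \<Gamma>))"

definition arity :: "graph \<Rightarrow> nat" where
  "arity \<Gamma> = length (legs \<Gamma>)"

text \<open>
  Graphs with vertex labels and total genus in \<open>Is\<close>: for \<open>Is = {0}\<close> these are the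
  trees (with all genus labels \<open>0\<close>), for \<open>Is = UNIV\<close> all stable graphs.
\<close>

definition graphs :: "nat set \<Rightarrow> graph set" where
  "graphs Is = {\<Gamma>. stable_graph \<Gamma> \<and> fst ` set (verts \<Gamma>) \<subseteq> Is \<and> genus \<Gamma> \<in> Is}"

definition corolla :: "nat \<Rightarrow> nat \<Rightarrow> graph" where
  "corolla g n = Graph [(g, n)] [] (map (Pair 0) [0..<n])"

text \<open>
  Stable graphs without edges are the corollas with permuted legs; composing along them
  is the action of the symmetric groups.
\<close>

definition permuted_corollas :: "graph set" where
  "permuted_corollas = {\<Gamma>. stable_graph \<Gamma> \<and> edges \<Gamma> = []}"

definition corolla_inv :: "graph \<Rightarrow> graph" where
  "corolla_inv \<Gamma> = Graph (verts \<Gamma>) []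
     (map (\<lambda>k. (0, THE j. j < arity \<Gamma> \<and> legs \<Gamma> ! j = (0, k))) [0..<arity \<Gamma>])"

definition list_insert :: "nat \<Rightarrow> 'b list \<Rightarrow> 'b list \<Rightarrow> 'b list" where
  "list_insert i ys xs = take i xs @ ys @ drop (Suc i) xs"

text \<open>
  Insertion of \<open>\<Delta>\<close> into the \<open>i\<close>-th vertex of \<open>\<Gamma>\<close>: the \<open>k\<close>-th flag of
  that vertex is identified with the \<open>k\<close>-th leg of \<open>\<Delta>\<close>. The edges of \<open>\<Delta>\<close>
  come after those of \<open>\<Gamma>\<close>.
\<close>

definition graph_insert :: "graph \<Rightarrow> nat \<Rightarrow> graph \<Rightarrow> graph" where
  "graph_insert \<Gamma> i \<Delta> =
    (let inner = (\<lambda>(a, b). (i + a, b));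
         outer = (\<lambda>(j, k). if j < i then (j, k)
                           else if j = i then inner (legs \<Delta> ! k)
                           else (j + length (verts \<Delta>) - 1, k))
     in Graph (list_insert i (verts \<Delta>) (verts \<Gamma>))
              (map (map_prod outer outer) (edges \<Gamma>) @ map (map_prod inner inner) (edges \<Delta>))
              (map outer (legs \<Gamma>)))"

text \<open>Simultaneous insertion into all vertices, performed from the last vertex to the first.\<close>

definition graph_insert_all :: "graph \<Rightarrow> graph list \<Rightarrow> graph" where
  "graph_insert_all \<Gamma> \<Delta>s = foldr (\<lambda>(i, \<Delta>) \<Theta>. graph_insert \<Theta> i \<Delta>) (enumerate 0 \<Delta>s) \<Gamma>"

text \<open>
  Elementary changes of presentation; together with the insertion of permuted corollas
  they generate all isomorphisms of graphs.
\<close>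

definition swap_at :: "nat \<Rightarrow> 'b list \<Rightarrow> 'b list" where
  "swap_at i xs = xs[i := xs ! Suc i, Suc i := xs ! i]"

definition swap_verts :: "nat \<Rightarrow> graph \<Rightarrow> graph" where
  "swap_verts i \<Gamma> =
    (let \<sigma> = (\<lambda>(a, b). (if a = i then Suc i else if a = Suc i then i else a, b))
     in Graph (swap_at i (verts \<Gamma>)) (map (map_prod \<sigma> \<sigma>) (edges \<Gamma>)) (map \<sigma> (legs \<Gamma>)))"

definition swap_edges :: "nat \<Rightarrow> graph \<Rightarrow> graph" where
  "swap_edges i \<Gamma> = Graph (verts \<Gamma>) (swap_at i (edges \<Gamma>)) (legs \<Gamma>)"

definition flip_edge :: "nat \<Rightarrow> graph \<Rightarrow> graph" where
  "flip_edge i \<Gamma> = Graph (verts \<Gamma>) ((edges \<Gamma>)[i := prod.swap (edges \<Gamma> ! i)]) (legs \<Gamma>)"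


section \<open>Cyclic and modular operads\<close>

definition sg :: "int \<Rightarrow> 'k::ring_1" where
  "sg p = (if even p then 1 else - 1)"

text \<open>
  The degree of the twist \<open>det(k^Edges)\<close>, placed in degree \<open>|Edges|\<close>; the parameter
  \<open>tw\<close> distinguishes the odd / twisted structures (\<open>True\<close>) from the untwisted ones.
\<close>

definition tdeg :: "bool \<Rightarrow> graph \<Rightarrow> int" where
  "tdeg tw \<Gamma> = (if tw then int (length (edges \<Gamma>)) else 0)"

text \<open>
  A family of graded vector spaces \<open>cell M g n p\<close> (genus, arity, cohomological degree),
  all realised as subspaces of one ambient vector space \<open>(scl M, UNIV)\<close>. Nothing is assumed about
  how cells of different index meet, so all operations take the degrees of their arguments.
  \<open>cmp M \<Gamma> ps xs\<close> composes the elements \<open>xs\<close> of degrees \<open>ps\<close>, one for each vertex;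
  in the twisted case it is the value on \<open>(e\<^sub>1 \<and> \<dots> \<and> e\<^sub>m) \<otimes> x\<^sub>0 \<otimes> x\<^sub>1 \<otimes> \<dots>\<close>
  with edges and vertices in the order of \<open>\<Gamma>\<close>.
\<close>

record ('k, 'a) opd =
  scl :: "'k \<Rightarrow> 'a \<Rightarrow> 'a"
  cell :: "nat \<Rightarrow> nat \<Rightarrow> int \<Rightarrow> 'a set"
  dif :: "nat \<Rightarrow> nat \<Rightarrow> int \<Rightarrow> 'a \<Rightarrow> 'a"
  cmp :: "graph \<Rightarrow> int list \<Rightarrow> 'a list \<Rightarrow> 'a"

definition decorates :: "('k, 'a) opd \<Rightarrow> (nat \<times> nat) list \<Rightarrow> int list \<Rightarrow> 'a list \<Rightarrow> bool" where
  "decorates M vs ps xs \<longleftrightarrow> length ps = length vs \<and> length xs = length vs \<and>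
     (\<forall>i < length vs. xs ! i \<in> cell M (fst (vs ! i)) (snd (vs ! i)) (ps ! i))"

text \<open>
  Operads whose compositions are indexed by \<open>graphs Is\<close>. The signs follow the Koszul rule for
  \<open>det(k^Edges) \<otimes> \<Otimes>\<^sub>v M(v) \<rightarrow> M\<close> of degree \<open>0\<close>.
\<close>

locale operad =
  fixes tw :: bool and Is :: "nat set" and M :: "('k::field_char_0, 'a::ab_group_add) opd"
  assumes ambient: "vector_space (scl M)"
    and cell_subspace: "\<And>g n p. g \<in> Is \<Longrightarrow> stable g n \<Longrightarrow> module.subspace (scl M) (cell M g n p)"
    and dif_cell: "\<And>g n p x. g \<in> Is \<Longrightarrow> stable g n \<Longrightarrow> x \<in> cell M g n p \<Longrightarrow>
          dif M g n p x \<in> cell M g n (p + 1)"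
    and dif_linear: "\<And>g n p c x y. g \<in> Is \<Longrightarrow> stable g n \<Longrightarrow>
          x \<in> cell M g n p \<Longrightarrow> y \<in> cell M g n p \<Longrightarrow>
          dif M g n p (scl M c x + y) = scl M c (dif M g n p x) + dif M g n p y"
    and dif_dif: "\<And>g n p x. g \<in> Is \<Longrightarrow> stable g n \<Longrightarrow> x \<in> cell M g n p \<Longrightarrow>
          dif M g n (p + 1) (dif M g n p x) = 0"
    and cmp_cell: "\<And>\<Gamma> ps xs. \<Gamma> \<in> graphs Is \<Longrightarrow> decorates M (verts \<Gamma>) ps xs \<Longrightarrow>
          cmp M \<Gamma> ps xs \<in> cell M (genus \<Gamma>) (arity \<Gamma>) (sum_list ps + tdeg tw \<Gamma>)"
    and cmp_multilinear: "\<And>\<Gamma> ps xs i c x y. \<Gamma> \<in> graphs Is \<Longrightarrow> i < length (verts \<Gamma>) \<Longrightarrow>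
          decorates M (verts \<Gamma>) ps (xs[i := x]) \<Longrightarrow> decorates M (verts \<Gamma>) ps (xs[i := y]) \<Longrightarrow>
          cmp M \<Gamma> ps (xs[i := scl M c x + y]) =
            scl M c (cmp M \<Gamma> ps (xs[i := x])) + cmp M \<Gamma> ps (xs[i := y])"
    and cmp_corolla: "\<And>g n p x. g \<in> Is \<Longrightarrow> stable g n \<Longrightarrow> x \<in> cell M g n p \<Longrightarrow>
          cmp M (corolla g n) [p] [x] = x"
    and cmp_swap_verts: "\<And>\<Gamma> ps xs i. \<Gamma> \<in> graphs Is \<Longrightarrow> decorates M (verts \<Gamma>) ps xs \<Longrightarrow>
          Suc i < length (verts \<Gamma>) \<Longrightarrow>
          cmp M (swap_verts i \<Gamma>) (swap_at i ps) (swap_at i xs) =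
            scl M (sg (ps ! i * ps ! Suc i)) (cmp M \<Gamma> ps xs)"
    and cmp_swap_edges: "\<And>\<Gamma> ps xs i. \<Gamma> \<in> graphs Is \<Longrightarrow> decorates M (verts \<Gamma>) ps xs \<Longrightarrow>
          Suc i < length (edges \<Gamma>) \<Longrightarrow>
          cmp M (swap_edges i \<Gamma>) ps xs = scl M (if tw then - 1 else 1) (cmp M \<Gamma> ps xs)"
    and cmp_flip_edge: "\<And>\<Gamma> ps xs i. \<Gamma> \<in> graphs Is \<Longrightarrow> decorates M (verts \<Gamma>) ps xs \<Longrightarrow>
          i < length (edges \<Gamma>) \<Longrightarrow> cmp M (flip_edge i \<Gamma>) ps xs = cmp M \<Gamma> ps xs"
    and cmp_insert: "\<And>\<Gamma> ps xs i \<Delta> qs ys. \<Gamma> \<in> graphs Is \<Longrightarrow> \<Delta> \<in> graphs Is \<Longrightarrow>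
          i < length (verts \<Gamma>) \<Longrightarrow> verts \<Gamma> ! i = (genus \<Delta>, arity \<Delta>) \<Longrightarrow>
          decorates M (verts \<Delta>) qs ys \<Longrightarrow> ps ! i = sum_list qs + tdeg tw \<Delta> \<Longrightarrow>
          xs ! i = cmp M \<Delta> qs ys \<Longrightarrow> decorates M (verts \<Gamma>) ps xs \<Longrightarrow>
          cmp M \<Gamma> ps xs = scl M (sg (tdeg tw \<Delta> * sum_list (take i ps)))
            (cmp M (graph_insert \<Gamma> i \<Delta>) (list_insert i qs ps) (list_insert i ys xs))"
    and dif_cmp: "\<And>\<Gamma> ps xs. \<Gamma> \<in> graphs Is \<Longrightarrow> decorates M (verts \<Gamma>) ps xs \<Longrightarrow>
          dif M (genus \<Gamma>) (arity \<Gamma>) (sum_list ps + tdeg tw \<Gamma>) (cmp M \<Gamma> ps xs) =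
            (\<Sum>i < length (verts \<Gamma>). scl M (sg (tdeg tw \<Gamma> + sum_list (take i ps)))
               (cmp M \<Gamma> (ps[i := ps ! i + 1])
                 (xs[i := dif M (fst (verts \<Gamma> ! i)) (snd (verts \<Gamma> ! i)) (ps ! i) (xs ! i)])))"

abbreviation cyclic_operad :: "bool \<Rightarrow> ('k::field_char_0, 'a::ab_group_add) opd \<Rightarrow> bool" where
  "cyclic_operad tw \<equiv> operad tw {0}"

abbreviation modular_operad :: "bool \<Rightarrow> ('k::field_char_0, 'a::ab_group_add) opd \<Rightarrow> bool" where
  "modular_operad tw \<equiv> operad tw UNIV"

text \<open>
  As for \<open>iso\<close> in HOL-Algebra, an isomorphism is a structure preserving bijection of the data.
  It is in particular equivariant, because \<open>permuted_corollas \<subseteq> graphs UNIV\<close>.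
\<close>

definition modular_iso ::
  "bool \<Rightarrow> ('k, 'a::ab_group_add) opd \<Rightarrow> ('k, 'b::ab_group_add) opd \<Rightarrow>
   (nat \<Rightarrow> nat \<Rightarrow> int \<Rightarrow> 'a \<Rightarrow> 'b) \<Rightarrow> bool" where
  "modular_iso tw M N \<phi> \<longleftrightarrow>
     (\<forall>g n p. stable g n \<longrightarrow> bij_betw (\<phi> g n p) (cell M g n p) (cell N g n p)) \<and>
     (\<forall>g n p c. \<forall>x \<in> cell M g n p. \<forall>y \<in> cell M g n p. stable g n \<longrightarrow>
        \<phi> g n p (scl M c x + y) = scl N c (\<phi> g n p x) + \<phi> g n p y) \<and>
     (\<forall>g n p. \<forall>x \<in> cell M g n p. stable g n \<longrightarrow>
        \<phi> g n (p + 1) (dif M g n p x) = dif N g n p (\<phi> g n p x)) \<and>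
     (\<forall>\<Gamma> \<in> graphs UNIV. \<forall>ps xs. decorates M (verts \<Gamma>) ps xs \<longrightarrow>
        \<phi> (genus \<Gamma>) (arity \<Gamma>) (sum_list ps + tdeg tw \<Gamma>) (cmp M \<Gamma> ps xs) =
        cmp N \<Gamma> ps (map (\<lambda>i. \<phi> (fst (verts \<Gamma> ! i)) (snd (verts \<Gamma> ! i)) (ps ! i) (xs ! i))
                           [0..<length (verts \<Gamma>)]))"

definition extend_by_zero :: "('k, 'a::zero) opd \<Rightarrow> ('k, 'a) opd" where
  "extend_by_zero \<O> = \<lparr>
     scl = scl \<O>,
     cell = (\<lambda>g n p. if g = 0 then cell \<O> 0 n p else {0}),
     dif = (\<lambda>g n p x. if g = 0 then dif \<O> 0 n p x else 0),
     cmp = (\<lambda>\<Gamma> ps xs. if genus \<Gamma> = 0 then cmp \<O> \<Gamma> ps xs else 0)\<rparr>"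


section \<open>Formal sums of decorated graphs and their quotients\<close>

text \<open>
  A generator \<open>(\<Gamma>, ps, xs)\<close> is a graph with its \<open>i\<close>-th vertex decorated by \<open>xs ! i\<close>
  of degree \<open>ps ! i\<close>.
\<close>

type_synonym 'b gen = "graph \<times> int list \<times> 'b list"

definition fscale :: "'k::field_char_0 \<Rightarrow> ('c \<Rightarrow>\<^sub>0 'k) \<Rightarrow> ('c \<Rightarrow>\<^sub>0 'k)" where
  "fscale c f = Poly_Mapping.map ((*) c) f"

lemma lookup_fscale: "Poly_Mapping.lookup (fscale c f) x = c * Poly_Mapping.lookup f x"
  by (simp add: fscale_def map.rep_eq when_def)

interpretation formal: vector_space fscale
  by unfold_locales
    (auto intro!: poly_mapping_eqI simp: lookup_fscale lookup_add algebra_simps)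

definition lin_ext :: "('c \<Rightarrow> ('d \<Rightarrow>\<^sub>0 'k::field_char_0)) \<Rightarrow> ('c \<Rightarrow>\<^sub>0 'k) \<Rightarrow> ('d \<Rightarrow>\<^sub>0 'k)" where
  "lin_ext h f = (\<Sum>x \<in> Poly_Mapping.keys f. fscale (Poly_Mapping.lookup f x) (h x))"

text \<open>
  The quotient of a space of formal sums by a subspace \<open>R\<close> is realised on a complement of
  \<open>R\<close>: \<open>quot R\<close> is a linear projection with kernel \<open>R\<close>, and the class of a formal sum
  is its image.
\<close>

definition quot :: "('c \<Rightarrow>\<^sub>0 'k::field_char_0) set \<Rightarrow> ('c \<Rightarrow>\<^sub>0 'k) \<Rightarrow> ('c \<Rightarrow>\<^sub>0 'k)" where
  "quot R = (SOME q. Vector_Spaces.linear fscale fscale q \<and> (\<forall>x. q (q x) = q x) \<and>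
                     (\<forall>x. q x = 0 \<longleftrightarrow> x \<in> R))"

lemma quot:
  assumes "formal.subspace R"
  shows "Vector_Spaces.linear fscale fscale (quot R)" "quot R (quot R x) = quot R x"
    "quot R x = 0 \<longleftrightarrow> x \<in> R"
proof -
  interpret fp: vector_space_pair fscale fscale ..
  obtain g where g: "range g \<subseteq> R" "Vector_Spaces.linear fscale fscale g" "\<forall>v\<in>R. g v = v"
    using fp.linear_exists_left_inverse_on[OF formal.linear_id assms inj_on_id] by auto
  let ?q = "\<lambda>x. x - g x"
  have lin: "Vector_Spaces.linear fscale fscale ?q"
    using fp.linear_compose_sub[OF formal.linear_ident g(2)] by simp
  have "?q (?q x) = ?q x" for x
    using g fp.linear_diff[OF g(2)] by (simp add: image_subset_iff)
  moreover have "?q x = 0 \<longleftrightarrow> x \<in> R" for x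
    using g by (metis eq_iff_diff_eq_0 range_subsetD)
  ultimately have "\<exists>q. Vector_Spaces.linear fscale fscale q \<and> (\<forall>x. q (q x) = q x) \<and>
      (\<forall>x. q x = 0 \<longleftrightarrow> x \<in> R)"
    using lin by blast
  from someI_ex[OF this] show "Vector_Spaces.linear fscale fscale (quot R)"
    "quot R (quot R x) = quot R x" "quot R x = 0 \<longleftrightarrow> x \<in> R"
    unfolding quot_def by blast+
qed

definition gdeg :: "bool \<Rightarrow> 'b gen \<Rightarrow> int" where
  "gdeg tw = (\<lambda>(\<Gamma>, ps, xs). sum_list ps + tdeg tw \<Gamma>)"

definition gens :: "nat set \<Rightarrow> nat set \<Rightarrow> ('k, 'b) opd \<Rightarrow> 'b gen set" where
  "gens Is Js X = {(\<Gamma>, ps, xs). stable_graph \<Gamma> \<and> fst ` set (verts \<Gamma>) \<subseteq> Is \<and> genus \<Gamma> \<in> Js \<and>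
                     decorates X (verts \<Gamma>) ps xs}"

text \<open>
  The relations of the colimit of \<open>det(k^Edges) \<otimes> \<Otimes>\<^sub>v X(v)\<close>. The last one identifies a
  graph containing a subgraph from \<open>C\<close> with the graph in which it is
  contracted and its decorations are composed in \<open>X\<close>.
\<close>

inductive_set relators ::
  "bool \<Rightarrow> nat set \<Rightarrow> nat set \<Rightarrow> graph set \<Rightarrow> ('k::field_char_0, 'b::ab_group_add) opd \<Rightarrow> ('b gen \<Rightarrow>\<^sub>0 'k) set"
  for tw :: bool and Is Js :: "nat set" and C :: "graph set" and X :: "('k, 'b) opd" where
  multilinear: "\<lbrakk>(\<Gamma>, ps, xs[i := x]) \<in> gens Is Js X; (\<Gamma>, ps, xs[i := y]) \<in> gens Is Js X;
      i < length (verts \<Gamma>)\<rbrakk> \<Longrightarrow>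
    Poly_Mapping.single (\<Gamma>, ps, xs[i := scl X c x + y]) 1
      - Poly_Mapping.single (\<Gamma>, ps, xs[i := x]) c - Poly_Mapping.single (\<Gamma>, ps, xs[i := y]) 1
    \<in> relators tw Is Js C X"
| verts: "\<lbrakk>(\<Gamma>, ps, xs) \<in> gens Is Js X; Suc i < length (verts \<Gamma>)\<rbrakk> \<Longrightarrow>
    Poly_Mapping.single (swap_verts i \<Gamma>, swap_at i ps, swap_at i xs) 1
      - Poly_Mapping.single (\<Gamma>, ps, xs) (sg (ps ! i * ps ! Suc i))
    \<in> relators tw Is Js C X"
| edges: "\<lbrakk>(\<Gamma>, ps, xs) \<in> gens Is Js X; Suc i < length (edges \<Gamma>)\<rbrakk> \<Longrightarrow>
    Poly_Mapping.single (swap_edges i \<Gamma>, ps, xs) 1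
      - Poly_Mapping.single (\<Gamma>, ps, xs) (if tw then - 1 else 1)
    \<in> relators tw Is Js C X"
| flip: "\<lbrakk>(\<Gamma>, ps, xs) \<in> gens Is Js X; i < length (edges \<Gamma>)\<rbrakk> \<Longrightarrow>
    Poly_Mapping.single (flip_edge i \<Gamma>, ps, xs) 1 - Poly_Mapping.single (\<Gamma>, ps, xs) 1
    \<in> relators tw Is Js C X"
| contract: "\<lbrakk>(\<Gamma>, ps, xs) \<in> gens Is Js X; i < length (verts \<Gamma>);
      \<Delta> \<in> C \<inter> graphs Is; verts \<Gamma> ! i = (genus \<Delta>, arity \<Delta>); decorates X (verts \<Delta>) qs ys;
      ps ! i = sum_list qs + tdeg tw \<Delta>; xs ! i = cmp X \<Delta> qs ys\<rbrakk> \<Longrightarrow>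
    Poly_Mapping.single (\<Gamma>, ps, xs) 1
      - Poly_Mapping.single (graph_insert \<Gamma> i \<Delta>, list_insert i qs ps, list_insert i ys xs)
          (sg (tdeg tw \<Delta> * sum_list (take i ps)))
    \<in> relators tw Is Js C X"

definition graft_at :: "bool \<Rightarrow> 'b gen \<Rightarrow> nat \<Rightarrow> 'b gen \<Rightarrow> ('b gen \<Rightarrow>\<^sub>0 'k::field_char_0)" where
  "graft_at tw = (\<lambda>(\<Gamma>, ps, xs) i (\<Delta>, qs, ys).
     Poly_Mapping.single (graph_insert \<Gamma> i \<Delta>, list_insert i qs ps, list_insert i ys xs)
       (sg (tdeg tw \<Delta> * sum_list (take i ps))))"

text \<open>The sign moves the twists of all inserted graphs to the front.\<close>

definition graft :: "bool \<Rightarrow> graph \<Rightarrow> 'b gen list \<Rightarrow> ('b gen \<Rightarrow>\<^sub>0 'k::field_char_0)" where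
  "graft tw \<Gamma> hs = Poly_Mapping.single
     (graph_insert_all \<Gamma> (map fst hs), concat (map (fst \<circ> snd) hs), concat (map (snd \<circ> snd) hs))
     (sg (\<Sum>i < length hs. \<Sum>j < i. tdeg tw (fst (hs ! i)) * gdeg tw (hs ! j)))"

text \<open>Only generators of matching genus, arity and degree can be inserted into a vertex.\<close>

definition fits :: "bool \<Rightarrow> graph \<Rightarrow> int list \<Rightarrow> 'b gen list \<Rightarrow> bool" where
  "fits tw \<Gamma> ps hs \<longleftrightarrow> length ps = length (verts \<Gamma>) \<and> length hs = length (verts \<Gamma>) \<and>
     (\<forall>i < length hs. (genus (fst (hs ! i)), arity (fst (hs ! i))) = verts \<Gamma> ! i \<and>
                      gdeg tw (hs ! i) = ps ! i)"

definition graft_sums ::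
  "bool \<Rightarrow> graph \<Rightarrow> int list \<Rightarrow> ('b gen \<Rightarrow>\<^sub>0 'k::field_char_0) list \<Rightarrow> ('b gen \<Rightarrow>\<^sub>0 'k)" where
  "graft_sums tw \<Gamma> ps fs =
     (\<Sum>hs \<in> {hs \<in> listset (map Poly_Mapping.keys fs). fits tw \<Gamma> ps hs}.
        fscale (\<Prod>i < length fs. Poly_Mapping.lookup (fs ! i) (hs ! i)) (graft tw \<Gamma> hs))"

text \<open>The derivation determined by its values \<open>\<delta> g n p x\<close> on a vertex decorated by \<open>x\<close>.\<close>

definition derivation ::
  "bool \<Rightarrow> (nat \<Rightarrow> nat \<Rightarrow> int \<Rightarrow> 'b \<Rightarrow> ('b gen \<Rightarrow>\<^sub>0 'k::field_char_0)) \<Rightarrow> 'b gen \<Rightarrow> ('b gen \<Rightarrow>\<^sub>0 'k)" where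
  "derivation tw \<delta> = (\<lambda>(\<Gamma>, ps, xs). \<Sum>i < length (verts \<Gamma>).
     fscale (sg (tdeg tw \<Gamma> + sum_list (take i ps)))
       (lin_ext (graft_at tw (\<Gamma>, ps, xs) i)
         (\<delta> (fst (verts \<Gamma> ! i)) (snd (verts \<Gamma> ! i)) (ps ! i) (xs ! i))))"

text \<open>
  Pointwise left Kan extension: the cell \<open>(g, n)\<close> is the colimit, over all stable graphs of
  type \<open>(g, n)\<close> with vertex genera in \<open>Is\<close>, of the decorations by \<open>X\<close>; composition is
  insertion of graphs. \<open>C\<close> consists of the graphs along which \<open>X\<close> can be composed.
\<close>

definition kan_extension ::
  "bool \<Rightarrow> nat set \<Rightarrow> nat set \<Rightarrow> graph set \<Rightarrow> ('k::field_char_0, 'b::ab_group_add) opd \<Rightarrow>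
   (nat \<Rightarrow> nat \<Rightarrow> int \<Rightarrow> 'b \<Rightarrow> ('b gen \<Rightarrow>\<^sub>0 'k)) \<Rightarrow> ('k, 'b gen \<Rightarrow>\<^sub>0 'k) opd" where
  "kan_extension tw Is Js C X \<delta> = (let cls = quot (formal.span (relators tw Is Js C X)) in \<lparr>
     scl = fscale,
     cell = (\<lambda>g n p. cls ` {f. \<forall>h \<in> Poly_Mapping.keys f.
               h \<in> gens Is Js X \<and> genus (fst h) = g \<and> arity (fst h) = n \<and> gdeg tw h = p}),
     dif = (\<lambda>g n p f. cls (lin_ext (derivation tw \<delta>) f)),
     cmp = (\<lambda>\<Gamma> ps fs. cls (graft_sums tw \<Gamma> ps fs))\<rparr>)"

text \<open>
  The modular envelope \<open>f\<^sub>*\<close> of a cyclic operad \<open>P\<close>: left Kan extension along the inclusion of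
  trees into graphs. Since \<open>P\<close> only has genus \<open>0\<close>, the graphs contracted here are exactly trees.
\<close>

definition modular_envelope ::
  "bool \<Rightarrow> ('k::field_char_0, 'b::ab_group_add) opd \<Rightarrow> ('k, 'b gen \<Rightarrow>\<^sub>0 'k) opd" where
  "modular_envelope tw P = kan_extension tw {0} UNIV (graphs {0}) P
     (\<lambda>g n p x. Poly_Mapping.single (corolla g n, [p + 1], [dif P g n p x]) 1)"


section \<open>The Feynman transform\<close>

text \<open>
  The level-wise graded dual, with \<open>\<alpha>\<close> of degree \<open>p\<close> a functional on the
  degree \<open>-p\<close> part, with differential minus the transpose (\<open>d \<alpha> = - (-1)\<^sup>p \<alpha> \<circ> d\<close>) and with
  the contragredient action of the symmetric groups. Functionals are set to \<open>0\<close> outside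
  their cell. The only compositions are those along \<open>permuted_corollas\<close>.
\<close>

definition dual :: "('k::field_char_0, 'a::ab_group_add) opd \<Rightarrow> ('k, 'a \<Rightarrow> 'k) opd" where
  "dual \<O> = \<lparr>
     scl = (\<lambda>c \<alpha> x. c * \<alpha> x),
     cell = (\<lambda>g n p. {\<alpha>. (\<forall>x. x \<notin> cell \<O> g n (- p) \<longrightarrow> \<alpha> x = 0) \<and>
               (\<forall>c. \<forall>x \<in> cell \<O> g n (- p). \<forall>y \<in> cell \<O> g n (- p).
                  \<alpha> (scl \<O> c x + y) = c * \<alpha> x + \<alpha> y)}),
     dif = (\<lambda>g n p \<alpha> x. if x \<in> cell \<O> g n (- p - 1)
               then - sg p * \<alpha> (dif \<O> g n (- p - 1) x) else 0),
     cmp = (\<lambda>\<Gamma> ps \<alpha>s x. if x \<in> cell \<O> (genus \<Gamma>) (arity \<Gamma>) (- hd ps)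
               then hd \<alpha>s (cmp \<O> (corolla_inv \<Gamma>) [- hd ps] [x]) else 0)\<rparr>"

text \<open>
  The canonical pairing of \<open>\<Otimes>\<^sub>v \<O>(v)\<^sup>*\<close> with \<open>\<Otimes>\<^sub>v \<O>(v)\<close>, elements of the former being
  written as formal sums of pure tensors \<open>(qs, \<alpha>s)\<close>; the Koszul sign
  is that of moving each \<open>x\<^sub>i\<close> (of degree \<open>- qs ! i\<close>) to the left past the
  \<open>\<alpha>\<^sub>j\<close> with \<open>j > i\<close>.
\<close>

definition tensor_eval ::
  "(int list \<times> ('a \<Rightarrow> 'k) list \<Rightarrow>\<^sub>0 'k::field_char_0) \<Rightarrow> int list \<Rightarrow> 'a list \<Rightarrow> 'k" where
  "tensor_eval t rs xs =
     (\<Sum>(qs, \<alpha>s) \<in> {h \<in> Poly_Mapping.keys t. fst h = map uminus rs}.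
        Poly_Mapping.lookup t (qs, \<alpha>s) * sg (\<Sum>j < length qs. \<Sum>i < j. qs ! i * qs ! j) *
        (\<Prod>i < length xs. (\<alpha>s ! i) (xs ! i)))"

text \<open>\<open>t \<in> \<Otimes>\<^sub>v \<O>(v)\<^sup>*\<close> of degree \<open>d\<close> induces the graded functional \<open>F\<close> on \<open>\<Otimes>\<^sub>v \<O>(v)\<close>.\<close>

definition represents ::
  "('k::field_char_0, 'a::ab_group_add) opd \<Rightarrow> (nat \<times> nat) list \<Rightarrow> int \<Rightarrow>
   (int list \<times> ('a \<Rightarrow> 'k) list \<Rightarrow>\<^sub>0 'k) \<Rightarrow> (int list \<Rightarrow> 'a list \<Rightarrow> 'k) \<Rightarrow> bool" where
  "represents \<O> vs d t F \<longleftrightarrow>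
     (\<forall>(qs, \<alpha>s) \<in> Poly_Mapping.keys t. decorates (dual \<O>) vs qs \<alpha>s \<and> sum_list qs = d) \<and>
     (\<forall>rs xs. decorates \<O> vs rs xs \<and> sum_list rs = - d \<longrightarrow> tensor_eval t rs xs = F rs xs)"

definition graded_multilinear ::
  "('k::field_char_0, 'a::ab_group_add) opd \<Rightarrow> (nat \<times> nat) list \<Rightarrow> int \<Rightarrow>
   (int list \<Rightarrow> 'a list \<Rightarrow> 'k) \<Rightarrow> bool" where
  "graded_multilinear \<O> vs d F \<longleftrightarrow>
     (\<forall>rs xs i c x y. sum_list rs = - d \<and> i < length vs \<and>
        decorates \<O> vs rs (xs[i := x]) \<and> decorates \<O> vs rs (xs[i := y]) \<longrightarrow>
        F rs (xs[i := scl \<O> c x + y]) = c * F rs (xs[i := x]) + F rs (xs[i := y]))"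

text \<open>
  Linear duality is compatible with \<open>\<otimes>\<close>: the canonical map
  \<open>\<Otimes>\<^sub>v \<O>(v)\<^sup>* \<rightarrow> (\<Otimes>\<^sub>v \<O>(v))\<^sup>*\<close>, which is always injective, is surjective.
\<close>

definition duality_compatible :: "nat set \<Rightarrow> ('k::field_char_0, 'a::ab_group_add) opd \<Rightarrow> bool" where
  "duality_compatible Is \<O> \<longleftrightarrow>
     (\<forall>vs d F. (\<forall>(g, n) \<in> set vs. g \<in> Is \<and> stable g n) \<and> graded_multilinear \<O> vs d F \<longrightarrow>
        (\<exists>t. represents \<O> vs d t F))"

text \<open>
  All presentations of the one-edge graphs of type \<open>(g, n)\<close>. An isomorphism class contains
  \<open>2 |V|! \<Prod>\<^sub>v n\<^sub>v! / |Aut|\<close> of them, so that with the following weight the sum over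
  presentations is the sum over isomorphism classes, each counted \<open>1 / |Aut|\<close> times.
  For trees \<open>|Aut| = 1\<close>. In general the factor comes from identifying coinvariants
  (which span the free object) with invariants (where the dual of a composition lives)
  by the norm map.
\<close>

definition one_edge_graphs :: "nat \<Rightarrow> nat \<Rightarrow> graph set" where
  "one_edge_graphs g n = {\<Lambda>. stable_graph \<Lambda> \<and> length (edges \<Lambda>) = 1 \<and> genus \<Lambda> = g \<and> arity \<Lambda> = n}"

lemma finite_one_edge_graphs: "finite (one_edge_graphs g n)"
proof -
  define N where "N = n + g + 3"
  define V where "V = {vs :: (nat \<times> nat) list. set vs \<subseteq> {..N} \<times> {..N} \<and> length vs \<le> N}"
  define E where "E = {es :: (flag \<times> flag) list. set es \<subseteq> ({..N} \<times> {..N}) \<times> ({..N} \<times> {..N}) \<and> length es \<le> N}"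
  define L where "L = {ls :: flag list. set ls \<subseteq> {..N} \<times> {..N} \<and> length ls \<le> N}"
  have "one_edge_graphs g n \<subseteq> (\<lambda>(vs, es, ls). Graph vs es ls) ` (V \<times> E \<times> L)"
  proof
    fix \<Lambda> assume "\<Lambda> \<in> one_edge_graphs g n"
    then have st: "stable_graph \<Lambda>" and e: "length (edges \<Lambda>) = 1" and ge: "genus \<Lambda> = g"
      and ar: "length (legs \<Lambda>) = n"
      by (auto simp: one_edge_graphs_def arity_def)
    have fl: "set (flag_list \<Lambda>) = flags \<Lambda>" and con: "connected_graph \<Lambda>"
      using st by (auto simp: stable_graph_def)
    have len: "length (flag_list \<Lambda>) = n + 2" using e ar by (simp add: flag_list_def)
    have card: "finite (flags \<Lambda>)" "card (flags \<Lambda>) \<le> n + 2"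
      using List.finite_set[of "flag_list \<Lambda>"] card_length[of "flag_list \<Lambda>"] unfolding fl len .
    have vert: "fst (verts \<Lambda> ! i) \<le> g" "snd (verts \<Lambda> ! i) \<le> n + 2" if "i < length (verts \<Lambda>)" for i
    proof -
      have "fst (verts \<Lambda> ! i) \<le> sum_list (map fst (verts \<Lambda>))"
        using that by (intro member_le_sum_list) auto
      then show "fst (verts \<Lambda> ! i) \<le> g" using ge by (simp add: genus_def)
      have "Pair i ` {..<snd (verts \<Lambda> ! i)} \<subseteq> flags \<Lambda>" using that by (auto simp: flags_def)
      then have "card (Pair i ` {..<snd (verts \<Lambda> ! i)}) \<le> n + 2"
        by (rule order_trans[OF card_mono[OF card(1)] card(2)])
      then show "snd (verts \<Lambda> ! i) \<le> n + 2" by (simp add: card_image inj_on_def)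
    qed
    have "length (verts \<Lambda>) \<le> n + 2"
    proof (cases "length (verts \<Lambda>) \<le> 1")
      case False
      have "i \<in> fst ` flags \<Lambda>" if "i < length (verts \<Lambda>)" for i
      proof -
        define j where "j = (if i = 0 then 1 else 0::nat)"
        have "(i, j) \<in> (adjacent \<Lambda>)\<^sup>*" "i \<noteq> j"
          using con that False by (auto simp: connected_graph_def j_def)
        then obtain k where "(i, k) \<in> adjacent \<Lambda>" by (cases rule: converse_rtranclE) auto
        then obtain a b where ab: "i = fst a" "(a, b) \<in> set (edges \<Lambda>) \<or> (b, a) \<in> set (edges \<Lambda>)"
          unfolding adjacent_def mem_Collect_eq prod.inject by blast
        then have "a \<in> set (flag_list \<Lambda>)" by (force simp: flag_list_def)
        then show ?thesis using fl ab by auto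
      qed
      then have "{..<length (verts \<Lambda>)} \<subseteq> fst ` flags \<Lambda>" by auto
      then have "length (verts \<Lambda>) \<le> card (fst ` flags \<Lambda>)"
        using card_mono[OF finite_imageI[OF card(1)]] by fastforce
      then show ?thesis using card_image_le[OF card(1), of fst] card(2) by linarith
    qed simp
    then have lv: "length (verts \<Lambda>) \<le> N" by (simp add: N_def)
    have "set (verts \<Lambda>) \<subseteq> {..N} \<times> {..N}"
    proof
      fix v assume "v \<in> set (verts \<Lambda>)"
      then obtain i where "i < length (verts \<Lambda>)" "v = verts \<Lambda> ! i" by (metis in_set_conv_nth)
      then show "v \<in> {..N} \<times> {..N}" using vert[of i] by (simp add: N_def mem_Times_iff)
    qed
    then have V: "verts \<Lambda> \<in> V" using lv by (simp add: V_def)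
    have "flags \<Lambda> \<subseteq> {..N} \<times> {..N}"
    proof
      fix f assume "f \<in> flags \<Lambda>"
      then show "f \<in> {..N} \<times> {..N}" using lv vert[of "fst f"] by (auto simp: flags_def N_def)
    qed
    then have sub: "set (flag_list \<Lambda>) \<subseteq> {..N} \<times> {..N}" using fl by simp
    have "fst ` set (edges \<Lambda>) \<subseteq> {..N} \<times> {..N}" "snd ` set (edges \<Lambda>) \<subseteq> {..N} \<times> {..N}"
      using sub unfolding flag_list_def by simp_all
    then have "set (edges \<Lambda>) \<subseteq> ({..N} \<times> {..N}) \<times> ({..N} \<times> {..N})"
      unfolding image_subset_iff mem_Times_iff subset_iff by blast
    then have E: "edges \<Lambda> \<in> E" using e by (simp add: E_def N_def)
    have L: "legs \<Lambda> \<in> L" using sub ar by (auto simp: L_def flag_list_def N_def)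
    show "\<Lambda> \<in> (\<lambda>(vs, es, ls). Graph vs es ls) ` (V \<times> E \<times> L)"
      by (rule image_eqI[of _ _ "(verts \<Lambda>, edges \<Lambda>, legs \<Lambda>)"]) (use V E L in auto)
  qed
  moreover have "finite V" "finite E" "finite L"
    unfolding V_def E_def L_def by (intro finite_lists_length_le finite_cartesian_product; simp)+
  ultimately show ?thesis by (meson finite_SigmaI finite_imageI finite_subset)
qed

definition weight :: "graph \<Rightarrow> 'k::field_char_0" where
  "weight \<Lambda> = 1 / of_nat (2 * fact (length (verts \<Lambda>)) * (\<Prod>(g, n) \<leftarrow> verts \<Lambda>. fact n))"

text \<open>
  The differential of the Feynman transform on a generator \<open>\<alpha>\<close> of degree \<open>p\<close>: the
  internal one, plus the sum over one-edge graphs of the transposed compositions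
  \<open>(-1)\<^bsup>|cmp| p\<^esup> \<alpha> \<circ> cmp\<close>, where \<open>|cmp|\<close> is \<open>1\<close> if \<open>\<O>\<close> is twisted and \<open>0\<close> otherwise.
  The tensor chosen to represent a functional is unique up to multilinearity.
\<close>

definition feynman_gen ::
  "bool \<Rightarrow> ('k::field_char_0, 'a::ab_group_add) opd \<Rightarrow> nat \<Rightarrow> nat \<Rightarrow> int \<Rightarrow> ('a \<Rightarrow> 'k) \<Rightarrow>
   (('a \<Rightarrow> 'k) gen \<Rightarrow>\<^sub>0 'k)" where
  "feynman_gen tw \<O> g n p \<alpha> =
     Poly_Mapping.single (corolla g n, [p + 1], [dif (dual \<O>) g n p \<alpha>]) 1 +
     (\<Sum>\<Lambda> \<in> one_edge_graphs g n.
        fscale (weight \<Lambda> * sg (tdeg tw \<Lambda> * p))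
          (lin_ext (\<lambda>(qs, \<alpha>s). Poly_Mapping.single (\<Lambda>, qs, \<alpha>s) 1)
            (SOME t. represents \<O> (verts \<Lambda>) (p + tdeg tw \<Lambda>) t (\<lambda>rs xs. \<alpha> (cmp \<O> \<Lambda> rs xs)))))"

text \<open>
  The free object of the other parity on the dual, i.e. only symmetric group actions are
  taken into account in the relations. \<open>Is\<close> is \<open>{0}\<close> for cyclic and \<open>UNIV\<close> for modular operads.
\<close>

definition feynman ::
  "bool \<Rightarrow> nat set \<Rightarrow> ('k::field_char_0, 'a::ab_group_add) opd \<Rightarrow> ('k, ('a \<Rightarrow> 'k) gen \<Rightarrow>\<^sub>0 'k) opd" where
  "feynman tw Is \<O> =
     kan_extension (\<not> tw) Is Is permuted_corollas (dual \<O>) (feynman_gen tw \<O>)"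

abbreviation cyclic_feynman ::
  "bool \<Rightarrow> ('k::field_char_0, 'a::ab_group_add) opd \<Rightarrow> ('k, ('a \<Rightarrow> 'k) gen \<Rightarrow>\<^sub>0 'k) opd" where
  "cyclic_feynman tw \<equiv> feynman tw {0}"

abbreviation modular_feynman ::
  "bool \<Rightarrow> ('k::field_char_0, 'a::ab_group_add) opd \<Rightarrow> ('k, ('a \<Rightarrow> 'k) gen \<Rightarrow>\<^sub>0 'k) opd" where
  "modular_feynman tw \<equiv> feynman tw UNIV"

end

theory Submission
  imports Defs "HOL-Library.Multiset"
begin

text \<open>
  A generator of \<open>f\<^sub>*(D(\<O>))\<close> is a graph whose vertices carry classes of trees decorated by
  \<open>\<O>\<^sup>*\<close>, and a generator of \<open>D(f\<^sub>!(\<O>))\<close> is a graph decorated by \<open>(f\<^sub>!\<O>)\<^sup>*\<close>. The map \<open>Phi\<close>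
  inserts the trees into the vertices. The map \<open>Psi\<close> regards every vertex as a corolla; it kills
  graphs with a vertex of positive genus, which are \<open>0\<close> because \<open>f\<^sub>!(\<O>)\<close> vanishes there.

  Insertion of graphs is associative and commutative up to a permutation of edges and vertices whose
  sign is the Koszul sign, hence \<open>Phi\<close> respects the relations. One composite is the identity because
  inserting corollas changes nothing, the other one because the relations of the Kan
  extension contract a tree inserted into a vertex back to its class.

  The differential of \<open>D(f\<^sub>!(\<O>))\<close> satisfies the Leibniz rule for insertion, and on vertices of
  genus \<open>0\<close> it agrees with the differential of \<open>D(\<O>)\<close>, hence \<open>Phi\<close> commutes with the differentials.
  It is well defined on classes although the tensors representing the dual compositions are
  chosen arbitrarily: a tensor of functionals is determined by its values modulo multilinearity.
\<close>

section \<open>Linear and multilinear extensions\<close>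

text \<open>The obstacle is that little holds on the nose: graphs carry orders of vertices and
  edges, a class is a projected formal sum, and the labels in the envelope are themselves such sums.
  Statements are therefore congruences modulo the span of the relators, with explicit signs, checked
  on generators and spread by multilinear extension. Signs are tracked through two moves: exchanging
  adjacent blocks of edges and exchanging adjacent blocks of vertices. The two directions share the
  work. Well-definedness of \<open>Phi\<close> rests on associativity of insertion, whereas
  \<open>Psi\<close> commutes with grafting exactly, so compatibility with composition is proved for
  the inverse. Compatibility with the differential is proved for \<open>Phi\<close>, where the
  Leibniz rule is at hand. Duality is assumed in genus 0 only. In positive genus the functionals on
  the extension by zero are 0 and are represented by the tensor 0. A one-edge graph with a loop has
  positive genus, so on genus 0 vertices both differentials sum over the same trees.\<close>

abbreviation flinear :: "(('c \<Rightarrow>\<^sub>0 'k::field_char_0) \<Rightarrow> ('d \<Rightarrow>\<^sub>0 'k)) \<Rightarrow> bool" where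
  "flinear \<equiv> Vector_Spaces.linear fscale fscale"

abbreviation sing :: "'c \<Rightarrow> ('c \<Rightarrow>\<^sub>0 'k::field_char_0)" where
  "sing x \<equiv> Poly_Mapping.single x 1"

lemma flinear_iff:
  "flinear f \<longleftrightarrow> (\<forall>x y. f (x + y) = f x + f y) \<and> (\<forall>c x. f (fscale c x) = fscale c (f x))"
  by (simp add: Vector_Spaces.linear_def formal.vector_space_axioms module_hom_iff formal.module_axioms)

lemma flinear_add: "flinear f \<Longrightarrow> f (x + y) = f x + f y"
  and flinear_scale: "flinear f \<Longrightarrow> f (fscale c x) = fscale c (f x)"
  by (simp_all add: flinear_iff)

lemma flinear_0: "flinear f \<Longrightarrow> f 0 = 0"
  by (metis add_cancel_right_right flinear_add)

lemma flinear_diff: "flinear f \<Longrightarrow> f (x - y) = f x - f y"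
  by (metis add_diff_cancel_right' diff_add_cancel flinear_add)

lemma flinear_sum: "flinear f \<Longrightarrow> f (sum g A) = (\<Sum>a\<in>A. f (g a))"
  by (induction A rule: infinite_finite_induct) (simp_all add: flinear_0 flinear_add)

lemma fscale_single: "fscale c (Poly_Mapping.single x d) = Poly_Mapping.single x (c * d)"
  by (rule poly_mapping_eqI) (simp add: lookup_fscale lookup_single when_def)

text \<open>Terms may cancel in a sum, so its support can be smaller than the union of the supports;
  summing over a common finite superset makes additivity termwise.\<close>

lemma lin_ext_superset:
  assumes "finite A" "Poly_Mapping.keys f \<subseteq> A"
  shows "lin_ext h f = (\<Sum>x\<in>A. fscale (Poly_Mapping.lookup f x) (h x))"
  unfolding lin_ext_def
  by (rule sum.mono_neutral_left[OF assms]) (simp add: in_keys_iff)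

lemma flinear_lin_ext: "flinear (lin_ext h)"
proof -
  have "lin_ext h (x + y) = lin_ext h x + lin_ext h y" for x y
  proof -
    let ?A = "Poly_Mapping.keys x \<union> Poly_Mapping.keys y"
    have A: "finite ?A" by simp
    show ?thesis
      unfolding lin_ext_superset[OF A Poly_Mapping.keys_add]
      by (simp add: lin_ext_superset[OF A] lookup_add formal.scale_left_distrib sum.distrib)
  qed
  moreover have "lin_ext h (fscale c x) = fscale c (lin_ext h x)" for c x
  proof -
    have "Poly_Mapping.keys (fscale c x) \<subseteq> Poly_Mapping.keys x"
      by (auto simp: in_keys_iff lookup_fscale)
    from lin_ext_superset[OF _ this] show ?thesis
      by (simp add: lin_ext_def[of h x] lookup_fscale formal.scale_sum_right)
  qed
  ultimately show ?thesis by (simp add: flinear_iff)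
qed

lemmas lin_ext_add = flinear_add[OF flinear_lin_ext]
  and lin_ext_scale = flinear_scale[OF flinear_lin_ext]
  and lin_ext_diff = flinear_diff[OF flinear_lin_ext]
  and lin_ext_zero [simp] = flinear_0[OF flinear_lin_ext]
  and lin_ext_sum = flinear_sum[OF flinear_lin_ext]

lemma lin_ext_single: "lin_ext h (Poly_Mapping.single x c) = fscale c (h x)"
  by (cases "c = 0") (simp_all add: lin_ext_def)

lemma lin_ext_sing [simp]: "lin_ext h (sing x) = h x"
  by (simp add: lin_ext_single)

lemma lin_ext_cong:
  "(\<And>x. x \<in> Poly_Mapping.keys f \<Longrightarrow> h x = h' x) \<Longrightarrow> lin_ext h f = lin_ext h' f"
  by (simp add: lin_ext_def)

lemma flinear_lin_ext_right: "flinear A \<Longrightarrow> A (lin_ext h f) = lin_ext (\<lambda>x. A (h x)) f"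
  by (simp add: lin_ext_def flinear_sum flinear_scale)

lemma lin_ext_lin_ext: "lin_ext h (lin_ext k f) = lin_ext (\<lambda>x. lin_ext h (k x)) f"
  by (rule flinear_lin_ext_right[OF flinear_lin_ext])

lemma lin_ext_of_sing [simp]: "lin_ext sing f = f"
  by (rule poly_mapping_eqI)
    (simp add: lin_ext_def lookup_sum lookup_fscale lookup_single when_def in_keys_iff
      if_distrib[of "(*) _"] cong: if_cong)

lemma lin_ext_fun_linear:
  "lin_ext (\<lambda>x. fscale c (h x) + k x) f = fscale c (lin_ext h f) + lin_ext k f"
  by (simp add: lin_ext_def sum.distrib formal.scale_right_distrib formal.scale_sum_right mult.commute)

lemma lin_ext_zero_fun [simp]: "lin_ext (\<lambda>x. 0) f = 0"
  by (simp add: lin_ext_def)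

lemma lin_ext_fun_scale: "lin_ext (\<lambda>x. fscale c (h x)) f = fscale c (lin_ext h f)"
  using lin_ext_fun_linear[of c h "\<lambda>x. 0" f] by simp

lemma lin_ext_fun_add: "lin_ext (\<lambda>x. h x + k x) f = lin_ext h f + lin_ext k f"
  using lin_ext_fun_linear[of 1 h k f] by simp

lemma lin_ext_fun_sum: "lin_ext (\<lambda>x. \<Sum>i\<in>I. h i x) f = (\<Sum>i\<in>I. lin_ext (h i) f)"
  by (induction I rule: infinite_finite_induct) (simp_all add: lin_ext_fun_add)

lemma lin_ext_in_subspace:
  "formal.subspace S \<Longrightarrow> (\<And>x. x \<in> Poly_Mapping.keys f \<Longrightarrow> h x \<in> S) \<Longrightarrow> lin_ext h f \<in> S"
  unfolding lin_ext_def by (intro formal.subspace_sum formal.subspace_scale)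

lemma keys_fscale: "Poly_Mapping.keys (fscale c x) \<subseteq> Poly_Mapping.keys x"
  by (auto simp: in_keys_iff lookup_fscale)

text \<open>Support conditions become membership in a subspace, so the closure rules for sums,
  linear extensions and spans bound supports as well.\<close>

lemma subspace_keys: "formal.subspace {f :: 'c \<Rightarrow>\<^sub>0 'k::field_char_0. Poly_Mapping.keys f \<subseteq> A}"
proof (rule formal.subspaceI)
  fix c :: 'k and f g :: "'c \<Rightarrow>\<^sub>0 'k"
  assume "f \<in> {f. Poly_Mapping.keys f \<subseteq> A}" "g \<in> {f. Poly_Mapping.keys f \<subseteq> A}"
  then show "f + g \<in> {f. Poly_Mapping.keys f \<subseteq> A}" "fscale c f \<in> {f. Poly_Mapping.keys f \<subseteq> A}"
    using Poly_Mapping.keys_add[of f g] keys_fscale[of c f] by blast+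
qed simp

lemma keys_lin_ext:
  "(\<And>x. x \<in> Poly_Mapping.keys f \<Longrightarrow> Poly_Mapping.keys (h x) \<subseteq> A) \<Longrightarrow> Poly_Mapping.keys (lin_ext h f) \<subseteq> A"
  using lin_ext_in_subspace[OF subspace_keys[of A], of f h] by simp

lemma keys_span:
  "(\<And>r. r \<in> S \<Longrightarrow> Poly_Mapping.keys r \<subseteq> A) \<Longrightarrow> x \<in> formal.span S \<Longrightarrow> Poly_Mapping.keys x \<subseteq> A"
  using subsetD[OF formal.span_minimal[OF _ subspace_keys[of A]], of S x] by (simp add: subset_iff)

text \<open>The reduction used for maps that descend to quotients: only the relators have to be
  checked.\<close>

lemma flinear_span_image:
  assumes "flinear A" "\<And>r. r \<in> S \<Longrightarrow> A r \<in> formal.span T" "x \<in> formal.span S"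
  shows "A x \<in> formal.span T"
proof -
  have "formal.subspace {x. A x \<in> formal.span T}"
    using assms(1)
    by (auto simp: formal.subspace_def flinear_0 flinear_add flinear_scale formal.span_zero
        formal.span_add formal.span_scale)
  then have "formal.span S \<subseteq> {x. A x \<in> formal.span T}"
    using assms(2) by (intro formal.span_minimal) auto
  then show ?thesis using assms(3) by blast
qed

text \<open>The map induced by \<open>G\<close> on a tensor product of free spaces, evaluated on a
  pure tensor of formal sums. Recursion over the slots replaces a sum over the product of the
  supports, so that a single slot can be handled by \<open>lin_ext\<close>.\<close>

fun ml :: "('c \<Rightarrow>\<^sub>0 'k::field_char_0) list \<Rightarrow> ('c list \<Rightarrow> ('d \<Rightarrow>\<^sub>0 'k)) \<Rightarrow> ('d \<Rightarrow>\<^sub>0 'k)" where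
  "ml [] G = G []"
| "ml (f # fs) G = lin_ext (\<lambda>h. ml fs (\<lambda>hs. G (h # hs))) f"

abbreviation in_keys :: "'c list \<Rightarrow> ('c \<Rightarrow>\<^sub>0 'k::zero) list \<Rightarrow> bool" where
  "in_keys \<equiv> list_all2 (\<lambda>h f. h \<in> Poly_Mapping.keys f)"

lemma ml_cong: "(\<And>hs. in_keys hs fs \<Longrightarrow> G hs = G' hs) \<Longrightarrow> ml fs G = ml fs G'"
proof (induction fs arbitrary: G G')
  case (Cons f fs)
  have "ml fs (\<lambda>hs. G (h # hs)) = ml fs (\<lambda>hs. G' (h # hs))" if "h \<in> Poly_Mapping.keys f" for h
    using that by (intro Cons.IH Cons.prems) simp
  then show ?case by (simp cong: lin_ext_cong)
qed simp

lemma ml_linear_out: "flinear A \<Longrightarrow> A (ml fs G) = ml fs (\<lambda>hs. A (G hs))"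
  by (induction fs arbitrary: G) (simp_all add: flinear_lin_ext_right)

lemma ml_append: "ml (fs @ gs) G = ml fs (\<lambda>hs. ml gs (\<lambda>ks. G (hs @ ks)))"
  by (induction fs arbitrary: G) simp_all

lemma ml_fun_linear: "ml fs (\<lambda>hs. fscale c (G hs) + K hs) = fscale c (ml fs G) + ml fs K"
  by (induction fs arbitrary: G K) (simp_all add: lin_ext_fun_linear)

lemma ml_zero_fun [simp]: "ml fs (\<lambda>hs. 0) = 0"
  by (induction fs) simp_all

lemma ml_fun_scale: "ml fs (\<lambda>hs. fscale c (G hs)) = fscale c (ml fs G)"
  using ml_fun_linear[of fs c G "\<lambda>hs. 0"] by simp

lemma ml_fun_add: "ml fs (\<lambda>hs. G hs + K hs) = ml fs G + ml fs K"
  using ml_fun_linear[of fs 1 G K] by simp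

lemma ml_fun_sum: "ml fs (\<lambda>hs. \<Sum>i\<in>I. G i hs) = (\<Sum>i\<in>I. ml fs (G i))"
  by (induction I rule: infinite_finite_induct) (simp_all add: ml_fun_add)

text \<open>Interchange of finite sums: the expansion of one slot can be moved outside or inside the
  others.\<close>

lemma ml_lin_ext_commute:
  "ml fs (\<lambda>hs. lin_ext (\<lambda>h. G h hs) f) = lin_ext (\<lambda>h. ml fs (G h)) f"
  by (simp add: lin_ext_def ml_fun_sum ml_fun_scale)

lemma ml_slot_linear:
  "flinear (\<lambda>f. ml (as @ f # bs) G)"
  by (simp add: ml_append ml_lin_ext_commute flinear_lin_ext)

lemma ml_sing [simp]: "ml (map sing hs) G = G hs"
  by (induction hs arbitrary: G) simp_all

text \<open>Substitution: the labels are expanded into generators first, and the images of these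
  generators afterwards.\<close>

lemma ml_map_lin_ext: "ml (map (lin_ext A) fs) G = ml fs (\<lambda>hs. ml (map A hs) G)"
proof (induction fs arbitrary: G)
  case (Cons f fs)
  have "ml fs (\<lambda>hs. ml (map A (h # hs)) G) = lin_ext (\<lambda>x. ml fs (\<lambda>hs. ml (map A hs) (\<lambda>ks. G (x # ks)))) (A h)" for h
    by (simp add: ml_lin_ext_commute)
  then show ?case by (simp add: lin_ext_lin_ext Cons.IH)
qed simp

lemma ml_in_subspace:
  "formal.subspace S \<Longrightarrow> (\<And>hs. in_keys hs fs \<Longrightarrow> G hs \<in> S) \<Longrightarrow> ml fs G \<in> S"
proof (induction fs arbitrary: G)
  case (Cons f fs)
  have "ml fs (\<lambda>hs. G (h # hs)) \<in> S" if "h \<in> Poly_Mapping.keys f" for h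
    using that by (intro Cons.IH Cons.prems) simp_all
  then show ?case using Cons.prems(1) by (simp add: lin_ext_in_subspace)
qed simp

section \<open>Grafting sums as multilinear extensions\<close>

lemma sum_set_Cons:
  "(\<Sum>hs \<in> set_Cons A B. F hs) = (\<Sum>h\<in>A. \<Sum>hs\<in>B. F (h # hs))"
proof -
  have eq: "set_Cons A B = (\<lambda>(h, hs). h # hs) ` (A \<times> B)" by (auto simp: set_Cons_def)
  show ?thesis
    unfolding eq by (subst sum.reindex) (auto simp: inj_on_def sum.cartesian_product case_prod_beta)
qed

lemma listset_iff: "hs \<in> listset As \<longleftrightarrow> list_all2 (\<in>) hs As"
  by (induction As arbitrary: hs) (auto simp: set_Cons_def list_all2_Cons2)

lemma finite_listset: "(\<And>A. A \<in> set As \<Longrightarrow> finite A) \<Longrightarrow> finite (listset As)"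
proof (induction As)
  case (Cons A As)
  have "set_Cons A (listset As) = (\<lambda>(h, hs). h # hs) ` (A \<times> listset As)" by (auto simp: set_Cons_def)
  then show ?case using Cons by simp
qed simp

lemma ml_eq_sum:
  "ml fs G = (\<Sum>hs \<in> listset (map Poly_Mapping.keys fs).
     fscale (\<Prod>i < length fs. Poly_Mapping.lookup (fs ! i) (hs ! i)) (G hs))"
proof (induction fs arbitrary: G)
  case (Cons f fs)
  show ?case
    unfolding ml.simps Cons list.map listset.simps sum_set_Cons list.size lin_ext_def
    by (simp add: formal.scale_sum_right prod.lessThan_Suc_shift del: prod.lessThan_Suc)
qed simp

text \<open>The restriction of the index set by \<open>fits\<close> turns into a summand that is 0
  on tuples that do not fit.\<close>

lemma graft_sums_eq_ml:
  "graft_sums tw \<Gamma> ps fs = ml fs (\<lambda>hs. if fits tw \<Gamma> ps hs then graft tw \<Gamma> hs else 0)"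
proof -
  have "finite (listset (map Poly_Mapping.keys fs))" by (rule finite_listset) auto
  then show ?thesis
    unfolding graft_sums_def ml_eq_sum
    by (simp add: sum.If_cases if_distrib[of "fscale _"] Int_def)
qed

section \<open>Insertion of graphs\<close>

lemma length_list_insert:
  "i < length xs \<Longrightarrow> length (list_insert i ys xs) = length xs + length ys - 1"
  by (simp add: list_insert_def)

lemma nth_list_insert:
  "i < length xs \<Longrightarrow> j < length xs + length ys - 1 \<Longrightarrow>
    list_insert i ys xs ! j = (if j < i then xs ! j else if j < i + length ys then ys ! (j - i)
      else xs ! (j + 1 - length ys))"
proof -
  assume *: "i < length xs" "j < length xs + length ys - 1"
  have "Suc (i + (j - (i + length ys))) = j + 1 - length ys" if "i + length ys \<le> j" using that by simp
  with * show ?thesis by (auto simp: list_insert_def nth_append min_def)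
qed

lemma list_insert_singleton: "i < length xs \<Longrightarrow> list_insert i [y] xs = xs[i := y]"
  by (simp add: list_insert_def upd_conv_take_nth_drop)

lemma list_insert_append [simp]: "list_insert (length as) ys (as @ x # bs) = as @ ys @ bs"
  by (simp add: list_insert_def)

lemma split_nth: "i < length xs \<Longrightarrow> xs = take i xs @ xs ! i # drop (Suc i) xs"
  by (simp add: id_take_nth_drop)

lemma split_nthE:
  assumes "i < length xs"
  obtains as x bs where "xs = as @ x # bs" "length as = i" "x = xs ! i"
  using split_nth[OF assms] assms by (metis length_take less_imp_le_nat min.absorb2)

text \<open>Position \<open>j\<close> of the inserted list is position \<open>i + j\<close> of the
  result; this is associativity of insertion at the level of vertex lists.\<close>

lemma list_insert_nested:
  assumes "i < length xs" "j < length ys"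
  shows "list_insert (i + j) zs (list_insert i ys xs) = list_insert i (list_insert j zs ys) xs"
proof -
  obtain as x bs where xs: "xs = as @ x # bs" "length as = i" using assms(1) by (rule split_nthE)
  obtain cs y ds where ys: "ys = cs @ y # ds" "length cs = j" using assms(2) by (rule split_nthE)
  show ?thesis
    using list_insert_append[of "as @ cs" zs y "ds @ bs"] list_insert_append[of as ys x bs]
      list_insert_append[of cs zs y ds] list_insert_append[of as "cs @ zs @ ds" x bs]
    by (simp add: xs(1) ys(1) flip: xs(2) ys(2))
qed

text \<open>Insertion at \<open>i\<close> replaces one entry by \<open>length ys\<close> entries,
  hence the later position \<open>j\<close> becomes \<open>j + length ys - 1\<close>.\<close>

lemma list_insert_parallel:
  assumes "i < j" "j < length xs"
  shows "list_insert i ys (list_insert j zs xs) = list_insert (j + length ys - 1) zs (list_insert i ys xs)"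
proof -
  obtain as y cs where xs: "xs = as @ y # cs" "length as = j" using assms(2) by (rule split_nthE)
  have "i < length as" using xs(2) assms(1) by simp
  then obtain as' x bs where as: "as = as' @ x # bs" "length as' = i" by (rule split_nthE)
  have j: "j + length ys - 1 = length (as' @ ys @ bs)" using as xs(2) by simp
  have "list_insert j zs xs = as @ zs @ cs" using xs by auto
  then show ?thesis
    using as(2) list_insert_append[of as' ys x "bs @ zs @ cs"] list_insert_append[of as' ys x "bs @ y # cs"]
      list_insert_append[of "as' @ ys @ bs" zs y cs]
    unfolding j by (simp add: as(1) xs(1))
qed

section \<open>Relabelling of flags and well-formed graphs\<close>

definition inner_flag :: "nat \<Rightarrow> flag \<Rightarrow> flag" where
  "inner_flag i f = (i + fst f, snd f)"

text \<open>The second relabelling local to \<open>graph_insert\<close>: a flag of the replaced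
  vertex becomes the leg of \<open>\<Delta>\<close> glued to it, and later vertices are
  renumbered.\<close>

definition outer_flag :: "nat \<Rightarrow> graph \<Rightarrow> flag \<Rightarrow> flag" where
  "outer_flag i \<Delta> f = (if fst f < i then f else if fst f = i then inner_flag i (legs \<Delta> ! snd f)
     else (fst f + length (verts \<Delta>) - 1, snd f))"

text \<open>The relabelling does not see the edges of the inserted graph, so changing their order or
  direction commutes with insertion.\<close>

lemma outer_flag_cong:
  "legs \<Delta>' = legs \<Delta> \<Longrightarrow> length (verts \<Delta>') = length (verts \<Delta>) \<Longrightarrow> outer_flag i \<Delta>' = outer_flag i \<Delta>"
  by (rule ext) (simp add: outer_flag_def)

lemma graph_insert_simps [simp]:
  "verts (graph_insert \<Gamma> i \<Delta>) = list_insert i (verts \<Delta>) (verts \<Gamma>)"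
  "edges (graph_insert \<Gamma> i \<Delta>) = map (map_prod (outer_flag i \<Delta>) (outer_flag i \<Delta>)) (edges \<Gamma>) @
     map (map_prod (inner_flag i) (inner_flag i)) (edges \<Delta>)"
  "legs (graph_insert \<Gamma> i \<Delta>) = map (outer_flag i \<Delta>) (legs \<Gamma>)"
proof -
  have "(\<lambda>(j, k). if j < i then (j, k) else if j = i then inner_flag i (legs \<Delta> ! k)
      else (j + length (verts \<Delta>) - 1, k)) = outer_flag i \<Delta>"
    by (auto simp: outer_flag_def fun_eq_iff split: prod.splits)
  moreover have "(\<lambda>(a, b). (i + a, b)) = inner_flag i" by (auto simp: inner_flag_def)
  ultimately show "verts (graph_insert \<Gamma> i \<Delta>) = list_insert i (verts \<Delta>) (verts \<Gamma>)"
    "edges (graph_insert \<Gamma> i \<Delta>) = map (map_prod (outer_flag i \<Delta>) (outer_flag i \<Delta>)) (edges \<Gamma>) @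
     map (map_prod (inner_flag i) (inner_flag i)) (edges \<Delta>)"
    "legs (graph_insert \<Gamma> i \<Delta>) = map (outer_flag i \<Delta>) (legs \<Gamma>)"
    unfolding graph_insert_def by (simp_all add: Let_def)
qed

lemma arity_graph_insert [simp]: "arity (graph_insert \<Gamma> i \<Delta>) = arity \<Gamma>"
  by (simp add: arity_def)

text \<open>The part of stability on which identities of insertion rest: a flag outside
  \<open>flags\<close> could address a leg that does not exist, where \<open>!\<close> is
  unspecified. It is preserved by insertion without a condition on the genus.\<close>

definition wf_graph :: "graph \<Rightarrow> bool" where
  "wf_graph \<Gamma> \<longleftrightarrow> set (flag_list \<Gamma>) \<subseteq> flags \<Gamma>"

lemma stable_imp_wf: "stable_graph \<Gamma> \<Longrightarrow> wf_graph \<Gamma>"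
  by (simp add: stable_graph_def wf_graph_def)

lemma wf_edges: "wf_graph \<Gamma> \<Longrightarrow> (a, b) \<in> set (edges \<Gamma>) \<Longrightarrow> a \<in> flags \<Gamma> \<and> b \<in> flags \<Gamma>"
  by (force simp: wf_graph_def flag_list_def)

lemma wf_legs: "wf_graph \<Gamma> \<Longrightarrow> a \<in> set (legs \<Gamma>) \<Longrightarrow> a \<in> flags \<Gamma>"
  by (auto simp: wf_graph_def flag_list_def)

lemma wf_legs_nth: "wf_graph \<Gamma> \<Longrightarrow> k < arity \<Gamma> \<Longrightarrow>
    fst (legs \<Gamma> ! k) < length (verts \<Gamma>) \<and> snd (legs \<Gamma> ! k) < snd (verts \<Gamma> ! fst (legs \<Gamma> ! k))"
  using wf_legs[of \<Gamma> "legs \<Gamma> ! k"] by (auto simp: flags_def arity_def case_prod_beta)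

lemma wf_graphI:
  "(\<And>a b. (a, b) \<in> set (edges \<Gamma>) \<Longrightarrow> a \<in> flags \<Gamma> \<and> b \<in> flags \<Gamma>) \<Longrightarrow>
   (\<And>a. a \<in> set (legs \<Gamma>) \<Longrightarrow> a \<in> flags \<Gamma>) \<Longrightarrow> wf_graph \<Gamma>"
  by (fastforce simp: wf_graph_def flag_list_def)

lemma in_flags: "f \<in> flags \<Gamma> \<longleftrightarrow> fst f < length (verts \<Gamma>) \<and> snd f < snd (verts \<Gamma> ! fst f)"
  by (cases f) (simp add: flags_def)

lemma map_edges_cong:
  assumes "wf_graph \<Gamma>" "\<And>f. f \<in> flags \<Gamma> \<Longrightarrow> \<phi> f = \<psi> f"
  shows "map (map_prod \<phi> \<phi>) (edges \<Gamma>) = map (map_prod \<psi> \<psi>) (edges \<Gamma>)"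
    and "map \<phi> (legs \<Gamma>) = map \<psi> (legs \<Gamma>)"
  using wf_edges[OF assms(1)] wf_legs[OF assms(1)] assms(2) by auto

lemma graph_eqI: "verts \<Gamma> = verts \<Delta> \<Longrightarrow> edges \<Gamma> = edges \<Delta> \<Longrightarrow> legs \<Gamma> = legs \<Delta> \<Longrightarrow> \<Gamma> = \<Delta>"
  by (simp add: graph.expand)

lemma outer_flag_in_flags:
  assumes "wf_graph \<Delta>" "f \<in> flags \<Gamma>" "i < length (verts \<Gamma>)" "snd (verts \<Gamma> ! i) = arity \<Delta>"
  shows "outer_flag i \<Delta> f \<in> flags (graph_insert \<Gamma> i \<Delta>)"
proof (cases "fst f = i")
  case True
  then have "snd f < arity \<Delta>" using assms by (simp add: in_flags)
  from wf_legs_nth[OF assms(1) this] show ?thesis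
    using True assms(3) nth_list_insert[of i "verts \<Gamma>" "i + fst (legs \<Delta> ! snd f)" "verts \<Delta>"]
    by (auto simp: in_flags outer_flag_def inner_flag_def length_list_insert)
next
  case False
  then show ?thesis
    using assms by (auto simp: in_flags outer_flag_def length_list_insert nth_list_insert)
qed

lemma inner_flag_in_flags:
  "f \<in> flags \<Delta> \<Longrightarrow> i < length (verts \<Gamma>) \<Longrightarrow> inner_flag i f \<in> flags (graph_insert \<Gamma> i \<Delta>)"
  by (auto simp: in_flags inner_flag_def length_list_insert nth_list_insert)

lemma wf_graph_insert:
  assumes "wf_graph \<Gamma>" "wf_graph \<Delta>" "i < length (verts \<Gamma>)" "snd (verts \<Gamma> ! i) = arity \<Delta>"
  shows "wf_graph (graph_insert \<Gamma> i \<Delta>)"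
proof (rule wf_graphI)
  fix a b assume "(a, b) \<in> set (edges (graph_insert \<Gamma> i \<Delta>))"
  then show "a \<in> flags (graph_insert \<Gamma> i \<Delta>) \<and> b \<in> flags (graph_insert \<Gamma> i \<Delta>)"
    using outer_flag_in_flags[OF assms(2) _ assms(3,4)] inner_flag_in_flags[OF _ assms(3), of _ \<Delta>]
      wf_edges[OF assms(1)] wf_edges[OF assms(2)] by auto
next
  fix a assume "a \<in> set (legs (graph_insert \<Gamma> i \<Delta>))"
  then show "a \<in> flags (graph_insert \<Gamma> i \<Delta>)"
    using outer_flag_in_flags[OF assms(2) _ assms(3,4)] wf_legs[OF assms(1)] by auto
qed

lemma outer_inner_flag: "outer_flag (i + j) \<Theta> (inner_flag i f) = inner_flag i (outer_flag j \<Theta> f)"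
  by (auto simp: outer_flag_def inner_flag_def)

lemma inner_inner_flag: "inner_flag i (inner_flag j f) = inner_flag (i + j) f"
  by (simp add: inner_flag_def)

lemma inner_flag_0 [simp]: "inner_flag 0 = id"
  by (auto simp: inner_flag_def)

text \<open>Associativity is strict: on both sides the edges appear in the order of
  \<open>\<Gamma>\<close>, \<open>\<Delta>\<close>, \<open>\<Theta>\<close>, so only the
  relabellings of flags have to be compared.\<close>

lemma graph_insert_nested:
  assumes "wf_graph \<Gamma>" "i < length (verts \<Gamma>)" "snd (verts \<Gamma> ! i) = arity \<Delta>" "j < length (verts \<Delta>)"
  shows "graph_insert (graph_insert \<Gamma> i \<Delta>) (i + j) \<Theta> = graph_insert \<Gamma> i (graph_insert \<Delta> j \<Theta>)"
proof -
  have o: "outer_flag (i + j) \<Theta> (outer_flag i \<Delta> f) = outer_flag i (graph_insert \<Delta> j \<Theta>) f"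
    if "f \<in> flags \<Gamma>" for f
  proof -
    consider "fst f < i" | "fst f = i" | "fst f > i" by linarith
    then show ?thesis
    proof cases
      case 2
      then have "snd f < length (legs \<Delta>)" using that assms(3) by (simp add: in_flags arity_def)
      then show ?thesis using 2 outer_inner_flag[of i j \<Theta>] by (simp add: outer_flag_def[of i])
    qed (use assms in \<open>auto simp: outer_flag_def length_list_insert\<close>)
  qed
  show ?thesis
    by (rule graph_eqI)
      (use list_insert_nested[OF assms(2,4)] o map_edges_cong[OF assms(1), of "\<lambda>x. outer_flag (i + j) \<Theta> (outer_flag i \<Delta> x)"]
       in \<open>simp_all add: outer_inner_flag inner_inner_flag map_prod_compose comp_def map_prod.compositionality\<close>)
qed

section \<open>Reordering edges\<close>

text \<open>The number of adjacent transpositions is recorded because its parity is the sign in the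
  twisted case; it is not claimed to be minimal.\<close>

inductive reorder :: "graph \<Rightarrow> nat \<Rightarrow> graph \<Rightarrow> bool" where
  refl: "reorder \<Gamma> 0 \<Gamma>"
| swap: "reorder \<Gamma> n \<Gamma>' \<Longrightarrow> Suc i < length (edges \<Gamma>') \<Longrightarrow> reorder \<Gamma> (Suc n) (swap_edges i \<Gamma>')"

lemma reorder_trans: "reorder \<Gamma>' n \<Gamma>'' \<Longrightarrow> reorder \<Gamma> m \<Gamma>' \<Longrightarrow> reorder \<Gamma> (m + n) \<Gamma>''"
proof (induction rule: reorder.induct)
  case (swap \<Gamma> n \<Gamma>' i)
  then show ?case using reorder.swap[of _ "m + n"] by simp
qed simp

lemma swap_at_append: "swap_at (length A) (A @ x # y # B) = A @ y # x # B"
  by (simp add: swap_at_def nth_append list_update_append)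

lemma length_swap_at [simp]: "length (swap_at i xs) = length xs"
  by (simp add: swap_at_def)

lemma reorder_one: "reorder (Graph V (A @ B @ c # D) L) (length B) (Graph V (A @ c # B @ D) L)"
proof (induction B arbitrary: D rule: rev_induct)
  case Nil
  show ?case by (simp add: reorder.refl)
next
  case (snoc b B)
  have "swap_edges (length (A @ B)) (Graph V (A @ B @ b # c # D) L) = Graph V (A @ B @ c # b # D) L"
    using swap_at_append[of "A @ B" b c D] by (simp add: swap_edges_def)
  then have "reorder (Graph V (A @ B @ b # c # D) L) 1 (Graph V (A @ B @ c # b # D) L)"
    using reorder.swap[OF reorder.refl, of "length (A @ B)" "Graph V (A @ B @ b # c # D) L"] by simp
  from reorder_trans[OF snoc[of "b # D"] this] show ?case by simp
qed

text \<open>Each edge of \<open>C\<close> passes all of \<open>B\<close>; the count has the parity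
  that the Koszul rule gives for two blocks of odd elements.\<close>

lemma reorder_block:
  "reorder (Graph V (A @ B @ C @ D) L) (length B * length C) (Graph V (A @ C @ B @ D) L)"
proof (induction C arbitrary: A)
  case Nil
  show ?case by (simp add: reorder.refl)
next
  case (Cons c C)
  from reorder_trans[OF Cons[of "A @ [c]"] ] reorder_one[of V A B c "C @ D" L]
  show ?case by simp
qed

lemma swap_at_map: "Suc i < length xs \<Longrightarrow> swap_at i (map f xs) = map f (swap_at i xs)"
  by (simp add: swap_at_def map_update)

lemma swap_at_append1: "Suc i < length xs \<Longrightarrow> swap_at i (xs @ ys) = swap_at i xs @ ys"
  by (simp add: swap_at_def nth_append list_update_append)

lemma swap_at_append2: "swap_at (length xs + i) (xs @ ys) = xs @ swap_at i ys"
  by (simp add: swap_at_def nth_append list_update_append)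

lemma graph_insert_swap_edges:
  "Suc m < length (edges \<Gamma>) \<Longrightarrow> graph_insert (swap_edges m \<Gamma>) i \<Delta> = swap_edges m (graph_insert \<Gamma> i \<Delta>)"
  by (rule graph_eqI) (simp_all add: swap_edges_def swap_at_map swap_at_append1)

lemma graph_insert_swap_edges_inner:
  "Suc m < length (edges \<Delta>) \<Longrightarrow>
    graph_insert \<Gamma> i (swap_edges m \<Delta>) = swap_edges (length (edges \<Gamma>) + m) (graph_insert \<Gamma> i \<Delta>)"
  using outer_flag_cong[of "swap_edges m \<Delta>" \<Delta> i]
  by (intro graph_eqI)
    (simp_all add: swap_edges_def swap_at_map swap_at_append2[of "map f xs" for f xs, simplified])

lemma graph_insert_flip_edge:
  "m < length (edges \<Gamma>) \<Longrightarrow> graph_insert (flip_edge m \<Gamma>) i \<Delta> = flip_edge m (graph_insert \<Gamma> i \<Delta>)"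
  by (rule graph_eqI)
    (simp_all add: flip_edge_def map_update nth_append list_update_append prod.swap_def)

lemma graph_insert_flip_edge_inner:
  "m < length (edges \<Delta>) \<Longrightarrow>
    graph_insert \<Gamma> i (flip_edge m \<Delta>) = flip_edge (length (edges \<Gamma>) + m) (graph_insert \<Gamma> i \<Delta>)"
  using outer_flag_cong[of "flip_edge m \<Delta>" \<Delta> i]
  by (intro graph_eqI)
    (simp_all add: flip_edge_def map_update nth_append list_update_append prod.swap_def)

lemma reorder_graph_insert:
  "reorder \<Gamma> n \<Gamma>' \<Longrightarrow> reorder (graph_insert \<Gamma> i \<Delta>) n (graph_insert \<Gamma>' i \<Delta>)"
proof (induction rule: reorder.induct)
  case (swap \<Gamma> n \<Gamma>' m)
  then show ?case using reorder.swap[of _ n _ m] by (simp add: graph_insert_swap_edges)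
qed (rule reorder.refl)

text \<open>The edges of the graph inserted last stand last, so the two orders of insertion differ
  by exchanging the edge block of \<open>\<Delta>\<close> with that of
  \<open>\<Theta>\<close>.\<close>

lemma graph_insert_parallel:
  assumes "wf_graph \<Gamma>" "wf_graph \<Delta>" "i < j" "j < length (verts \<Gamma>)" "snd (verts \<Gamma> ! i) = arity \<Delta>"
  shows "reorder (graph_insert (graph_insert \<Gamma> i \<Delta>) (j + length (verts \<Delta>) - 1) \<Theta>)
           (length (edges \<Delta>) * length (edges \<Theta>)) (graph_insert (graph_insert \<Gamma> j \<Theta>) i \<Delta>)"
proof -
  let ?j = "j + length (verts \<Delta>) - 1"
  have o: "outer_flag ?j \<Theta> (outer_flag i \<Delta> f) = outer_flag i \<Delta> (outer_flag j \<Theta> f)" if "f \<in> flags \<Gamma>" for f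
  proof -
    consider "fst f < i" | "fst f = i" | "fst f > i" by linarith
    then show ?thesis
    proof cases
      case 2
      then have "snd f < arity \<Delta>" using that assms(5) by (simp add: in_flags)
      from wf_legs_nth[OF assms(2) this] show ?thesis
        using 2 assms(3) by (auto simp: outer_flag_def inner_flag_def)
    qed (use assms in \<open>auto simp: outer_flag_def inner_flag_def\<close>)
  qed
  have i: "outer_flag ?j \<Theta> (inner_flag i f) = inner_flag i f" if "f \<in> flags \<Delta>" for f
    using that assms(3) by (auto simp: outer_flag_def inner_flag_def in_flags)
  have k: "outer_flag i \<Delta> (inner_flag j f) = inner_flag ?j f" for f
    using assms(3) by (auto simp: outer_flag_def inner_flag_def)
  let ?A = "map (map_prod (outer_flag i \<Delta>) (outer_flag i \<Delta>)) (map (map_prod (outer_flag j \<Theta>) (outer_flag j \<Theta>)) (edges \<Gamma>))"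
  let ?B = "map (map_prod (inner_flag i) (inner_flag i)) (edges \<Delta>)"
  let ?C = "map (map_prod (inner_flag ?j) (inner_flag ?j)) (edges \<Theta>)"
  let ?V = "list_insert i (verts \<Delta>) (list_insert j (verts \<Theta>) (verts \<Gamma>))"
  let ?L = "map (outer_flag i \<Delta>) (map (outer_flag j \<Theta>) (legs \<Gamma>))"
  have "graph_insert (graph_insert \<Gamma> i \<Delta>) ?j \<Theta> = Graph ?V (?A @ ?B @ ?C) ?L"
  proof (rule graph_eqI)
    show "verts (graph_insert (graph_insert \<Gamma> i \<Delta>) ?j \<Theta>) = verts (Graph ?V (?A @ ?B @ ?C) ?L)"
      using list_insert_parallel[OF assms(3,4)] by simp
    show "edges (graph_insert (graph_insert \<Gamma> i \<Delta>) ?j \<Theta>) = edges (Graph ?V (?A @ ?B @ ?C) ?L)"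
      using map_edges_cong(1)[OF assms(1) o] map_edges_cong(1)[OF assms(2) i]
      by (simp add: comp_def map_prod.compositionality)
    show "legs (graph_insert (graph_insert \<Gamma> i \<Delta>) ?j \<Theta>) = legs (Graph ?V (?A @ ?B @ ?C) ?L)"
      using map_edges_cong(2)[OF assms(1) o] by (simp add: comp_def)
  qed
  moreover have "graph_insert (graph_insert \<Gamma> j \<Theta>) i \<Delta> = Graph ?V (?A @ ?C @ ?B) ?L"
    by (rule graph_eqI) (simp_all add: comp_def map_prod.compositionality k)
  ultimately show ?thesis using reorder_block[of ?V ?A ?B ?C "[]" ?L] by simp
qed

section \<open>Simultaneous insertion\<close>

abbreviation nverts :: "graph \<Rightarrow> nat" where "nverts \<Gamma> \<equiv> length (verts \<Gamma>)"
abbreviation nedges :: "graph \<Rightarrow> nat" where "nedges \<Gamma> \<equiv> length (edges \<Gamma>)"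

text \<open>Adds a starting vertex \<open>m\<close> to \<open>graph_insert_all\<close>, for
  induction on the list. As the last vertex is treated first, the vertices still to be replaced keep
  their numbers.\<close>

definition insert_from :: "nat \<Rightarrow> graph list \<Rightarrow> graph \<Rightarrow> graph" where
  "insert_from m \<Delta>s \<Gamma> = foldr (\<lambda>(i, \<Delta>) \<Theta>. graph_insert \<Theta> i \<Delta>) (enumerate m \<Delta>s) \<Gamma>"

lemma insert_from_Nil [simp]: "insert_from m [] \<Gamma> = \<Gamma>"
  and insert_from_Cons [simp]:
    "insert_from m (\<Delta> # \<Delta>s) \<Gamma> = graph_insert (insert_from (Suc m) \<Delta>s \<Gamma>) m \<Delta>"
  by (simp_all add: insert_from_def)

lemma graph_insert_all_eq: "graph_insert_all \<Gamma> \<Delta>s = insert_from 0 \<Delta>s \<Gamma>"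
  by (simp add: graph_insert_all_def insert_from_def)

lemma insert_from_append:
  "insert_from m (As @ Bs) \<Gamma> = insert_from m As (insert_from (m + length As) Bs \<Gamma>)"
  by (induction As arbitrary: m) simp_all

text \<open>The arities and well-formedness needed for inserting into the vertices \<open>m\<close>,
  \<open>m + 1\<close> and so on; the base case also ensures that there are enough vertices.\<close>

primrec insertable :: "nat \<Rightarrow> graph list \<Rightarrow> graph \<Rightarrow> bool" where
  "insertable m [] \<Gamma> \<longleftrightarrow> m \<le> nverts \<Gamma>"
| "insertable m (\<Delta> # \<Delta>s) \<Gamma> \<longleftrightarrow> snd (verts \<Gamma> ! m) = arity \<Delta> \<and> wf_graph \<Delta> \<and> insertable (Suc m) \<Delta>s \<Gamma>"

lemma insertable_append:
  "insertable m (As @ Bs) \<Gamma> \<longleftrightarrow> insertable m As \<Gamma> \<and> insertable (m + length As) Bs \<Gamma>"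
proof -
  have le: "m + length Bs \<le> nverts \<Gamma>" if "insertable m Bs \<Gamma>" for m Bs
    using that by (induction Bs arbitrary: m) force+
  show ?thesis
  proof (induction As arbitrary: m)
    case Nil
    show ?case using le[of m Bs] by auto
  qed auto
qed

lemma insertable_length: "insertable m Bs \<Gamma> \<Longrightarrow> m + length Bs \<le> nverts \<Gamma>"
  by (induction Bs arbitrary: m) force+

text \<open>Only the vertex types at the positions in question matter, so the condition can be
  carried to graphs that are modified elsewhere.\<close>

lemma insertable_cong:
  "insertable m Bs \<Gamma> \<Longrightarrow> m' + length Bs \<le> nverts \<Gamma>' \<Longrightarrow>
   (\<And>j. j < length Bs \<Longrightarrow> verts \<Gamma>' ! (m' + j) = verts \<Gamma> ! (m + j)) \<Longrightarrow> insertable m' Bs \<Gamma>'"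
proof (induction Bs arbitrary: m m')
  case (Cons B Bs)
  have "verts \<Gamma>' ! (Suc m' + j) = verts \<Gamma> ! (Suc m + j)" if "j < length Bs" for j
    using Cons.prems(3)[of "Suc j"] that by simp
  then show ?case using Cons.IH[of "Suc m" "Suc m'"] Cons.prems(1,2) Cons.prems(3)[of 0] by simp
qed simp

lemma verts_insert_from:
  "m + length \<Delta>s \<le> nverts \<Gamma> \<Longrightarrow>
    verts (insert_from m \<Delta>s \<Gamma>) = take m (verts \<Gamma>) @ concat (map verts \<Delta>s) @ drop (m + length \<Delta>s) (verts \<Gamma>)"
proof (induction \<Delta>s arbitrary: m)
  case (Cons \<Delta> \<Delta>s)
  then have "verts (insert_from (Suc m) \<Delta>s \<Gamma>) =
      take m (verts \<Gamma>) @ verts \<Gamma> ! m # concat (map verts \<Delta>s) @ drop (m + length (\<Delta> # \<Delta>s)) (verts \<Gamma>)"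
    by (simp add: take_Suc_conv_app_nth)
  moreover have "length (take m (verts \<Gamma>)) = m" using Cons.prems by simp
  ultimately show ?case
    using list_insert_append[of "take m (verts \<Gamma>)"] by simp
qed simp

text \<open>The replaced vertices are added on the left, which avoids a truncated
  subtraction.\<close>

lemma nverts_insert_from:
  "m + length \<Delta>s \<le> nverts \<Gamma> \<Longrightarrow>
    nverts (insert_from m \<Delta>s \<Gamma>) + length \<Delta>s = nverts \<Gamma> + sum_list (map nverts \<Delta>s)"
  by (simp add: verts_insert_from length_concat comp_def)

lemma nedges_insert_from: "nedges (insert_from m \<Delta>s \<Gamma>) = nedges \<Gamma> + sum_list (map nedges \<Delta>s)"
  by (induction \<Delta>s arbitrary: m) simp_all

lemma arity_insert_from [simp]: "arity (insert_from m \<Delta>s \<Gamma>) = arity \<Gamma>"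
  by (induction \<Delta>s arbitrary: m) simp_all

lemma nth_insert_from:
  "m + length \<Delta>s \<le> nverts \<Gamma> \<Longrightarrow> j < m \<Longrightarrow>
    j < nverts (insert_from m \<Delta>s \<Gamma>) \<and> verts (insert_from m \<Delta>s \<Gamma>) ! j = verts \<Gamma> ! j"
  by (simp add: verts_insert_from nth_append)

lemma insertable_insert_from:
  assumes "insertable m As \<Gamma>" "m + length As \<le> k" "k + length Bs \<le> nverts \<Gamma>"
  shows "insertable m As (insert_from k Bs \<Gamma>)"
  by (rule insertable_cong[OF assms(1)])
    (use assms nth_insert_from[of k Bs \<Gamma>] in \<open>auto simp: verts_insert_from\<close>)

lemma wf_insert_from: "wf_graph \<Gamma> \<Longrightarrow> insertable m \<Delta>s \<Gamma> \<Longrightarrow> wf_graph (insert_from m \<Delta>s \<Gamma>)"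
proof (induction \<Delta>s arbitrary: m)
  case (Cons \<Delta> \<Delta>s)
  have "m < nverts (insert_from (Suc m) \<Delta>s \<Gamma>) \<and> verts (insert_from (Suc m) \<Delta>s \<Gamma>) ! m = verts \<Gamma> ! m"
    using Cons.prems(2) insertable_length[of "Suc m" \<Delta>s \<Gamma>] by (intro nth_insert_from) auto
  then show ?case using Cons by (auto intro!: wf_graph_insert)
qed simp

lemma reorder_insert_from:
  "reorder \<Gamma> n \<Gamma>' \<Longrightarrow> reorder (insert_from m \<Delta>s \<Gamma>) n (insert_from m \<Delta>s \<Gamma>')"
  by (induction \<Delta>s arbitrary: m) (simp_all add: reorder_graph_insert)

lemma insert_from_nested:
  assumes "wf_graph \<Gamma>" "i < nverts \<Gamma>" "snd (verts \<Gamma> ! i) = arity \<Delta>"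
  shows "insertable m Ks \<Delta> \<Longrightarrow>
    insert_from (i + m) Ks (graph_insert \<Gamma> i \<Delta>) = graph_insert \<Gamma> i (insert_from m Ks \<Delta>)"
proof (induction Ks arbitrary: m)
  case (Cons K Ks)
  have "m < nverts (insert_from (Suc m) Ks \<Delta>)"
    using Cons.prems insertable_length[of "Suc m" Ks \<Delta>] nth_insert_from[of "Suc m" Ks \<Delta> m] by auto
  then have "graph_insert (graph_insert \<Gamma> i (insert_from (Suc m) Ks \<Delta>)) (i + m) K =
      graph_insert \<Gamma> i (graph_insert (insert_from (Suc m) Ks \<Delta>) m K)"
    using assms by (intro graph_insert_nested) auto
  then show ?case using Cons.IH[of "Suc m"] Cons.prems by simp
qed simp

text \<open>The edges of \<open>\<Delta>\<close> precede those of \<open>Bs\<close> if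
  \<open>\<Delta>\<close> is inserted first, and follow them if it is inserted last.\<close>

lemma insert_from_parallel_after:
  assumes "wf_graph \<Gamma>" "wf_graph \<Delta>" "snd (verts \<Gamma> ! i) = arity \<Delta>"
  shows "i < j \<Longrightarrow> insertable j Bs \<Gamma> \<Longrightarrow>
    reorder (insert_from (j + nverts \<Delta> - 1) Bs (graph_insert \<Gamma> i \<Delta>))
      (nedges \<Delta> * sum_list (map nedges Bs)) (graph_insert (insert_from j Bs \<Gamma>) i \<Delta>)"
proof (induction Bs arbitrary: j)
  case (Cons B Bs)
  let ?G = "insert_from (Suc j) Bs \<Gamma>"
  have j: "Suc (j + nverts \<Delta> - 1) = Suc j + nverts \<Delta> - 1" using Cons.prems by simp
  have le: "Suc j + length Bs \<le> nverts \<Gamma>" using Cons.prems insertable_length[of "Suc j" Bs \<Gamma>] by simp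
  have "reorder (insert_from (Suc j + nverts \<Delta> - 1) Bs (graph_insert \<Gamma> i \<Delta>))
      (nedges \<Delta> * sum_list (map nedges Bs)) (graph_insert ?G i \<Delta>)"
    using Cons.prems by (intro Cons.IH) auto
  then have 1: "reorder (insert_from (j + nverts \<Delta> - 1) (B # Bs) (graph_insert \<Gamma> i \<Delta>))
      (nedges \<Delta> * sum_list (map nedges Bs)) (graph_insert (graph_insert ?G i \<Delta>) (j + nverts \<Delta> - 1) B)"
    unfolding insert_from_Cons j by (rule reorder_graph_insert)
  have 2: "reorder (graph_insert (graph_insert ?G i \<Delta>) (j + nverts \<Delta> - 1) B) (nedges \<Delta> * nedges B)
      (graph_insert (graph_insert ?G j B) i \<Delta>)"
    using Cons.prems assms nth_insert_from[OF le, of i] nth_insert_from[OF le, of j]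
    by (intro graph_insert_parallel wf_insert_from) auto
  from reorder_trans[OF 2 1] show ?case by (simp add: algebra_simps)
qed (simp add: reorder.refl)

text \<open>\<open>\<Lambda>\<close> goes into a vertex behind those replaced by \<open>As\<close>,
  with \<open>c\<close> further vertices in between. Its edges start after those of
  \<open>As\<close> and end up before them.\<close>

lemma insert_from_parallel_before:
  assumes "wf_graph \<Gamma>"
  shows "insertable m As \<Gamma> \<Longrightarrow> m + length As + c < nverts \<Gamma> \<Longrightarrow>
    reorder (graph_insert (insert_from m As \<Gamma>) (m + sum_list (map nverts As) + c) \<Lambda>)
      (sum_list (map nedges As) * nedges \<Lambda>) (insert_from m As (graph_insert \<Gamma> (m + length As + c) \<Lambda>))"
proof (induction As arbitrary: m)
  case (Cons A As)
  let ?G = "insert_from (Suc m) As \<Gamma>"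
  let ?j = "Suc m + sum_list (map nverts As) + c"
  have le: "Suc m + length As \<le> nverts \<Gamma>" using Cons.prems by simp
  have len: "nverts ?G + length As = nverts \<Gamma> + sum_list (map nverts As)"
    using nverts_insert_from[OF le] by simp
  have "reorder (graph_insert (graph_insert ?G m A) (?j + nverts A - 1) \<Lambda>) (nedges A * nedges \<Lambda>)
     (graph_insert (graph_insert ?G ?j \<Lambda>) m A)"
    using Cons.prems assms nth_insert_from[OF le, of m] len
    by (intro graph_insert_parallel wf_insert_from) auto
  moreover have "?j + nverts A - 1 = m + sum_list (map nverts (A # As)) + c" by simp
  moreover have "reorder (graph_insert (graph_insert ?G ?j \<Lambda>) m A) (sum_list (map nedges As) * nedges \<Lambda>)
     (graph_insert (insert_from (Suc m) As (graph_insert \<Gamma> (Suc m + length As + c) \<Lambda>)) m A)"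
    using Cons.prems by (intro reorder_graph_insert Cons.IH) auto
  ultimately show ?case
    using reorder_trans by (fastforce simp: algebra_simps)
qed (simp add: reorder.refl)

text \<open>Describes the moment at which one slot is filled: \<open>Bs\<close> are already
  inserted, \<open>As\<close> are still to come.\<close>

lemma insertable_slot:
  assumes "insertable 0 (As @ \<Delta> # Bs) \<Gamma>" "wf_graph \<Gamma>"
  shows "insertable (Suc (length As)) Bs \<Gamma>" "insertable 0 As \<Gamma>" "wf_graph \<Delta>"
    "snd (verts \<Gamma> ! length As) = arity \<Delta>" "length As < nverts \<Gamma>"
    "insertable 0 As (insert_from (Suc (length As)) Bs \<Gamma>)"
    "wf_graph (insert_from (Suc (length As)) Bs \<Gamma>)"
    "length As < nverts (insert_from (Suc (length As)) Bs \<Gamma>)"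
    "snd (verts (insert_from (Suc (length As)) Bs \<Gamma>) ! length As) = arity \<Delta>"
    "insertable 0 As (graph_insert (insert_from (Suc (length As)) Bs \<Gamma>) (length As) \<Theta>)"
proof -
  let ?G = "insert_from (Suc (length As)) Bs \<Gamma>"
  show 1: "insertable (Suc (length As)) Bs \<Gamma>" "insertable 0 As \<Gamma>" "wf_graph \<Delta>"
    "snd (verts \<Gamma> ! length As) = arity \<Delta>"
    using assms by (auto simp: insertable_append)
  have le: "Suc (length As) + length Bs \<le> nverts \<Gamma>" using insertable_length[OF 1(1)] .
  then show "length As < nverts \<Gamma>" by simp
  show 2: "insertable 0 As ?G" using 1 le by (intro insertable_insert_from) auto
  show "wf_graph ?G" using 1 assms by (intro wf_insert_from)
  show 3: "length As < nverts ?G" "snd (verts ?G ! length As) = arity \<Delta>"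
    using nth_insert_from[OF le, of "length As"] 1 by auto
  show "insertable 0 As (graph_insert ?G (length As) \<Theta>)"
    by (rule insertable_cong[OF 2]) (use 3 in \<open>auto simp: list_insert_def nth_append\<close>)
qed

text \<open>The graphs \<open>As\<close> are inserted last, so edges appended to the whole graph
  have to pass those of \<open>As\<close> in order to become part of the graph between
  \<open>As\<close> and \<open>Bs\<close>.\<close>

lemma graph_insert_all_insert:
  assumes "wf_graph \<Gamma>" "insertable 0 (As @ \<Delta> # Bs) \<Gamma>" "a < nverts \<Delta>"
  shows "reorder (graph_insert (graph_insert_all \<Gamma> (As @ \<Delta> # Bs)) (sum_list (map nverts As) + a) \<Lambda>)
    (sum_list (map nedges As) * nedges \<Lambda>)
    (graph_insert_all \<Gamma> (As @ graph_insert \<Delta> a \<Lambda> # Bs))"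
proof -
  let ?G = "insert_from (Suc (length As)) Bs \<Gamma>"
  note s = insertable_slot[OF assms(2,1)]
  have "reorder (graph_insert (insert_from 0 As (graph_insert ?G (length As) \<Delta>)) (0 + sum_list (map nverts As) + a) \<Lambda>)
     (sum_list (map nedges As) * nedges \<Lambda>)
     (insert_from 0 As (graph_insert (graph_insert ?G (length As) \<Delta>) (0 + length As + a) \<Lambda>))"
    using s assms(3) by (intro insert_from_parallel_before wf_graph_insert) (auto simp: length_list_insert)
  moreover have "graph_insert (graph_insert ?G (length As) \<Delta>) (length As + a) \<Lambda> =
      graph_insert ?G (length As) (graph_insert \<Delta> a \<Lambda>)"
    using s assms(3) by (intro graph_insert_nested) auto
  ultimately show ?thesis by (simp add: graph_insert_all_eq insert_from_append)
qed

text \<open>Inserting \<open>\<Delta>\<close> beforehand places its edges in front of those of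
  \<open>Bs\<close>, inserting the composite of \<open>\<Delta>\<close> and \<open>Ks\<close> places
  them behind. The edges of \<open>Ks\<close> follow those of \<open>Bs\<close> both times.\<close>

lemma graph_insert_all_nested:
  assumes "wf_graph \<Gamma>" "insertable 0 (As @ \<Delta> # Bs) \<Gamma>" "insertable 0 Ks \<Delta>" "length Ks = nverts \<Delta>"
  shows "reorder (graph_insert_all (graph_insert \<Gamma> (length As) \<Delta>) (As @ Ks @ Bs))
    (nedges \<Delta> * sum_list (map nedges Bs))
    (graph_insert_all \<Gamma> (As @ graph_insert_all \<Delta> Ks # Bs))"
proof -
  let ?G = "insert_from (Suc (length As)) Bs \<Gamma>"
  note s = insertable_slot[OF assms(2,1)]
  have "reorder (insert_from (Suc (length As) + nverts \<Delta> - 1) Bs (graph_insert \<Gamma> (length As) \<Delta>))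
      (nedges \<Delta> * sum_list (map nedges Bs)) (graph_insert ?G (length As) \<Delta>)"
    using s assms(1) by (intro insert_from_parallel_after) auto
  then have "reorder (insert_from (length As + length Ks) Bs (graph_insert \<Gamma> (length As) \<Delta>))
      (nedges \<Delta> * sum_list (map nedges Bs)) (graph_insert ?G (length As) \<Delta>)"
    using assms(4) by simp
  then have "reorder (insert_from 0 As (insert_from (length As + 0) Ks
        (insert_from (length As + length Ks) Bs (graph_insert \<Gamma> (length As) \<Delta>))))
      (nedges \<Delta> * sum_list (map nedges Bs))
      (insert_from 0 As (insert_from (length As + 0) Ks (graph_insert ?G (length As) \<Delta>)))"
    by (intro reorder_insert_from)
  moreover have "insert_from (length As + 0) Ks (graph_insert ?G (length As) \<Delta>) =
      graph_insert ?G (length As) (insert_from 0 Ks \<Delta>)"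
    using s assms(3) by (intro insert_from_nested) auto
  ultimately show ?thesis by (simp add: graph_insert_all_eq insert_from_append)
qed

lemma insert_from_swap_edges:
  "Suc a < nedges \<Gamma> \<Longrightarrow> insert_from m As (swap_edges a \<Gamma>) = swap_edges a (insert_from m As \<Gamma>)"
  by (induction As arbitrary: m) (simp_all add: graph_insert_swap_edges nedges_insert_from)

lemma insert_from_flip_edge:
  "a < nedges \<Gamma> \<Longrightarrow> insert_from m As (flip_edge a \<Gamma>) = flip_edge a (insert_from m As \<Gamma>)"
  by (induction As arbitrary: m) (simp_all add: graph_insert_flip_edge nedges_insert_from)

text \<open>The graphs \<open>Bs\<close> are inserted earlier, so the edges of
  \<open>\<Delta>\<close> begin at position
  \<open>nedges \<Gamma> + sum_list (map nedges Bs)\<close>.\<close>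

lemma graph_insert_all_swap_edges:
  "Suc a < nedges \<Delta> \<Longrightarrow> graph_insert_all \<Gamma> (As @ swap_edges a \<Delta> # Bs) =
    swap_edges (nedges \<Gamma> + sum_list (map nedges Bs) + a) (graph_insert_all \<Gamma> (As @ \<Delta> # Bs))"
  by (simp add: graph_insert_all_eq insert_from_append graph_insert_swap_edges_inner
      insert_from_swap_edges nedges_insert_from)

lemma graph_insert_all_flip_edge:
  "a < nedges \<Delta> \<Longrightarrow> graph_insert_all \<Gamma> (As @ flip_edge a \<Delta> # Bs) =
    flip_edge (nedges \<Gamma> + sum_list (map nedges Bs) + a) (graph_insert_all \<Gamma> (As @ \<Delta> # Bs))"
  by (simp add: graph_insert_all_eq insert_from_append graph_insert_flip_edge_inner
      insert_from_flip_edge nedges_insert_from)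

section \<open>Exchanging blocks of vertices\<close>

text \<open>Exchange of adjacent blocks of \<open>m\<close> and \<open>m'\<close> vertices starting
  at \<open>a\<close>. This is what a transposition of two vertices becomes once graphs with several
  vertices are inserted into them.\<close>

definition block_index :: "nat \<Rightarrow> nat \<Rightarrow> nat \<Rightarrow> nat \<Rightarrow> nat" where
  "block_index a m m' j = (if j < a then j else if j < a + m then j + m' else if j < a + m + m' then j - m else j)"

definition block_list :: "nat \<Rightarrow> nat \<Rightarrow> nat \<Rightarrow> 'b list \<Rightarrow> 'b list" where
  "block_list a m m' xs = take a xs @ take m' (drop (a + m) xs) @ take m (drop a xs) @ drop (a + m + m') xs"

definition block_flag :: "nat \<Rightarrow> nat \<Rightarrow> nat \<Rightarrow> flag \<Rightarrow> flag" where
  "block_flag a m m' f = (block_index a m m' (fst f), snd f)"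

definition block_swap :: "nat \<Rightarrow> nat \<Rightarrow> nat \<Rightarrow> graph \<Rightarrow> graph" where
  "block_swap a m m' \<Gamma> = Graph (block_list a m m' (verts \<Gamma>))
     (map (map_prod (block_flag a m m') (block_flag a m m')) (edges \<Gamma>)) (map (block_flag a m m') (legs \<Gamma>))"

lemma block_swap_simps [simp]:
  "verts (block_swap a m m' \<Gamma>) = block_list a m m' (verts \<Gamma>)"
  "edges (block_swap a m m' \<Gamma>) = map (map_prod (block_flag a m m') (block_flag a m m')) (edges \<Gamma>)"
  "legs (block_swap a m m' \<Gamma>) = map (block_flag a m m') (legs \<Gamma>)"
  by (simp_all add: block_swap_def)

lemma block_list_append [simp]:
  "length A = a \<Longrightarrow> length B = m \<Longrightarrow> length C = m' \<Longrightarrow> block_list a m m' (A @ B @ C @ D) = A @ C @ B @ D"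
  by (simp add: block_list_def)

lemma split_blocks:
  assumes "a + m + m' \<le> length xs"
  obtains A B C D where "xs = A @ B @ C @ D" "length A = a" "length B = m" "length C = m'"
proof
  show "xs = take a xs @ take m (drop a xs) @ take m' (drop (a + m) xs) @ drop (a + m + m') xs"
    by (metis append_take_drop_id drop_drop add.commute)
qed (use assms in auto)

lemma length_block_list [simp]: "a + m + m' \<le> length xs \<Longrightarrow> length (block_list a m m' xs) = length xs"
  by (erule split_blocks) simp

lemma swap_verts_eq_block:
  assumes "Suc i < nverts \<Gamma>"
  shows "swap_verts i \<Gamma> = block_swap i (Suc 0) (Suc 0) \<Gamma>"
proof -
  have \<sigma>: "(\<lambda>(a, b). (if a = i then Suc i else if a = Suc i then i else a, b)) = block_flag i (Suc 0) (Suc 0)"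
    by (auto simp: block_flag_def block_index_def fun_eq_iff)
  have "i + Suc 0 + Suc 0 \<le> nverts \<Gamma>" using assms by simp
  then obtain A B C D where "verts \<Gamma> = A @ B @ C @ D" "length A = i" "length B = Suc 0" "length C = Suc 0"
    by (rule split_blocks)
  then have "swap_at i (verts \<Gamma>) = block_list i (Suc 0) (Suc 0) (verts \<Gamma>)"
    using swap_at_append[of A] by (auto simp: length_Suc_conv)
  then show ?thesis by (simp add: swap_verts_def block_swap_def \<sigma> Let_def)
qed

text \<open>The blocks lie behind the replaced vertex and move by \<open>nverts A - 1\<close>; the
  subtraction in \<open>b + nverts A - 1\<close> is exact since \<open>k < b\<close>.\<close>

lemma graph_insert_block_swap_before:
  assumes "wf_graph \<Gamma>" "wf_graph A" "k < b" "b + m + m' \<le> nverts \<Gamma>" "snd (verts \<Gamma> ! k) = arity A"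
  shows "graph_insert (block_swap b m m' \<Gamma>) k A = block_swap (b + nverts A - 1) m m' (graph_insert \<Gamma> k A)"
proof -
  have o: "outer_flag k A (block_flag b m m' f) = block_flag (b + nverts A - 1) m m' (outer_flag k A f)"
    if "f \<in> flags \<Gamma>" for f
  proof (cases "fst f = k")
    case True
    then have "snd f < arity A" using that assms(5) by (simp add: in_flags)
    from wf_legs_nth[OF assms(2) this] show ?thesis
      using True assms(3) by (auto simp: outer_flag_def inner_flag_def block_flag_def block_index_def)
  next
    case False
    \<comment> \<open>Writing \<open>b\<close> as a successor keeps truncated subtraction out of the
      arithmetic.\<close>
    obtain c where c: "b = Suc c" using assms(3) by (cases b) auto
    show ?thesis
    proof (cases "fst f < k")
      case True
      then show ?thesis using c assms(3) by (simp add: outer_flag_def block_flag_def block_index_def)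
    next
      case False
      with \<open>fst f \<noteq> k\<close> obtain x y where "f = (Suc x, y)" "k \<le> x"
        by (cases f; cases "fst f") auto
      then show ?thesis
        using c assms(3) by (simp add: outer_flag_def block_flag_def block_index_def, intro impI, arith)
    qed
  qed
  have i: "block_flag (b + nverts A - 1) m m' (inner_flag k f) = inner_flag k f" if "f \<in> flags A" for f
    using that assms(3) by (auto simp: block_flag_def block_index_def inner_flag_def in_flags)
  obtain X B C D where v: "verts \<Gamma> = X @ B @ C @ D" "length X = b" "length B = m" "length C = m'"
    using assms(4) by (rule split_blocks)
  have "k < length X" using v(2) assms(3) by simp
  then obtain Y x Z where X: "X = Y @ x # Z" "length Y = k" by (rule split_nthE)
  have "list_insert k (verts A) (block_list b m m' (verts \<Gamma>)) =
      block_list (b + nverts A - 1) m m' (list_insert k (verts A) (verts \<Gamma>))"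
    using v(2-) list_insert_append[of Y "verts A" x "Z @ C @ B @ D"] list_insert_append[of Y "verts A" x "Z @ B @ C @ D"]
      block_list_append[of "Y @ verts A @ Z" "b + nverts A - 1" B m C m' D]
      block_list_append[of X b B m C m' D]
    by (simp add: v(1) X(1) flip: X(2))
  then show ?thesis
    using map_edges_cong[OF assms(1) o] map_edges_cong(1)[OF assms(2) i]
    by (intro graph_eqI) (simp_all add: map_prod.compositionality comp_def)
qed

text \<open>A vertex behind both blocks keeps its number under the exchange, so the insertion there
  does not interfere.\<close>

lemma graph_insert_block_swap_after:
  assumes "b + m + m' \<le> k" "k < nverts \<Gamma>"
  shows "graph_insert (block_swap b m m' \<Gamma>) k A = block_swap b m m' (graph_insert \<Gamma> k A)"
proof -
  have o: "outer_flag k A (block_flag b m m' f) = block_flag b m m' (outer_flag k A f)" for f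
    using assms(1) by (auto simp: outer_flag_def inner_flag_def block_flag_def block_index_def)
  have i: "block_flag b m m' (inner_flag k f) = inner_flag k f" for f
    using assms(1) by (auto simp: block_flag_def block_index_def inner_flag_def)
  have "b + m + m' \<le> nverts \<Gamma>" using assms by simp
  then obtain X B C D where v: "verts \<Gamma> = X @ B @ C @ D" "length X = b" "length B = m" "length C = m'"
    by (rule split_blocks)
  have "k - (b + m + m') < length D" using v assms by simp
  then obtain Y x Z where D: "D = Y @ x # Z" "length Y = k - (b + m + m')" by (rule split_nthE)
  have k: "k = length (X @ B @ C @ Y)" "k = length (X @ C @ B @ Y)" using D v assms by simp_all
  have "list_insert k (verts A) (X @ C @ B @ Y @ x # Z) = X @ C @ B @ Y @ verts A @ Z"
    using list_insert_append[of "X @ C @ B @ Y" "verts A" x Z] unfolding k(2) by simp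
  moreover have "list_insert k (verts A) (X @ B @ C @ Y @ x # Z) = X @ B @ C @ Y @ verts A @ Z"
    using list_insert_append[of "X @ B @ C @ Y" "verts A" x Z] unfolding k(1) by simp
  ultimately have "list_insert k (verts A) (block_list b m m' (verts \<Gamma>)) =
      block_list b m m' (list_insert k (verts A) (verts \<Gamma>))"
    using v(2-) by (simp add: v(1) D(1))
  then show ?thesis
    by (intro graph_eqI) (simp_all add: map_prod.compositionality comp_def o i)
qed

lemma graph_insert_block_swap_inner:
  assumes "wf_graph \<Gamma>" "i < nverts \<Gamma>" "snd (verts \<Gamma> ! i) = arity \<Delta>" "a + m + m' \<le> nverts \<Delta>"
  shows "graph_insert \<Gamma> i (block_swap a m m' \<Delta>) = block_swap (i + a) m m' (graph_insert \<Gamma> i \<Delta>)"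
proof -
  have o: "outer_flag i (block_swap a m m' \<Delta>) f = block_flag (i + a) m m' (outer_flag i \<Delta> f)"
    if "f \<in> flags \<Gamma>" for f
  proof (cases "fst f = i")
    case True
    then have "snd f < length (legs \<Delta>)" using that assms(3) by (simp add: in_flags arity_def)
    then show ?thesis
      using True by (auto simp: outer_flag_def inner_flag_def block_flag_def block_index_def)
  qed (use assms(4) in \<open>auto simp: outer_flag_def inner_flag_def block_flag_def block_index_def\<close>)
  have i: "block_flag (i + a) m m' (inner_flag i f) = inner_flag i (block_flag a m m' f)" for f
    by (auto simp: block_flag_def block_index_def inner_flag_def)
  obtain X B C D where v: "verts \<Delta> = X @ B @ C @ D" "length X = a" "length B = m" "length C = m'"
    using assms(4) by (rule split_blocks)
  obtain Y x Z where G: "verts \<Gamma> = Y @ x # Z" "length Y = i" using assms(2) by (rule split_nthE)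
  have "list_insert i (block_list a m m' (verts \<Delta>)) (verts \<Gamma>) =
      block_list (i + a) m m' (list_insert i (verts \<Delta>) (verts \<Gamma>))"
    using v(2-) list_insert_append[of Y "X @ C @ B @ D" x Z] list_insert_append[of Y "X @ B @ C @ D" x Z]
      block_list_append[of "Y @ X" "i + a" B m C m' "D @ Z"] G(2) unfolding v(1) G(1)
    by simp
  then show ?thesis
    using map_edges_cong[OF assms(1) o]
    by (intro graph_eqI) (simp_all add: map_prod.compositionality comp_def i)
qed

lemma insert_from_block_swap_before:
  assumes "wf_graph \<Gamma>"
  shows "insertable k As \<Gamma> \<Longrightarrow> k + length As + c + m + m' \<le> nverts \<Gamma> \<Longrightarrow>
    insert_from k As (block_swap (k + length As + c) m m' \<Gamma>) =
    block_swap (k + sum_list (map nverts As) + c) m m' (insert_from k As \<Gamma>)"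
proof (induction As arbitrary: k)
  case (Cons A As)
  let ?G = "insert_from (Suc k) As \<Gamma>"
  have le: "Suc k + length As \<le> nverts \<Gamma>" using Cons.prems by simp
  have "insert_from (Suc k) As (block_swap (Suc k + length As + c) m m' \<Gamma>) =
      block_swap (Suc k + sum_list (map nverts As) + c) m m' ?G"
    using Cons.prems by (intro Cons.IH) auto
  moreover have "graph_insert (block_swap (Suc k + sum_list (map nverts As) + c) m m' ?G) k A =
      block_swap (Suc k + sum_list (map nverts As) + c + nverts A - 1) m m' (graph_insert ?G k A)"
    using Cons.prems assms nth_insert_from[OF le, of k] nverts_insert_from[OF le]
    by (intro graph_insert_block_swap_before wf_insert_from) auto
  moreover have "Suc k + sum_list (map nverts As) + c + nverts A - 1 = k + sum_list (map nverts (A # As)) + c"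
    by simp
  ultimately show ?case by (simp add: ac_simps)
qed simp

lemma insert_from_block_swap_after:
  "b + m + m' \<le> k \<Longrightarrow> k + length As \<le> nverts \<Gamma> \<Longrightarrow>
    insert_from k As (block_swap b m m' \<Gamma>) = block_swap b m m' (insert_from k As \<Gamma>)"
proof (induction As arbitrary: k)
  case (Cons A As)
  then have "k < nverts (insert_from (Suc k) As \<Gamma>)"
    using nth_insert_from[of "Suc k" As \<Gamma> k] by simp
  then show ?case using Cons by (simp add: graph_insert_block_swap_after)
qed simp

lemma graph_insert_all_block_swap:
  assumes "wf_graph \<Gamma>" "insertable 0 (As @ \<Delta> # Bs) \<Gamma>" "a + m + m' \<le> nverts \<Delta>"
  shows "graph_insert_all \<Gamma> (As @ block_swap a m m' \<Delta> # Bs) =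
    block_swap (sum_list (map nverts As) + a) m m' (graph_insert_all \<Gamma> (As @ \<Delta> # Bs))"
proof -
  let ?G = "insert_from (Suc (length As)) Bs \<Gamma>"
  note s = insertable_slot[OF assms(2,1)]
  have "graph_insert ?G (length As) (block_swap a m m' \<Delta>) =
      block_swap (length As + a) m m' (graph_insert ?G (length As) \<Delta>)"
    using s assms(3) by (intro graph_insert_block_swap_inner) auto
  moreover have "insert_from 0 As (block_swap (0 + length As + a) m m' (graph_insert ?G (length As) \<Delta>)) =
      block_swap (0 + sum_list (map nverts As) + a) m m' (insert_from 0 As (graph_insert ?G (length As) \<Delta>))"
    using s assms(3)
    by (intro insert_from_block_swap_before wf_graph_insert) (auto simp: length_list_insert)
  ultimately show ?thesis by (simp add: graph_insert_all_eq insert_from_append)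
qed

text \<open>Two effects are separated: the vertices of the inserted graphs change places as blocks,
  and so do their edges. The first is an exact relabelling, the second a
  \<open>reorder\<close>.\<close>

lemma graph_insert_swapped_pair:
  assumes "wf_graph \<Gamma>" "wf_graph \<Delta>" "wf_graph \<Delta>'" "Suc i < nverts \<Gamma>"
    "snd (verts \<Gamma> ! i) = arity \<Delta>" "snd (verts \<Gamma> ! Suc i) = arity \<Delta>'"
  shows "reorder (block_swap i (nverts \<Delta>) (nverts \<Delta>') (graph_insert (graph_insert \<Gamma> (Suc i) \<Delta>') i \<Delta>))
      (nedges \<Delta>' * nedges \<Delta>) (graph_insert (graph_insert (swap_verts i \<Gamma>) (Suc i) \<Delta>) i \<Delta>')"
proof -
  let ?\<beta> = "block_flag i (nverts \<Delta>) (nverts \<Delta>')"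
  have o: "?\<beta> (outer_flag i \<Delta> (outer_flag (Suc i) \<Delta>' f)) =
      outer_flag i \<Delta>' (outer_flag (Suc i) \<Delta> (block_flag i (Suc 0) (Suc 0) f))" if "f \<in> flags \<Gamma>" for f
  proof -
    consider "fst f = i" | "fst f = Suc i" | "fst f < i" | "fst f > Suc i" by linarith
    then show ?thesis
    proof cases
      case 1
      then have "snd f < arity \<Delta>" using that assms(5) by (simp add: in_flags)
      from wf_legs_nth[OF assms(2) this] show ?thesis
        using 1 by (auto simp: outer_flag_def inner_flag_def block_flag_def block_index_def)
    next
      case 2
      then have "snd f < arity \<Delta>'" using that assms(6) by (simp add: in_flags)
      from wf_legs_nth[OF assms(3) this] show ?thesis
        using 2 by (auto simp: outer_flag_def inner_flag_def block_flag_def block_index_def)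
    qed (auto simp: outer_flag_def inner_flag_def block_flag_def block_index_def)
  qed
  have i': "?\<beta> (outer_flag i \<Delta> (inner_flag (Suc i) f)) = inner_flag i f" if "f \<in> flags \<Delta>'" for f
    using that by (auto simp: outer_flag_def inner_flag_def block_flag_def block_index_def in_flags)
  have i: "?\<beta> (inner_flag i f) = outer_flag i \<Delta>' (inner_flag (Suc i) f)" if "f \<in> flags \<Delta>" for f
    using that by (auto simp: outer_flag_def inner_flag_def block_flag_def block_index_def in_flags)
  have "i + Suc 0 + Suc 0 \<le> nverts \<Gamma>" using assms(4) by simp
  then obtain X B C D where "verts \<Gamma> = X @ B @ C @ D" "length X = i" "length B = Suc 0" "length C = Suc 0"
    by (rule split_blocks)
  then obtain x y where v: "verts \<Gamma> = X @ x # y # D" "length X = i" by (auto simp: length_Suc_conv)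
  have v1: "list_insert i (verts \<Delta>) (list_insert (Suc i) (verts \<Delta>') (verts \<Gamma>)) = X @ verts \<Delta> @ verts \<Delta>' @ D"
    using list_insert_append[of "X @ [x]" "verts \<Delta>'" y D] list_insert_append[of X "verts \<Delta>" x "verts \<Delta>' @ D"]
    by (simp add: v(1) flip: v(2))
  have v2: "list_insert i (verts \<Delta>') (list_insert (Suc i) (verts \<Delta>) (block_list i (Suc 0) (Suc 0) (verts \<Gamma>))) = X @ verts \<Delta>' @ verts \<Delta> @ D"
    using list_insert_append[of "X @ [y]" "verts \<Delta>" x D] list_insert_append[of X "verts \<Delta>'" y "verts \<Delta> @ D"]
      block_list_append[of X "length X" "[x]" "Suc 0" "[y]" "Suc 0" D]
    by (simp add: v(1) flip: v(2))
  let ?h = "\<lambda>f. outer_flag i \<Delta>' (outer_flag (Suc i) \<Delta> (block_flag i (Suc 0) (Suc 0) f))"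
  let ?A = "map (map_prod ?h ?h) (edges \<Gamma>)"
  let ?B = "map (map_prod (inner_flag i) (inner_flag i)) (edges \<Delta>')"
  let ?C = "map (map_prod ?\<beta> ?\<beta>) (map (map_prod (inner_flag i) (inner_flag i)) (edges \<Delta>))"
  let ?V = "X @ verts \<Delta>' @ verts \<Delta> @ D"
  let ?L = "map ?h (legs \<Gamma>)"
  have "block_swap i (nverts \<Delta>) (nverts \<Delta>') (graph_insert (graph_insert \<Gamma> (Suc i) \<Delta>') i \<Delta>) =
      Graph ?V (?A @ ?B @ ?C) ?L"
    using map_edges_cong[OF assms(1) o] map_edges_cong(1)[OF assms(3) i'] v1 v(2)
    by (intro graph_eqI) (simp_all add: map_prod.compositionality comp_def)
  moreover have "graph_insert (graph_insert (swap_verts i \<Gamma>) (Suc i) \<Delta>) i \<Delta>' = Graph ?V (?A @ ?C @ ?B) ?L"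
    using map_edges_cong(1)[OF assms(2) i] v2 unfolding swap_verts_eq_block[OF assms(4)]
    by (intro graph_eqI) (simp_all add: map_prod.compositionality comp_def)
  ultimately show ?thesis using reorder_block[of ?V ?A ?B ?C "[]" ?L] by simp
qed

text \<open>Insertions behind the pair commute with the exchange unchanged; those before it shift
  the start of the blocks to \<open>sum_list (map nverts As)\<close>.\<close>

lemma graph_insert_all_swap_verts:
  assumes "wf_graph \<Gamma>" "insertable 0 (As @ \<Delta> # \<Delta>' # Bs) \<Gamma>"
  shows "reorder (block_swap (sum_list (map nverts As)) (nverts \<Delta>) (nverts \<Delta>') (graph_insert_all \<Gamma> (As @ \<Delta> # \<Delta>' # Bs)))
    (nedges \<Delta>' * nedges \<Delta>) (graph_insert_all (swap_verts (length As) \<Gamma>) (As @ \<Delta>' # \<Delta> # Bs))"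
proof -
  let ?i = "length As"
  let ?G = "insert_from (Suc (Suc ?i)) Bs \<Gamma>"
  have ins: "insertable (Suc (Suc ?i)) Bs \<Gamma>" "insertable 0 As \<Gamma>" "wf_graph \<Delta>" "wf_graph \<Delta>'"
    "snd (verts \<Gamma> ! ?i) = arity \<Delta>" "snd (verts \<Gamma> ! Suc ?i) = arity \<Delta>'"
    using assms(2) by (auto simp: insertable_append)
  have le: "Suc (Suc ?i) + length Bs \<le> nverts \<Gamma>" using insertable_length[OF ins(1)] .
  have w: "wf_graph ?G" using assms(1) ins(1) by (rule wf_insert_from)
  have len: "Suc ?i < nverts ?G" using nth_insert_from[OF le, of "Suc ?i"] by simp
  have ar: "snd (verts ?G ! ?i) = arity \<Delta>" "snd (verts ?G ! Suc ?i) = arity \<Delta>'"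
    using nth_insert_from[OF le] ins by auto
  let ?H = "graph_insert (graph_insert ?G (Suc ?i) \<Delta>') ?i \<Delta>"
  have "insert_from (Suc (Suc ?i)) Bs (swap_verts ?i \<Gamma>) = swap_verts ?i ?G"
    using insert_from_block_swap_after[of ?i "Suc 0" "Suc 0" "Suc (Suc ?i)" Bs \<Gamma>] le len
    by (simp add: swap_verts_eq_block)
  then have eq: "graph_insert_all (swap_verts ?i \<Gamma>) (As @ \<Delta>' # \<Delta> # Bs) =
      insert_from 0 As (graph_insert (graph_insert (swap_verts ?i ?G) (Suc ?i) \<Delta>) ?i \<Delta>')"
    by (simp add: graph_insert_all_eq insert_from_append)
  have wH: "wf_graph (graph_insert ?G (Suc ?i) \<Delta>')"
    using w ins(4) len ar(2) by (intro wf_graph_insert) auto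
  have lH: "?i < nverts (graph_insert ?G (Suc ?i) \<Delta>')" "snd (verts (graph_insert ?G (Suc ?i) \<Delta>') ! ?i) = arity \<Delta>"
    using len ar by (auto simp: list_insert_def nth_append)
  have "wf_graph ?H"
    by (rule wf_graph_insert[OF wH ins(3) lH])
  moreover have "insertable 0 As ?H"
  proof (rule insertable_cong[OF ins(2)])
    show "0 + length As \<le> nverts ?H" using len by (auto simp: list_insert_def)
    show "verts ?H ! (0 + j) = verts \<Gamma> ! (0 + j)" if "j < length As" for j
      using that len nth_insert_from[OF le, of j] by (simp add: list_insert_def nth_append)
  qed
  moreover have "?i + nverts \<Delta> + nverts \<Delta>' \<le> nverts ?H" using len by (simp add: list_insert_def)
  ultimately have "insert_from 0 As (block_swap (0 + ?i + 0) (nverts \<Delta>) (nverts \<Delta>') ?H) =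
      block_swap (0 + sum_list (map nverts As) + 0) (nverts \<Delta>) (nverts \<Delta>') (insert_from 0 As ?H)"
    by (intro insert_from_block_swap_before) auto
  then have eq': "insert_from 0 As (block_swap ?i (nverts \<Delta>) (nverts \<Delta>') ?H) =
      block_swap (sum_list (map nverts As)) (nverts \<Delta>) (nverts \<Delta>') (graph_insert_all \<Gamma> (As @ \<Delta> # \<Delta>' # Bs))"
    by (simp add: graph_insert_all_eq insert_from_append)
  have "reorder (block_swap ?i (nverts \<Delta>) (nverts \<Delta>') ?H) (nedges \<Delta>' * nedges \<Delta>)
      (graph_insert (graph_insert (swap_verts ?i ?G) (Suc ?i) \<Delta>) ?i \<Delta>')"
    using w ins len ar by (intro graph_insert_swapped_pair) auto
  from reorder_insert_from[OF this, of 0 As] show ?thesis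
    unfolding eq eq' .
qed

section \<open>Stability and genus\<close>

lemma flags_eq_Sigma: "flags \<Gamma> = Sigma {..<nverts \<Gamma>} (\<lambda>i. {..<snd (verts \<Gamma> ! i)})"
  by (auto simp: flags_def)

lemma card_flags: "finite (flags \<Gamma>)" "card (flags \<Gamma>) = sum_list (map snd (verts \<Gamma>))"
  unfolding flags_eq_Sigma by (simp_all add: sum_list_sum_nth lessThan_atLeast0)

lemma length_flag_list: "length (flag_list \<Gamma>) = 2 * nedges \<Gamma> + arity \<Gamma>"
  by (simp add: flag_list_def arity_def)

text \<open>A list that enumerates a finite set is distinct iff its length is the cardinality, here
  the sum of the valences. Distinctness of flags becomes an equation that is additive under
  insertion.\<close>

lemma distinct_flag_list_iff:
  assumes "set (flag_list \<Gamma>) = flags \<Gamma>"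
  shows "distinct (flag_list \<Gamma>) \<longleftrightarrow> 2 * nedges \<Gamma> + arity \<Gamma> = sum_list (map snd (verts \<Gamma>))"
  using card_distinct[of "flag_list \<Gamma>"] distinct_card[of "flag_list \<Gamma>"] card_flags(2)[of \<Gamma>]
  unfolding assms length_flag_list by auto

lemma stable_graph_iff:
  "stable_graph \<Gamma> \<longleftrightarrow> set (flag_list \<Gamma>) = flags \<Gamma> \<and> 2 * nedges \<Gamma> + arity \<Gamma> = sum_list (map snd (verts \<Gamma>)) \<and>
     connected_graph \<Gamma> \<and> (\<forall>(g, n) \<in> set (verts \<Gamma>). stable g n)"
  using distinct_flag_list_iff[of \<Gamma>] by (auto simp: stable_graph_def)

lemma set_flag_list:
  "set (flag_list \<Gamma>) = fst ` set (edges \<Gamma>) \<union> snd ` set (edges \<Gamma>) \<union> set (legs \<Gamma>)"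
  by (auto simp: flag_list_def)

lemma adjacent_iff:
  "(u, v) \<in> adjacent \<Gamma> \<longleftrightarrow> (\<exists>e \<in> set (edges \<Gamma>). (u = fst (fst e) \<and> v = fst (snd e)) \<or> (u = fst (snd e) \<and> v = fst (fst e)))"
  unfolding adjacent_def by force

lemma adjacent_sym: "(u, v) \<in> adjacent \<Gamma> \<Longrightarrow> (v, u) \<in> adjacent \<Gamma>"
  by (auto simp: adjacent_iff)

text \<open>Collapsing the inserted vertices to \<open>i\<close> gives a map \<open>pr\<close> to
  the vertices of \<open>\<Gamma>\<close>. Its fibres are connected because \<open>\<Delta>\<close>
  is, and every edge of \<open>\<Gamma>\<close> lifts.\<close>

lemma connected_graph_insert:
  assumes "connected_graph \<Gamma>" "connected_graph \<Delta>" "wf_graph \<Gamma>" "wf_graph \<Delta>" "i < nverts \<Gamma>"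
    "snd (verts \<Gamma> ! i) = arity \<Delta>"
  shows "connected_graph (graph_insert \<Gamma> i \<Delta>)"
proof -
  let ?G = "graph_insert \<Gamma> i \<Delta>"
  let ?R = "(adjacent ?G)\<^sup>*"
  define pr where "pr x = (if x < i then x else if x < i + nverts \<Delta> then i else x + 1 - nverts \<Delta>)" for x
  have len: "nverts ?G = nverts \<Gamma> + nverts \<Delta> - 1" using assms(5) by (simp add: length_list_insert)
  have D: "nverts \<Delta> \<noteq> 0" using assms(2) by (simp add: connected_graph_def)
  have pr: "pr (fst (outer_flag i \<Delta> f)) = fst f" if "f \<in> flags \<Gamma>" for f
  proof (cases "fst f = i")
    case True
    then have "snd f < arity \<Delta>" using that assms(6) by (simp add: in_flags)
    from wf_legs_nth[OF assms(4) this] show ?thesis using True by (simp add: outer_flag_def inner_flag_def pr_def)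
  next
    case False
    then show ?thesis using D by (auto simp: outer_flag_def pr_def)
  qed
  have in': "(i + a, i + b) \<in> ?R" if "a < nverts \<Delta>" "b < nverts \<Delta>" for a b
  proof -
    have "(a, b) \<in> (adjacent \<Delta>)\<^sup>*" using assms(2) that by (simp add: connected_graph_def)
    then show ?thesis
    proof (induction rule: rtrancl_induct)
      case (step u v)
      from step(2) obtain e where "e \<in> set (edges \<Delta>)"
        "(u = fst (fst e) \<and> v = fst (snd e)) \<or> (u = fst (snd e) \<and> v = fst (fst e))"
        by (auto simp: adjacent_iff)
      then have "(i + u, i + v) \<in> adjacent ?G"
        unfolding adjacent_iff
        by (intro bexI[of _ "map_prod (inner_flag i) (inner_flag i) e"]) (auto simp: inner_flag_def)
      with step(3) show ?case by (rule rtrancl_into_rtrancl)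
    qed simp
  qed
  have fib: "(x, y) \<in> ?R" if "pr x = pr y" for x y
  proof (cases "x = y")
    case False
    with that have "x = i + (x - i)" "x - i < nverts \<Delta>" "y = i + (y - i)" "y - i < nverts \<Delta>"
      by (auto simp: pr_def split: if_splits)
    then show ?thesis using in' by metis
  qed simp
  \<comment> \<open>Path lifting: the endpoint of a lift is controlled only up to its fibre, which
    \<open>fib\<close> repairs.\<close>
  have path: "\<exists>y. pr y = v \<and> (x, y) \<in> ?R" if "(pr x, v) \<in> (adjacent \<Gamma>)\<^sup>*" for x v
    using that
  proof (induction rule: rtrancl_induct)
    case (step u v)
    from step(3) obtain y where y: "pr y = u" "(x, y) \<in> ?R" by blast
    from step(2) obtain e where e: "e \<in> set (edges \<Gamma>)"
      "(u = fst (fst e) \<and> v = fst (snd e)) \<or> (u = fst (snd e) \<and> v = fst (fst e))"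
      by (auto simp: adjacent_iff)
    let ?e = "map_prod (outer_flag i \<Delta>) (outer_flag i \<Delta>) e"
    have fl: "fst e \<in> flags \<Gamma>" "snd e \<in> flags \<Gamma>" using wf_edges[OF assms(3), of "fst e" "snd e"] e(1) by auto
    have "?e \<in> set (edges ?G)" using e(1) by simp
    then have "(fst (fst ?e), fst (snd ?e)) \<in> adjacent ?G" unfolding adjacent_iff by blast
    moreover note adjacent_sym[OF this]
    ultimately obtain p q where "(p, q) \<in> adjacent ?G" "pr p = u" "pr q = v"
      using e(2) pr[OF fl(1)] pr[OF fl(2)] by auto
    moreover have "(y, p) \<in> ?R" using fib y(1) \<open>pr p = u\<close> by simp
    ultimately have "(x, q) \<in> ?R" using y(2) by (meson rtrancl.rtrancl_into_rtrancl rtrancl_trans)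
    then show ?case using \<open>pr q = v\<close> by blast
  qed auto
  have "(x, y) \<in> ?R" if "x < nverts ?G" "y < nverts ?G" for x y
  proof -
    have "pr x < nverts \<Gamma>" "pr y < nverts \<Gamma>" using that assms(5) D unfolding len by (auto simp: pr_def)
    then have "(pr x, pr y) \<in> (adjacent \<Gamma>)\<^sup>*" using assms(1) by (simp add: connected_graph_def)
    from path[OF this] fib show ?thesis by (metis rtrancl_trans)
  qed
  moreover have "nverts ?G > 0" using len D assms(5) by arith
  then have "verts ?G \<noteq> []" by (simp only: length_greater_0_conv not_False_eq_True)
  ultimately show ?thesis by (simp add: connected_graph_def)
qed

lemma sum_list_insert:
  fixes f :: "'b \<Rightarrow> nat"
  shows "i < length xs \<Longrightarrow> sum_list (map f (list_insert i ys xs)) + f (xs ! i) = sum_list (map f xs) + sum_list (map f ys)"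
proof -
  assume "i < length xs"
  then obtain as x bs where xs: "xs = as @ x # bs" "length as = i" by (rule split_nthE)
  then show ?thesis by (auto simp: nth_append)
qed

lemma set_list_insert: "set (list_insert i ys xs) \<subseteq> set xs \<union> set ys"
  by (auto simp: list_insert_def dest: in_set_takeD in_set_dropD)

lemma stable_graph_insert:
  assumes "stable_graph \<Gamma>" "stable_graph \<Delta>" "i < nverts \<Gamma>" "snd (verts \<Gamma> ! i) = arity \<Delta>"
  shows "stable_graph (graph_insert \<Gamma> i \<Delta>)"
proof -
  let ?G = "graph_insert \<Gamma> i \<Delta>"
  note wf = stable_imp_wf[OF assms(1)] stable_imp_wf[OF assms(2)]
  have fl: "set (flag_list \<Gamma>) = flags \<Gamma>" "set (flag_list \<Delta>) = flags \<Delta>"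
    using assms by (auto simp: stable_graph_def)
  have "nverts \<Delta> \<noteq> 0" using assms(2) by (auto simp: stable_graph_def connected_graph_def)
  then have D: "nverts \<Delta> \<ge> 1" by linarith
  have out: "outer_flag i \<Delta> f \<in> set (flag_list ?G)" if "f \<in> flags \<Gamma>" for f
    using that unfolding fl(1)[symmetric] set_flag_list by (force simp: image_image)
  \<comment> \<open>By the counting criterion it remains to see that every flag is used. A flag that
    is a leg of \<open>\<Delta>\<close> is used because the flag of \<open>\<Gamma>\<close> glued to
    it is.\<close>
  have "f \<in> set (flag_list ?G)" if "f \<in> flags ?G" for f
  proof -
    from that have f: "fst f < nverts \<Gamma> + nverts \<Delta> - 1" "snd f < snd (verts ?G ! fst f)"
      using assms(3) by (auto simp: in_flags length_list_insert)
    consider "fst f < i" | "i \<le> fst f" "fst f < i + nverts \<Delta>" | "i + nverts \<Delta> \<le> fst f" by linarith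
    then show ?thesis
    proof cases
      case 1
      then have "f \<in> flags \<Gamma>" "outer_flag i \<Delta> f = f"
        using f assms(3) by (auto simp: in_flags nth_list_insert outer_flag_def)
      then show ?thesis using out by metis
    next
      case 2
      let ?f = "(fst f - i, snd f)"
      have f': "?f \<in> flags \<Delta>" "inner_flag i ?f = f"
        using 2 f assms(3) by (auto simp: in_flags nth_list_insert inner_flag_def)
      then consider "?f \<in> fst ` set (edges \<Delta>) \<union> snd ` set (edges \<Delta>)" | "?f \<in> set (legs \<Delta>)"
        unfolding fl(2)[symmetric] set_flag_list by blast
      then show ?thesis
      proof cases
        case 1
        then obtain e where e: "e \<in> set (edges \<Delta>)" "?f = fst e \<or> ?f = snd e" by blast
        let ?e = "map_prod (inner_flag i) (inner_flag i) e"
        have "?e \<in> set (edges ?G)" using e(1) by simp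
        then have "fst ?e \<in> set (flag_list ?G)" "snd ?e \<in> set (flag_list ?G)"
          unfolding set_flag_list by blast+
        then show ?thesis using e(2) f'(2) by (metis fst_map_prod snd_map_prod)
      next
        case 2
        then obtain m where m: "m < arity \<Delta>" "legs \<Delta> ! m = ?f" by (auto simp: in_set_conv_nth arity_def)
        then have "(i, m) \<in> flags \<Gamma>" "outer_flag i \<Delta> (i, m) = f"
          using assms f' by (auto simp: in_flags outer_flag_def)
        then show ?thesis using out by metis
      qed
    next
      case 3
      let ?f = "(fst f + 1 - nverts \<Delta>, snd f)"
      have "?f \<in> flags \<Gamma>" "outer_flag i \<Delta> ?f = f"
        using 3 f assms(3) D by (auto simp: in_flags nth_list_insert outer_flag_def prod_eq_iff)
      then show ?thesis using out by metis
    qed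
  qed
  then have "set (flag_list ?G) = flags ?G"
    using wf_graph_insert[OF wf assms(3,4)] by (auto simp: wf_graph_def)
  moreover have "2 * nedges ?G + arity ?G = sum_list (map snd (verts ?G))"
    using sum_list_insert[OF assms(3), of snd "verts \<Delta>"] assms by (simp add: stable_graph_iff)
  moreover have "connected_graph ?G"
    using assms wf by (intro connected_graph_insert) (auto simp: stable_graph_def)
  moreover have "\<forall>(g, n) \<in> set (verts ?G). stable g n"
    using set_list_insert[of i "verts \<Delta>" "verts \<Gamma>"] assms(1,2) by (auto simp: stable_graph_def)
  ultimately show ?thesis by (simp only: stable_graph_iff)
qed

text \<open>Every vertex but the first has an edge leading closer to the first one.\<close>

lemma nverts_le_nedges:
  assumes "connected_graph \<Gamma>"
  shows "nverts \<Gamma> \<le> nedges \<Gamma> + 1"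
proof -
  let ?A = "adjacent \<Gamma>"
  define d where "d y = (LEAST n. (0, y) \<in> ?A ^^ n)" for y
  have reach: "\<exists>n. (0, y) \<in> ?A ^^ n" if "y < nverts \<Gamma>" for y
  proof -
    have "(0, y) \<in> ?A\<^sup>*" using assms that by (auto simp: connected_graph_def)
    then show ?thesis by (simp add: rtrancl_power)
  qed
  have "\<exists>e. e < nedges \<Gamma> \<and> (\<exists>z. d z < d y \<and> {y, z} = {fst (fst (edges \<Gamma> ! e)), fst (snd (edges \<Gamma> ! e))})"
    if y: "y \<in> {1..<nverts \<Gamma>}" for y
  proof -
    have "(0, y) \<in> ?A ^^ d y" unfolding d_def by (rule LeastI_ex[OF reach]) (use y in simp)
    moreover have "d y \<noteq> 0" using calculation y by (cases "d y") auto
    ultimately obtain m z where m: "d y = Suc m" "(0, z) \<in> ?A ^^ m" "(z, y) \<in> ?A"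
      by (cases "d y") auto
    have "d z \<le> m" unfolding d_def by (rule Least_le) (rule m(2))
    then have dz: "d z < d y" using m(1) by simp
    from m(3) obtain e' where e': "e' \<in> set (edges \<Gamma>)"
      "(z = fst (fst e') \<and> y = fst (snd e')) \<or> (z = fst (snd e') \<and> y = fst (fst e'))"
      by (auto simp: adjacent_iff)
    then obtain e where e: "e < nedges \<Gamma>" "edges \<Gamma> ! e = e'" by (auto simp: in_set_conv_nth)
    have "{y, z} = {fst (fst (edges \<Gamma> ! e)), fst (snd (edges \<Gamma> ! e))}" using e'(2) unfolding e(2) by auto
    then show ?thesis using e(1) dz by blast
  qed
  then obtain e where e: "\<And>y. y \<in> {1..<nverts \<Gamma>} \<Longrightarrow> e y < nedges \<Gamma> \<and>
      (\<exists>z. d z < d y \<and> {y, z} = {fst (fst (edges \<Gamma> ! e y)), fst (snd (edges \<Gamma> ! e y))})"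
    by metis
  \<comment> \<open>One edge serving two different vertices would make each of them strictly closer
    to vertex 0 than the other.\<close>
  have "inj_on e {1..<nverts \<Gamma>}"
  proof (rule inj_onI)
    fix y y' assume y: "y \<in> {1..<nverts \<Gamma>}" "y' \<in> {1..<nverts \<Gamma>}" "e y = e y'"
    obtain z where z: "d z < d y" "{y, z} = {fst (fst (edges \<Gamma> ! e y)), fst (snd (edges \<Gamma> ! e y))}"
      using e[OF y(1)] by blast
    obtain z' where z': "d z' < d y'" "{y', z'} = {fst (fst (edges \<Gamma> ! e y)), fst (snd (edges \<Gamma> ! e y))}"
      using e[OF y(2)] y(3) by auto
    have "{y, z} = {y', z'}" using z(2) z'(2) by simp
    then show "y = y'" using z(1) z'(1) by (metis doubleton_eq_iff less_asym)
  qed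
  moreover have "e ` {1..<nverts \<Gamma>} \<subseteq> {..<nedges \<Gamma>}" using e by auto
  ultimately have "card {1..<nverts \<Gamma>} \<le> card {..<nedges \<Gamma>}" by (intro card_inj_on_le) auto
  then show ?thesis by simp
qed

lemma stable_nverts: "stable_graph \<Gamma> \<Longrightarrow> nverts \<Gamma> \<le> nedges \<Gamma> + 1"
  "stable_graph \<Gamma> \<Longrightarrow> nverts \<Gamma> \<ge> 1"
  using nverts_le_nedges[of \<Gamma>] by (auto simp: stable_graph_def connected_graph_def Suc_le_eq)

text \<open>The bound \<open>nverts \<le> nedges + 1\<close> for connected graphs makes the
  truncated subtraction in \<open>genus\<close> exact, so that first Betti numbers add up.\<close>

lemma genus_graph_insert:
  assumes "stable_graph \<Gamma>" "stable_graph \<Delta>" "i < nverts \<Gamma>" "fst (verts \<Gamma> ! i) = genus \<Delta>"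
  shows "genus (graph_insert \<Gamma> i \<Delta>) = genus \<Gamma>"
  using sum_list_insert[OF assms(3), of fst "verts \<Delta>"] stable_nverts[OF assms(1)] stable_nverts[OF assms(2)] assms(3,4)
  by (simp add: genus_def length_list_insert)

lemma stable_insert_from:
  "stable_graph \<Gamma> \<Longrightarrow> insertable m \<Delta>s \<Gamma> \<Longrightarrow> (\<And>\<Delta>. \<Delta> \<in> set \<Delta>s \<Longrightarrow> stable_graph \<Delta>) \<Longrightarrow>
    stable_graph (insert_from m \<Delta>s \<Gamma>)"
proof (induction \<Delta>s arbitrary: m)
  case (Cons \<Delta> \<Delta>s)
  have "m < nverts (insert_from (Suc m) \<Delta>s \<Gamma>) \<and> verts (insert_from (Suc m) \<Delta>s \<Gamma>) ! m = verts \<Gamma> ! m"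
    using Cons.prems(2) insertable_length[of "Suc m" \<Delta>s \<Gamma>] by (intro nth_insert_from) auto
  then show ?case using Cons by (auto intro!: stable_graph_insert)
qed simp

lemma genus_insert_from:
  assumes "stable_graph \<Gamma>"
  shows "m + length \<Delta>s \<le> nverts \<Gamma> \<Longrightarrow> (\<And>\<Delta>. \<Delta> \<in> set \<Delta>s \<Longrightarrow> stable_graph \<Delta>) \<Longrightarrow>
   (\<And>j. j < length \<Delta>s \<Longrightarrow> verts \<Gamma> ! (m + j) = (genus (\<Delta>s ! j), arity (\<Delta>s ! j))) \<Longrightarrow>
   insertable m \<Delta>s \<Gamma> \<and> genus (insert_from m \<Delta>s \<Gamma>) = genus \<Gamma>"
proof (induction \<Delta>s arbitrary: m)
  case (Cons \<Delta> \<Delta>s)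
  have IH: "insertable (Suc m) \<Delta>s \<Gamma> \<and> genus (insert_from (Suc m) \<Delta>s \<Gamma>) = genus \<Gamma>"
    using Cons.prems Cons.prems(3)[of "Suc _"] by (intro Cons.IH) auto
  have m: "m < nverts (insert_from (Suc m) \<Delta>s \<Gamma>) \<and> verts (insert_from (Suc m) \<Delta>s \<Gamma>) ! m = verts \<Gamma> ! m"
    using Cons.prems(1) by (intro nth_insert_from) auto
  have "stable_graph (insert_from (Suc m) \<Delta>s \<Gamma>)" using IH Cons.prems(2) assms by (intro stable_insert_from) auto
  then have "genus (insert_from m (\<Delta> # \<Delta>s) \<Gamma>) = genus \<Gamma>"
    using m Cons.prems(2) Cons.prems(3)[of 0] IH by (simp add: genus_graph_insert)
  then show ?case using IH Cons.prems(2) Cons.prems(3)[of 0] stable_imp_wf by simp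
qed simp

lemma graph_insert_all_stable:
  assumes "stable_graph \<Gamma>" "\<And>\<Delta>. \<Delta> \<in> set \<Delta>s \<Longrightarrow> stable_graph \<Delta>" "verts \<Gamma> = map (\<lambda>\<Delta>. (genus \<Delta>, arity \<Delta>)) \<Delta>s"
  shows "insertable 0 \<Delta>s \<Gamma>" "stable_graph (graph_insert_all \<Gamma> \<Delta>s)"
    "genus (graph_insert_all \<Gamma> \<Delta>s) = genus \<Gamma>" "arity (graph_insert_all \<Gamma> \<Delta>s) = arity \<Gamma>"
    "verts (graph_insert_all \<Gamma> \<Delta>s) = concat (map verts \<Delta>s)"
    "nedges (graph_insert_all \<Gamma> \<Delta>s) = nedges \<Gamma> + sum_list (map nedges \<Delta>s)"
proof -
  have "insertable 0 \<Delta>s \<Gamma> \<and> genus (insert_from 0 \<Delta>s \<Gamma>) = genus \<Gamma>"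
    using assms by (intro genus_insert_from) auto
  then show "insertable 0 \<Delta>s \<Gamma>" "stable_graph (graph_insert_all \<Gamma> \<Delta>s)" "genus (graph_insert_all \<Gamma> \<Delta>s) = genus \<Gamma>"
    using assms stable_insert_from[of \<Gamma> 0 \<Delta>s] by (auto simp: graph_insert_all_eq)
  show "arity (graph_insert_all \<Gamma> \<Delta>s) = arity \<Gamma>"
    "verts (graph_insert_all \<Gamma> \<Delta>s) = concat (map verts \<Delta>s)"
    "nedges (graph_insert_all \<Gamma> \<Delta>s) = nedges \<Gamma> + sum_list (map nedges \<Delta>s)"
    using assms(3) by (simp_all add: graph_insert_all_eq verts_insert_from nedges_insert_from)
qed

section \<open>Corollas as units for insertion\<close>

lemma corolla_simps [simp]:
  "verts (corolla g n) = [(g, n)]" "edges (corolla g n) = []" "legs (corolla g n) = map (Pair 0) [0..<n]"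
  "arity (corolla g n) = n" "genus (corolla g n) = g"
  by (simp_all add: corolla_def arity_def genus_def)

lemma stable_corolla [simp]: "stable g n \<Longrightarrow> stable_graph (corolla g n)"
  by (auto simp: stable_graph_iff set_flag_list in_flags connected_graph_def)

lemma graph_insert_corolla:
  assumes "wf_graph \<Gamma>" "i < nverts \<Gamma>" "verts \<Gamma> ! i = (g, n)"
  shows "graph_insert \<Gamma> i (corolla g n) = \<Gamma>"
proof -
  have o: "outer_flag i (corolla g n) f = id f" if "f \<in> flags \<Gamma>" for f
    using that assms(3) by (cases f) (auto simp: outer_flag_def inner_flag_def in_flags)
  have "map (map_prod (outer_flag i (corolla g n)) (outer_flag i (corolla g n))) (edges \<Gamma>) = edges \<Gamma>"
    "map (outer_flag i (corolla g n)) (legs \<Gamma>) = legs \<Gamma>"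
    using map_edges_cong[where \<phi> = "outer_flag i (corolla g n)" and \<psi> = id, OF assms(1)] o
    by (simp_all only: map_prod.id list.map_id id_apply)
  then show ?thesis
    using assms list_insert_singleton[of i "verts \<Gamma>"]
    by (intro graph_eqI) (simp_all only: graph_insert_simps corolla_simps list.map append_Nil2 list_update_id, metis list_update_id)
qed

lemma corolla_graph_insert:
  assumes "arity \<Delta> = n"
  shows "graph_insert (corolla g n) 0 \<Delta> = \<Delta>"
proof (rule graph_eqI)
  show "legs (graph_insert (corolla g n) 0 \<Delta>) = legs \<Delta>"
    using assms by (intro nth_equalityI) (auto simp: arity_def outer_flag_def)
qed (simp_all add: list_insert_def map_prod.id)

lemma insert_from_corollas:
  assumes "wf_graph \<Gamma>"
  shows "(\<And>j. j < length vs \<Longrightarrow> verts \<Gamma> ! (m + j) = vs ! j) \<Longrightarrow> m + length vs \<le> nverts \<Gamma> \<Longrightarrow>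
    insert_from m (map (\<lambda>(g, n). corolla g n) vs) \<Gamma> = \<Gamma>"
proof (induction vs arbitrary: m)
  case (Cons v vs)
  have "verts \<Gamma> ! (Suc m + j) = vs ! j" if "j < length vs" for j using Cons.prems(1)[of "Suc j"] that by simp
  then have "insert_from (Suc m) (map (\<lambda>(g, n). corolla g n) vs) \<Gamma> = \<Gamma>"
    using Cons.prems(2) by (intro Cons.IH) auto
  then show ?case
    using Cons.prems(1)[of 0] Cons.prems(2) assms by (cases v) (simp add: graph_insert_corolla)
qed simp

section \<open>Changes of presentation\<close>

lemma mset_swap_at: "Suc i < length xs \<Longrightarrow> mset (swap_at i xs) = mset xs"
  by (auto simp: swap_at_def mset_swap)

lemma set_swap_at: "Suc i < length xs \<Longrightarrow> set (swap_at i xs) = set xs"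
  by (metis mset_swap_at set_mset_mset)

lemma sum_list_swap_at:
  fixes f :: "'b \<Rightarrow> 'c::comm_monoid_add"
  shows "Suc i < length xs \<Longrightarrow> sum_list (map f (swap_at i xs)) = sum_list (map f xs)"
  by (metis mset_map mset_swap_at sum_mset_sum_list)

lemma nth_swap_at: "Suc i < length xs \<Longrightarrow> j < length xs \<Longrightarrow>
    swap_at i xs ! j = (if j = i then xs ! Suc i else if j = Suc i then xs ! i else xs ! j)"
  by (simp add: swap_at_def nth_list_update)

lemma swap_at_swap_at [simp]: "Suc i < length xs \<Longrightarrow> swap_at i (swap_at i xs) = xs"
  by (intro nth_equalityI) (simp_all add: nth_swap_at)

lemma swap_edges_simps [simp]:
  "verts (swap_edges i \<Gamma>) = verts \<Gamma>" "legs (swap_edges i \<Gamma>) = legs \<Gamma>" "edges (swap_edges i \<Gamma>) = swap_at i (edges \<Gamma>)"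
  "arity (swap_edges i \<Gamma>) = arity \<Gamma>" "genus (swap_edges i \<Gamma>) = genus \<Gamma>"
  by (simp_all add: swap_edges_def arity_def genus_def)

lemma flip_edge_simps [simp]:
  "verts (flip_edge i \<Gamma>) = verts \<Gamma>" "legs (flip_edge i \<Gamma>) = legs \<Gamma>"
  "edges (flip_edge i \<Gamma>) = (edges \<Gamma>)[i := prod.swap (edges \<Gamma> ! i)]"
  "arity (flip_edge i \<Gamma>) = arity \<Gamma>" "genus (flip_edge i \<Gamma>) = genus \<Gamma>"
  by (simp_all add: flip_edge_def arity_def genus_def)

lemma swap_edges_swap_edges [simp]: "Suc i < nedges \<Gamma> \<Longrightarrow> swap_edges i (swap_edges i \<Gamma>) = \<Gamma>"
  by (rule graph_eqI) simp_all

lemma stable_swap_edges: "Suc i < nedges \<Gamma> \<Longrightarrow> stable_graph \<Gamma> \<Longrightarrow> stable_graph (swap_edges i \<Gamma>)"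
  by (simp add: stable_graph_iff set_flag_list set_swap_at connected_graph_def adjacent_def flags_def)

lemma stable_flip_edge:
  assumes "i < nedges \<Gamma>" "stable_graph \<Gamma>"
  shows "stable_graph (flip_edge i \<Gamma>)"
proof -
  obtain A e B where e: "edges \<Gamma> = A @ e # B" "length A = i" using assms(1) by (rule split_nthE)
  then have f: "edges (flip_edge i \<Gamma>) = A @ prod.swap e # B"
    by (simp add: nth_append list_update_append)
  have "adjacent (flip_edge i \<Gamma>) = adjacent \<Gamma>"
    unfolding adjacent_def f e(1) by (auto simp: prod_eq_iff)
  moreover have "set (flag_list (flip_edge i \<Gamma>)) = set (flag_list \<Gamma>)"
    unfolding set_flag_list f by (auto simp: e(1))
  ultimately show ?thesis
    using assms(2) by (simp add: stable_graph_iff connected_graph_def flags_def)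
qed

lemma swap_verts_simps:
  assumes "Suc i < nverts \<Gamma>"
  shows "verts (swap_verts i \<Gamma>) = swap_at i (verts \<Gamma>)" "nedges (swap_verts i \<Gamma>) = nedges \<Gamma>"
    "arity (swap_verts i \<Gamma>) = arity \<Gamma>" "genus (swap_verts i \<Gamma>) = genus \<Gamma>"
  using assms by (simp_all add: swap_verts_def Let_def arity_def genus_def sum_list_swap_at)

lemma block_flag_involution: "block_flag i (Suc 0) (Suc 0) (block_flag i (Suc 0) (Suc 0) f) = f"
  by (auto simp: block_flag_def block_index_def prod_eq_iff)

lemma swap_verts_swap_verts:
  assumes "Suc i < nverts \<Gamma>"
  shows "swap_verts i (swap_verts i \<Gamma>) = \<Gamma>"
proof -
  have len: "Suc i < nverts (swap_verts i \<Gamma>)" using assms by (simp add: swap_verts_simps)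
  have "verts (swap_verts i (swap_verts i \<Gamma>)) = verts \<Gamma>" using assms len by (simp add: swap_verts_simps)
  moreover have "edges (swap_verts i (swap_verts i \<Gamma>)) = edges \<Gamma>" "legs (swap_verts i (swap_verts i \<Gamma>)) = legs \<Gamma>"
    unfolding swap_verts_eq_block[OF len]
    by (simp_all add: swap_verts_eq_block[OF assms] comp_def block_flag_involution map_prod.compositionality map_prod.identity)
  ultimately show ?thesis by (rule graph_eqI)
qed

lemma stable_swap_verts:
  assumes "Suc i < nverts \<Gamma>" "stable_graph \<Gamma>"
  shows "stable_graph (swap_verts i \<Gamma>)"
proof -
  let ?G = "swap_verts i \<Gamma>" and ?\<beta> = "block_flag i (Suc 0) (Suc 0)" and ?b = "block_index i (Suc 0) (Suc 0)"
  have G: "edges ?G = map (map_prod ?\<beta> ?\<beta>) (edges \<Gamma>)" "legs ?G = map ?\<beta> (legs \<Gamma>)"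
    using swap_verts_eq_block[OF assms(1)] by simp_all
  have bb: "?b (?b x) = x" for x by (auto simp: block_index_def)
  have bl: "?b x < nverts \<Gamma> \<longleftrightarrow> x < nverts \<Gamma>" for x using assms(1) by (auto simp: block_index_def)
  have v: "verts ?G ! ?b x = verts \<Gamma> ! x" if "x < nverts \<Gamma>" for x
  proof -
    consider "x < i" | "x = i" | "x = Suc i" | "Suc i < x" by linarith
    then show ?thesis
      by cases (use that assms(1) in \<open>simp_all add: swap_verts_simps nth_swap_at block_index_def\<close>)
  qed
  have fl: "?\<beta> f \<in> flags ?G \<longleftrightarrow> f \<in> flags \<Gamma>" for f
    using v[of "fst f"] assms(1) by (auto simp: in_flags block_flag_def bl swap_verts_simps)
  have "flags ?G = ?\<beta> ` flags \<Gamma>"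
  proof (intro equalityI subsetI)
    fix f assume "f \<in> flags ?G"
    then have "?\<beta> f \<in> flags \<Gamma>" using fl[of "?\<beta> f"] by (simp add: block_flag_involution)
    then show "f \<in> ?\<beta> ` flags \<Gamma>" by (rule image_eqI[rotated]) (simp add: block_flag_involution)
  qed (use fl in auto)
  moreover have "set (flag_list ?G) = ?\<beta> ` set (flag_list \<Gamma>)"
    unfolding set_flag_list G by (auto simp: image_Un image_image)
  ultimately have "set (flag_list ?G) = flags ?G" using assms(2) by (simp add: stable_graph_iff)
  moreover have "2 * nedges ?G + arity ?G = sum_list (map snd (verts ?G))"
    using assms by (simp add: stable_graph_iff swap_verts_simps sum_list_swap_at)
  moreover have "connected_graph ?G"
  proof -
    have adj: "(?b u, ?b v) \<in> adjacent ?G" if "(u, v) \<in> adjacent \<Gamma>" for u v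
      using that unfolding adjacent_iff G by (force simp: block_flag_def)
    have path: "(?b u, ?b v) \<in> (adjacent ?G)\<^sup>*" if "(u, v) \<in> (adjacent \<Gamma>)\<^sup>*" for u v
      using that by (induction rule: rtrancl_induct) (auto intro: adj rtrancl_into_rtrancl)
    have "(x, y) \<in> (adjacent ?G)\<^sup>*" if "x < nverts ?G" "y < nverts ?G" for x y
      using path[of "?b x" "?b y"] that assms bl[of x] bl[of y]
      by (simp add: bb swap_verts_simps stable_graph_def connected_graph_def)
    moreover have "verts ?G \<noteq> []" using assms(1) by (metis length_swap_at list.size(3) not_less_zero swap_verts_simps(1))
    ultimately show ?thesis by (simp add: connected_graph_def)
  qed
  moreover have "\<forall>(g, n) \<in> set (verts ?G). stable g n"
    using assms by (simp add: swap_verts_simps set_swap_at stable_graph_def)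
  ultimately show ?thesis by (simp only: stable_graph_iff)
qed

section \<open>Signs\<close>

lemma sg_cong: "even (a - b) \<Longrightarrow> sg a = sg b"
  by (auto simp: sg_def)

lemma sg_add: "sg (a + b) = (sg a * sg b :: 'k::ring_1)"
  by (auto simp: sg_def)

lemma sg_0 [simp]: "sg 0 = 1"
  by (simp add: sg_def)

lemma sg_square [simp]: "sg a * (sg a * c) = (c :: 'k::ring_1)"
  by (simp_all add: sg_def)

definition tsum :: "bool \<Rightarrow> 'b gen list \<Rightarrow> int" where
  "tsum tw hs = sum_list (map (\<lambda>h. tdeg tw (fst h)) hs)"

definition gsum :: "bool \<Rightarrow> 'b gen list \<Rightarrow> int" where
  "gsum tw hs = sum_list (map (gdeg tw) hs)"

text \<open>The exponent of the sign in \<open>graft\<close>, arranged for computation along the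
  list: each twist moves to the front past the total degrees of the generators before it.\<close>

primrec gsign :: "bool \<Rightarrow> 'b gen list \<Rightarrow> int" where
  "gsign tw [] = 0"
| "gsign tw (h # hs) = gsign tw hs + gdeg tw h * tsum tw hs"

lemma tsum_simps [simp]:
  "tsum tw [] = 0" "tsum tw (h # hs) = tdeg tw (fst h) + tsum tw hs" "tsum tw (as @ bs) = tsum tw as + tsum tw bs"
  by (simp_all add: tsum_def)

lemma gsum_simps [simp]:
  "gsum tw [] = 0" "gsum tw (h # hs) = gdeg tw h + gsum tw hs" "gsum tw (as @ bs) = gsum tw as + gsum tw bs"
  by (simp_all add: gsum_def)

lemma gsign_append: "gsign tw (as @ bs) = gsign tw as + gsign tw bs + gsum tw as * tsum tw bs"
  by (induction as) (simp_all add: algebra_simps)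

lemma gdeg_eq: "gdeg tw h = sum_list (fst (snd h)) + tdeg tw (fst h)"
  by (simp add: gdeg_def case_prod_beta)

abbreviation graphs_of :: "'b gen list \<Rightarrow> graph list" where "graphs_of hs \<equiv> map fst hs"
abbreviation degrees_of :: "'b gen list \<Rightarrow> int list" where "degrees_of hs \<equiv> concat (map (\<lambda>h. fst (snd h)) hs)"
abbreviation labels_of :: "'b gen list \<Rightarrow> 'b list" where "labels_of hs \<equiv> concat (map (\<lambda>h. snd (snd h)) hs)"

lemma sum_list_degrees_of: "sum_list (degrees_of hs) = gsum tw hs - tsum tw hs"
  by (induction hs) (simp_all add: gdeg_eq)

lemma graft_eq:
  "graft tw \<Gamma> hs = Poly_Mapping.single (graph_insert_all \<Gamma> (graphs_of hs), degrees_of hs, labels_of hs) (sg (gsign tw hs))"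
proof -
  have "(\<Sum>i < length hs. \<Sum>j < i. tdeg tw (fst (hs ! i)) * gdeg tw (hs ! j)) = gsign tw hs"
  proof (induction hs)
    case (Cons h hs)
    have "(\<Sum>i < length (h # hs). \<Sum>j < i. tdeg tw (fst ((h # hs) ! i)) * gdeg tw ((h # hs) ! j)) =
       (\<Sum>i < length hs. tdeg tw (fst (hs ! i)) * gdeg tw h + (\<Sum>j < i. tdeg tw (fst (hs ! i)) * gdeg tw (hs ! j)))"
      unfolding length_Cons sum.lessThan_Suc_shift by (simp add: sum.lessThan_Suc_shift del: sum.lessThan_Suc)
    also have "\<dots> = (\<Sum>i < length hs. tdeg tw (fst (hs ! i))) * gdeg tw h + gsign tw hs"
      by (simp add: sum.distrib Cons sum_distrib_right)
    also have "(\<Sum>i < length hs. tdeg tw (fst (hs ! i))) = tsum tw hs"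
      by (simp add: tsum_def sum_list_sum_nth lessThan_atLeast0)
    finally show ?case by (simp add: mult.commute)
  qed simp
  then show ?thesis by (simp add: graft_def comp_def)
qed

abbreviation vtype :: "'b gen \<Rightarrow> nat \<times> nat" where
  "vtype h \<equiv> (genus (fst h), arity (fst h))"

lemma fits_iff: "fits tw \<Gamma> ps hs \<longleftrightarrow> ps = map (gdeg tw) hs \<and> verts \<Gamma> = map vtype hs"
  by (auto simp: fits_def list_eq_iff_nth_eq)

lemma tdeg_graph_insert_all:
  "length hs \<le> nverts \<Gamma> \<Longrightarrow> tdeg tw (graph_insert_all \<Gamma> (graphs_of hs)) = tdeg tw \<Gamma> + tsum tw hs"
proof -
  have "tsum tw hs = (if tw then int (sum_list (map nedges (graphs_of hs))) else 0)"
    by (induction hs) (auto simp: tdeg_def)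
  then show ?thesis by (simp add: graph_insert_all_eq tdeg_def nedges_insert_from)
qed

lemma tdeg_graph_insert [simp]: "tdeg tw (graph_insert \<Gamma> i \<Delta>) = tdeg tw \<Gamma> + tdeg tw \<Delta>"
  by (simp add: tdeg_def)

section \<open>Symmetry relations\<close>

text \<open>
  The relations for changes of presentation do not refer to the decorations, so that they can be
  used before the vertices are decorated properly.
\<close>

inductive_set symrel :: "bool \<Rightarrow> ('b gen \<Rightarrow>\<^sub>0 'k::field_char_0) set" for tw :: bool where
  verts: "\<lbrakk>Suc i < nverts \<Gamma>; length ps = nverts \<Gamma>; length xs = nverts \<Gamma>\<rbrakk> \<Longrightarrow>
    sing (swap_verts i \<Gamma>, swap_at i ps, swap_at i xs)
      - Poly_Mapping.single (\<Gamma>, ps, xs) (sg (ps ! i * ps ! Suc i)) \<in> symrel tw"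
| edges: "Suc i < nedges \<Gamma> \<Longrightarrow>
    sing (swap_edges i \<Gamma>, ps, xs) - Poly_Mapping.single (\<Gamma>, ps, xs) (if tw then - 1 else 1) \<in> symrel tw"

text \<open>Congruences between multiples of generators compose and their scalars multiply; chains
  of moves are built in this way.\<close>

lemma span_single_trans:
  assumes "Poly_Mapping.single x 1 - Poly_Mapping.single y c \<in> formal.span S"
    "Poly_Mapping.single y 1 - Poly_Mapping.single z d \<in> formal.span S"
  shows "Poly_Mapping.single x 1 - Poly_Mapping.single z (c * d) \<in> formal.span S"
proof -
  have eq: "Poly_Mapping.single x 1 - Poly_Mapping.single z (c * d) =
    (Poly_Mapping.single x 1 - Poly_Mapping.single y c) + fscale c (Poly_Mapping.single y 1 - Poly_Mapping.single z d)"
    by (simp add: formal.scale_right_diff_distrib fscale_single)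
  show ?thesis
    unfolding eq by (rule formal.span_add[OF assms(1) formal.span_scale[OF assms(2)]])
qed

lemma sg_tw_Suc:
  "(if tw then - 1 else 1) * sg (if tw then int n else 0) = (sg (if tw then int (Suc n) else 0) :: 'k::ring_1)"
  by (simp add: sg_def)

text \<open>Each transposition contributes the scalar of one edge relation, which is -1 in the
  twisted and 1 in the untwisted case.\<close>

lemma symrel_reorder:
  "reorder \<Gamma> n \<Gamma>' \<Longrightarrow>
    sing (\<Gamma>', ps, xs) - Poly_Mapping.single (\<Gamma>, ps, xs) (sg (if tw then int n else 0)) \<in> formal.span (symrel tw)"
proof (induction rule: reorder.induct)
  case (refl \<Gamma>)
  show ?case by (simp add: formal.span_zero)
next
  case (swap \<Gamma> n \<Gamma>' i)
  show ?case
    using span_single_trans[OF formal.span_base[OF symrel.edges[OF swap(2)]] swap(3)] unfolding sg_tw_Suc .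
qed

section \<open>Block exchanges as products of transpositions, with their Koszul signs\<close>

lemma block_swap_comp_left:
  assumes "a + Suc m + Suc 0 \<le> nverts \<Gamma>"
  shows "block_swap a m (Suc 0) (swap_verts (a + m) \<Gamma>) = block_swap a (Suc m) (Suc 0) \<Gamma>"
proof -
  have i: "block_flag a m (Suc 0) (block_flag (a + m) (Suc 0) (Suc 0) f) = block_flag a (Suc m) (Suc 0) f" for f
  proof -
    consider "fst f < a" | "a \<le> fst f" "fst f < a + m" | "fst f = a + m" | "fst f = Suc (a + m)" | "Suc (a + m) < fst f"
      by linarith
    then show ?thesis by cases (auto simp add: block_flag_def block_index_def)
  qed
  obtain A B C D where v: "verts \<Gamma> = A @ B @ C @ D" "length A = a" "length B = Suc m" "length C = Suc 0"
    using assms by (rule split_blocks)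
  then obtain B' b c where b: "B = B' @ [b]" "length B' = m" "C = [c]"
    by (metis length_Suc_conv_rev length_Suc_conv length_0_conv)
  have "block_list (a + m) (Suc 0) (Suc 0) (verts \<Gamma>) = A @ B' @ [c] @ [b] @ D"
    using block_list_append[of "A @ B'" "a + m" "[b]" "Suc 0" "[c]" "Suc 0" D] v b by simp
  moreover have "block_list a (Suc m) (Suc 0) (verts \<Gamma>) = A @ [c] @ B' @ [b] @ D"
    using block_list_append[of A a B "Suc m" C "Suc 0" D] v b by simp
  moreover have "block_list a m (Suc 0) (A @ B' @ [c] @ [b] @ D) = A @ [c] @ B' @ [b] @ D"
    using v b by (intro block_list_append) auto
  ultimately show ?thesis
    using swap_verts_eq_block[of "a + m" \<Gamma>] assms
    by (intro graph_eqI) (simp_all add: i comp_def map_prod.compositionality)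
qed

lemma block_swap_comp_right:
  assumes "a + m + Suc m' \<le> nverts \<Gamma>"
  shows "block_swap (Suc a) m m' (block_swap a m (Suc 0) \<Gamma>) = block_swap a m (Suc m') \<Gamma>"
proof -
  have i: "block_flag (Suc a) m m' (block_flag a m (Suc 0) f) = block_flag a m (Suc m') f" for f
  proof -
    consider "fst f < a" | "a \<le> fst f" "fst f < a + m" | "fst f = a + m" | "a + m < fst f" "fst f < a + m + Suc m'"
      | "a + m + Suc m' \<le> fst f" by linarith
    then show ?thesis by cases (auto simp add: block_flag_def block_index_def)
  qed
  obtain A B C D where v: "verts \<Gamma> = A @ B @ C @ D" "length A = a" "length B = m" "length C = Suc m'"
    using assms by (rule split_blocks)
  then obtain C' c where c: "C = [c] @ C'" "length C' = m'"
    by (metis length_Suc_conv append_Cons append_Nil)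
  have "block_list a m (Suc 0) (verts \<Gamma>) = A @ [c] @ B @ C' @ D"
    using block_list_append[of A a B m "[c]" "Suc 0" "C' @ D"] v c by simp
  moreover have "block_list a m (Suc m') (verts \<Gamma>) = A @ [c] @ C' @ B @ D"
    using block_list_append[of A a B m C "Suc m'" D] v c by simp
  moreover have "block_list (Suc a) m m' (A @ [c] @ B @ C' @ D) = A @ [c] @ C' @ B @ D"
    using block_list_append[of "A @ [c]" "Suc a" B m C' m' D] v c by simp
  ultimately show ?thesis
    by (intro graph_eqI) (simp_all add: i comp_def map_prod.compositionality)
qed

lemma block_swap_trivial: "block_swap a 0 m \<Gamma> = \<Gamma>" "block_swap a m 0 \<Gamma> = \<Gamma>"
proof -
  have "block_list a 0 m xs = xs" "block_list a m 0 xs = xs" for xs :: "(nat \<times> nat) list"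
    by (simp_all add: block_list_def flip: append_assoc take_add)
  moreover have "block_flag a 0 m = id" "block_flag a m 0 = id"
    by (auto simp: block_flag_def block_index_def)
  ultimately show "block_swap a 0 m \<Gamma> = \<Gamma>" "block_swap a m 0 \<Gamma> = \<Gamma>"
    by (auto intro!: graph_eqI simp: map_prod.id)
qed

text \<open>The single vertex behind the block \<open>P2\<close> moves forward step by step, over
  the last vertex of the block first; hence the induction from the right.\<close>

lemma symrel_block_swap_one:
  assumes "length P4 = length X4"
  shows "nverts \<Gamma> = length (P1 @ P2 @ p # P4) \<Longrightarrow> length X1 = length P1 \<Longrightarrow> length X2 = length P2 \<Longrightarrow>
    sing (block_swap (length P1) (length P2) (Suc 0) \<Gamma>, P1 @ p # P2 @ P4, X1 @ x # X2 @ X4)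
      - Poly_Mapping.single (\<Gamma>, P1 @ P2 @ p # P4, X1 @ X2 @ x # X4) (sg (sum_list P2 * p) :: 'k::field_char_0) \<in> formal.span (symrel tw)"
  using assms
proof (induction P2 arbitrary: X2 P4 X4 \<Gamma> rule: rev_induct)
  case Nil
  show ?case using Nil by (simp add: formal.span_zero block_swap_trivial)
next
  case (snoc q Q)
  obtain X2' y where X2: "X2 = X2' @ [y]" "length X2' = length Q"
    using snoc.prems(3) by (cases X2 rule: rev_cases) auto
  let ?i = "length P1 + length Q"
  let ?\<Gamma> = "swap_verts ?i \<Gamma>"
  have n: "Suc ?i < nverts \<Gamma>" using snoc.prems(1) by simp
  have ps: "swap_at ?i (P1 @ Q @ q # p # P4) = P1 @ Q @ p # q # P4"
    "swap_at ?i (X1 @ X2' @ y # x # X4) = X1 @ X2' @ x # y # X4"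
    using swap_at_append[of "P1 @ Q"] swap_at_append[of "X1 @ X2'" y x X4] X2(2) snoc.prems(2) by simp_all
  have nth: "(P1 @ Q @ q # p # P4) ! ?i = q" "(P1 @ Q @ q # p # P4) ! Suc ?i = p"
    using nth_append[of "P1 @ Q" "q # p # P4"] by simp_all
  have 1: "sing (?\<Gamma>, P1 @ Q @ p # q # P4, X1 @ X2' @ x # y # X4)
      - Poly_Mapping.single (\<Gamma>, P1 @ Q @ q # p # P4, X1 @ X2' @ y # x # X4) (sg (q * p) :: 'k) \<in> formal.span (symrel tw)"
    using formal.span_base[OF symrel.verts[of ?i \<Gamma> "P1 @ Q @ q # p # P4" "X1 @ X2' @ y # x # X4"]] n snoc.prems X2
    by (simp add: ps nth)
  have 2: "sing (block_swap (length P1) (length Q) (Suc 0) ?\<Gamma>, P1 @ p # Q @ q # P4, X1 @ x # X2' @ y # X4)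
      - Poly_Mapping.single (?\<Gamma>, P1 @ Q @ p # q # P4, X1 @ X2' @ x # y # X4) (sg (sum_list Q * p) :: 'k) \<in> formal.span (symrel tw)"
    using snoc.prems X2 n by (intro snoc.IH) (auto simp: swap_verts_simps)
  have "block_swap (length P1) (length Q) (Suc 0) ?\<Gamma> = block_swap (length P1) (Suc (length Q)) (Suc 0) \<Gamma>"
    using snoc.prems(1) by (intro block_swap_comp_left) simp
  then show ?case
    using span_single_trans[OF 2 1] X2 by (simp add: sg_add[symmetric] algebra_simps)
qed

text \<open>The vertices of the second block pass the first block one after the other; the exponents
  \<open>sum_list P2 * p\<close> add up to the product of the total degrees.\<close>

lemma symrel_block_swap:
  assumes "length P4 = length X4" "length X2 = length P2"
  shows "nverts \<Gamma> = length (P1 @ P2 @ P3 @ P4) \<Longrightarrow> length X1 = length P1 \<Longrightarrow> length X3 = length P3 \<Longrightarrow>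
    sing (block_swap (length P1) (length P2) (length P3) \<Gamma>, P1 @ P3 @ P2 @ P4, X1 @ X3 @ X2 @ X4)
      - Poly_Mapping.single (\<Gamma>, P1 @ P2 @ P3 @ P4, X1 @ X2 @ X3 @ X4) (sg (sum_list P2 * sum_list P3) :: 'k::field_char_0) \<in> formal.span (symrel tw)"
proof (induction P3 arbitrary: X3 P1 X1 \<Gamma>)
  case Nil
  show ?case using Nil by (simp add: formal.span_zero block_swap_trivial)
next
  case (Cons p P3)
  obtain x X3' where X3: "X3 = x # X3'" "length X3' = length P3"
    using Cons.prems(3) by (cases X3) auto
  let ?\<Gamma> = "block_swap (length P1) (length P2) (Suc 0) \<Gamma>"
  have 1: "sing (?\<Gamma>, P1 @ p # P2 @ P3 @ P4, X1 @ x # X2 @ X3' @ X4)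
      - Poly_Mapping.single (\<Gamma>, P1 @ P2 @ p # P3 @ P4, X1 @ X2 @ x # X3' @ X4) (sg (sum_list P2 * p) :: 'k) \<in> formal.span (symrel tw)"
    using Cons.prems X3 assms by (intro symrel_block_swap_one) auto
  have 2: "sing (block_swap (length (P1 @ [p])) (length P2) (length P3) ?\<Gamma>, (P1 @ [p]) @ P3 @ P2 @ P4, (X1 @ [x]) @ X3' @ X2 @ X4)
      - Poly_Mapping.single (?\<Gamma>, (P1 @ [p]) @ P2 @ P3 @ P4, (X1 @ [x]) @ X2 @ X3' @ X4) (sg (sum_list P2 * sum_list P3) :: 'k) \<in> formal.span (symrel tw)"
    using Cons.prems X3 by (intro Cons.IH) auto
  have "block_swap (Suc (length P1)) (length P2) (length P3) ?\<Gamma> = block_swap (length P1) (length P2) (Suc (length P3)) \<Gamma>"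
    using Cons.prems(1) by (intro block_swap_comp_right) simp
  then show ?case
    using span_single_trans[OF 2[simplified] 1] X3 by (simp add: sg_add[symmetric] algebra_simps)
qed

section \<open>Generators and relators\<close>

lemma decorates_lengths: "decorates X vs ps xs \<Longrightarrow> length ps = length vs \<and> length xs = length vs"
  by (simp add: decorates_def)

lemma decorates_iff_list_all2:
  "decorates X vs ps xs \<longleftrightarrow> length ps = length vs \<and>
     list_all2 (\<lambda>(v, p) x. x \<in> cell X (fst v) (snd v) p) (zip vs ps) xs"
  by (auto simp: decorates_def list_all2_conv_all_nth)

lemma decorates_append:
  assumes "length ps = length vs" "length xs = length vs"
  shows "decorates X (vs @ vs') (ps @ ps') (xs @ xs') \<longleftrightarrow> decorates X vs ps xs \<and> decorates X vs' ps' xs'"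
  using assms by (auto simp: decorates_iff_list_all2 list_all2_append list_all2_lengthD)

lemma decorates_Cons [simp]:
  "decorates X (v # vs) (p # ps) (x # xs) \<longleftrightarrow> x \<in> cell X (fst v) (snd v) p \<and> decorates X vs ps xs"
  by (auto simp: decorates_iff_list_all2)

lemma decorates_Nil [simp]: "decorates X [] ps xs \<longleftrightarrow> ps = [] \<and> xs = []"
  by (auto simp: decorates_def)

lemma decorates_nth: "decorates X vs ps xs \<Longrightarrow> i < length vs \<Longrightarrow> xs ! i \<in> cell X (fst (vs ! i)) (snd (vs ! i)) (ps ! i)"
  by (simp add: decorates_def)

lemma decorates_update:
  "decorates X vs ps xs \<Longrightarrow> i < length vs \<Longrightarrow> x \<in> cell X (fst (vs ! i)) (snd (vs ! i)) p \<Longrightarrow>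
    decorates X vs (ps[i := p]) (xs[i := x])"
  by (auto simp: decorates_def nth_list_update)

lemma decorates_update_same:
  "decorates X vs ps xs \<Longrightarrow> i < length vs \<Longrightarrow> x \<in> cell X (fst (vs ! i)) (snd (vs ! i)) (ps ! i) \<Longrightarrow>
    decorates X vs ps (xs[i := x])"
  using decorates_update[of X vs ps xs i x "ps ! i"] by simp

lemma decorates_list_insert:
  assumes "decorates X vs ps xs" "i < length vs" "decorates X us qs ys"
  shows "decorates X (list_insert i us vs) (list_insert i qs ps) (list_insert i ys xs)"
proof -
  note len = decorates_lengths[OF assms(1)] decorates_lengths[OF assms(3)]
  obtain vs1 v vs2 where v: "vs = vs1 @ v # vs2" "length vs1 = i" using assms(2) by (rule split_nthE)
  obtain ps1 p ps2 where p: "ps = ps1 @ p # ps2" "length ps1 = i" using assms(2) len by (metis split_nthE)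
  obtain xs1 x xs2 where x: "xs = xs1 @ x # xs2" "length xs1 = i" using assms(2) len by (metis split_nthE)
  have "decorates X vs1 ps1 xs1 \<and> decorates X vs2 ps2 xs2"
    using assms(1) v p x by (simp add: decorates_append)
  then have "decorates X (vs1 @ us @ vs2) (ps1 @ qs @ ps2) (xs1 @ ys @ xs2)"
    using assms(3) v(2) p(2) x(2) len by (simp add: decorates_append)
  then show ?thesis
    using list_insert_append[of vs1 us v vs2] list_insert_append[of ps1 qs p ps2] list_insert_append[of xs1 ys x xs2]
    using v p x by simp
qed

lemma decorates_swap_at:
  assumes "decorates X vs ps xs" "Suc i < length vs"
  shows "decorates X (swap_at i vs) (swap_at i ps) (swap_at i xs)"
  using assms by (auto simp: decorates_def nth_swap_at)

lemma decorates_concat: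
  "(\<And>h. h \<in> set hs \<Longrightarrow> decorates X (verts (fst h)) (fst (snd h)) (snd (snd h))) \<Longrightarrow>
    decorates X (concat (map verts (graphs_of hs))) (degrees_of hs) (labels_of hs)"
proof (induction hs)
  case (Cons h hs)
  have "decorates X (verts (fst h)) (fst (snd h)) (snd (snd h))" using Cons.prems by simp
  from decorates_lengths[OF this] show ?case using Cons by (simp add: decorates_append)
qed simp

lemma gens_iff: "h \<in> gens Is Js X \<longleftrightarrow> stable_graph (fst h) \<and> fst ` set (verts (fst h)) \<subseteq> Is \<and> genus (fst h) \<in> Js \<and>
    decorates X (verts (fst h)) (fst (snd h)) (snd (snd h))"
  by (cases h) (simp add: gens_def)

lemma gens_stable: "h \<in> gens Is Js X \<Longrightarrow> stable_graph (fst h)"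
  and gens_lengths: "h \<in> gens Is Js X \<Longrightarrow> length (fst (snd h)) = nverts (fst h) \<and> length (snd (snd h)) = nverts (fst h)"
  by (auto simp: gens_iff decorates_def)

lemma gens_swap_verts:
  "(\<Gamma>, ps, xs) \<in> gens Is Js X \<Longrightarrow> Suc i < nverts \<Gamma> \<Longrightarrow> (swap_verts i \<Gamma>, swap_at i ps, swap_at i xs) \<in> gens Is Js X"
  by (simp add: gens_iff stable_swap_verts swap_verts_simps decorates_swap_at set_swap_at)

lemma gens_swap_edges:
  "(\<Gamma>, ps, xs) \<in> gens Is Js X \<Longrightarrow> Suc i < nedges \<Gamma> \<Longrightarrow> (swap_edges i \<Gamma>, ps, xs) \<in> gens Is Js X"
  by (simp add: gens_iff stable_swap_edges)

lemma gens_flip_edge: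
  "(\<Gamma>, ps, xs) \<in> gens Is Js X \<Longrightarrow> i < nedges \<Gamma> \<Longrightarrow> (flip_edge i \<Gamma>, ps, xs) \<in> gens Is Js X"
  by (simp add: gens_iff stable_flip_edge)

lemma gens_insert:
  assumes "(\<Gamma>, ps, xs) \<in> gens Is Js X" "i < nverts \<Gamma>" "stable_graph \<Delta>" "fst ` set (verts \<Delta>) \<subseteq> Is"
    "verts \<Gamma> ! i = (genus \<Delta>, arity \<Delta>)" "decorates X (verts \<Delta>) qs ys"
  shows "(graph_insert \<Gamma> i \<Delta>, list_insert i qs ps, list_insert i ys xs) \<in> gens Is Js X"
proof -
  have "fst ` set (list_insert i (verts \<Delta>) (verts \<Gamma>)) \<subseteq> fst ` (set (verts \<Gamma>) \<union> set (verts \<Delta>))"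
    by (intro image_mono set_list_insert)
  also have "\<dots> \<subseteq> Is" using assms(1,4) by (simp add: gens_iff image_Un)
  finally show ?thesis
    using assms by (simp add: gens_iff stable_graph_insert genus_graph_insert decorates_list_insert)
qed

text \<open>The generator underlying \<open>graft\<close>, without its sign, so that congruences can
  be stated between single generators.\<close>

definition graft_gen :: "graph \<Rightarrow> 'b gen list \<Rightarrow> 'b gen" where
  "graft_gen \<Gamma> hs = (graph_insert_all \<Gamma> (graphs_of hs), degrees_of hs, labels_of hs)"

lemma graft_eq_gen: "graft tw \<Gamma> hs = Poly_Mapping.single (graft_gen \<Gamma> hs) (sg (gsign tw hs))"
  by (simp add: graft_eq graft_gen_def)

lemma graft_gen_in_gens:
  assumes "stable_graph \<Gamma>" "genus \<Gamma> \<in> Js'" "verts \<Gamma> = map vtype hs" "set hs \<subseteq> gens Is Js X"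
  shows "graft_gen \<Gamma> hs \<in> gens Is Js' X" "vtype (graft_gen \<Gamma> hs) = (genus \<Gamma>, arity \<Gamma>)"
    "gdeg tw (graft_gen \<Gamma> hs) = gsum tw hs + tdeg tw \<Gamma>" "insertable 0 (graphs_of hs) \<Gamma>"
    "nverts (graph_insert_all \<Gamma> (graphs_of hs)) = length (degrees_of hs)" "length (labels_of hs) = length (degrees_of hs)"
proof -
  have st: "\<And>\<Delta>. \<Delta> \<in> set (graphs_of hs) \<Longrightarrow> stable_graph \<Delta>"
    using assms(4) by (auto simp: gens_iff subset_iff)
  have v: "verts \<Gamma> = map (\<lambda>\<Delta>. (genus \<Delta>, arity \<Delta>)) (graphs_of hs)" using assms(3) by simp
  note * = graph_insert_all_stable[OF assms(1) st v]
  have dec: "decorates X (concat (map verts (graphs_of hs))) (degrees_of hs) (labels_of hs)"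
    using assms(4) by (intro decorates_concat) (auto simp: gens_iff)
  then show "graft_gen \<Gamma> hs \<in> gens Is Js' X"
  proof -
    have "fst ` set (concat (map verts (graphs_of hs))) \<subseteq> Is"
    proof
      fix g assume "g \<in> fst ` set (concat (map verts (graphs_of hs)))"
      then obtain h v where "h \<in> set hs" "v \<in> set (verts (fst h))" "g = fst v" by auto
      moreover from this have "h \<in> gens Is Js X" using assms(4) by blast
      ultimately show "g \<in> Is" by (simp add: gens_iff image_subset_iff)
    qed
    then show ?thesis using * assms(2) dec by (simp add: gens_iff graft_gen_def)
  qed
  show "vtype (graft_gen \<Gamma> hs) = (genus \<Gamma>, arity \<Gamma>)" using * by (simp add: graft_gen_def)
  have "length hs \<le> nverts \<Gamma>" using assms(3) by simp
  from tdeg_graph_insert_all[OF this, of tw] show "gdeg tw (graft_gen \<Gamma> hs) = gsum tw hs + tdeg tw \<Gamma>"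
    by (simp add: gdeg_eq graft_gen_def sum_list_degrees_of[of _ tw])
  show "insertable 0 (graphs_of hs) \<Gamma>" using *(1) .
  show "nverts (graph_insert_all \<Gamma> (graphs_of hs)) = length (degrees_of hs)" "length (labels_of hs) = length (degrees_of hs)"
    using *(5) decorates_lengths[OF dec] by simp_all
qed

text \<open>The moves in \<open>symrel\<close> are involutions that preserve \<open>gens\<close>, so
  a relation has both of its generators in \<open>gens\<close> or neither. The projection that kills
  generators outside \<open>gens\<close> maps it to a relator or to 0, and it fixes
  \<open>x\<close>.\<close>

lemma span_symrel_imp_relators:
  assumes "x \<in> formal.span (symrel tw)" "Poly_Mapping.keys x \<subseteq> gens Is Js X"
  shows "x \<in> formal.span (relators tw Is Js C X)"
proof -
  let ?p = "lin_ext (\<lambda>h. if h \<in> gens Is Js X then sing h else 0)"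
  have "?p r \<in> formal.span (relators tw Is Js C X)" if "r \<in> symrel tw" for r
    using that
  proof cases
    case (verts i \<Gamma> ps xs)
    let ?h = "(\<Gamma>, ps, xs)" and ?h' = "(swap_verts i \<Gamma>, swap_at i ps, swap_at i xs)"
    have iff: "?h' \<in> gens Is Js X \<longleftrightarrow> ?h \<in> gens Is Js X"
      using gens_swap_verts[of \<Gamma> ps xs Is Js X i] gens_swap_verts[of "swap_verts i \<Gamma>" "swap_at i ps" "swap_at i xs" Is Js X i] verts
      by (auto simp: swap_verts_swap_verts swap_verts_simps)
    show ?thesis
    proof (cases "?h \<in> gens Is Js X")
      case True
      from relators.verts[OF this verts(2)] show ?thesis
        using True iff unfolding verts(1) lin_ext_diff lin_ext_single
        by (simp add: formal.span_base fscale_single)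
    next
      case False
      then show ?thesis using iff unfolding verts(1) lin_ext_diff lin_ext_single by (simp add: formal.span_zero)
    qed
  next
    case (edges i \<Gamma> ps xs)
    let ?h = "(\<Gamma>, ps, xs)" and ?h' = "(swap_edges i \<Gamma>, ps, xs)"
    have iff: "?h' \<in> gens Is Js X \<longleftrightarrow> ?h \<in> gens Is Js X"
      using gens_swap_edges[of \<Gamma> ps xs Is Js X i] gens_swap_edges[of "swap_edges i \<Gamma>" ps xs Is Js X i] edges(2)
      by auto
    show ?thesis
    proof (cases "?h \<in> gens Is Js X")
      case True
      from relators.edges[OF this edges(2), of tw C] show ?thesis
        using True iff unfolding edges(1) lin_ext_diff lin_ext_single fscale_single mult_1_right
        by (simp only: if_True formal.span_base fscale_single mult_1_right formal.scale_one)
    next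
      case False
      then show ?thesis using iff unfolding edges(1) lin_ext_diff lin_ext_single by (simp add: formal.span_zero)
    qed
  qed
  from flinear_span_image[OF flinear_lin_ext this assms(1)]
  have "?p x \<in> formal.span (relators tw Is Js C X)" .
  moreover have "?p x = lin_ext sing x" using assms(2) by (intro lin_ext_cong) auto
  ultimately show ?thesis by simp
qed

section \<open>Grafting and the relations\<close>

lemma keys_single_diff: "Poly_Mapping.keys (Poly_Mapping.single a c - Poly_Mapping.single b d) \<subseteq> {a, b}"
  by (auto simp: in_keys_iff lookup_minus lookup_single when_def split: if_splits)

lemma keys_single_diff2:
  "Poly_Mapping.keys (Poly_Mapping.single a c - Poly_Mapping.single b d - Poly_Mapping.single e f) \<subseteq> {a, b, e}"
  by (auto simp: in_keys_iff lookup_minus lookup_single when_def split: if_splits)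

text \<open>What the labels have to satisfy when multilinear relations are formed; it will be
  verified for functionals as well as for classes of trees.\<close>

definition linear_cells :: "nat set \<Rightarrow> ('k, 'b::ab_group_add) opd \<Rightarrow> bool" where
  "linear_cells Is X \<longleftrightarrow> (\<forall>g n p c x y. g \<in> Is \<longrightarrow> stable g n \<longrightarrow> x \<in> cell X g n p \<longrightarrow> y \<in> cell X g n p \<longrightarrow>
     scl X c x + y \<in> cell X g n p)"

lemma gens_vertex: "(\<Gamma>, ps, xs) \<in> gens Is Js X \<Longrightarrow> i < nverts \<Gamma> \<Longrightarrow>
    fst (verts \<Gamma> ! i) \<in> Is \<and> stable (fst (verts \<Gamma> ! i)) (snd (verts \<Gamma> ! i)) \<and>
    xs ! i \<in> cell X (fst (verts \<Gamma> ! i)) (snd (verts \<Gamma> ! i)) (ps ! i)"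
  using nth_mem[of i "verts \<Gamma>"] by (force simp: gens_iff stable_graph_def decorates_def image_subset_iff)

lemma gens_linear:
  assumes "linear_cells Is X" "(\<Gamma>, ps, xs[i := x]) \<in> gens Is Js X" "(\<Gamma>, ps, xs[i := y]) \<in> gens Is Js X" "i < nverts \<Gamma>"
  shows "(\<Gamma>, ps, xs[i := scl X c x + y]) \<in> gens Is Js X"
proof -
  have len: "length xs = nverts \<Gamma>" using gens_lengths[OF assms(2)] by simp
  have "scl X c x + y \<in> cell X (fst (verts \<Gamma> ! i)) (snd (verts \<Gamma> ! i)) (ps ! i)"
    using gens_vertex[OF assms(2,4)] gens_vertex[OF assms(3,4)] assms(1,4) len by (auto simp: linear_cells_def)
  then have "decorates X (verts \<Gamma>) ps ((xs[i := x])[i := scl X c x + y])"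
    using assms(2,4) decorates_update_same[of X "verts \<Gamma>" ps "xs[i := x]" i "scl X c x + y"]
    by (simp add: gens_iff)
  then show ?thesis using assms(2) by (simp add: gens_iff)
qed

lemma sum_list_list_insert:
  fixes ps :: "int list"
  shows "i < length ps \<Longrightarrow> sum_list (list_insert i qs ps) = sum_list ps - ps ! i + sum_list qs"
proof -
  assume "i < length ps"
  then obtain as x bs where "ps = as @ x # bs" "length as = i" by (rule split_nthE)
  then show ?thesis by (auto simp: nth_append)
qed

text \<open>All terms of a relator are generators again, so passing to another representative does
  not lose control of the support.\<close>

lemma relators_keys:
  assumes "r \<in> relators tw Is Js C X" "linear_cells Is X"
  shows "Poly_Mapping.keys r \<subseteq> gens Is Js X"
  using assms(1)
proof cases
  case (multilinear \<Gamma> ps xs i x y c)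
  show ?thesis
    unfolding multilinear(1)
    by (rule order_trans[OF keys_single_diff2]) (use multilinear gens_linear[OF assms(2)] in auto)
next
  case (verts \<Gamma> ps xs i)
  show ?thesis
    unfolding verts(1)
    by (rule order_trans[OF keys_single_diff]) (use verts gens_swap_verts in auto)
next
  case (edges \<Gamma> ps xs i)
  show ?thesis
    unfolding edges(1)
    by (rule order_trans[OF keys_single_diff]) (use edges gens_swap_edges in auto)
next
  case (flip \<Gamma> ps xs i)
  show ?thesis
    unfolding flip(1)
    by (rule order_trans[OF keys_single_diff]) (use flip gens_flip_edge in auto)
next
  case (contract \<Gamma> ps xs i \<Delta> qs ys)
  have "(graph_insert \<Gamma> i \<Delta>, list_insert i qs ps, list_insert i ys xs) \<in> gens Is Js X"
    using contract by (intro gens_insert) (auto simp: graphs_def)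
  then show ?thesis
    unfolding contract(1)
    by (intro order_trans[OF keys_single_diff]) (use contract in auto)
qed

lemma span_relators_keys:
  "linear_cells Is X \<Longrightarrow> x \<in> formal.span (relators tw Is Js C X) \<Longrightarrow> Poly_Mapping.keys x \<subseteq> gens Is Js X"
  by (rule keys_span[OF relators_keys])

lemma fits_slot_cong:
  "vtype h = vtype h' \<Longrightarrow> gdeg tw h = gdeg tw h' \<Longrightarrow>
    fits tw \<Gamma> ps (as @ h # bs) \<longleftrightarrow> fits tw \<Gamma> ps (as @ h' # bs)"
  by (simp add: fits_iff)

lemma gens_off:
  "set as \<subseteq> gens Is Js X \<Longrightarrow> sum_list (map nverts (graphs_of as)) = length (degrees_of as) \<and>
     length (labels_of as) = length (degrees_of as)"
proof (induction as)
  case (Cons h as)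
  then show ?case using gens_lengths[of h Is Js X] by simp
qed simp

lemma tsum_nat: "tsum tw hs = (if tw then int (sum_list (map nedges (graphs_of hs))) else 0)"
  by (induction hs) (auto simp: tdeg_def)

lemma list_insert_append_mid:
  "a < length ys \<Longrightarrow> list_insert (length xs + a) us (xs @ ys @ zs) = xs @ list_insert a us ys @ zs"
  by (simp add: list_insert_def)

lemma gens_graph_insert_all:
  assumes "stable_graph \<Gamma>" "verts \<Gamma> = map vtype hs" "set hs \<subseteq> gens Is Js X"
  shows "insertable 0 (graphs_of hs) \<Gamma>" "verts (graph_insert_all \<Gamma> (graphs_of hs)) = concat (map verts (graphs_of hs))"
proof -
  have st: "\<And>\<Delta>. \<Delta> \<in> set (graphs_of hs) \<Longrightarrow> stable_graph \<Delta>" using assms(3) by (auto simp: gens_iff subset_iff)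
  have v: "verts \<Gamma> = map (\<lambda>\<Delta>. (genus \<Delta>, arity \<Delta>)) (graphs_of hs)" using assms(2) by simp
  show "insertable 0 (graphs_of hs) \<Gamma>" "verts (graph_insert_all \<Gamma> (graphs_of hs)) = concat (map verts (graphs_of hs))"
    using graph_insert_all_stable(1,5)[OF assms(1) st v] by simp_all
qed

text \<open>Insertion into vertex \<open>a\<close> of one grafted graph, seen from the whole graph:
  the vertex number is shifted by the vertices of \<open>as\<close>, and the new edges have to pass
  those of \<open>as\<close>.\<close>

lemma symrel_insert_graft:
  assumes "stable_graph \<Gamma>" "verts \<Gamma> = map vtype (as @ h # bs)" "set (as @ h # bs) \<subseteq> gens Is Js X" "a < nverts (fst h)"
  shows "sing (graft_gen \<Gamma> (as @ (graph_insert (fst h) a \<Lambda>, list_insert a qs (fst (snd h)), list_insert a ys (snd (snd h))) # bs))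
     - Poly_Mapping.single (graph_insert (graph_insert_all \<Gamma> (graphs_of (as @ h # bs))) (length (degrees_of as) + a) \<Lambda>,
         list_insert (length (degrees_of as) + a) qs (degrees_of (as @ h # bs)),
         list_insert (length (degrees_of as) + a) ys (labels_of (as @ h # bs)))
        (sg (tsum tw as * tdeg tw \<Lambda>) :: 'k::field_char_0)
     \<in> formal.span (symrel tw)"
proof -
  have "insertable 0 (graphs_of (as @ h # bs)) \<Gamma>"
    by (rule gens_graph_insert_all[OF assms(1-3)])
  then have "reorder (graph_insert (graph_insert_all \<Gamma> (graphs_of as @ fst h # graphs_of bs)) (sum_list (map nverts (graphs_of as)) + a) \<Lambda>)
    (sum_list (map nedges (graphs_of as)) * nedges \<Lambda>)
    (graph_insert_all \<Gamma> (graphs_of as @ graph_insert (fst h) a \<Lambda> # graphs_of bs))"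
    using assms by (intro graph_insert_all_insert stable_imp_wf) auto
  note R = symrel_reorder[OF this, where tw = tw]
  have off: "sum_list (map nverts (graphs_of as)) = length (degrees_of as)" "length (labels_of as) = length (degrees_of as)"
    using gens_off[of as Is Js X] assms(3) by auto
  have h: "length (fst (snd h)) = nverts (fst h)" "length (snd (snd h)) = nverts (fst h)"
    using gens_lengths[of h Is Js X] assms(3) by auto
  have s: "(if tw then int (sum_list (map nedges (graphs_of as)) * nedges \<Lambda>) else 0) = tsum tw as * tdeg tw \<Lambda>"
    by (simp add: tsum_nat tdeg_def)
  show ?thesis
    using R[of "degrees_of as @ list_insert a qs (fst (snd h)) @ degrees_of bs"
        "labels_of as @ list_insert a ys (snd (snd h)) @ labels_of bs"]
      list_insert_append_mid[of a "fst (snd h)" "degrees_of as" qs "degrees_of bs"]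
      list_insert_append_mid[of a "snd (snd h)" "labels_of as" ys "labels_of bs"] assms(4) h off
    unfolding s by (simp add: graft_gen_def)
qed

lemma span_fscale_eq:
  "x \<in> formal.span S \<Longrightarrow> y = fscale c x \<Longrightarrow> y \<in> formal.span S"
  by (simp add: formal.span_scale)

text \<open>A relator in the slot becomes a multiple of a relator of the same kind for the grafted
  graph, at shifted positions. Only contraction needs an additional reordering of edges.\<close>

lemma graft_relator:
  fixes X :: "('k::field_char_0, 'b::ab_group_add) opd"
  assumes \<Gamma>: "stable_graph \<Gamma>" "genus \<Gamma> \<in> Js" and ab: "set as \<subseteq> gens Is Js X" "set bs \<subseteq> gens Is Js X"
    and X: "linear_cells Is X" and r: "r \<in> relators tw Is Js C X"
  shows "lin_ext (\<lambda>h. if fits tw \<Gamma> ps (as @ h # bs) then graft tw \<Gamma> (as @ h # bs) else 0) r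
     \<in> formal.span (relators tw Is Js C X)" (is "lin_ext ?T r \<in> ?S")
proof -
  let ?d = "length (degrees_of as)"
  have la: "length (labels_of as) = ?d" "sum_list (map nverts (graphs_of as)) = ?d"
    using gens_off[OF ab(1)] by auto
  have base: "graft_gen \<Gamma> (as @ h # bs) \<in> gens Is Js X" "insertable 0 (graphs_of (as @ h # bs)) \<Gamma>"
    "nverts (graph_insert_all \<Gamma> (graphs_of (as @ h # bs))) = length (degrees_of (as @ h # bs))"
    "length (labels_of (as @ h # bs)) = length (degrees_of (as @ h # bs))"
    "length (fst (snd h)) = nverts (fst h) \<and> length (snd (snd h)) = nverts (fst h)"
    "nedges (graph_insert_all \<Gamma> (graphs_of (as @ h # bs))) =
       nedges \<Gamma> + sum_list (map nedges (graphs_of bs)) + nedges (fst h) + sum_list (map nedges (graphs_of as))"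
    if "h \<in> gens Is Js X" "verts \<Gamma> = map vtype (as @ h # bs)" for h
  proof -
    have "set (as @ h # bs) \<subseteq> gens Is Js X" using that(1) ab by auto
    note g = graft_gen_in_gens[OF \<Gamma> that(2) this]
    show "graft_gen \<Gamma> (as @ h # bs) \<in> gens Is Js X" "insertable 0 (graphs_of (as @ h # bs)) \<Gamma>"
      "nverts (graph_insert_all \<Gamma> (graphs_of (as @ h # bs))) = length (degrees_of (as @ h # bs))"
      "length (labels_of (as @ h # bs)) = length (degrees_of (as @ h # bs))"
      using g by blast+
    show "length (fst (snd h)) = nverts (fst h) \<and> length (snd (snd h)) = nverts (fst h)"
      using gens_lengths[OF that(1)] .
    show "nedges (graph_insert_all \<Gamma> (graphs_of (as @ h # bs))) =
       nedges \<Gamma> + sum_list (map nedges (graphs_of bs)) + nedges (fst h) + sum_list (map nedges (graphs_of as))"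
      by (simp add: graph_insert_all_eq nedges_insert_from)
  qed
  from r show ?thesis
  proof cases
    case (multilinear \<Delta> qs ys a x y c)
    let ?h = "\<lambda>z. (\<Delta>, qs, ys[a := z])"
    \<comment> \<open>Type and degree do not see the label, so all three terms fit or none
      does.\<close>
    have fit: "fits tw \<Gamma> ps (as @ ?h z # bs) \<longleftrightarrow> fits tw \<Gamma> ps (as @ ?h x # bs)" for z
      by (rule fits_slot_cong) (auto simp: gdeg_eq)
    show ?thesis
    proof (cases "fits tw \<Gamma> ps (as @ ?h x # bs)")
      case True
      then have v: "verts \<Gamma> = map vtype (as @ ?h z # bs)" for z by (simp add: fits_iff)
      have len: "length ys = nverts \<Delta>" "length qs = nverts \<Delta>" using gens_lengths[OF multilinear(2)] by simp_all
      let ?G = "graph_insert_all \<Gamma> (graphs_of as @ \<Delta> # graphs_of bs)"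
      let ?P = "degrees_of as @ qs @ degrees_of bs" and ?L = "labels_of as @ ys @ labels_of bs"
      have gg: "graft_gen \<Gamma> (as @ ?h z # bs) = (?G, ?P, ?L[?d + a := z])" for z
        using la len multilinear(4) by (simp add: graft_gen_def list_update_append)
      have "sing (?G, ?P, ?L[?d + a := scl X c x + y]) - Poly_Mapping.single (?G, ?P, ?L[?d + a := x]) c
           - sing (?G, ?P, ?L[?d + a := y]) \<in> relators tw Is Js C X"
        using base(1)[OF multilinear(2) v] base(1)[OF multilinear(3) v] base(3)[OF multilinear(2) v] multilinear(4) len
        unfolding gg by (intro relators.multilinear) auto
      note R = formal.span_base[OF this]
      have s: "gsign tw (as @ ?h z # bs) = gsign tw (as @ ?h x # bs)" for z
        by (simp add: gsign_append gdeg_eq)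
      have T: "?T (?h z) = fscale (sg (gsign tw (as @ ?h x # bs))) (sing (?G, ?P, ?L[?d + a := z]))" for z
        using True fit[of z] s[of z] by (simp add: graft_eq_gen gg fscale_single)
      show ?thesis
        unfolding multilinear(1) lin_ext_diff lin_ext_single T
        by (rule span_fscale_eq[OF R, of _ "sg (gsign tw (as @ ?h x # bs))"])
          (simp add: formal.scale_right_diff_distrib fscale_single mult.commute)
    next
      case False
      then have "?T (?h z) = 0" for z using fit[of z] by simp
      then show ?thesis unfolding multilinear(1) lin_ext_diff lin_ext_single by (simp add: formal.span_zero)
    qed
  next
    case (verts \<Delta> qs ys a)
    let ?h = "(\<Delta>, qs, ys)" and ?h' = "(swap_verts a \<Delta>, swap_at a qs, swap_at a ys)"
    have len: "length ys = nverts \<Delta>" "length qs = nverts \<Delta>" using gens_lengths[OF verts(2)] by simp_all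
    have same: "vtype ?h' = vtype ?h" "gdeg tw ?h' = gdeg tw ?h"
      using verts(3) len sum_list_swap_at[of a qs id] by (simp_all add: swap_verts_simps gdeg_eq tdeg_def)
    note fit = fits_slot_cong[OF same]
    show ?thesis
    proof (cases "fits tw \<Gamma> ps (as @ ?h # bs)")
      case True
      then have v: "verts \<Gamma> = map vtype (as @ ?h # bs)" by (simp add: fits_iff)
      let ?G = "graph_insert_all \<Gamma> (graphs_of as @ \<Delta> # graphs_of bs)"
      let ?P = "degrees_of as @ qs @ degrees_of bs" and ?L = "labels_of as @ ys @ labels_of bs"
      have n: "Suc (?d + a) < nverts ?G" using base(3)[OF verts(2) v] verts(3) len by simp
      have G': "graph_insert_all \<Gamma> (graphs_of as @ swap_verts a \<Delta> # graphs_of bs) = swap_verts (?d + a) ?G"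
        using graph_insert_all_block_swap[of \<Gamma> "graphs_of as" \<Delta> "graphs_of bs" a "Suc 0" "Suc 0"]
          base(2)[OF verts(2) v] stable_imp_wf[OF \<Gamma>(1)] verts(3) la n
        by (simp add: swap_verts_eq_block)
      have "sing (swap_verts (?d + a) ?G, swap_at (?d + a) ?P, swap_at (?d + a) ?L)
          - Poly_Mapping.single (?G, ?P, ?L) (sg (?P ! (?d + a) * ?P ! Suc (?d + a))) \<in> relators tw Is Js C X"
        using base(1)[OF verts(2) v] n by (intro relators.verts) (auto simp: graft_gen_def)
      note R = formal.span_base[OF this]
      have P: "swap_at (?d + a) ?P = degrees_of as @ swap_at a qs @ degrees_of bs"
        "swap_at (?d + a) ?L = labels_of as @ swap_at a ys @ labels_of bs"
        "?P ! (?d + a) = qs ! a" "?P ! Suc (?d + a) = qs ! Suc a"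
        using verts(3) len swap_at_append2[of "degrees_of as" a "qs @ degrees_of bs"]
          swap_at_append2[of "labels_of as" a "ys @ labels_of bs"] la
        by (simp_all add: swap_at_append1 nth_append)
      have s: "gsign tw (as @ ?h' # bs) = gsign tw (as @ ?h # bs)"
        using same(2) verts(3) by (simp add: gsign_append swap_verts_simps tdeg_def)
      have T: "?T ?h' = fscale (sg (gsign tw (as @ ?h # bs))) (sing (swap_verts (?d + a) ?G, swap_at (?d + a) ?P, swap_at (?d + a) ?L))"
        "?T ?h = fscale (sg (gsign tw (as @ ?h # bs))) (sing (?G, ?P, ?L))"
        using True fit unfolding P(1,2) by (simp_all add: graft_eq_gen graft_gen_def G' fscale_single s)
      show ?thesis
        unfolding verts(1) lin_ext_diff lin_ext_single T
        by (rule span_fscale_eq[OF R, of _ "sg (gsign tw (as @ ?h # bs))"])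
          (use verts(3) len in \<open>simp add: formal.scale_right_diff_distrib fscale_single mult.commute nth_append\<close>)
    next
      case False
      then show ?thesis using fit unfolding verts(1) lin_ext_diff lin_ext_single by (simp add: formal.span_zero)
    qed
  next
    case (edges \<Delta> qs ys a)
    let ?h = "(\<Delta>, qs, ys)" and ?h' = "(swap_edges a \<Delta>, qs, ys)"
    have same: "vtype ?h' = vtype ?h" "gdeg tw ?h' = gdeg tw ?h" by (simp_all add: gdeg_eq tdeg_def)
    note fit = fits_slot_cong[OF same]
    show ?thesis
    proof (cases "fits tw \<Gamma> ps (as @ ?h # bs)")
      case True
      then have v: "verts \<Gamma> = map vtype (as @ ?h # bs)" by (simp add: fits_iff)
      let ?G = "graph_insert_all \<Gamma> (graphs_of as @ \<Delta> # graphs_of bs)"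
      let ?e = "nedges \<Gamma> + sum_list (map nedges (graphs_of bs)) + a"
      have G': "graph_insert_all \<Gamma> (graphs_of as @ swap_edges a \<Delta> # graphs_of bs) = swap_edges ?e ?G"
        by (rule graph_insert_all_swap_edges[OF edges(3)])
      have "sing (swap_edges ?e ?G, degrees_of as @ qs @ degrees_of bs, labels_of as @ ys @ labels_of bs)
          - Poly_Mapping.single (?G, degrees_of as @ qs @ degrees_of bs, labels_of as @ ys @ labels_of bs) (if tw then - 1 else 1) \<in> relators tw Is Js C X"
        using base(1)[OF edges(2) v] base(6)[OF edges(2) v] edges(3) by (intro relators.edges) (auto simp: graft_gen_def)
      note R = formal.span_base[OF this]
      have s: "gsign tw (as @ ?h' # bs) = gsign tw (as @ ?h # bs)"
        using same(2) by (simp add: gsign_append tdeg_def)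
      have T: "?T ?h' = fscale (sg (gsign tw (as @ ?h # bs))) (sing (swap_edges ?e ?G, degrees_of as @ qs @ degrees_of bs, labels_of as @ ys @ labels_of bs))"
        "?T ?h = fscale (sg (gsign tw (as @ ?h # bs))) (sing (?G, degrees_of as @ qs @ degrees_of bs, labels_of as @ ys @ labels_of bs))"
        using True fit by (simp_all add: graft_eq_gen graft_gen_def G' fscale_single s)
      show ?thesis
        unfolding edges(1) lin_ext_diff lin_ext_single T
        by (rule span_fscale_eq[OF R, of _ "sg (gsign tw (as @ ?h # bs))"])
          (simp add: formal.scale_right_diff_distrib fscale_single mult.commute)
    next
      case False
      then show ?thesis using fit unfolding edges(1) lin_ext_diff lin_ext_single by (simp add: formal.span_zero)
    qed
  next
    case (flip \<Delta> qs ys a)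
    let ?h = "(\<Delta>, qs, ys)" and ?h' = "(flip_edge a \<Delta>, qs, ys)"
    have same: "vtype ?h' = vtype ?h" "gdeg tw ?h' = gdeg tw ?h" by (simp_all add: gdeg_eq tdeg_def)
    note fit = fits_slot_cong[OF same]
    show ?thesis
    proof (cases "fits tw \<Gamma> ps (as @ ?h # bs)")
      case True
      then have v: "verts \<Gamma> = map vtype (as @ ?h # bs)" by (simp add: fits_iff)
      let ?G = "graph_insert_all \<Gamma> (graphs_of as @ \<Delta> # graphs_of bs)"
      let ?e = "nedges \<Gamma> + sum_list (map nedges (graphs_of bs)) + a"
      have G': "graph_insert_all \<Gamma> (graphs_of as @ flip_edge a \<Delta> # graphs_of bs) = flip_edge ?e ?G"
        by (rule graph_insert_all_flip_edge[OF flip(3)])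
      have "sing (flip_edge ?e ?G, degrees_of as @ qs @ degrees_of bs, labels_of as @ ys @ labels_of bs)
          - sing (?G, degrees_of as @ qs @ degrees_of bs, labels_of as @ ys @ labels_of bs) \<in> relators tw Is Js C X"
        using base(1)[OF flip(2) v] base(6)[OF flip(2) v] flip(3) by (intro relators.flip) (auto simp: graft_gen_def)
      note R = formal.span_base[OF this]
      have s: "gsign tw (as @ ?h' # bs) = gsign tw (as @ ?h # bs)"
        using same(2) by (simp add: gsign_append tdeg_def)
      have T: "?T ?h' = fscale (sg (gsign tw (as @ ?h # bs))) (sing (flip_edge ?e ?G, degrees_of as @ qs @ degrees_of bs, labels_of as @ ys @ labels_of bs))"
        "?T ?h = fscale (sg (gsign tw (as @ ?h # bs))) (sing (?G, degrees_of as @ qs @ degrees_of bs, labels_of as @ ys @ labels_of bs))"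
        using True fit by (simp_all add: graft_eq_gen graft_gen_def G' fscale_single s)
      show ?thesis
        unfolding flip(1) lin_ext_diff lin_ext_single T
        by (rule span_fscale_eq[OF R, of _ "sg (gsign tw (as @ ?h # bs))"])
          (simp add: formal.scale_right_diff_distrib fscale_single mult.commute)
    next
      case False
      then show ?thesis using fit unfolding flip(1) lin_ext_diff lin_ext_single by (simp add: formal.span_zero)
    qed
  next
    case (contract \<Delta> qs ys a \<Lambda> us zs)
    let ?h = "(\<Delta>, qs, ys)" and ?h' = "(graph_insert \<Delta> a \<Lambda>, list_insert a us qs, list_insert a zs ys)"
    let ?c = "sg (tdeg tw \<Lambda> * sum_list (take a qs)) :: 'k"
    have len: "length ys = nverts \<Delta>" "length qs = nverts \<Delta>" using gens_lengths[OF contract(2)] by simp_all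
    have st: "stable_graph \<Delta>" "stable_graph \<Lambda>" using gens_stable[OF contract(2)] contract(4) by (auto simp: graphs_def)
    have same: "vtype ?h' = vtype ?h" "gdeg tw ?h' = gdeg tw ?h"
      using contract st len by (simp_all add: genus_graph_insert gdeg_eq sum_list_list_insert)
    note fit = fits_slot_cong[OF same]
    show ?thesis
    proof (cases "fits tw \<Gamma> ps (as @ ?h # bs)")
      case True
      then have v: "verts \<Gamma> = map vtype (as @ ?h # bs)" by (simp add: fits_iff)
      let ?G = "graph_insert_all \<Gamma> (graphs_of (as @ ?h # bs))"
      let ?P = "degrees_of (as @ ?h # bs)" and ?L = "labels_of (as @ ?h # bs)"
      \<comment> \<open>\<open>?H\<close> is reached in two ways: by the contraction relation of the
        whole graph, and from the grafted composite by moving the edges of \<open>\<Lambda>\<close>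
        past those of \<open>as\<close>.\<close>
      let ?H = "(graph_insert ?G (?d + a) \<Lambda>, list_insert (?d + a) us ?P, list_insert (?d + a) zs ?L)"
      let ?s = "sg (gsign tw (as @ ?h # bs)) :: 'k" and ?s' = "sg (gsign tw (as @ ?h' # bs)) :: 'k"
      let ?e = "sg (tsum tw as * tdeg tw \<Lambda>) :: 'k"
      let ?f = "sg (tdeg tw \<Lambda> * sum_list (take (?d + a) ?P)) :: 'k"
      have abh: "set (as @ ?h # bs) \<subseteq> gens Is Js X" using ab contract(2) by auto
      have h'g: "?h' \<in> gens Is Js X" using contract by (intro gens_insert) (auto simp: graphs_def)
      have v': "verts \<Gamma> = map vtype (as @ ?h' # bs)" using v same(1) by simp
      have vG: "verts ?G = concat (map verts (graphs_of (as @ ?h # bs)))"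
        by (rule gens_graph_insert_all[OF \<Gamma>(1) v abh])
      have at: "verts ?G ! (?d + a) = verts \<Delta> ! a"
        unfolding vG using la contract(3) by (simp add: nth_append length_concat comp_def)
      have nP: "?P ! (?d + a) = qs ! a" "?L ! (?d + a) = ys ! a"
        using contract(3) len la nth_append[of "degrees_of as" "qs @ degrees_of bs" "?d + a"]
          nth_append[of "labels_of as" "ys @ labels_of bs" "?d + a"] by (simp_all add: nth_append)
      have n: "?d + a < nverts ?G" using base(3)[OF contract(2) v] contract(3) len by simp
      have R1: "sing (?G, ?P, ?L) - Poly_Mapping.single ?H ?f \<in> formal.span (relators tw Is Js C X)"
        using base(1)[OF contract(2) v] n contract at nP
        by (intro formal.span_base relators.contract) (auto simp: graft_gen_def)
      have Hg: "?H \<in> gens Is Js X"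
        using base(1)[OF contract(2) v] n contract at
        by (intro gens_insert) (auto simp: graft_gen_def graphs_def)
      have "sing (graft_gen \<Gamma> (as @ ?h' # bs)) - Poly_Mapping.single ?H ?e \<in> formal.span (symrel tw)"
        using symrel_insert_graft[OF \<Gamma>(1) v abh, of a \<Lambda> us zs tw] contract(3) by simp
      then have R2: "sing (graft_gen \<Gamma> (as @ ?h' # bs)) - Poly_Mapping.single ?H ?e \<in> formal.span (relators tw Is Js C X)"
        by (rule span_symrel_imp_relators)
          (rule order_trans[OF keys_single_diff], use Hg base(1)[OF h'g v'] in auto)
      have take: "sum_list (take (?d + a) ?P) = gsum tw as - tsum tw as + sum_list (take a qs)"
        using contract(3) len by (simp add: sum_list_degrees_of[of as tw])
      \<comment> \<open>The signs of the two routes to \<open>?H\<close> agree, so the terms at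
        \<open>?H\<close> cancel in \<open>eq\<close>.\<close>
      have "?s * ?f = ?c * (?s' * ?e)"
        unfolding sg_add[symmetric] take
        by (rule sg_cong) (simp add: gsign_append same(2) algebra_simps del: gsign.simps, simp add: algebra_simps same(2))
      then have eq: "?T ?h - fscale ?c (?T ?h') =
          fscale ?s (sing (?G, ?P, ?L) - Poly_Mapping.single ?H ?f)
          - fscale (?c * ?s') (sing (graft_gen \<Gamma> (as @ ?h' # bs)) - Poly_Mapping.single ?H ?e)"
        using True fit
        by (simp add: graft_eq_gen graft_gen_def fscale_single formal.scale_right_diff_distrib mult.assoc)
      have L: "lin_ext ?T r = ?T ?h - fscale ?c (?T ?h')"
        unfolding contract(1) lin_ext_diff lin_ext_single by (simp only: formal.scale_one)
      show ?thesis
        unfolding L eq by (rule formal.span_diff[OF formal.span_scale[OF R1] formal.span_scale[OF R2]])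
    next
      case False
      then show ?thesis using fit unfolding contract(1) lin_ext_diff lin_ext_single by (simp add: formal.span_zero)
    qed
  qed
qed

lemma in_keys_subset:
  "in_keys hs fs \<Longrightarrow> (\<And>f. f \<in> set fs \<Longrightarrow> Poly_Mapping.keys f \<subseteq> A) \<Longrightarrow> set hs \<subseteq> A"
  by (induction rule: list_all2_induct) auto

lemma graft_sums_slot:
  assumes \<Gamma>: "stable_graph \<Gamma>" "genus \<Gamma> \<in> Js" and X: "linear_cells Is X"
    and ab: "\<And>f. f \<in> set as \<union> set bs \<Longrightarrow> Poly_Mapping.keys f \<subseteq> gens Is Js X"
    and fg: "f - g \<in> formal.span (relators tw Is Js C X)"
  shows "graft_sums tw \<Gamma> ps (as @ f # bs) - graft_sums tw \<Gamma> ps (as @ g # bs) \<in> formal.span (relators tw Is Js C X)"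
proof -
  let ?G = "\<lambda>hs. if fits tw \<Gamma> ps hs then graft tw \<Gamma> hs else 0"
  have "graft_sums tw \<Gamma> ps (as @ f # bs) - graft_sums tw \<Gamma> ps (as @ g # bs) = ml (as @ (f - g) # bs) ?G"
    by (simp only: graft_sums_eq_ml flinear_diff[OF ml_slot_linear])
  also have "\<dots> = ml as (\<lambda>ha. ml bs (\<lambda>hb. lin_ext (\<lambda>h. ?G (ha @ h # hb)) (f - g)))"
    by (simp only: ml_append ml.simps ml_lin_ext_commute)
  also have "\<dots> \<in> formal.span (relators tw Is Js C X)"
  proof (intro ml_in_subspace formal.subspace_span)
    fix ha hb assume "in_keys ha as" "in_keys hb bs"
    then have "set ha \<subseteq> gens Is Js X" "set hb \<subseteq> gens Is Js X"
      using in_keys_subset[of ha as] in_keys_subset[of hb bs] ab by blast+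
    then show "lin_ext (\<lambda>h. ?G (ha @ h # hb)) (f - g) \<in> formal.span (relators tw Is Js C X)"
      by (intro flinear_span_image[OF flinear_lin_ext _ fg] graft_relator[OF \<Gamma> _ _ X])
  qed
  finally show ?thesis .
qed

text \<open>Entries are exchanged one at a time; \<open>as\<close> collects those already replaced,
  so that each step changes a single slot.\<close>

lemma graft_sums_cong:
  assumes \<Gamma>: "stable_graph \<Gamma>" "genus \<Gamma> \<in> Js" and X: "linear_cells Is X"
    and fg: "list_all2 (\<lambda>f g. f - g \<in> formal.span (relators tw Is Js C X)) fs gs"
    and fs: "\<And>f. f \<in> set fs \<union> set gs \<Longrightarrow> Poly_Mapping.keys f \<subseteq> gens Is Js X"
  shows "graft_sums tw \<Gamma> ps fs - graft_sums tw \<Gamma> ps gs \<in> formal.span (relators tw Is Js C X)"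
proof -
  have "graft_sums tw \<Gamma> ps (as @ fs) - graft_sums tw \<Gamma> ps (as @ gs) \<in> formal.span (relators tw Is Js C X)"
    if "\<And>f. f \<in> set as \<Longrightarrow> Poly_Mapping.keys f \<subseteq> gens Is Js X" for as
    using fg fs that
  proof (induction fs gs arbitrary: as rule: list_all2_induct)
    case Nil
    show ?case by (simp add: formal.span_zero)
  next
    case (Cons f fs g gs)
    have "graft_sums tw \<Gamma> ps (as @ f # fs) - graft_sums tw \<Gamma> ps (as @ g # fs) \<in> formal.span (relators tw Is Js C X)"
      using Cons.hyps(1) Cons.prems by (intro graft_sums_slot[OF \<Gamma> X]) auto
    moreover have "graft_sums tw \<Gamma> ps ((as @ [g]) @ fs) - graft_sums tw \<Gamma> ps ((as @ [g]) @ gs) \<in> formal.span (relators tw Is Js C X)"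
      using Cons.prems by (intro Cons.IH) auto
    ultimately show ?case using formal.span_add by fastforce
  qed
  from this[of "[]"] show ?thesis by simp
qed

lemma keys_graft_sums:
  assumes "stable_graph \<Gamma>" "genus \<Gamma> \<in> Js'" "\<And>f. f \<in> set fs \<Longrightarrow> Poly_Mapping.keys f \<subseteq> gens Is Js X"
  shows "Poly_Mapping.keys (graft_sums tw \<Gamma> ps fs) \<subseteq>
     {h \<in> gens Is Js' X. vtype h = (genus \<Gamma>, arity \<Gamma>) \<and> gdeg tw h = sum_list ps + tdeg tw \<Gamma>}" (is "_ \<subseteq> ?A")
proof -
  have "graft_sums tw \<Gamma> ps fs \<in> {f. Poly_Mapping.keys f \<subseteq> ?A}"
    unfolding graft_sums_eq_ml
  proof (rule ml_in_subspace[OF subspace_keys])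
    fix hs assume "in_keys hs fs"
    then have hs: "set hs \<subseteq> gens Is Js X" using in_keys_subset[OF _ assms(3)] by blast
    show "(if fits tw \<Gamma> ps hs then graft tw \<Gamma> hs else 0) \<in> {f. Poly_Mapping.keys f \<subseteq> ?A}"
    proof (cases "fits tw \<Gamma> ps hs")
      case True
      then have "verts \<Gamma> = map vtype hs" "ps = map (gdeg tw) hs" by (simp_all add: fits_iff)
      with graft_gen_in_gens[OF assms(1,2) this(1) hs] True show ?thesis
        by (simp add: graft_eq_gen gsum_def)
    qed simp
  qed
  then show ?thesis by simp
qed

section \<open>Relations of the outer graph under grafting\<close>

lemma graft_swap_edges:
  assumes "stable_graph \<Gamma>" "genus \<Gamma> \<in> Js" "verts \<Gamma> = map vtype hs" "set hs \<subseteq> gens Is Js X" "Suc i < nedges \<Gamma>"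
  shows "graft tw (swap_edges i \<Gamma>) hs - fscale (if tw then - 1 else 1) (graft tw \<Gamma> hs) \<in> formal.span (relators tw Is Js C X)"
proof -
  have "Suc i < nedges (graph_insert_all \<Gamma> (graphs_of hs))"
    using assms(5) by (simp add: graph_insert_all_eq nedges_insert_from)
  note R = formal.span_base[OF relators.edges[OF graft_gen_in_gens(1)[OF assms(1-4), unfolded graft_gen_def] this], of tw C]
  show ?thesis
    by (rule span_fscale_eq[OF R, of _ "sg (gsign tw hs)"])
      (simp add: graft_eq graph_insert_all_eq insert_from_swap_edges[OF assms(5)] formal.scale_right_diff_distrib fscale_single mult.commute)
qed

lemma graft_flip_edge:
  assumes "stable_graph \<Gamma>" "genus \<Gamma> \<in> Js" "verts \<Gamma> = map vtype hs" "set hs \<subseteq> gens Is Js X" "i < nedges \<Gamma>"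
  shows "graft tw (flip_edge i \<Gamma>) hs - graft tw \<Gamma> hs \<in> formal.span (relators tw Is Js C X)"
proof -
  have "i < nedges (graph_insert_all \<Gamma> (graphs_of hs))"
    using assms(5) by (simp add: graph_insert_all_eq nedges_insert_from)
  note R = formal.span_base[OF relators.flip[OF graft_gen_in_gens(1)[OF assms(1-4), unfolded graft_gen_def] this], of tw C]
  show ?thesis
    by (rule span_fscale_eq[OF R, of _ "sg (gsign tw hs)"])
      (simp add: graft_eq graph_insert_all_eq insert_from_flip_edge[OF assms(5)] formal.scale_right_diff_distrib fscale_single)
qed

text \<open>The two grafted graphs move as blocks of vertices and as blocks of edges. The product of
  both signs, together with the change of \<open>gsign\<close>, is the Koszul sign of the total
  degrees.\<close>

lemma graft_swap_verts:
  fixes tw :: bool and C :: "graph set" and X :: "('k::field_char_0, 'b::ab_group_add) opd"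
  assumes "stable_graph \<Gamma>" "genus \<Gamma> \<in> Js" "verts \<Gamma> = map vtype (as @ h # h' # bs)" "set (as @ h # h' # bs) \<subseteq> gens Is Js X"
  shows "graft tw (swap_verts (length as) \<Gamma>) (as @ h' # h # bs) -
      fscale (sg (gdeg tw h * gdeg tw h')) (graft tw \<Gamma> (as @ h # h' # bs)) \<in> formal.span (relators tw Is Js C X)"
proof -
  let ?hs = "as @ h # h' # bs" and ?hs' = "as @ h' # h # bs"
  let ?G = "graph_insert_all \<Gamma> (graphs_of ?hs)"
  let ?B = "block_swap (length (degrees_of as)) (length (fst (snd h))) (length (fst (snd h'))) ?G"
  have n: "Suc (length as) < nverts \<Gamma>" using assms(3) by simp
  have v': "verts (swap_verts (length as) \<Gamma>) = map vtype ?hs'"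
    using n assms(3) swap_at_append[of "map vtype as" "vtype h" "vtype h'"] by (simp add: swap_verts_simps)
  have hs': "set ?hs' \<subseteq> gens Is Js X" using assms(4) by auto
  note g = graft_gen_in_gens[OF assms(1-4)]
  have g': "graft_gen (swap_verts (length as) \<Gamma>) ?hs' \<in> gens Is Js X"
    using stable_swap_verts[OF n assms(1)] assms(2) v' hs' n by (intro graft_gen_in_gens(1)) (auto simp: swap_verts_simps)
  have len: "length (fst (snd h)) = nverts (fst h)" "length (snd (snd h)) = nverts (fst h)"
    "length (fst (snd h')) = nverts (fst h')" "length (snd (snd h')) = nverts (fst h')"
    "length (labels_of as) = length (degrees_of as)" "sum_list (map nverts (graphs_of as)) = length (degrees_of as)"
    using gens_lengths[of h Is Js X] gens_lengths[of h' Is Js X] gens_off[of as Is Js X] assms(4) by auto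
  have "reorder (block_swap (sum_list (map nverts (graphs_of as))) (nverts (fst h)) (nverts (fst h')) ?G)
      (nedges (fst h') * nedges (fst h)) (graph_insert_all (swap_verts (length (graphs_of as)) \<Gamma>) (graphs_of as @ fst h' # fst h # graphs_of bs))"
    using graph_insert_all_swap_verts[OF stable_imp_wf[OF assms(1)], of "graphs_of as" "fst h" "fst h'" "graphs_of bs"]
      gens_graph_insert_all[OF assms(1,3,4)] by simp
  from symrel_reorder[OF this, of "degrees_of ?hs'" "labels_of ?hs'" tw]
  have 1: "sing (graft_gen (swap_verts (length as) \<Gamma>) ?hs') -
      Poly_Mapping.single (?B, degrees_of ?hs', labels_of ?hs') (sg (tdeg tw (fst h) * tdeg tw (fst h')) :: 'k) \<in> formal.span (symrel tw)"
    using len by (simp add: graft_gen_def tdeg_def mult.commute split: if_splits)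
  have 2: "sing (?B, degrees_of ?hs', labels_of ?hs') -
      Poly_Mapping.single (graft_gen \<Gamma> ?hs) (sg (sum_list (fst (snd h)) * sum_list (fst (snd h'))) :: 'k) \<in> formal.span (symrel tw)"
    using symrel_block_swap[of "degrees_of bs" "labels_of bs" "snd (snd h)" "fst (snd h)" ?G "degrees_of as" "fst (snd h')"
        "labels_of as" "snd (snd h')" tw] g(5,6) len
    by (simp add: graft_gen_def)
  let ?e = "sg (tdeg tw (fst h) * tdeg tw (fst h')) * sg (sum_list (fst (snd h)) * sum_list (fst (snd h'))) :: 'k"
  have R: "sing (graft_gen (swap_verts (length as) \<Gamma>) ?hs') - Poly_Mapping.single (graft_gen \<Gamma> ?hs) ?e \<in> formal.span (relators tw Is Js C X)"
    by (rule span_symrel_imp_relators[OF span_single_trans[OF 1 2]], rule order_trans[OF keys_single_diff])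
      (use g(1) g' in auto)
  have s: "sg (gdeg tw h * gdeg tw h') * sg (gsign tw ?hs) = sg (gsign tw ?hs') * ?e"
    unfolding sg_add[symmetric] by (rule sg_cong) (simp add: gsign_append gdeg_eq algebra_simps)
  show ?thesis
    by (rule span_fscale_eq[OF R, of _ "sg (gsign tw ?hs')"])
      (simp only: graft_eq_gen formal.scale_right_diff_distrib fscale_single s mult_1_right)
qed

text \<open>Associativity of grafting with signs: the twist of \<open>\<Delta>\<close> passes the
  generators before the slot, and the edges of \<open>\<Delta>\<close> are exchanged with those
  grafted behind it.\<close>

lemma graft_contract:
  fixes tw :: bool and C :: "graph set" and X :: "('k::field_char_0, 'b::ab_group_add) opd"
  assumes "stable_graph \<Gamma>" "genus \<Gamma> \<in> Js" "stable_graph \<Delta>" "genus \<Delta> \<in> Js"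
    "verts \<Gamma> = map vtype as @ (genus \<Delta>, arity \<Delta>) # map vtype bs" "verts \<Delta> = map vtype ks"
    "set (as @ ks @ bs) \<subseteq> gens Is Js X"
  shows "fscale (sg (gsign tw ks)) (graft tw \<Gamma> (as @ graft_gen \<Delta> ks # bs)) -
      fscale (sg (tdeg tw \<Delta> * gsum tw as)) (graft tw (graph_insert \<Gamma> (length as) \<Delta>) (as @ ks @ bs))
      \<in> formal.span (relators tw Is Js C X)"
proof -
  let ?h = "graft_gen \<Delta> ks" and ?G' = "graph_insert \<Gamma> (length as) \<Delta>"
  have n: "length as < nverts \<Gamma>" "verts \<Gamma> ! length as = (genus \<Delta>, arity \<Delta>)"
    using assms(5) nth_append_length[of "map vtype as"] by simp_all
  have ks: "set ks \<subseteq> gens Is Js X" using assms(7) by auto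
  note gk = graft_gen_in_gens[OF assms(3,4,6) ks]
  have v: "verts \<Gamma> = map vtype (as @ ?h # bs)" using assms(5) gk(2) by simp
  have v': "verts ?G' = map vtype (as @ ks @ bs)"
    using list_insert_append[of "map vtype as" "map vtype ks" "(genus \<Delta>, arity \<Delta>)" "map vtype bs"] assms(5,6) by simp
  have hs: "set (as @ ?h # bs) \<subseteq> gens Is Js X" using assms(7) gk(1) by auto
  have G': "stable_graph ?G'" "genus ?G' = genus \<Gamma>"
    using assms(1,3) n by (auto intro!: stable_graph_insert genus_graph_insert)
  note g = graft_gen_in_gens(1)[OF assms(1,2) v hs]
  have g': "graft_gen ?G' (as @ ks @ bs) \<in> gens Is Js X"
    using G' assms(2,7) v' by (intro graft_gen_in_gens(1)) auto
  have "reorder (graph_insert_all (graph_insert \<Gamma> (length (graphs_of as)) \<Delta>) (graphs_of as @ graphs_of ks @ graphs_of bs))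
    (nedges \<Delta> * sum_list (map nedges (graphs_of bs)))
    (graph_insert_all \<Gamma> (graphs_of as @ graph_insert_all \<Delta> (graphs_of ks) # graphs_of bs))"
  proof (rule graph_insert_all_nested)
    show "insertable 0 (graphs_of ks) \<Delta>" by (rule gens_graph_insert_all[OF assms(3,6) ks])
    have "insertable 0 (graphs_of (as @ ?h # bs)) \<Gamma>" by (rule gens_graph_insert_all[OF assms(1) v hs])
    then show "insertable 0 (graphs_of as @ \<Delta> # graphs_of bs) \<Gamma>"
      using n(2) stable_imp_wf[OF assms(3)] by (simp add: insertable_append)
    show "length (graphs_of ks) = nverts \<Delta>" using assms(6) by simp
  qed (rule stable_imp_wf[OF assms(1)])
  from symrel_reorder[OF this, of "degrees_of (as @ ks @ bs)" "labels_of (as @ ks @ bs)" tw]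
  have "sing (graft_gen \<Gamma> (as @ ?h # bs)) - Poly_Mapping.single (graft_gen ?G' (as @ ks @ bs)) (sg (tdeg tw \<Delta> * tsum tw bs) :: 'k)
      \<in> formal.span (symrel tw)"
    by (simp add: graft_gen_def tdeg_def tsum_nat split: if_splits)
  then have R: "sing (graft_gen \<Gamma> (as @ ?h # bs)) - Poly_Mapping.single (graft_gen ?G' (as @ ks @ bs)) (sg (tdeg tw \<Delta> * tsum tw bs) :: 'k)
      \<in> formal.span (relators tw Is Js C X)"
    by (rule span_symrel_imp_relators, intro order_trans[OF keys_single_diff]) (use g g' in auto)
  have td: "tdeg tw (fst ?h) = tdeg tw \<Delta> + tsum tw ks"
    using tdeg_graph_insert_all[of ks \<Delta> tw] assms(6) by (simp add: graft_gen_def)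
  have s: "sg (tdeg tw \<Delta> * gsum tw as) * sg (gsign tw (as @ ks @ bs)) =
      (sg (gsign tw ks) * sg (gsign tw (as @ ?h # bs)) * sg (tdeg tw \<Delta> * tsum tw bs) :: 'k)"
    unfolding sg_add[symmetric] by (rule sg_cong) (simp add: gsign_append td gk(3) algebra_simps)
  show ?thesis
    by (rule span_fscale_eq[OF R, of _ "sg (gsign tw ks) * sg (gsign tw (as @ ?h # bs))"])
      (simp only: graft_eq_gen formal.scale_right_diff_distrib fscale_single s mult_1_right)
qed

section \<open>Insertion into a single vertex\<close>

definition cor :: "nat \<times> nat \<Rightarrow> int \<Rightarrow> 'b \<Rightarrow> 'b gen" where
  "cor v p x = (corolla (fst v) (snd v), [p], [x])"

text \<open>Grafting these corollas into the graph they come from changes nothing, so they fill the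
  slots that are not to be touched.\<close>

definition cors :: "(nat \<times> nat) list \<Rightarrow> int list \<Rightarrow> 'b list \<Rightarrow> 'b gen list" where
  "cors vs ps xs = map (\<lambda>(v, p, x). cor v p x) (zip vs (zip ps xs))"

lemma cor_simps [simp]:
  "fst (cor v p x) = corolla (fst v) (snd v)" "snd (cor v p x) = ([p], [x])" "gdeg tw (cor v p x) = p"
  "tdeg tw (corolla g n) = 0"
  by (simp_all add: cor_def gdeg_def tdeg_def)

lemma cors_simps [simp]:
  "cors [] ps xs = []" "cors (v # vs) (p # ps) (x # xs) = cor v p x # cors vs ps xs"
  by (simp_all add: cors_def)

lemma cors_props:
  "length ps = length vs \<Longrightarrow> length xs = length vs \<Longrightarrow>
    length (cors vs ps xs) = length vs \<and> map vtype (cors vs ps xs) = vs \<and> map (gdeg tw) (cors vs ps xs) = ps \<and>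
    degrees_of (cors vs ps xs) = ps \<and> labels_of (cors vs ps xs) = xs \<and> tsum tw (cors vs ps xs) = 0 \<and>
    gsum tw (cors vs ps xs) = sum_list ps \<and> gsign tw (cors vs ps xs) = 0 \<and>
    graphs_of (cors vs ps xs) = map (\<lambda>(g, n). corolla g n) vs"
proof (induction vs arbitrary: ps xs)
  case (Cons v vs)
  then obtain p ps' x xs' where "ps = p # ps'" "xs = x # xs'" by (metis length_Suc_conv)
  then show ?case using Cons by (cases v) simp
qed simp

lemma cors_gens:
  "decorates X vs ps xs \<Longrightarrow> fst ` set vs \<subseteq> Is \<Longrightarrow> (\<And>v. v \<in> set vs \<Longrightarrow> stable (fst v) (snd v)) \<Longrightarrow> Is \<subseteq> Js \<Longrightarrow>
    set (cors vs ps xs) \<subseteq> gens Is Js X"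
proof (induction vs arbitrary: ps xs)
  case (Cons v vs)
  then obtain p ps' x xs' where eq: "ps = p # ps'" "xs = x # xs'"
    using decorates_lengths[OF Cons.prems(1)] by (metis length_Suc_conv)
  have "cor v p x \<in> gens Is Js X"
    using Cons.prems eq by (auto simp: gens_iff)
  then show ?case using Cons eq by auto
qed simp

text \<open>Insertion into one vertex is simultaneous insertion with corollas elsewhere, which makes
  the results on \<open>graft\<close> available for \<open>graft_at\<close>.\<close>

lemma graph_insert_all_slot:
  assumes "wf_graph \<Gamma>" "i < nverts \<Gamma>" "wf_graph \<Delta>" "snd (verts \<Gamma> ! i) = arity \<Delta>"
  shows "graph_insert_all \<Gamma> (map (\<lambda>(g, n). corolla g n) (take i (verts \<Gamma>)) @ \<Delta> #
      map (\<lambda>(g, n). corolla g n) (drop (Suc i) (verts \<Gamma>))) = graph_insert \<Gamma> i \<Delta>"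
proof -
  have "insert_from (Suc i) (map (\<lambda>(g, n). corolla g n) (drop (Suc i) (verts \<Gamma>))) \<Gamma> = \<Gamma>"
    using assms(1,2) by (intro insert_from_corollas) auto
  moreover have "insert_from 0 (map (\<lambda>(g, n). corolla g n) (take i (verts \<Gamma>))) (graph_insert \<Gamma> i \<Delta>) = graph_insert \<Gamma> i \<Delta>"
    using assms wf_graph_insert[OF assms(1,3,2,4)]
    by (intro insert_from_corollas) (auto simp: list_insert_def nth_append)
  ultimately show ?thesis
    using assms(2) by (simp add: graph_insert_all_eq insert_from_append)
qed

definition around :: "'b gen \<Rightarrow> nat \<Rightarrow> 'b gen list \<times> 'b gen list" where
  "around h i = (cors (take i (verts (fst h))) (take i (fst (snd h))) (take i (snd (snd h))),
     cors (drop (Suc i) (verts (fst h))) (drop (Suc i) (fst (snd h))) (drop (Suc i) (snd (snd h))))"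

lemma around_gens:
  assumes "h \<in> gens Is Js X" "Is \<subseteq> Js" "i < nverts (fst h)"
  shows "set (fst (around h i)) \<subseteq> gens Is Js X" "set (snd (around h i)) \<subseteq> gens Is Js X"
    "map vtype (fst (around h i)) = take i (verts (fst h))" "map vtype (snd (around h i)) = drop (Suc i) (verts (fst h))"
proof -
  have st: "stable (fst v) (snd v)" "fst v \<in> Is" if "v \<in> set (verts (fst h))" for v
    using assms(1) that by (auto simp: gens_iff stable_graph_def)
  have d: "decorates X (verts (fst h)) (fst (snd h)) (snd (snd h))" using assms(1) by (simp add: gens_iff)
  note len = decorates_lengths[OF d]
  have d1: "decorates X (take i (verts (fst h))) (take i (fst (snd h))) (take i (snd (snd h)))"
    "decorates X (drop (Suc i) (verts (fst h))) (drop (Suc i) (fst (snd h))) (drop (Suc i) (snd (snd h)))"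
    using d by (auto simp: decorates_def)
  show "set (fst (around h i)) \<subseteq> gens Is Js X" unfolding around_def fst_conv
    using st by (intro cors_gens[OF d1(1) _ _ assms(2)]) (auto dest: in_set_takeD)
  show "set (snd (around h i)) \<subseteq> gens Is Js X" unfolding around_def snd_conv
    using st by (intro cors_gens[OF d1(2) _ _ assms(2)]) (auto dest: in_set_dropD)
  show "map vtype (fst (around h i)) = take i (verts (fst h))" "map vtype (snd (around h i)) = drop (Suc i) (verts (fst h))"
    using len by (simp_all add: around_def cors_props)
qed

lemma graft_at_eq:
  "graft_at tw h i k = Poly_Mapping.single (graph_insert (fst h) i (fst k), list_insert i (fst (snd k)) (fst (snd h)),
     list_insert i (snd (snd k)) (snd (snd h))) (sg (tdeg tw (fst k) * sum_list (take i (fst (snd h)))))"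
  by (simp add: graft_at_def case_prod_beta)

lemma graft_at_eq_graft:
  assumes "h \<in> gens Is Js X" "i < nverts (fst h)" "wf_graph (fst k)" "snd (verts (fst h) ! i) = arity (fst k)"
  shows "graft_at tw h i k = graft tw (fst h) (fst (around h i) @ k # snd (around h i))"
proof -
  note len = gens_lengths[OF assms(1)]
  have p: "cors (take i (verts (fst h))) (take i (fst (snd h))) (take i (snd (snd h))) = fst (around h i)"
    "cors (drop (Suc i) (verts (fst h))) (drop (Suc i) (fst (snd h))) (drop (Suc i) (snd (snd h))) = snd (around h i)"
    by (simp_all add: around_def)
  note c1 = cors_props[of "take i (fst (snd h))" "take i (verts (fst h))" "take i (snd (snd h))" tw, unfolded p]
  note c2 = cors_props[of "drop (Suc i) (fst (snd h))" "drop (Suc i) (verts (fst h))" "drop (Suc i) (snd (snd h))" tw, unfolded p]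
  have "graph_insert_all (fst h) (graphs_of (fst (around h i) @ k # snd (around h i))) = graph_insert (fst h) i (fst k)"
    using graph_insert_all_slot[OF stable_imp_wf[OF gens_stable[OF assms(1)]] assms(2-4)] c1 c2 len by simp
  moreover have "gsign tw (fst (around h i) @ k # snd (around h i)) = sum_list (take i (fst (snd h))) * tdeg tw (fst k)"
    using c1 c2 len by (simp add: gsign_append)
  ultimately show ?thesis
    using c1 c2 len assms(2) by (simp add: graft_at_eq graft_eq list_insert_def mult.commute)
qed

text \<open>\<open>graft_relator\<close> prescribes the degree of the slot through
  \<open>fits\<close>, whereas \<open>graft_at\<close> does not; homogeneity of the relators bridges
  this gap.\<close>

lemma relators_degree:
  assumes "r \<in> relators tw Is Js C X"
  shows "\<exists>d. \<forall>h \<in> Poly_Mapping.keys r. gdeg tw h = d"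
proof -
  have 1: "\<exists>d. \<forall>h \<in> Poly_Mapping.keys r. gdeg tw h = d" if "Poly_Mapping.keys r \<subseteq> {a, b, c}" "gdeg tw b = gdeg tw a" "gdeg tw c = gdeg tw a" for a b c
    using that by blast
  from assms show ?thesis
  proof cases
    case (multilinear \<Gamma> ps xs i x y c)
    show ?thesis unfolding multilinear(1) by (rule 1[unfolded multilinear(1), OF keys_single_diff2]) (simp_all add: gdeg_eq)
  next
    case (verts \<Gamma> ps xs i)
    have "Suc i < length ps" using verts gens_lengths[OF verts(2)] by simp
    then show ?thesis unfolding verts(1) using verts sum_list_swap_at[of i ps id]
      by (intro 1[unfolded verts(1), OF order_trans[OF keys_single_diff], of "(\<Gamma>, ps, xs)" "(swap_verts i \<Gamma>, swap_at i ps, swap_at i xs)" "(\<Gamma>, ps, xs)"])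
        (auto simp: gdeg_eq tdeg_def swap_verts_simps)
  next
    case (edges \<Gamma> ps xs i)
    show ?thesis unfolding edges(1)
      by (intro 1[unfolded edges(1), OF order_trans[OF keys_single_diff], of "(\<Gamma>, ps, xs)" "(swap_edges i \<Gamma>, ps, xs)" "(\<Gamma>, ps, xs)"])
        (auto simp: gdeg_eq tdeg_def)
  next
    case (flip \<Gamma> ps xs i)
    show ?thesis unfolding flip(1)
      by (intro 1[unfolded flip(1), OF order_trans[OF keys_single_diff], of "(\<Gamma>, ps, xs)" "(flip_edge i \<Gamma>, ps, xs)" "(\<Gamma>, ps, xs)"])
        (auto simp: gdeg_eq tdeg_def)
  next
    case (contract \<Gamma> ps xs i \<Delta> qs ys)
    have "i < length ps" using contract gens_lengths[OF contract(2)] by simp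
    then show ?thesis unfolding contract(1) using contract
      by (intro 1[unfolded contract(1), OF order_trans[OF keys_single_diff], of "(\<Gamma>, ps, xs)" "(graph_insert \<Gamma> i \<Delta>, list_insert i qs ps, list_insert i ys xs)" "(\<Gamma>, ps, xs)"])
        (auto simp: gdeg_eq sum_list_list_insert)
  qed
qed

text \<open>The condition on the type stays explicit because an element of the span may have terms
  of various types.\<close>

lemma graft_at_relators:
  fixes X :: "('k::field_char_0, 'b::ab_group_add) opd"
  assumes h: "h \<in> gens Is Js X" "Is \<subseteq> Js" "i < nverts (fst h)" and X: "linear_cells Is X"
    and x: "x \<in> formal.span (relators tw Is Js C X)"
  shows "lin_ext (\<lambda>k. if vtype k = verts (fst h) ! i then graft_at tw h i k else 0) x \<in> formal.span (relators tw Is Js C X)"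
proof (rule flinear_span_image[OF flinear_lin_ext _ x])
  fix r assume r: "r \<in> relators tw Is Js C X"
  obtain d where d: "\<forall>k \<in> Poly_Mapping.keys r. gdeg tw k = d" using relators_degree[OF r] by blast
  let ?as = "fst (around h i)" and ?bs = "snd (around h i)"
  note ab = around_gens[OF h]
  let ?ps = "map (gdeg tw) ?as @ d # map (gdeg tw) ?bs"
  have st: "stable_graph (fst h)" "genus (fst h) \<in> Js" using h(1) by (auto simp: gens_iff)
  have "lin_ext (\<lambda>k. if vtype k = verts (fst h) ! i then graft_at tw h i k else 0) r =
      lin_ext (\<lambda>k. if fits tw (fst h) ?ps (?as @ k # ?bs) then graft tw (fst h) (?as @ k # ?bs) else 0) r"
  proof (rule lin_ext_cong)
    fix k assume k: "k \<in> Poly_Mapping.keys r"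
    have "verts (fst h) = map vtype (?as @ k # ?bs) \<longleftrightarrow> vtype k = verts (fst h) ! i"
    proof -
      have m: "map vtype (?as @ k # ?bs) = take i (verts (fst h)) @ vtype k # drop (Suc i) (verts (fst h))"
        using ab(3,4) by simp
      show ?thesis unfolding m
      proof
        assume e: "verts (fst h) = take i (verts (fst h)) @ vtype k # drop (Suc i) (verts (fst h))"
        from arg_cong[OF e, of "\<lambda>xs. xs ! i"] show "vtype k = verts (fst h) ! i" using h(3) by (simp add: nth_append)
      qed (use id_take_nth_drop[OF h(3)] in simp)
    qed
    then have fit: "fits tw (fst h) ?ps (?as @ k # ?bs) \<longleftrightarrow> vtype k = verts (fst h) ! i"
      using d k by (simp add: fits_iff)
    have "wf_graph (fst k)" using relators_keys[OF r X] k by (auto intro!: stable_imp_wf gens_stable)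
    then show "(if vtype k = verts (fst h) ! i then graft_at tw h i k else 0) =
        (if fits tw (fst h) ?ps (?as @ k # ?bs) then graft tw (fst h) (?as @ k # ?bs) else 0)"
      unfolding fit using graft_at_eq_graft[OF h(1,3), of k tw] by (metis snd_conv)
  qed
  then show "lin_ext (\<lambda>k. if vtype k = verts (fst h) ! i then graft_at tw h i k else 0) r \<in> formal.span (relators tw Is Js C X)"
    using graft_relator[OF st ab(1,2) X r, of ?ps] by simp
qed

section \<open>Derivations\<close>

lemma lin_ext_fun_diff: "lin_ext (\<lambda>x. h x - k x) f = lin_ext h f - lin_ext k f"
  by (simp add: lin_ext_def sum_subtractf formal.scale_right_diff_distrib)

lemma lin_ext_combination_in:
  assumes "formal.subspace S" "\<And>k. k \<in> Poly_Mapping.keys K \<Longrightarrow> fscale c (A k) - fscale d (B k) \<in> S"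
  shows "fscale c (lin_ext A K) - fscale d (lin_ext B K) \<in> S"
  using lin_ext_in_subspace[OF assms(1), of K "\<lambda>k. fscale c (A k) - fscale d (B k)"] assms(2)
  by (simp add: lin_ext_fun_diff lin_ext_fun_scale)

lemma lin_ext_combination3_in:
  assumes "formal.subspace S" "\<And>k. k \<in> Poly_Mapping.keys K \<Longrightarrow> A k - fscale d (B k) - E k \<in> S"
  shows "lin_ext A K - fscale d (lin_ext B K) - lin_ext E K \<in> S"
  using lin_ext_in_subspace[OF assms(1), of K "\<lambda>k. A k - fscale d (B k) - E k"] assms(2)
  by (simp add: lin_ext_fun_diff lin_ext_fun_scale)

lemma list_insert_update_other:
  assumes "i < length xs" "a < length xs" "i \<noteq> a"
  shows "list_insert i ys (xs[a := z]) = (list_insert i ys xs)[(if a < i then a else a + length ys - 1) := z]"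
proof (cases "a < i")
  case True
  then show ?thesis using assms by (simp add: list_insert_def list_update_append take_update_swap)
next
  case False
  with assms obtain b where b: "a = Suc (i + b)" by (metis less_iff_Suc_add linorder_neqE_nat)
  have "drop (Suc i) (xs[a := z]) = (drop (Suc i) xs)[b := z]" using b by (simp add: drop_update_swap)
  then show ?thesis using assms b by (simp add: list_insert_def list_update_append take_update_cancel)
qed

lemma list_insert_update_same: "i < length xs \<Longrightarrow> list_insert i ys (xs[i := z]) = list_insert i ys xs"
  by (simp add: list_insert_def)

lemma list_insert_swap_at_before:
  assumes "i < b" "Suc b < length xs"
  shows "list_insert i ys (swap_at b xs) = swap_at (b + length ys - 1) (list_insert i ys xs)"
proof -
  have n: "b + Suc 0 + Suc 0 \<le> length xs" using assms by simp
  obtain A B C D where v: "xs = A @ B @ C @ D" "length A = b" "length B = Suc 0" "length C = Suc 0"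
    using n by (rule split_blocks)
  obtain x y where BC: "B = [x]" "C = [y]" using v by (auto simp: length_Suc_conv)
  have "i < length A" using assms v by simp
  then obtain A1 z A2 where A: "A = A1 @ z # A2" "length A1 = i" by (rule split_nthE)
  have l: "b + length ys - 1 = length (A1 @ ys @ A2)" using A v by simp
  have "swap_at b xs = A @ y # x # D" using swap_at_append[of A x y D] v BC by simp
  then have "list_insert i ys (swap_at b xs) = A1 @ ys @ A2 @ y # x # D"
    using list_insert_append[of A1 ys z "A2 @ y # x # D"] A by simp
  moreover have "list_insert i ys xs = A1 @ ys @ A2 @ x # y # D"
    using list_insert_append[of A1 ys z "A2 @ x # y # D"] A v BC by simp
  ultimately show ?thesis using swap_at_append[of "A1 @ ys @ A2" x y D] unfolding l by simp
qed

lemma list_insert_swap_at_after: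
  assumes "Suc b < i" "i < length xs"
  shows "list_insert i ys (swap_at b xs) = swap_at b (list_insert i ys xs)"
proof -
  obtain A z B where A: "xs = A @ z # B" "length A = i" using assms(2) by (rule split_nthE)
  have "list_insert i ys (swap_at b xs) = swap_at b A @ ys @ B"
    using list_insert_append[of "swap_at b A" ys z B] A assms by (simp add: swap_at_append1)
  moreover have "list_insert i ys xs = A @ ys @ B" using list_insert_append[of A ys z B] A by simp
  ultimately show ?thesis using A assms by (simp add: swap_at_append1)
qed

lemma reorder_0: "reorder \<Gamma> 0 \<Gamma>' \<Longrightarrow> \<Gamma>' = \<Gamma>"
  by (erule reorder.cases) simp_all

text \<open>A connected graph without edges has a single vertex, by the bound on the number of
  vertices.\<close>

lemma permuted_corolla:
  assumes "\<Delta> \<in> permuted_corollas"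
  shows "stable_graph \<Delta>" "edges \<Delta> = []" "verts \<Delta> = [(genus \<Delta>, arity \<Delta>)]" "tdeg tw \<Delta> = 0"
proof -
  show st: "stable_graph \<Delta>" and e: "edges \<Delta> = []" using assms by (auto simp: permuted_corollas_def)
  then have "nverts \<Delta> = 1" using stable_nverts[OF st] by simp
  then obtain v where v: "verts \<Delta> = [v]" by (auto simp: length_Suc_conv)
  moreover have "fst v = genus \<Delta>" "snd v = arity \<Delta>"
    using st e v by (auto simp: genus_def stable_graph_iff)
  ultimately show "verts \<Delta> = [(genus \<Delta>, arity \<Delta>)]" by (metis prod.collapse)
  show "tdeg tw \<Delta> = 0" using e by (simp add: tdeg_def)
qed

text \<open>Splits the sum over the vertices of a grafted graph according to the inserted graph to
  which a vertex belongs.\<close>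

lemma sum_concat:
  fixes F :: "nat \<Rightarrow> 'c::comm_monoid_add"
  shows "(\<Sum>v < length (concat ls). F v) =
    (\<Sum>i < length ls. \<Sum>a < length (ls ! i). F (length (concat (take i ls)) + a))"
proof (induction ls arbitrary: F)
  case (Cons l ls)
  have "(\<Sum>v < length l + m. F v) = (\<Sum>a < length l. F a) + (\<Sum>v < m. F (length l + v))" for m
    by (induction m) (simp_all add: add.assoc)
  then show ?case
    unfolding length_Cons sum.lessThan_Suc_shift by (simp add: Cons add.assoc comp_def)
qed simp

lemma nth_append_mid: "length xs = m \<Longrightarrow> a < length ys \<Longrightarrow> (xs @ ys @ zs) ! (m + a) = ys ! a"
  by (auto simp: nth_append)

text \<open>\<open>\<delta>\<close> raises the degree by 1 and keeps genus and arity, so its values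
  can be inserted into the vertex on which it acts.\<close>

locale derivation_data =
  fixes tw :: bool and Is Js :: "nat set" and C :: "graph set" and X :: "('k::field_char_0, 'b::ab_group_add) opd"
    and \<delta> :: "nat \<Rightarrow> nat \<Rightarrow> int \<Rightarrow> 'b \<Rightarrow> ('b gen \<Rightarrow>\<^sub>0 'k)"
  assumes Is: "Is \<subseteq> Js" and X: "linear_cells Is X"
    and keys_\<delta>: "\<And>g n p x k. g \<in> Is \<Longrightarrow> stable g n \<Longrightarrow> x \<in> cell X g n p \<Longrightarrow> k \<in> Poly_Mapping.keys (\<delta> g n p x) \<Longrightarrow>
      k \<in> gens Is Js X \<and> vtype k = (g, n) \<and> gdeg tw k = p + 1"
begin

abbreviation Rel where "Rel \<equiv> formal.span (relators tw Is Js C X)"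

definition D_at :: "'b gen \<Rightarrow> nat \<Rightarrow> ('b gen \<Rightarrow>\<^sub>0 'k)" where
  "D_at h i = lin_ext (graft_at tw h i) (\<delta> (fst (verts (fst h) ! i)) (snd (verts (fst h) ! i)) (fst (snd h) ! i) (snd (snd h) ! i))"

lemma derivation_eq:
  "derivation tw \<delta> h = (\<Sum>i < nverts (fst h). fscale (sg (tdeg tw (fst h) + sum_list (take i (fst (snd h))))) (D_at h i))"
  by (simp add: derivation_def D_at_def case_prod_beta)

lemma keys_vertex:
  assumes "h \<in> gens Is Js X" "i < nverts (fst h)"
    "k \<in> Poly_Mapping.keys (\<delta> (fst (verts (fst h) ! i)) (snd (verts (fst h) ! i)) (fst (snd h) ! i) (snd (snd h) ! i))"
  shows "k \<in> gens Is Js X" "vtype k = verts (fst h) ! i" "gdeg tw k = fst (snd h) ! i + 1"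
    "stable_graph (fst k)" "wf_graph (fst k)" "snd (verts (fst h) ! i) = arity (fst k)"
    "length (fst (snd k)) = nverts (fst k)" "length (snd (snd k)) = nverts (fst k)"
    "sum_list (fst (snd k)) = fst (snd h) ! i + 1 - tdeg tw (fst k)"
proof -
  have v: "fst (verts (fst h) ! i) \<in> Is \<and> stable (fst (verts (fst h) ! i)) (snd (verts (fst h) ! i)) \<and>
    snd (snd h) ! i \<in> cell X (fst (verts (fst h) ! i)) (snd (verts (fst h) ! i)) (fst (snd h) ! i)"
    using gens_vertex[of "fst h" "fst (snd h)" "snd (snd h)"] assms(1,2) by simp
  note * = keys_\<delta>[OF _ _ _ assms(3)]
  show g: "k \<in> gens Is Js X" and t: "vtype k = verts (fst h) ! i" and d: "gdeg tw k = fst (snd h) ! i + 1" using * v by auto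
  show "stable_graph (fst k)" using gens_stable[OF g] .
  then show "wf_graph (fst k)" by (rule stable_imp_wf)
  show "snd (verts (fst h) ! i) = arity (fst k)" using t by (metis snd_conv)
  show "length (fst (snd k)) = nverts (fst k)" "length (snd (snd k)) = nverts (fst k)" using gens_lengths[OF g] by auto
  show "sum_list (fst (snd k)) = fst (snd h) ! i + 1 - tdeg tw (fst k)" using d by (simp add: gdeg_eq)
qed

lemma graft_at_gens:
  assumes "h \<in> gens Is Js X" "i < nverts (fst h)" "k \<in> gens Is Js X" "vtype k = verts (fst h) ! i"
  shows "(graph_insert (fst h) i (fst k), list_insert i (fst (snd k)) (fst (snd h)), list_insert i (snd (snd k)) (snd (snd h))) \<in> gens Is Js X"
  using assms(1,2) assms(3)[unfolded gens_iff] assms(4)[symmetric] by (intro gens_insert) auto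

lemma lin_ext_graft_at_Rel:
  assumes "h \<in> gens Is Js X" "i < nverts (fst h)" "w \<in> Rel" "\<And>k. k \<in> Poly_Mapping.keys w \<Longrightarrow> vtype k = verts (fst h) ! i"
  shows "lin_ext (graft_at tw h i) w \<in> Rel"
proof -
  have "lin_ext (graft_at tw h i) w = lin_ext (\<lambda>k. if vtype k = verts (fst h) ! i then graft_at tw h i k else 0) w"
    using assms(4) by (intro lin_ext_cong) auto
  then show ?thesis using graft_at_relators[OF assms(1) Is assms(2) X assms(3)] by simp
qed

text \<open>Leibniz rule. Every vertex of the grafted graph belongs to exactly one inserted graph,
  and acting there before or after grafting differs by moving the new edges past those of the
  earlier slots.\<close>

lemma derivation_graft:
  assumes \<Gamma>: "stable_graph \<Gamma>" "genus \<Gamma> \<in> Js" "verts \<Gamma> = map vtype hs" "set hs \<subseteq> gens Is Js X"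
  shows "lin_ext (derivation tw \<delta>) (graft tw \<Gamma> hs) -
    (\<Sum>i < length hs. fscale (sg (tdeg tw \<Gamma> + gsum tw (take i hs)))
       (lin_ext (\<lambda>h'. graft tw \<Gamma> (hs[i := h'])) (derivation tw \<delta> (hs ! i)))) \<in> Rel"
proof -
  let ?h = "graft_gen \<Gamma> hs"
  note g = graft_gen_in_gens[OF \<Gamma>]
  have vh: "verts (fst ?h) = concat (map verts (graphs_of hs))"
    using gens_graph_insert_all(2)[OF \<Gamma>(1,3,4)] by (simp add: graft_gen_def)
  let ?off = "\<lambda>i. length (concat (take i (map verts (graphs_of hs))))"
  let ?F = "\<lambda>v. fscale (sg (gsign tw hs) * sg (tdeg tw (fst ?h) + sum_list (take v (fst (snd ?h))))) (D_at ?h v)"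
  let ?E = "\<lambda>i a. fscale (sg (tdeg tw \<Gamma> + gsum tw (take i hs)) * sg (tdeg tw (fst (hs ! i)) + sum_list (take a (fst (snd (hs ! i))))))
      (lin_ext (\<lambda>h'. graft tw \<Gamma> (hs[i := h'])) (D_at (hs ! i) a))"
  have "lin_ext (derivation tw \<delta>) (graft tw \<Gamma> hs) = (\<Sum>v < nverts (fst ?h). ?F v)"
    by (simp add: graft_eq_gen lin_ext_single derivation_eq formal.scale_sum_right)
  also have "\<dots> = (\<Sum>i < length hs. \<Sum>a < nverts (fst (hs ! i)). ?F (?off i + a))"
    unfolding vh sum_concat by simp
  finally have 1: "lin_ext (derivation tw \<delta>) (graft tw \<Gamma> hs) = (\<Sum>i < length hs. \<Sum>a < nverts (fst (hs ! i)). ?F (?off i + a))" .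
  have 2: "(\<Sum>i < length hs. fscale (sg (tdeg tw \<Gamma> + gsum tw (take i hs)))
       (lin_ext (\<lambda>h'. graft tw \<Gamma> (hs[i := h'])) (derivation tw \<delta> (hs ! i)))) =
     (\<Sum>i < length hs. \<Sum>a < nverts (fst (hs ! i)). ?E i a)"
    by (simp add: derivation_eq lin_ext_sum lin_ext_scale formal.scale_sum_right)
  have "?F (?off i + a) - ?E i a \<in> Rel" if i: "i < length hs" and a: "a < nverts (fst (hs ! i))" for i a
  proof -
    obtain as h bs where hs: "hs = as @ h # bs" "length as = i" "h = hs ! i" using i by (rule split_nthE)
    have hg: "h \<in> gens Is Js X" and asg: "set as \<subseteq> gens Is Js X" and bsg: "set bs \<subseteq> gens Is Js X" using \<Gamma>(4) unfolding hs(1) by auto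
    have a': "a < nverts (fst h)" using a unfolding hs(3) .
    note hl = gens_lengths[OF hg]
    have off: "?off i = length (degrees_of as)" "length (labels_of as) = length (degrees_of as)"
      using gens_off[OF asg] hs(2) unfolding hs(1) by (simp_all add: length_concat comp_def)
    have at: "verts (fst ?h) ! (?off i + a) = verts (fst h) ! a"
      "fst (snd ?h) ! (?off i + a) = fst (snd h) ! a" "snd (snd ?h) ! (?off i + a) = snd (snd h) ! a"
    proof -
      have "length (concat (map verts (graphs_of as))) = length (degrees_of as)"
        using gens_off[OF asg] by (simp add: length_concat comp_def)
      from nth_append_mid[OF this, of a "verts (fst h)"] nth_append_mid[OF HOL.refl, of a "fst (snd h)" "degrees_of as"]
        nth_append_mid[OF off(2), of a "snd (snd h)"]
      show "verts (fst ?h) ! (?off i + a) = verts (fst h) ! a"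
        "fst (snd ?h) ! (?off i + a) = fst (snd h) ! a" "snd (snd ?h) ! (?off i + a) = snd (snd h) ! a"
        using a' hl unfolding vh off(1) by (simp_all only: graft_gen_def hs(1) fst_conv snd_conv map_append list.map concat_append concat.simps)
    qed
    have take: "sum_list (take (?off i + a) (fst (snd ?h))) = gsum tw as - tsum tw as + sum_list (take a (fst (snd h)))"
      using a' hl unfolding off by (simp add: graft_gen_def hs(1) sum_list_degrees_of[of as tw])
    have td: "tdeg tw (fst ?h) = tdeg tw \<Gamma> + tsum tw as + tdeg tw (fst h) + tsum tw bs"
      using tdeg_graph_insert_all[of hs \<Gamma> tw] \<Gamma>(3) by (simp add: graft_gen_def hs(1))
    let ?K = "\<delta> (fst (verts (fst h) ! a)) (snd (verts (fst h) ! a)) (fst (snd h) ! a) (snd (snd h) ! a)"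
    have up: "hs[i := h'] = as @ h' # bs" for h' using hs(2) unfolding hs(1) by auto
    have F: "?F (?off i + a) = fscale (sg (gsign tw hs) * sg (tdeg tw (fst ?h) + sum_list (take (?off i + a) (fst (snd ?h)))))
        (lin_ext (graft_at tw ?h (?off i + a)) ?K)"
      by (simp only: D_at_def at)
    have E: "?E i a = fscale (sg (tdeg tw \<Gamma> + gsum tw as) * sg (tdeg tw (fst h) + sum_list (take a (fst (snd h)))))
        (lin_ext (\<lambda>k. lin_ext (\<lambda>h'. graft tw \<Gamma> (as @ h' # bs)) (graft_at tw h a k)) ?K)"
      using hs(2) unfolding hs(3)[symmetric] up by (simp add: D_at_def lin_ext_lin_ext hs(1))
    show ?thesis
      unfolding F E
    proof (rule lin_ext_combination_in[OF formal.subspace_span])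
      fix k assume k: "k \<in> Poly_Mapping.keys ?K"
      note kk = keys_vertex[OF hg a' k]
      let ?h' = "(graph_insert (fst h) a (fst k), list_insert a (fst (snd k)) (fst (snd h)), list_insert a (snd (snd k)) (snd (snd h)))"
      let ?H = "(graph_insert (fst ?h) (?off i + a) (fst k), list_insert (?off i + a) (fst (snd k)) (fst (snd ?h)), list_insert (?off i + a) (snd (snd k)) (snd (snd ?h)))"
      let ?e = "sg (tsum tw as * tdeg tw (fst k)) :: 'k"
      have h'g: "?h' \<in> gens Is Js X" by (rule graft_at_gens[OF hg a' kk(1,2)])
      have vt: "vtype ?h' = vtype h"
        using genus_graph_insert[OF gens_stable[OF hg] kk(4) a'] kk(2) by (simp add: prod_eq_iff)
      have v': "verts \<Gamma> = map vtype (as @ ?h' # bs)" using \<Gamma>(3) vt by (simp add: hs(1))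
      have nn: "?off i + a < nverts (fst ?h)" using a' unfolding vh off using gens_off[OF asg]
        by (simp add: hs(1) length_concat comp_def)
      have Hg: "?H \<in> gens Is Js X" by (rule graft_at_gens[OF g(1) nn kk(1)]) (simp only: at kk(2))
      have gg: "graft_gen \<Gamma> (as @ ?h' # bs) \<in> gens Is Js X"
        using asg bsg h'g by (intro graft_gen_in_gens(1)[OF \<Gamma>(1,2) v']) auto
      have R: "sing (graft_gen \<Gamma> (as @ ?h' # bs)) - Poly_Mapping.single ?H ?e \<in> Rel"
      proof (rule span_symrel_imp_relators)
        show "sing (graft_gen \<Gamma> (as @ ?h' # bs)) - Poly_Mapping.single ?H ?e \<in> formal.span (symrel tw)"
          using symrel_insert_graft[OF \<Gamma>(1) \<Gamma>(3)[unfolded hs(1)] \<Gamma>(4)[unfolded hs(1)] a'] unfolding off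
          by (simp only: graft_gen_def fst_conv snd_conv hs(1))
        show "Poly_Mapping.keys (sing (graft_gen \<Gamma> (as @ ?h' # bs)) - Poly_Mapping.single ?H ?e) \<subseteq> gens Is Js X"
          by (rule order_trans[OF keys_single_diff]) (use Hg gg in auto)
      qed
      \<comment> \<open>Raising the degree of the slot by 1 adds \<open>tsum tw bs\<close> to
        \<open>gsign\<close>, which matches the share of \<open>bs\<close> in the twist of the whole
        graph.\<close>
      have s: "sg (gsign tw hs) * sg (tdeg tw (fst ?h) + sum_list (take (?off i + a) (fst (snd ?h)))) *
            sg (tdeg tw (fst k) * sum_list (take (?off i + a) (fst (snd ?h)))) =
          sg (tdeg tw \<Gamma> + gsum tw as) * sg (tdeg tw (fst h) + sum_list (take a (fst (snd h)))) *
            (sg (tdeg tw (fst k) * sum_list (take a (fst (snd h)))) * (sg (gsign tw (as @ ?h' # bs)) * ?e))"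
      proof -
        have gd: "gdeg tw ?h' = gdeg tw h + 1"
          using a' hl kk(9) by (simp add: gdeg_eq sum_list_list_insert)
        show ?thesis
          unfolding sg_add[symmetric] take td unfolding hs(1)
          by (rule sg_cong) (simp add: gsign_append gd algebra_simps)
      qed
      have A: "fscale (sg (gsign tw hs) * sg (tdeg tw (fst ?h) + sum_list (take (?off i + a) (fst (snd ?h))))) (graft_at tw ?h (?off i + a) k)
          - fscale (sg (tdeg tw \<Gamma> + gsum tw as) * sg (tdeg tw (fst h) + sum_list (take a (fst (snd h)))))
            (lin_ext (\<lambda>h'. graft tw \<Gamma> (as @ h' # bs)) (graft_at tw h a k)) =
          fscale (- (sg (tdeg tw \<Gamma> + gsum tw as) * sg (tdeg tw (fst h) + sum_list (take a (fst (snd h)))) *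
             (sg (tdeg tw (fst k) * sum_list (take a (fst (snd h)))) * sg (gsign tw (as @ ?h' # bs)))))
          (sing (graft_gen \<Gamma> (as @ ?h' # bs)) - Poly_Mapping.single ?H ?e)"
        unfolding graft_at_eq[of tw h] graft_at_eq[of tw ?h] lin_ext_single graft_eq_gen formal.scale_right_diff_distrib fscale_single s
        by (simp add: mult.assoc single_uminus)
      show "fscale (sg (gsign tw hs) * sg (tdeg tw (fst ?h) + sum_list (take (?off i + a) (fst (snd ?h))))) (graft_at tw ?h (?off i + a) k)
          - fscale (sg (tdeg tw \<Gamma> + gsum tw as) * sg (tdeg tw (fst h) + sum_list (take a (fst (snd h)))))
            (lin_ext (\<lambda>h'. graft tw \<Gamma> (as @ h' # bs)) (graft_at tw h a k)) \<in> Rel"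
        unfolding A by (rule formal.span_scale[OF R])
    qed
  qed
  then have "(\<Sum>i < length hs. \<Sum>a < nverts (fst (hs ! i)). ?F (?off i + a) - ?E i a) \<in> Rel"
    by (intro formal.span_sum) auto
  then show ?thesis unfolding 1 2 by (simp add: sum_subtractf)
qed

end

section \<open>Transpositions of vertices against a single insertion\<close>

lemma list_insert_single [simp]: "list_insert 0 us [z] = us"
  by (simp add: list_insert_def)

lemma graph_insert_swap_verts_before:
  assumes "wf_graph \<Gamma>" "wf_graph A" "i < b" "Suc b < nverts \<Gamma>" "snd (verts \<Gamma> ! i) = arity A"
  shows "graph_insert (swap_verts b \<Gamma>) i A = swap_verts (b + nverts A - 1) (graph_insert \<Gamma> i A)"
proof -
  have "Suc (b + nverts A - 1) < nverts (graph_insert \<Gamma> i A)"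
    using assms(3,4) by (simp add: length_list_insert)
  then show ?thesis
    using graph_insert_block_swap_before[OF assms(1,2,3), of "Suc 0" "Suc 0"] assms(4,5)
    by (simp add: swap_verts_eq_block)
qed

lemma graph_insert_swap_verts_after:
  assumes "Suc b < i" "i < nverts \<Gamma>"
  shows "graph_insert (swap_verts b \<Gamma>) i A = swap_verts b (graph_insert \<Gamma> i A)"
proof -
  have "Suc b < nverts (graph_insert \<Gamma> i A)" using assms by (simp add: length_list_insert)
  then show ?thesis
    using graph_insert_block_swap_after[of b "Suc 0" "Suc 0" i \<Gamma> A] assms by (simp add: swap_verts_eq_block)
qed

text \<open>A special case of exchanging two insertions: the other vertex receives a corolla, which
  has no edges, so the \<open>reorder\<close> has length 0 and is an equality.\<close>

lemma graph_insert_swap_verts_left: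
  assumes "wf_graph \<Gamma>" "wf_graph A" "Suc b < nverts \<Gamma>" "snd (verts \<Gamma> ! b) = arity A" "wf_graph (swap_verts b \<Gamma>)"
  shows "graph_insert (swap_verts b \<Gamma>) (Suc b) A = block_swap b (nverts A) (Suc 0) (graph_insert \<Gamma> b A)"
proof -
  let ?c = "corolla (fst (verts \<Gamma> ! Suc b)) (snd (verts \<Gamma> ! Suc b))"
  have wc: "wf_graph ?c" by (auto simp: wf_graph_def in_flags set_flag_list)
  have vS: "verts (swap_verts b \<Gamma>) ! Suc b = verts \<Gamma> ! b" "verts (swap_verts b \<Gamma>) ! b = verts \<Gamma> ! Suc b"
    using assms(3) by (simp_all add: swap_verts_simps nth_swap_at)
  have n: "Suc b < nverts (swap_verts b \<Gamma>)" using assms(3) by (simp add: swap_verts_simps)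
  have "reorder (block_swap b (nverts A) (nverts ?c) (graph_insert (graph_insert \<Gamma> (Suc b) ?c) b A))
      (nedges ?c * nedges A) (graph_insert (graph_insert (swap_verts b \<Gamma>) (Suc b) A) b ?c)"
    using assms wc by (intro graph_insert_swapped_pair) auto
  moreover have "graph_insert \<Gamma> (Suc b) ?c = \<Gamma>" using assms by (intro graph_insert_corolla) auto
  moreover have "graph_insert (graph_insert (swap_verts b \<Gamma>) (Suc b) A) b ?c = graph_insert (swap_verts b \<Gamma>) (Suc b) A"
    using wf_graph_insert[OF assms(5,2) n] assms(4) vS n
    by (intro graph_insert_corolla) (auto simp: length_list_insert nth_list_insert)
  ultimately show ?thesis using reorder_0 by fastforce
qed

lemma graph_insert_swap_verts_right:
  assumes "wf_graph \<Gamma>" "wf_graph A" "Suc b < nverts \<Gamma>" "snd (verts \<Gamma> ! Suc b) = arity A" "wf_graph (swap_verts b \<Gamma>)"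
  shows "graph_insert (swap_verts b \<Gamma>) b A = block_swap b (Suc 0) (nverts A) (graph_insert \<Gamma> (Suc b) A)"
proof -
  let ?c = "corolla (fst (verts \<Gamma> ! b)) (snd (verts \<Gamma> ! b))"
  have wc: "wf_graph ?c" by (auto simp: wf_graph_def in_flags set_flag_list)
  have vS: "verts (swap_verts b \<Gamma>) ! Suc b = verts \<Gamma> ! b"
    using assms(3) by (simp add: swap_verts_simps nth_swap_at)
  have n: "Suc b < nverts (swap_verts b \<Gamma>)" using assms(3) by (simp add: swap_verts_simps)
  have "reorder (block_swap b (nverts ?c) (nverts A) (graph_insert (graph_insert \<Gamma> (Suc b) A) b ?c))
      (nedges A * nedges ?c) (graph_insert (graph_insert (swap_verts b \<Gamma>) (Suc b) ?c) b A)"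
    using assms wc by (intro graph_insert_swapped_pair) auto
  moreover have "graph_insert (swap_verts b \<Gamma>) (Suc b) ?c = swap_verts b \<Gamma>"
    using assms vS n by (intro graph_insert_corolla) auto
  moreover have "graph_insert (graph_insert \<Gamma> (Suc b) A) b ?c = graph_insert \<Gamma> (Suc b) A"
    using wf_graph_insert[OF assms(1,2,3,4)] assms(3)
    by (intro graph_insert_corolla) (auto simp: length_list_insert nth_list_insert)
  ultimately show ?thesis using reorder_0 by fastforce
qed

lemma take_swap_at:
  fixes ps :: "int list"
  assumes "Suc b < length ps"
  shows "i \<le> b \<Longrightarrow> take i (swap_at b ps) = take i ps"
    "Suc b < i \<Longrightarrow> sum_list (take i (swap_at b ps)) = sum_list (take i ps)"
    "sum_list (take (Suc b) (swap_at b ps)) = sum_list (take b ps) + ps ! Suc b"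
proof -
  obtain A x y D where xy: "ps = A @ x # y # D" "length A = b"
    by (rule that[of "take b ps" "ps ! b" "ps ! Suc b" "drop (Suc (Suc b)) ps"])
      (use assms in \<open>simp_all add: Cons_nth_drop_Suc\<close>)
  have s: "swap_at b ps = A @ y # x # D" using swap_at_append[of A x y D] xy by simp
  show "i \<le> b \<Longrightarrow> take i (swap_at b ps) = take i ps" using xy(2) unfolding s unfolding xy(1) by simp
  show "Suc b < i \<Longrightarrow> sum_list (take i (swap_at b ps)) = sum_list (take i ps)"
    using xy(2) unfolding s unfolding xy(1) by (auto simp: take_Cons split: nat.splits)
  show "sum_list (take (Suc b) (swap_at b ps)) = sum_list (take b ps) + ps ! Suc b"
    using xy(2) unfolding s unfolding xy(1) by (simp add: nth_append)
qed

text \<open>Linearity can only be asked modulo relations since the tensors in the differential are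
  chosen; equivariance likewise, since moving a permutation from the label to the graph is itself a
  relation. The graphs in \<open>C\<close> are corollas, as for a free object.\<close>

locale derivation_respects = derivation_data +
  assumes C: "C \<subseteq> permuted_corollas"
    and \<delta>_linear: "\<And>g n p c x y. g \<in> Is \<Longrightarrow> stable g n \<Longrightarrow> x \<in> cell X g n p \<Longrightarrow> y \<in> cell X g n p \<Longrightarrow>
      \<delta> g n p (scl X c x + y) - fscale c (\<delta> g n p x) - \<delta> g n p y \<in> formal.span (relators tw Is Js C X)"
    and \<delta>_equivariant: "\<And>\<Delta> p y. \<Delta> \<in> C \<Longrightarrow> \<Delta> \<in> graphs Is \<Longrightarrow> y \<in> cell X (genus \<Delta>) (arity \<Delta>) p \<Longrightarrow>
      \<delta> (genus \<Delta>) (arity \<Delta>) p (cmp X \<Delta> [p] [y]) -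
        lin_ext (graft_at tw (\<Delta>, [p], [y]) 0) (\<delta> (genus \<Delta>) (arity \<Delta>) p y) \<in> formal.span (relators tw Is Js C X)"
begin

text \<open>Acting at a vertex other than \<open>a\<close> leaves a multilinear relation at the
  shifted position of \<open>a\<close>; acting at \<open>a\<close> itself uses linearity of
  \<open>\<delta>\<close>.\<close>

lemma derivation_multilinear:
  assumes "(\<Gamma>, ps, xs[a := x]) \<in> gens Is Js X" "(\<Gamma>, ps, xs[a := y]) \<in> gens Is Js X" "a < nverts \<Gamma>"
  shows "derivation tw \<delta> (\<Gamma>, ps, xs[a := scl X c x + y]) - fscale c (derivation tw \<delta> (\<Gamma>, ps, xs[a := x]))
     - derivation tw \<delta> (\<Gamma>, ps, xs[a := y]) \<in> Rel"
proof -
  let ?h = "\<lambda>z. (\<Gamma>, ps, xs[a := z])" and ?z = "scl X c x + y"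
  have len: "length xs = nverts \<Gamma>" "length ps = nverts \<Gamma>" using gens_lengths[OF assms(1)] by simp_all
  note g = assms(1,2) gens_linear[OF X assms]
  have "D_at (?h ?z) i - fscale c (D_at (?h x) i) - D_at (?h y) i \<in> Rel" if i: "i < nverts \<Gamma>" for i
  proof (cases "i = a")
    case False
    let ?K = "\<delta> (fst (verts \<Gamma> ! i)) (snd (verts \<Gamma> ! i)) (ps ! i) (xs ! i)"
    have D: "D_at (?h z) i = lin_ext (graft_at tw (?h z) i) ?K" for z using False by (simp add: D_at_def)
    show ?thesis
      unfolding D
    proof (rule lin_ext_combination3_in[OF formal.subspace_span])
      fix k assume "k \<in> Poly_Mapping.keys ?K"
      then have kk: "k \<in> gens Is Js X" "vtype k = verts \<Gamma> ! i" "length (snd (snd k)) = nverts (fst k)"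
        using keys_vertex[OF g(1), of i k] i False by auto
      let ?a = "if a < i then a else a + length (snd (snd k)) - 1"
      have gr: "graft_at tw (?h z) i k = fscale (sg (tdeg tw (fst k) * sum_list (take i ps)))
          (sing (graph_insert \<Gamma> i (fst k), list_insert i (fst (snd k)) ps, (list_insert i (snd (snd k)) xs)[?a := z]))" for z
        using list_insert_update_other[of i xs a "snd (snd k)" z] i assms(3) len False
        by (simp add: graft_at_eq fscale_single)
      have a: "?a < nverts (graph_insert \<Gamma> i (fst k))" using i assms(3) False kk(3) by (auto simp: length_list_insert)
      have "(graph_insert \<Gamma> i (fst k), list_insert i (fst (snd k)) ps, (list_insert i (snd (snd k)) xs)[?a := z]) \<in> gens Is Js X"
        if "?h z \<in> gens Is Js X" for z
        using graft_at_gens[OF that, of i k] kk i list_insert_update_other[of i xs a "snd (snd k)" z] assms(3) len False by simp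
      then have R: "sing (graph_insert \<Gamma> i (fst k), list_insert i (fst (snd k)) ps, (list_insert i (snd (snd k)) xs)[?a := scl X c x + y])
        - Poly_Mapping.single (graph_insert \<Gamma> i (fst k), list_insert i (fst (snd k)) ps, (list_insert i (snd (snd k)) xs)[?a := x]) c
        - sing (graph_insert \<Gamma> i (fst k), list_insert i (fst (snd k)) ps, (list_insert i (snd (snd k)) xs)[?a := y]) \<in> Rel"
        using g a by (intro formal.span_base relators.multilinear) blast+
      show "graft_at tw (?h ?z) i k - fscale c (graft_at tw (?h x) i k) - graft_at tw (?h y) i k \<in> Rel"
        unfolding gr
        by (rule span_fscale_eq[OF R, of _ "sg (tdeg tw (fst k) * sum_list (take i ps))"])
          (simp add: formal.scale_right_diff_distrib fscale_single mult.commute)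
    qed
  next
    case True
    let ?\<delta> = "\<delta> (fst (verts \<Gamma> ! a)) (snd (verts \<Gamma> ! a)) (ps ! a)"
    have D: "D_at (?h z) a = lin_ext (graft_at tw (?h x) a) (?\<delta> z)" for z
    proof -
      have "graft_at tw (?h z) a = (graft_at tw (?h x) a :: _ \<Rightarrow> (_ \<Rightarrow>\<^sub>0 'a))"
        using list_insert_update_same[of a xs] len assms(3) by (auto simp: graft_at_eq fun_eq_iff)
      then show ?thesis using len assms(3) by (simp add: D_at_def)
    qed
    have v: "fst (verts \<Gamma> ! a) \<in> Is" "stable (fst (verts \<Gamma> ! a)) (snd (verts \<Gamma> ! a))"
      "x \<in> cell X (fst (verts \<Gamma> ! a)) (snd (verts \<Gamma> ! a)) (ps ! a)" "y \<in> cell X (fst (verts \<Gamma> ! a)) (snd (verts \<Gamma> ! a)) (ps ! a)"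
      using gens_vertex[OF assms(1,3)] gens_vertex[OF assms(2,3)] len assms(3) by auto
    have zc: "scl X c x + y \<in> cell X (fst (verts \<Gamma> ! a)) (snd (verts \<Gamma> ! a)) (ps ! a)"
      using gens_vertex[OF g(3) assms(3)] len assms(3) by auto
    have "lin_ext (graft_at tw (?h x) a) (?\<delta> ?z - fscale c (?\<delta> x) - ?\<delta> y) \<in> Rel"
    proof (rule lin_ext_graft_at_Rel[OF g(1)])
      fix k assume "k \<in> Poly_Mapping.keys (?\<delta> ?z - fscale c (?\<delta> x) - ?\<delta> y)"
      then have "k \<in> Poly_Mapping.keys (?\<delta> ?z) \<union> Poly_Mapping.keys (?\<delta> x) \<union> Poly_Mapping.keys (?\<delta> y)"
        by (auto simp: in_keys_iff lookup_minus lookup_fscale)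
      then show "vtype k = verts (fst (?h x)) ! a"
        using keys_\<delta>[OF v(1,2,3), of k] keys_\<delta>[OF v(1,2,4), of k] keys_\<delta>[OF v(1,2) zc, of k] by auto
    qed (use assms(3) \<delta>_linear[OF v] in auto)
    then show ?thesis unfolding True D by (simp add: lin_ext_diff lin_ext_scale)
  qed
  then have "(\<Sum>i < nverts \<Gamma>. fscale (sg (tdeg tw \<Gamma> + sum_list (take i ps))) (D_at (?h ?z) i - fscale c (D_at (?h x) i) - D_at (?h y) i)) \<in> Rel"
    by (intro formal.span_sum formal.span_scale) auto
  then show ?thesis
    by (simp add: derivation_eq sum_subtractf formal.scale_right_diff_distrib formal.scale_sum_right mult.commute)
qed

lemma derivation_edges:
  assumes "(\<Gamma>, ps, xs) \<in> gens Is Js X" "Suc b < nedges \<Gamma>"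
  shows "derivation tw \<delta> (swap_edges b \<Gamma>, ps, xs) - fscale (if tw then - 1 else 1) (derivation tw \<delta> (\<Gamma>, ps, xs)) \<in> Rel"
proof -
  let ?h = "(\<Gamma>, ps, xs)" and ?h' = "(swap_edges b \<Gamma>, ps, xs)"
  let ?e = "if tw then - 1 else (1 :: 'a)"
  have "fscale 1 (D_at ?h' i) - fscale ?e (D_at ?h i) \<in> Rel" if i: "i < nverts \<Gamma>" for i
    unfolding D_at_def fst_conv snd_conv swap_edges_simps
  proof (rule lin_ext_combination_in[OF formal.subspace_span])
    fix k assume "k \<in> Poly_Mapping.keys (\<delta> (fst (verts \<Gamma> ! i)) (snd (verts \<Gamma> ! i)) (ps ! i) (xs ! i))"
    then have kk: "k \<in> gens Is Js X" "vtype k = verts \<Gamma> ! i" using keys_vertex[OF assms(1), of i k] i by auto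
    have g: "(graph_insert \<Gamma> i (fst k), list_insert i (fst (snd k)) ps, list_insert i (snd (snd k)) xs) \<in> gens Is Js X"
      using graft_at_gens[OF assms(1), of i k] i kk by simp
    have "sing (swap_edges b (graph_insert \<Gamma> i (fst k)), list_insert i (fst (snd k)) ps, list_insert i (snd (snd k)) xs)
      - Poly_Mapping.single (graph_insert \<Gamma> i (fst k), list_insert i (fst (snd k)) ps, list_insert i (snd (snd k)) xs) ?e \<in> Rel"
      using assms(2) by (intro formal.span_base relators.edges[OF g]) simp
    note R = this
    show "fscale 1 (graft_at tw ?h' i k) - fscale ?e (graft_at tw ?h i k) \<in> Rel"
      by (rule span_fscale_eq[OF R, of _ "sg (tdeg tw (fst k) * sum_list (take i ps))"])
        (simp add: graft_at_eq formal.scale_right_diff_distrib fscale_single mult.commute graph_insert_swap_edges[OF assms(2)])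
  qed
  then have "(\<Sum>i < nverts \<Gamma>. fscale (sg (tdeg tw \<Gamma> + sum_list (take i ps))) (fscale 1 (D_at ?h' i) - fscale ?e (D_at ?h i))) \<in> Rel"
    by (intro formal.span_sum formal.span_scale) auto
  moreover have td: "tdeg tw (swap_edges b \<Gamma>) = tdeg tw \<Gamma>" by (simp add: tdeg_def)
  ultimately show ?thesis
    by (simp only: derivation_eq fst_conv snd_conv swap_edges_simps td sum_subtractf formal.scale_right_diff_distrib
        formal.scale_sum_right formal.scale_scale formal.scale_one mult.commute)
qed

lemma derivation_flip:
  assumes "(\<Gamma>, ps, xs) \<in> gens Is Js X" "b < nedges \<Gamma>"
  shows "derivation tw \<delta> (flip_edge b \<Gamma>, ps, xs) - derivation tw \<delta> (\<Gamma>, ps, xs) \<in> Rel"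
proof -
  let ?h = "(\<Gamma>, ps, xs)" and ?h' = "(flip_edge b \<Gamma>, ps, xs)"
  have "fscale 1 (D_at ?h' i) - fscale 1 (D_at ?h i) \<in> Rel" if i: "i < nverts \<Gamma>" for i
    unfolding D_at_def fst_conv snd_conv flip_edge_simps
  proof (rule lin_ext_combination_in[OF formal.subspace_span])
    fix k assume "k \<in> Poly_Mapping.keys (\<delta> (fst (verts \<Gamma> ! i)) (snd (verts \<Gamma> ! i)) (ps ! i) (xs ! i))"
    then have kk: "k \<in> gens Is Js X" "vtype k = verts \<Gamma> ! i" using keys_vertex[OF assms(1), of i k] i by auto
    have g: "(graph_insert \<Gamma> i (fst k), list_insert i (fst (snd k)) ps, list_insert i (snd (snd k)) xs) \<in> gens Is Js X"
      using graft_at_gens[OF assms(1), of i k] i kk by simp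
    have "sing (flip_edge b (graph_insert \<Gamma> i (fst k)), list_insert i (fst (snd k)) ps, list_insert i (snd (snd k)) xs)
      - sing (graph_insert \<Gamma> i (fst k), list_insert i (fst (snd k)) ps, list_insert i (snd (snd k)) xs) \<in> Rel"
      using assms(2) by (intro formal.span_base relators.flip[OF g]) simp
    note R = this
    show "fscale 1 (graft_at tw ?h' i k) - fscale 1 (graft_at tw ?h i k) \<in> Rel"
      by (rule span_fscale_eq[OF R, of _ "sg (tdeg tw (fst k) * sum_list (take i ps))"])
        (simp add: graft_at_eq formal.scale_right_diff_distrib fscale_single graph_insert_flip_edge[OF assms(2)])
  qed
  then have "(\<Sum>i < nverts \<Gamma>. fscale (sg (tdeg tw \<Gamma> + sum_list (take i ps))) (fscale 1 (D_at ?h' i) - fscale 1 (D_at ?h i))) \<in> Rel"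
    by (intro formal.span_sum formal.span_scale) auto
  moreover have td: "tdeg tw (flip_edge b \<Gamma>) = tdeg tw \<Gamma>" by (simp add: tdeg_def)
  ultimately show ?thesis
    by (simp only: derivation_eq fst_conv snd_conv flip_edge_simps td sum_subtractf formal.scale_right_diff_distrib formal.scale_one)
qed

text \<open>A permuted corolla has one vertex and no edge, so vertices keep their numbers and
  insertions at other vertices commute strictly. At the vertex itself equivariance applies.\<close>

lemma derivation_contract:
  assumes h: "(\<Gamma>, ps, xs) \<in> gens Is Js X" "a < nverts \<Gamma>" and \<Delta>: "\<Delta> \<in> C \<inter> graphs Is" "verts \<Gamma> ! a = (genus \<Delta>, arity \<Delta>)"
    and y: "y \<in> cell X (genus \<Delta>) (arity \<Delta>) (ps ! a)" "xs ! a = cmp X \<Delta> [ps ! a] [y]"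
  shows "derivation tw \<delta> (\<Gamma>, ps, xs) - derivation tw \<delta> (graph_insert \<Gamma> a \<Delta>, ps, xs[a := y]) \<in> Rel"
proof -
  let ?h = "(\<Gamma>, ps, xs)" and ?h' = "(graph_insert \<Gamma> a \<Delta>, ps, xs[a := y])"
  have "\<Delta> \<in> permuted_corollas" using \<Delta>(1) C by blast
  note pc = permuted_corolla[OF this]
  have dec: "decorates X (verts \<Delta>) [ps ! a] [y]" using pc(3) y(1) by simp
  have vG: "verts (graph_insert \<Gamma> a \<Delta>) = verts \<Gamma>"
    using pc(3) h(2) \<Delta>(2) list_insert_singleton[of a "verts \<Gamma>" "(genus \<Delta>, arity \<Delta>)"] by (metis graph_insert_simps(1) list_update_id)
  have len: "length ps = nverts \<Gamma>" "length xs = nverts \<Gamma>" using gens_lengths[OF h(1)] by simp_all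
  have wf: "wf_graph \<Gamma>" "wf_graph \<Delta>" using stable_imp_wf gens_stable[OF h(1)] pc(1) by auto
  have h': "?h' \<in> gens Is Js X"
    using gens_insert[OF h pc(1) _ \<Delta>(2) dec] \<Delta>(1) list_insert_singleton[of a ps] list_insert_singleton[of a xs] h(2) len
    by (auto simp: graphs_def)
  have "fscale 1 (D_at ?h i) - fscale 1 (D_at ?h' i) \<in> Rel" if i: "i < nverts \<Gamma>" for i
  proof (cases "i = a")
    case False
    let ?K = "\<delta> (fst (verts \<Gamma> ! i)) (snd (verts \<Gamma> ! i)) (ps ! i) (xs ! i)"
    have D: "D_at ?h i = lin_ext (graft_at tw ?h i) ?K" "D_at ?h' i = lin_ext (graft_at tw ?h' i) ?K"
      using False vG by (simp_all add: D_at_def del: graph_insert_simps)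
    show ?thesis
      unfolding D
    proof (rule lin_ext_combination_in[OF formal.subspace_span])
      fix k assume "k \<in> Poly_Mapping.keys ?K"
      then have kk: "k \<in> gens Is Js X" "vtype k = verts \<Gamma> ! i" "wf_graph (fst k)" "snd (verts \<Gamma> ! i) = arity (fst k)"
        "length (fst (snd k)) = nverts (fst k)" "length (snd (snd k)) = nverts (fst k)"
        using keys_vertex[OF h(1), of i k] i by auto
      let ?a = "if a < i then a else a + nverts (fst k) - 1"
      have g: "(graph_insert \<Gamma> i (fst k), list_insert i (fst (snd k)) ps, list_insert i (snd (snd k)) xs) \<in> gens Is Js X"
        using graft_at_gens[OF h(1), of i k] i kk by simp
      have G: "graph_insert (graph_insert \<Gamma> i (fst k)) ?a \<Delta> = graph_insert (graph_insert \<Gamma> a \<Delta>) i (fst k)"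
      proof (cases "a < i")
        case True
        have "reorder (graph_insert (graph_insert \<Gamma> a \<Delta>) (i + nverts \<Delta> - 1) (fst k)) (nedges \<Delta> * nedges (fst k))
            (graph_insert (graph_insert \<Gamma> i (fst k)) a \<Delta>)"
          using wf i True \<Delta>(2) by (intro graph_insert_parallel) auto
        then show ?thesis using True pc(2,3) reorder_0 by fastforce
      next
        case False
        then have "i < a" using \<open>i \<noteq> a\<close> by simp
        then have "reorder (graph_insert (graph_insert \<Gamma> i (fst k)) (a + nverts (fst k) - 1) \<Delta>) (nedges (fst k) * nedges \<Delta>)
            (graph_insert (graph_insert \<Gamma> a \<Delta>) i (fst k))"
          using wf h(2) kk by (intro graph_insert_parallel) auto
        then show ?thesis using False pc(2) reorder_0 by fastforce
      qed
      have a: "?a < nverts (graph_insert \<Gamma> i (fst k))" using i h(2) False by (auto simp: length_list_insert)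
      have la: "length (list_insert i (fst (snd k)) ps) = nverts (graph_insert \<Gamma> i (fst k))"
        "length (list_insert i (snd (snd k)) xs) = nverts (graph_insert \<Gamma> i (fst k))"
        using i len kk by (simp_all add: length_list_insert)
      have at: "verts (graph_insert \<Gamma> i (fst k)) ! ?a = verts \<Gamma> ! a" "list_insert i (fst (snd k)) ps ! ?a = ps ! a"
        "list_insert i (snd (snd k)) xs ! ?a = xs ! a"
        using i h(2) False kk len by (auto simp: nth_list_insert)
      have ins: "list_insert ?a [ps ! a] (list_insert i (fst (snd k)) ps) = list_insert i (fst (snd k)) ps"
        "list_insert ?a [y] (list_insert i (snd (snd k)) xs) = list_insert i (snd (snd k)) (xs[a := y])"
        using list_insert_singleton[of ?a "list_insert i (fst (snd k)) ps" "ps ! a"]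
          list_insert_singleton[of ?a "list_insert i (snd (snd k)) xs" y] a la at
          list_insert_update_other[of i xs a "snd (snd k)" y] i h(2) False len kk
        by (auto simp: list_update_same_conv)
      have "sing (graph_insert \<Gamma> i (fst k), list_insert i (fst (snd k)) ps, list_insert i (snd (snd k)) xs) -
          Poly_Mapping.single (graph_insert (graph_insert \<Gamma> i (fst k)) ?a \<Delta>, list_insert ?a [ps ! a] (list_insert i (fst (snd k)) ps),
            list_insert ?a [y] (list_insert i (snd (snd k)) xs)) (sg (tdeg tw \<Delta> * sum_list (take ?a (list_insert i (fst (snd k)) ps)))) \<in> Rel"
        by (intro formal.span_base relators.contract[OF g a \<Delta>(1)])
          (use at \<Delta>(2) dec pc(4) y(2) in \<open>simp_all del: graph_insert_simps\<close>)
      then have R: "sing (graph_insert \<Gamma> i (fst k), list_insert i (fst (snd k)) ps, list_insert i (snd (snd k)) xs) -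
          sing (graph_insert (graph_insert \<Gamma> a \<Delta>) i (fst k), list_insert i (fst (snd k)) ps, list_insert i (snd (snd k)) (xs[a := y])) \<in> Rel"
        unfolding G ins pc(4) by simp
      show "fscale 1 (graft_at tw ?h i k) - fscale 1 (graft_at tw ?h' i k) \<in> Rel"
        by (rule span_fscale_eq[OF R, of _ "sg (tdeg tw (fst k) * sum_list (take i ps))"])
          (simp add: graft_at_eq formal.scale_right_diff_distrib fscale_single)
    qed
  next
    case True
    let ?\<delta> = "\<delta> (genus \<Delta>) (arity \<Delta>) (ps ! a)"
    have D: "D_at ?h a = lin_ext (graft_at tw ?h a) (?\<delta> (cmp X \<Delta> [ps ! a] [y]))"
      "D_at ?h' a = lin_ext (graft_at tw ?h' a) (?\<delta> y)"
      using vG \<Delta>(2) y(2) h(2) len by (simp_all add: D_at_def del: graph_insert_simps)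
    have st: "genus \<Delta> \<in> Is" "stable (genus \<Delta>) (arity \<Delta>)" using gens_vertex[OF h] \<Delta>(2) by auto
    have xa: "cmp X \<Delta> [ps ! a] [y] \<in> cell X (genus \<Delta>) (arity \<Delta>) (ps ! a)" using gens_vertex[OF h] \<Delta>(2) y(2) by simp
    \<comment> \<open>Strict associativity: grafting into the corolla and then at \<open>a\<close>
      is grafting at \<open>a\<close> into the graph that already contains the corolla.\<close>
    have gat: "graft_at tw ?h' a = (\<lambda>k. lin_ext (graft_at tw ?h a) (graft_at tw (\<Delta>, [ps ! a], [y]) 0 k) :: _ \<Rightarrow>\<^sub>0 'a)"
    proof (rule ext)
      fix k :: "'b gen"
      have "graph_insert (graph_insert \<Gamma> a \<Delta>) (a + 0) (fst k) = graph_insert \<Gamma> a (graph_insert \<Delta> 0 (fst k))"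
        using wf h(2) \<Delta>(2) pc(3) by (intro graph_insert_nested) auto
      then show "graft_at tw ?h' a k = (lin_ext (graft_at tw ?h a) (graft_at tw (\<Delta>, [ps ! a], [y]) 0 k) :: _ \<Rightarrow>\<^sub>0 'a)"
        using h(2) len pc(4) by (simp add: graft_at_eq lin_ext_single fscale_single list_insert_update_same)
    qed
    have "lin_ext (graft_at tw ?h a) (?\<delta> (cmp X \<Delta> [ps ! a] [y]) - lin_ext (graft_at tw (\<Delta>, [ps ! a], [y]) 0) (?\<delta> y)) \<in> Rel"
    proof (rule lin_ext_graft_at_Rel[OF h(1)])
      show "?\<delta> (cmp X \<Delta> [ps ! a] [y]) - lin_ext (graft_at tw (\<Delta>, [ps ! a], [y]) 0) (?\<delta> y) \<in> Rel"
        using \<Delta>(1) y(1) by (intro \<delta>_equivariant) auto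
      have 1: "Poly_Mapping.keys (lin_ext (graft_at tw (\<Delta>, [ps ! a], [y]) 0) (?\<delta> y)) \<subseteq> {k. vtype k = verts \<Gamma> ! a}"
      proof (rule keys_lin_ext)
        fix k assume "k \<in> Poly_Mapping.keys (?\<delta> y)"
        then have "k \<in> gens Is Js X" "vtype k = (genus \<Delta>, arity \<Delta>)" using keys_\<delta>[OF st y(1), of k] by auto
        then show "Poly_Mapping.keys (graft_at tw (\<Delta>, [ps ! a], [y]) 0 k :: _ \<Rightarrow>\<^sub>0 'a) \<subseteq> {k. vtype k = verts \<Gamma> ! a}"
          using genus_graph_insert[OF pc(1) gens_stable[of k Is Js X], of 0] pc(3) \<Delta>(2) by (auto simp: graft_at_eq)
      qed
      have 2: "vtype k = verts \<Gamma> ! a" if "k \<in> Poly_Mapping.keys (?\<delta> (cmp X \<Delta> [ps ! a] [y]))" for k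
        using keys_\<delta>[OF st xa that] \<Delta>(2) by simp
      show "vtype k = verts (fst ?h) ! a" if "k \<in> Poly_Mapping.keys (?\<delta> (cmp X \<Delta> [ps ! a] [y]) - lin_ext (graft_at tw (\<Delta>, [ps ! a], [y]) 0) (?\<delta> y))" for k
        using 1 2 that Poly_Mapping.keys_diff by (fastforce simp del: split_paired_All)
    qed (use h(2) in simp)
    then show ?thesis
      unfolding True D gat by (simp add: lin_ext_diff lin_ext_lin_ext)
  qed
  then have "(\<Sum>i < nverts \<Gamma>. fscale (sg (tdeg tw \<Gamma> + sum_list (take i ps))) (fscale 1 (D_at ?h i) - fscale 1 (D_at ?h' i))) \<in> Rel"
    by (intro formal.span_sum formal.span_scale) auto
  then show ?thesis
    using vG pc(4) by (simp add: derivation_eq sum_subtractf formal.scale_right_diff_distrib del: graph_insert_simps)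
qed

text \<open>Vertex \<open>i\<close> becomes \<open>\<sigma> i\<close>. If \<open>i\<close> is not
  moved, the transposition remains one, possibly at a shifted position; otherwise it becomes an
  exchange of one vertex with the whole inserted block.\<close>

lemma derivation_verts:
  assumes h: "(\<Gamma>, ps, xs) \<in> gens Is Js X" and b: "Suc b < nverts \<Gamma>"
  shows "derivation tw \<delta> (swap_verts b \<Gamma>, swap_at b ps, swap_at b xs) -
    fscale (sg (ps ! b * ps ! Suc b)) (derivation tw \<delta> (\<Gamma>, ps, xs)) \<in> Rel"
proof -
  let ?h = "(\<Gamma>, ps, xs)" and ?h' = "(swap_verts b \<Gamma>, swap_at b ps, swap_at b xs)"
  let ?e = "sg (ps ! b * ps ! Suc b) :: 'a"
  let ?c = "\<lambda>i. sg (tdeg tw \<Gamma> + sum_list (take i ps)) :: 'a"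
  let ?c' = "\<lambda>i. sg (tdeg tw \<Gamma> + sum_list (take i (swap_at b ps))) :: 'a"
  define \<sigma> where "\<sigma> i = (if i = b then Suc b else if i = Suc b then b else i)" for i
  have len: "length ps = nverts \<Gamma>" "length xs = nverts \<Gamma>" using gens_lengths[OF h] by simp_all
  have h': "?h' \<in> gens Is Js X" by (rule gens_swap_verts[OF h b])
  have wf: "wf_graph \<Gamma>" "wf_graph (swap_verts b \<Gamma>)"
    using stable_imp_wf gens_stable[OF h] gens_stable[OF h'] by auto
  have \<sigma>l: "\<sigma> i < nverts \<Gamma> \<longleftrightarrow> i < nverts \<Gamma>" for i using b by (auto simp: \<sigma>_def)
  have \<sigma>: "verts (swap_verts b \<Gamma>) ! \<sigma> i = verts \<Gamma> ! i" "swap_at b ps ! \<sigma> i = ps ! i" "swap_at b xs ! \<sigma> i = xs ! i"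
    if "i < nverts \<Gamma>" for i
    using that b len by (auto simp: \<sigma>_def swap_verts_simps nth_swap_at)
  have "fscale (?c' (\<sigma> i)) (D_at ?h' (\<sigma> i)) - fscale (?e * ?c i) (D_at ?h i) \<in> Rel" if i: "i < nverts \<Gamma>" for i
    unfolding D_at_def fst_conv snd_conv \<sigma>[OF i]
  proof (rule lin_ext_combination_in[OF formal.subspace_span])
    fix k assume k: "k \<in> Poly_Mapping.keys (\<delta> (fst (verts \<Gamma> ! i)) (snd (verts \<Gamma> ! i)) (ps ! i) (xs ! i))"
    let ?A = "fst k" and ?q = "fst (snd k)" and ?y = "snd (snd k)"
    have kk: "k \<in> gens Is Js X" "vtype k = verts \<Gamma> ! i" "wf_graph ?A" "snd (verts \<Gamma> ! i) = arity ?A"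
      "length ?q = nverts ?A" "length ?y = nverts ?A" "sum_list ?q = ps ! i + 1 - tdeg tw ?A"
      using keys_vertex[OF h, of i k] i k by auto
    let ?H = "(graph_insert \<Gamma> i ?A, list_insert i ?q ps, list_insert i ?y xs)"
    let ?H' = "(graph_insert (swap_verts b \<Gamma>) (\<sigma> i) ?A, list_insert (\<sigma> i) ?q (swap_at b ps), list_insert (\<sigma> i) ?y (swap_at b xs))"
    have Hg: "?H \<in> gens Is Js X" using graft_at_gens[OF h, of i k] i kk by simp
    have H'g: "?H' \<in> gens Is Js X"
      using graft_at_gens[OF h', of "\<sigma> i" k] \<sigma>l[of i] \<sigma>(1)[OF i] i kk b by (simp add: swap_verts_simps)
    let ?g = "tdeg tw ?A * sum_list (take i ps)" and ?g' = "tdeg tw ?A * sum_list (take (\<sigma> i) (swap_at b ps))"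
    \<comment> \<open>\<open>f\<close> is the exponent produced by moving the vertices; the second
      equation says that it absorbs the change in the Koszul signs of the derivation.\<close>
    have "\<exists>f. sing ?H' - Poly_Mapping.single ?H (sg f :: 'a) \<in> formal.span (symrel tw) \<and>
       ?c' (\<sigma> i) * sg ?g' * sg f = ?e * ?c i * sg ?g"
    proof -
      consider "i < b" | "i = b" | "i = Suc b" | "Suc b < i" by linarith
      then show ?thesis
      proof cases
        case 1
        let ?b = "b + nverts ?A - 1"
        have n: "Suc ?b < nverts (graph_insert \<Gamma> i ?A)" using 1 b by (simp add: length_list_insert)
        have "?H' = (swap_verts ?b (graph_insert \<Gamma> i ?A), swap_at ?b (list_insert i ?q ps), swap_at ?b (list_insert i ?y xs))"
          using 1 graph_insert_swap_verts_before[OF wf(1) kk(3) 1 b kk(4)] list_insert_swap_at_before[OF 1, of ps ?q]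
            list_insert_swap_at_before[OF 1, of xs ?y] len b kk by (simp add: \<sigma>_def)
        moreover have "list_insert i ?q ps ! ?b = ps ! b" "list_insert i ?q ps ! Suc ?b = ps ! Suc b"
        proof -
          obtain c where c: "b = Suc c" "i \<le> c" using 1 by (cases b) auto
          show "list_insert i ?q ps ! ?b = ps ! b" "list_insert i ?q ps ! Suc ?b = ps ! Suc b"
            using c b len kk by (simp_all add: nth_list_insert)
        qed
        moreover have "sing (swap_verts ?b (graph_insert \<Gamma> i ?A), swap_at ?b (list_insert i ?q ps), swap_at ?b (list_insert i ?y xs))
          - Poly_Mapping.single ?H (sg (list_insert i ?q ps ! ?b * list_insert i ?q ps ! Suc ?b) :: 'a) \<in> formal.span (symrel tw)"
          using gens_lengths[OF Hg] by (intro formal.span_base symrel.verts[OF n]) auto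
        ultimately have "sing ?H' - Poly_Mapping.single ?H ?e \<in> formal.span (symrel tw)"
          by (simp only:)
        moreover have "take (\<sigma> i) (swap_at b ps) = take i ps" using 1 take_swap_at(1)[of b ps i] b len by (simp add: \<sigma>_def)
        ultimately show ?thesis by (intro exI[of _ "ps ! b * ps ! Suc b"]) (simp add: ac_simps)
      next
        case 4
        have n: "Suc b < nverts (graph_insert \<Gamma> i ?A)" using 4 i b by (simp add: length_list_insert)
        have "?H' = (swap_verts b (graph_insert \<Gamma> i ?A), swap_at b (list_insert i ?q ps), swap_at b (list_insert i ?y xs))"
          using 4 graph_insert_swap_verts_after[OF 4 i] list_insert_swap_at_after[OF 4, of ps ?q]
            list_insert_swap_at_after[OF 4, of xs ?y] len i by (simp add: \<sigma>_def)
        moreover have "list_insert i ?q ps ! b = ps ! b" "list_insert i ?q ps ! Suc b = ps ! Suc b"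
          using 4 i len by (simp_all add: nth_list_insert)
        moreover have "sing (swap_verts b (graph_insert \<Gamma> i ?A), swap_at b (list_insert i ?q ps), swap_at b (list_insert i ?y xs))
          - Poly_Mapping.single ?H (sg (list_insert i ?q ps ! b * list_insert i ?q ps ! Suc b) :: 'a) \<in> formal.span (symrel tw)"
          using gens_lengths[OF Hg] by (intro formal.span_base symrel.verts[OF n]) auto
        ultimately have "sing ?H' - Poly_Mapping.single ?H ?e \<in> formal.span (symrel tw)"
          by (simp only:)
        moreover have "sum_list (take (\<sigma> i) (swap_at b ps)) = sum_list (take i ps)"
          using 4 take_swap_at(2)[of b ps i] b len by (simp add: \<sigma>_def)
        ultimately show ?thesis by (intro exI[of _ "ps ! b * ps ! Suc b"]) (simp add: ac_simps)
      next
        case 2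
        obtain P1 p p' P4 where P: "ps = P1 @ p # p' # P4" "length P1 = b"
          using split_nth[of b ps] split_nth[of "Suc b" ps] len b
          by (metis Cons_nth_drop_Suc Suc_lessD append_take_drop_id length_take less_imp_le_nat min.absorb2)
        obtain X1 x x' X4 where X: "xs = X1 @ x # x' # X4" "length X1 = b"
          using len b by (metis Cons_nth_drop_Suc Suc_lessD append_take_drop_id length_take less_imp_le_nat min.absorb2)
        have s: "swap_at b ps = P1 @ p' # p # P4" "swap_at b xs = X1 @ x' # x # X4"
          using swap_at_append[of P1 p p' P4] swap_at_append[of X1 x x' X4] P X by simp_all
        have "length P4 = length X4" using len P X by simp
        have L: "list_insert i ?q ps = P1 @ ?q @ [p'] @ P4" "list_insert i ?y xs = X1 @ ?y @ [x'] @ X4"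
          "list_insert (Suc b) ?q (swap_at b ps) = P1 @ [p'] @ ?q @ P4" "list_insert (Suc b) ?y (swap_at b xs) = X1 @ [x'] @ ?y @ X4"
          using list_insert_append[of P1 ?q p "p' # P4"] list_insert_append[of X1 ?y x "x' # X4"]
            list_insert_append[of "P1 @ [p']" ?q p P4] list_insert_append[of "X1 @ [x']" ?y x X4] P(2) X(2) 2
          unfolding s unfolding P(1) X(1) by simp_all
        have G: "graph_insert (swap_verts b \<Gamma>) (Suc b) ?A = block_swap b (nverts ?A) (Suc 0) (graph_insert \<Gamma> b ?A)"
          using wf kk b 2 by (intro graph_insert_swap_verts_left) auto
        have "sing (block_swap (length P1) (length ?q) (length [p']) (graph_insert \<Gamma> b ?A), P1 @ [p'] @ ?q @ P4, X1 @ [x'] @ ?y @ X4)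
          - Poly_Mapping.single (graph_insert \<Gamma> b ?A, P1 @ ?q @ [p'] @ P4, X1 @ ?y @ [x'] @ X4) (sg (sum_list ?q * sum_list [p']) :: 'a)
          \<in> formal.span (symrel tw)"
          by (rule symrel_block_swap) (use \<open>length P4 = length X4\<close> gens_lengths[OF Hg] kk P(2) X(2) L 2 in simp_all)
        then have "sing ?H' - Poly_Mapping.single ?H (sg (sum_list ?q * sum_list [p']) :: 'a) \<in> formal.span (symrel tw)"
          using kk(5) P(2) L 2 G by (simp add: \<sigma>_def del: graph_insert_simps)
        moreover have "?c' (\<sigma> i) * sg ?g' * sg (sum_list ?q * sum_list [p']) = ?e * ?c i * sg ?g"
        proof -
          have nth: "ps ! b = p" "ps ! Suc b = p'" using P by (auto simp: nth_append)
          have t: "sum_list (take (\<sigma> i) (swap_at b ps)) = sum_list (take i ps) + p'"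
            using take_swap_at(3)[of b ps] b len 2 nth by (simp add: \<sigma>_def)
          show ?thesis
            unfolding sg_add[symmetric] t kk(7) using 2 nth
            by (intro sg_cong) (simp add: algebra_simps)
        qed
        ultimately show ?thesis by blast
      next
        case 3
        obtain P1 p p' P4 where P: "ps = P1 @ p # p' # P4" "length P1 = b"
          using len b by (metis Cons_nth_drop_Suc Suc_lessD append_take_drop_id length_take less_imp_le_nat min.absorb2)
        obtain X1 x x' X4 where X: "xs = X1 @ x # x' # X4" "length X1 = b"
          using len b by (metis Cons_nth_drop_Suc Suc_lessD append_take_drop_id length_take less_imp_le_nat min.absorb2)
        have s: "swap_at b ps = P1 @ p' # p # P4" "swap_at b xs = X1 @ x' # x # X4"
          using swap_at_append[of P1 p p' P4] swap_at_append[of X1 x x' X4] P X by simp_all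
        have "length P4 = length X4" using len P X by simp
        have L: "list_insert i ?q ps = P1 @ [p] @ ?q @ P4" "list_insert i ?y xs = X1 @ [x] @ ?y @ X4"
          "list_insert b ?q (swap_at b ps) = P1 @ ?q @ [p] @ P4" "list_insert b ?y (swap_at b xs) = X1 @ ?y @ [x] @ X4"
          using list_insert_append[of "P1 @ [p]" ?q p' P4] list_insert_append[of "X1 @ [x]" ?y x' X4]
            list_insert_append[of P1 ?q p' "p # P4"] list_insert_append[of X1 ?y x' "x # X4"] P(2) X(2) 3
          unfolding s unfolding P(1) X(1) by simp_all
        have G: "graph_insert (swap_verts b \<Gamma>) b ?A = block_swap b (Suc 0) (nverts ?A) (graph_insert \<Gamma> (Suc b) ?A)"
          using wf kk b 3 by (intro graph_insert_swap_verts_right) auto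
        have "sing (block_swap (length P1) (length [p]) (length ?q) (graph_insert \<Gamma> (Suc b) ?A), P1 @ ?q @ [p] @ P4, X1 @ ?y @ [x] @ X4)
          - Poly_Mapping.single (graph_insert \<Gamma> (Suc b) ?A, P1 @ [p] @ ?q @ P4, X1 @ [x] @ ?y @ X4) (sg (sum_list [p] * sum_list ?q) :: 'a)
          \<in> formal.span (symrel tw)"
          by (rule symrel_block_swap) (use \<open>length P4 = length X4\<close> gens_lengths[OF Hg] kk P(2) X(2) L 3 in simp_all)
        then have "sing ?H' - Poly_Mapping.single ?H (sg (sum_list [p] * sum_list ?q) :: 'a) \<in> formal.span (symrel tw)"
          using kk(5) P(2) L 3 G by (simp add: \<sigma>_def del: graph_insert_simps)
        moreover have "?c' (\<sigma> i) * sg ?g' * sg (sum_list [p] * sum_list ?q) = ?e * ?c i * sg ?g"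
        proof -
          have nth: "ps ! b = p" "ps ! Suc b = p'" using P by (auto simp: nth_append)
          have t: "sum_list (take (\<sigma> i) (swap_at b ps)) = sum_list (take b ps)" "sum_list (take i ps) = sum_list (take b ps) + p"
            using take_swap_at(1)[of b ps b] b len 3 nth by (simp_all add: \<sigma>_def take_Suc_conv_app_nth)
          show ?thesis
            unfolding sg_add[symmetric] t kk(7) using 3 nth
            by (intro sg_cong) (simp add: algebra_simps)
        qed
        ultimately show ?thesis by blast
      qed
    qed
    then obtain f where f: "sing ?H' - Poly_Mapping.single ?H (sg f :: 'a) \<in> formal.span (symrel tw)"
       "?c' (\<sigma> i) * sg ?g' * sg f = ?e * ?c i * sg ?g" by blast
    have "sing ?H' - Poly_Mapping.single ?H (sg f :: 'a) \<in> Rel"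
      by (rule span_symrel_imp_relators[OF f(1)], rule order_trans[OF keys_single_diff]) (use Hg H'g in auto)
    note R = this
    show "fscale (?c' (\<sigma> i)) (graft_at tw ?h' (\<sigma> i) k) - fscale (?e * ?c i) (graft_at tw ?h i k) \<in> Rel"
      by (rule span_fscale_eq[OF R, of _ "?c' (\<sigma> i) * sg ?g'"])
        (simp only: graft_at_eq fst_conv snd_conv formal.scale_right_diff_distrib fscale_single f(2) mult_1_right)
  qed
  then have S: "(\<Sum>i < nverts \<Gamma>. fscale (?c' (\<sigma> i)) (D_at ?h' (\<sigma> i)) - fscale (?e * ?c i) (D_at ?h i)) \<in> Rel"
    by (intro formal.span_sum) auto
  have "bij_betw \<sigma> {..<nverts \<Gamma>} {..<nverts \<Gamma>}"
    by (rule bij_betw_byWitness[of _ \<sigma>]) (use b in \<open>auto simp: \<sigma>_def\<close>)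
  from sum.reindex_bij_betw[OF this, of "\<lambda>i. fscale (?c' i) (D_at ?h' i)"]
  have "derivation tw \<delta> ?h' = (\<Sum>i < nverts \<Gamma>. fscale (?c' (\<sigma> i)) (D_at ?h' (\<sigma> i)))"
    using b by (simp add: derivation_eq swap_verts_simps tdeg_def)
  moreover have "fscale ?e (derivation tw \<delta> ?h) = (\<Sum>i < nverts \<Gamma>. fscale (?e * ?c i) (D_at ?h i))"
    by (simp add: derivation_eq formal.scale_sum_right)
  ultimately show ?thesis using S by (simp only: sum_subtractf)
qed

theorem derivation_relators:
  assumes "x \<in> Rel"
  shows "lin_ext (derivation tw \<delta>) x \<in> Rel"
proof (rule flinear_span_image[OF flinear_lin_ext _ assms])
  fix r assume "r \<in> relators tw Is Js C X"
  then show "lin_ext (derivation tw \<delta>) r \<in> Rel"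
  proof cases
    case (multilinear \<Gamma> ps xs a x y c)
    show ?thesis
      using derivation_multilinear[OF multilinear(2,3,4)] unfolding multilinear(1)
      by (simp add: lin_ext_diff lin_ext_single)
  next
    case (verts \<Gamma> ps xs i)
    show ?thesis
      using derivation_verts[OF verts(2,3)] unfolding verts(1) by (simp add: lin_ext_diff lin_ext_single)
  next
    case (edges \<Gamma> ps xs i)
    show ?thesis
      using derivation_edges[OF edges(2,3)] unfolding edges(1) by (simp only: lin_ext_diff lin_ext_single formal.scale_one)
  next
    case (flip \<Gamma> ps xs i)
    show ?thesis
      using derivation_flip[OF flip(2,3)] unfolding flip(1) by (simp add: lin_ext_diff lin_ext_single)
  next
    case (contract \<Gamma> ps xs a \<Delta> qs ys)
    have "\<Delta> \<in> permuted_corollas" using contract(4) C by blast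
    note pc = permuted_corolla[OF this]
    obtain q y where qy: "qs = [q]" "ys = [y]"
      using decorates_lengths[OF contract(6)] pc(3) by (auto simp: length_Suc_conv)
    have q: "q = ps ! a" and y: "y \<in> cell X (genus \<Delta>) (arity \<Delta>) (ps ! a)"
      using contract(6,7) pc(3,4) qy by simp_all
    have "list_insert a qs ps = ps" "list_insert a ys xs = xs[a := y]"
      using gens_lengths[OF contract(2)] contract(3) qy q
      by (simp_all add: list_insert_singleton list_update_same_conv)
    then show ?thesis
      using derivation_contract[OF contract(2-5) y] contract(8) qy q pc(4) unfolding contract(1)
      by (simp add: lin_ext_diff lin_ext_single)
  qed
qed

end

section \<open>Tensors of functionals are determined by their values\<close>

text \<open>The scalar is kept as a formal sum over \<open>unit\<close>, a copy of the field, so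
  that evaluation is itself a \<open>lin_ext\<close>.\<close>

definition tensor_value :: "'a list \<Rightarrow> (('a \<Rightarrow> 'k) list \<Rightarrow>\<^sub>0 'k::field_char_0) \<Rightarrow> (unit \<Rightarrow>\<^sub>0 'k)" where
  "tensor_value xs = lin_ext (\<lambda>\<alpha>s. Poly_Mapping.single () (\<Prod>i < length xs. (\<alpha>s ! i) (xs ! i)))"

lemma flinear_tensor_value: "flinear (tensor_value xs)"
  unfolding tensor_value_def by (rule flinear_lin_ext)

definition closed_functions :: "('a \<Rightarrow> 'k::field_char_0) set \<Rightarrow> bool" where
  "closed_functions V \<longleftrightarrow> (\<forall>c. \<forall>v \<in> V. \<forall>w \<in> V. (\<lambda>x. c * v x + w x) \<in> V)"

text \<open>Multilinearity is required modulo \<open>S\<close> because \<open>T\<close> will send a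
  tuple of functionals to a decorated graph, which is multilinear only up to relations.\<close>

definition multilinear_mod ::
  "('d \<Rightarrow>\<^sub>0 'k::field_char_0) set \<Rightarrow> ('a \<Rightarrow> 'k) set list \<Rightarrow> (('a \<Rightarrow> 'k) list \<Rightarrow> ('d \<Rightarrow>\<^sub>0 'k)) \<Rightarrow> bool" where
  "multilinear_mod S Vs T \<longleftrightarrow> (\<forall>i < length Vs. \<forall>\<alpha>s \<in> listset Vs. \<forall>v \<in> Vs ! i. \<forall>w \<in> Vs ! i. \<forall>c.
     T (\<alpha>s[i := \<lambda>x. c * v x + w x]) - fscale c (T (\<alpha>s[i := v])) - T (\<alpha>s[i := w]) \<in> S)"

text \<open>
  Gaussian elimination: a point at which the function \<open>f j\<^sub>0\<close> does not vanish expresses \<open>u j\<^sub>0\<close>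
  through the other \<open>u j\<close>, which are then multiplied by \<open>f j - r j * f j\<^sub>0\<close>.
\<close>

lemma tensor_elimination:
  fixes T :: "('a \<Rightarrow> 'k::field_char_0) \<Rightarrow> 'b list \<Rightarrow> ('d \<Rightarrow>\<^sub>0 'k)" and u :: "'j \<Rightarrow> ('b list \<Rightarrow>\<^sub>0 'k)"
    and ev :: "'e \<Rightarrow> ('b list \<Rightarrow>\<^sub>0 'k) \<Rightarrow> (unit \<Rightarrow>\<^sub>0 'k)"
  assumes S: "formal.subspace S" and V: "closed_functions V" and ev: "\<And>xs. flinear (ev xs)"
    and T: "\<And>\<alpha>s v w c. \<alpha>s \<in> L \<Longrightarrow> v \<in> V \<Longrightarrow> w \<in> V \<Longrightarrow>
      T (\<lambda>x. c * v x + w x) \<alpha>s - fscale c (T v \<alpha>s) - T w \<alpha>s \<in> S"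
    and IH: "\<And>v t. v \<in> V \<Longrightarrow> Poly_Mapping.keys t \<subseteq> L \<Longrightarrow> (\<forall>xs. ev xs t = 0) \<Longrightarrow> lin_ext (T v) t \<in> S"
  shows "finite J \<Longrightarrow> (\<And>j. j \<in> J \<Longrightarrow> f j \<in> V) \<Longrightarrow> (\<And>j. j \<in> J \<Longrightarrow> Poly_Mapping.keys (u j) \<subseteq> L) \<Longrightarrow>
    (\<And>x xs. (\<Sum>j\<in>J. fscale (f j x) (ev xs (u j))) = 0) \<Longrightarrow> (\<Sum>j\<in>J. lin_ext (T (f j)) (u j)) \<in> S"
proof (induction J arbitrary: f rule: finite_induct)
  case empty
  show ?case using formal.subspace_0[OF S] by simp
next
  case (insert j0 J)
  have comb: "lin_ext (T (\<lambda>x. c * v x + w x)) t - fscale c (lin_ext (T v) t) - lin_ext (T w) t \<in> S"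
    if "v \<in> V" "w \<in> V" "Poly_Mapping.keys t \<subseteq> L" for c v w t
    using that T by (intro lin_ext_combination3_in[OF S]) auto
  show ?case
  proof (cases "\<exists>x0. f j0 x0 \<noteq> 0")
    case False
    then have f0: "f j0 = (\<lambda>x. 0)" by auto
    \<comment> \<open>With \<open>c = 1\<close> and the zero function in both arguments, additivity
      says that minus the term itself lies in \<open>S\<close>.\<close>
    have z: "(\<lambda>x. 1 * f j0 x + f j0 x) = f j0" by (simp add: f0)
    have "lin_ext (T (\<lambda>x. 1 * f j0 x + f j0 x)) (u j0) - fscale 1 (lin_ext (T (f j0)) (u j0)) - lin_ext (T (f j0)) (u j0) \<in> S"
      using insert.prems by (intro comb) auto
    then have "- lin_ext (T (f j0)) (u j0) \<in> S" unfolding z by simp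
    then have "lin_ext (T (f j0)) (u j0) \<in> S" using formal.subspace_neg[OF S] by fastforce
    moreover have "(\<Sum>j\<in>J. lin_ext (T (f j)) (u j)) \<in> S"
    proof (rule insert.IH)
      show "(\<Sum>j\<in>J. fscale (f j x) (ev xs (u j))) = 0" for x xs
        using insert.prems(3)[of x xs] insert.hyps by (simp add: f0)
    qed (use insert.prems in auto)
    ultimately show ?thesis using insert.hyps formal.subspace_add[OF S] by simp
  next
    case True
    then obtain x0 where x0: "f j0 x0 \<noteq> 0" by blast
    define r where "r j = f j x0 / f j0 x0" for j
    define f' where "f' j = (\<lambda>x. - r j * f j0 x + f j x)" for j
    \<comment> \<open>The factor of \<open>f j0\<close> after the elimination; the hypothesis at
      \<open>x0\<close> makes its evaluation vanish.\<close>
    define w where "w = u j0 + (\<Sum>j\<in>J. fscale (r j) (u j))"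
    have fJ: "f j0 \<in> V" "\<And>j. j \<in> J \<Longrightarrow> f j \<in> V" "Poly_Mapping.keys (u j0) \<subseteq> L" "\<And>j. j \<in> J \<Longrightarrow> Poly_Mapping.keys (u j) \<subseteq> L"
      using insert.prems by auto
    have evw: "ev xs w = 0" for xs
    proof -
      have "fscale (f j0 x0) (ev xs w) = fscale (f j0 x0) (ev xs (u j0)) + (\<Sum>j\<in>J. fscale (f j x0) (ev xs (u j)))"
        using x0 by (simp add: w_def r_def flinear_add[OF ev] flinear_sum[OF ev] flinear_scale[OF ev]
            formal.scale_right_distrib formal.scale_sum_right)
      also have "\<dots> = 0" using insert.prems(3)[of x0 xs] insert.hyps by simp
      finally show ?thesis using x0 by simp
    qed
    have kw: "Poly_Mapping.keys w \<subseteq> L"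
    proof -
      have "w \<in> {t. Poly_Mapping.keys t \<subseteq> L}"
        unfolding w_def using fJ
        by (intro formal.subspace_add[OF subspace_keys] formal.subspace_sum[OF subspace_keys] formal.subspace_scale[OF subspace_keys]) auto
      then show ?thesis by simp
    qed
    have 1: "lin_ext (T (f j0)) w \<in> S" using IH[OF fJ(1) kw] evw by blast
    have 2: "(\<Sum>j\<in>J. lin_ext (T (f' j)) (u j)) \<in> S"
    proof (rule insert.IH)
      show "f' j \<in> V" if "j \<in> J" for j
        using V fJ(1) fJ(2)[OF that] unfolding closed_functions_def f'_def by blast
      show "(\<Sum>j\<in>J. fscale (f' j x) (ev xs (u j))) = 0" for x xs
      proof -
        have "(\<Sum>j\<in>J. fscale (f' j x) (ev xs (u j))) =
            (\<Sum>j\<in>J. fscale (f j x) (ev xs (u j))) - fscale (f j0 x) (\<Sum>j\<in>J. fscale (r j) (ev xs (u j)))"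
          by (simp add: f'_def formal.scale_left_distrib formal.scale_sum_right sum.distrib sum_negf[symmetric] mult.commute
              sum_subtractf[symmetric] algebra_simps)
        also have "(\<Sum>j\<in>J. fscale (r j) (ev xs (u j))) = - ev xs (u j0)"
          using evw[of xs] by (simp add: w_def flinear_add[OF ev] flinear_sum[OF ev] flinear_scale[OF ev] add_eq_0_iff)
        finally show ?thesis using insert.prems(3)[of x xs] insert.hyps by (simp add: add.commute)
      qed
    qed (use fJ in auto)
    have 3: "(\<Sum>j\<in>J. lin_ext (T (f' j)) (u j) - fscale (- r j) (lin_ext (T (f j0)) (u j)) - lin_ext (T (f j)) (u j)) \<in> S"
      unfolding f'_def using fJ by (intro formal.subspace_sum[OF S] comb) auto
    have "(\<Sum>j\<in>insert j0 J. lin_ext (T (f j)) (u j)) = lin_ext (T (f j0)) w + (\<Sum>j\<in>J. lin_ext (T (f' j)) (u j)) -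
       (\<Sum>j\<in>J. lin_ext (T (f' j)) (u j) - fscale (- r j) (lin_ext (T (f j0)) (u j)) - lin_ext (T (f j)) (u j))"
      using insert.hyps
      by (simp add: w_def lin_ext_add lin_ext_sum lin_ext_scale sum_subtractf sum.distrib sum_negf)
    then show ?thesis using 1 2 3 formal.subspace_add[OF S] formal.subspace_diff[OF S] by simp
  qed
qed

text \<open>Injectivity of the map from a tensor product of function spaces to functions of several
  variables, proved without bases: induction on the number of factors, with elimination in the first
  one.\<close>

lemma tensor_value_injective:
  fixes Vs :: "('a \<Rightarrow> 'k::field_char_0) set list" and T :: "('a \<Rightarrow> 'k) list \<Rightarrow> ('d \<Rightarrow>\<^sub>0 'k)"
  assumes S: "formal.subspace S"
  shows "(\<And>V. V \<in> set Vs \<Longrightarrow> closed_functions V) \<Longrightarrow> multilinear_mod S Vs T \<Longrightarrow>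
    Poly_Mapping.keys t \<subseteq> listset Vs \<Longrightarrow> (\<And>xs. length xs = length Vs \<Longrightarrow> tensor_value xs t = 0) \<Longrightarrow> lin_ext T t \<in> S"
proof (induction Vs arbitrary: T t)
  case Nil
  have "tensor_value [] t = lin_ext (\<lambda>\<alpha>s. Poly_Mapping.single () 1) t" by (simp add: tensor_value_def)
  then have "lin_ext (\<lambda>\<alpha>s. Poly_Mapping.single () 1) t = (0 :: unit \<Rightarrow>\<^sub>0 'k)" using Nil.prems(4)[of "[]"] by simp
  moreover have "t = Poly_Mapping.single [] (Poly_Mapping.lookup t [])"
  proof (rule poly_mapping_eqI)
    fix k show "Poly_Mapping.lookup t k = Poly_Mapping.lookup (Poly_Mapping.single [] (Poly_Mapping.lookup t [])) k"
      using Nil.prems(3) by (cases "k = []") (auto simp: lookup_single in_keys_iff)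
  qed
  then obtain c where "t = Poly_Mapping.single [] c" by blast
  ultimately have "Poly_Mapping.single () c = 0" by (simp add: lin_ext_single fscale_single)
  then have "c = 0" by (metis lookup_single_eq lookup_zero)
  then have "t = 0" using \<open>t = Poly_Mapping.single [] c\<close> by simp
  then show ?case using formal.subspace_0[OF S] by simp
next
  case (Cons V Vs)
  let ?J = "Poly_Mapping.keys t"
  \<comment> \<open>The tensor is a sum of first factors \<open>hd ks\<close> times remainders
    \<open>?u ks\<close>; the coefficient is put into the remainder.\<close>
  let ?u = "\<lambda>ks. Poly_Mapping.single (tl ks) (Poly_Mapping.lookup t ks)"
  have ks: "hd ks \<in> V" "tl ks \<in> listset Vs" "hd ks # tl ks = ks" if "ks \<in> ?J" for ks
    using Cons.prems(3) that by (auto simp: set_Cons_def)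
  have len: "length \<alpha>s = length Vs" if "\<alpha>s \<in> listset Vs" for \<alpha>s
    using that by (simp add: listset_iff list_all2_lengthD)
  \<comment> \<open>Tuples of the wrong length get the value 0, so that vanishing can be stated for
    all lists.\<close>
  define ev where "ev xs t = (if length xs = length Vs then tensor_value xs t else 0)" for xs and t :: "('a \<Rightarrow> 'k) list \<Rightarrow>\<^sub>0 'k"
  have "(\<Sum>ks\<in>?J. lin_ext (\<lambda>\<alpha>s. T (hd ks # \<alpha>s)) (?u ks)) \<in> S"
  proof (rule tensor_elimination[OF S, where V = V and L = "listset Vs" and ev = ev and T = "\<lambda>v \<alpha>s. T (v # \<alpha>s)" and f = hd])
    show "closed_functions V" using Cons.prems(1) by simp
    show "flinear (ev xs)" for xs
      using flinear_tensor_value[of xs] by (auto simp: ev_def flinear_iff)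
    show "T ((\<lambda>x. c * v x + w x) # \<alpha>s) - fscale c (T (v # \<alpha>s)) - T (w # \<alpha>s) \<in> S"
      if "\<alpha>s \<in> listset Vs" "v \<in> V" "w \<in> V" for \<alpha>s v w c
    proof -
      have "v # \<alpha>s \<in> listset (V # Vs)" using that by (simp add: set_Cons_def)
      from Cons.prems(2)[unfolded multilinear_mod_def, rule_format, of 0, OF _ this] that show ?thesis by simp
    qed
    show "lin_ext (\<lambda>\<alpha>s. T (v # \<alpha>s)) t' \<in> S"
      if "v \<in> V" "Poly_Mapping.keys t' \<subseteq> listset Vs" "\<forall>xs. ev xs t' = 0" for v t'
    proof (rule Cons.IH)
      show "multilinear_mod S Vs (\<lambda>\<alpha>s. T (v # \<alpha>s))"
        unfolding multilinear_mod_def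
      proof (intro allI impI ballI)
        fix i \<alpha>s a b c assume i: "i < length Vs" "\<alpha>s \<in> listset Vs" "a \<in> Vs ! i" "b \<in> Vs ! i"
        have "v # \<alpha>s \<in> listset (V # Vs)" using that(1) i(2) by (simp add: set_Cons_def)
        from Cons.prems(2)[unfolded multilinear_mod_def, rule_format, of "Suc i", OF _ this] i
        show "T (v # \<alpha>s[i := \<lambda>x. c * a x + b x]) - fscale c (T (v # \<alpha>s[i := a])) - T (v # \<alpha>s[i := b]) \<in> S" by simp
      qed
      show "tensor_value xs t' = 0" if "length xs = length Vs" for xs
        using \<open>\<forall>xs. ev xs t' = 0\<close> that unfolding ev_def by (metis (full_types))
    qed (use that(2) Cons.prems(1) in auto)
    show "(\<Sum>ks\<in>?J. fscale (hd ks x) (ev xs (?u ks))) = 0" for x xs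
    proof (cases "length xs = length Vs")
      case True
      have "tensor_value (x # xs) t = (\<Sum>ks\<in>?J. fscale (hd ks x) (tensor_value xs (?u ks)))"
        unfolding tensor_value_def lin_ext_def[of _ t]
      proof (rule sum.cong)
        fix ks assume "ks \<in> ?J"
        from ks[OF this] obtain v \<alpha>s where k: "ks = v # \<alpha>s" by metis
        show "fscale (Poly_Mapping.lookup t ks) (Poly_Mapping.single () (\<Prod>i<length (x # xs). (ks ! i) ((x # xs) ! i))) =
           fscale (hd ks x) (lin_ext (\<lambda>\<alpha>s. Poly_Mapping.single () (\<Prod>i<length xs. (\<alpha>s ! i) (xs ! i))) (?u ks))"
          unfolding k length_Cons prod.lessThan_Suc_shift
          by (simp add: lin_ext_single fscale_single ac_simps)
      qed simp
      then show ?thesis using Cons.prems(4)[of "x # xs"] True by (simp add: ev_def)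
    qed (simp add: ev_def)
  qed (use ks in auto)
  also have "(\<Sum>ks\<in>?J. lin_ext (\<lambda>\<alpha>s. T (hd ks # \<alpha>s)) (?u ks)) = lin_ext T t"
    unfolding lin_ext_def[of T t] by (rule sum.cong) (simp_all add: lin_ext_single ks(3))
  finally show ?case .
qed

section \<open>The differential of the Feynman transform\<close>

lemma dual_simps [simp]:
  "scl (dual M) c \<alpha> + \<beta> = (\<lambda>x. c * \<alpha> x + \<beta> x)"
  by (auto simp: dual_def plus_fun_def)

lemma dual_cell:
  "\<alpha> \<in> cell (dual M) g n p \<longleftrightarrow> (\<forall>x. x \<notin> cell M g n (- p) \<longrightarrow> \<alpha> x = 0) \<and>
     (\<forall>c. \<forall>x \<in> cell M g n (- p). \<forall>y \<in> cell M g n (- p). \<alpha> (scl M c x + y) = c * \<alpha> x + \<alpha> y)"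
  by (simp add: dual_def)

lemma closed_functions_dual: "closed_functions (cell (dual M) g n p)"
  by (auto simp: closed_functions_def dual_cell algebra_simps)

section \<open>Representing tensors as decorated graphs\<close>

definition tensor_sign :: "int list \<Rightarrow> int" where
  "tensor_sign qs = (\<Sum>j < length qs. \<Sum>i < j. qs ! i * qs ! j)"

text \<open>\<open>tensor_eval\<close> reads only the terms of one tuple of degrees, so injectivity
  is applied to each such component separately.\<close>

definition degree_part :: "int list \<Rightarrow> (int list \<times> 'f list \<Rightarrow>\<^sub>0 'k::field_char_0) \<Rightarrow> ('f list \<Rightarrow>\<^sub>0 'k)" where
  "degree_part qs = lin_ext (\<lambda>(q, \<alpha>s). if q = qs then sing \<alpha>s else 0)"

lemma single_sum: "Poly_Mapping.single k (sum F A) = (\<Sum>a\<in>A. Poly_Mapping.single k (F a :: 'k::comm_monoid_add))"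
  by (induction A rule: infinite_finite_induct) (simp_all add: single_add)

text \<open>The Koszul sign depends on the degrees alone and therefore factors out of the evaluation
  of one component.\<close>

lemma tensor_eval_eq:
  "Poly_Mapping.single () (tensor_eval t rs xs) =
     fscale (sg (tensor_sign (map uminus rs))) (tensor_value xs (degree_part (map uminus rs) t))"
proof -
  let ?q = "map uminus rs"
  have "fscale (sg (tensor_sign ?q)) (tensor_value xs (degree_part ?q t)) =
      (\<Sum>h \<in> Poly_Mapping.keys t. if fst h = ?q then Poly_Mapping.single () (Poly_Mapping.lookup t h * sg (tensor_sign (fst h)) *
        (\<Prod>i < length xs. (snd h ! i) (xs ! i))) else 0)"
    unfolding degree_part_def tensor_value_def lin_ext_lin_ext unfolding lin_ext_def[of _ t] formal.scale_sum_right
    by (rule sum.cong) (auto simp: lin_ext_single fscale_single ac_simps split: prod.splits)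
  also have "\<dots> = (\<Sum>h \<in> {h \<in> Poly_Mapping.keys t. fst h = ?q}. Poly_Mapping.single () (Poly_Mapping.lookup t h * sg (tensor_sign (fst h)) *
        (\<Prod>i < length xs. (snd h ! i) (xs ! i))))"
    by (simp add: sum.If_cases Int_def)
  also have "\<dots> = Poly_Mapping.single () (tensor_eval t rs xs)"
    unfolding tensor_eval_def single_sum by (rule sum.cong) (auto simp: tensor_sign_def)
  finally show ?thesis by simp
qed

definition place :: "graph \<Rightarrow> (int list \<times> 'f list \<Rightarrow>\<^sub>0 'k::field_char_0) \<Rightarrow> ('f gen \<Rightarrow>\<^sub>0 'k)" where
  "place \<Lambda> = lin_ext (\<lambda>(qs, \<alpha>s). sing (\<Lambda>, qs, \<alpha>s))"

lemma place_eq_sum: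
  "place \<Lambda> t = (\<Sum>qs \<in> fst ` Poly_Mapping.keys t. lin_ext (\<lambda>\<alpha>s. sing (\<Lambda>, qs, \<alpha>s)) (degree_part qs t))"
proof -
  have "(\<Sum>qs \<in> fst ` Poly_Mapping.keys t. lin_ext (\<lambda>\<alpha>s. sing (\<Lambda>, qs, \<alpha>s)) (degree_part qs t)) =
      lin_ext (\<lambda>h. \<Sum>qs \<in> fst ` Poly_Mapping.keys t. if fst h = qs then sing (\<Lambda>, qs, snd h) else 0) t"
    unfolding degree_part_def lin_ext_lin_ext lin_ext_fun_sum
    by (intro sum.cong lin_ext_cong) (auto split: prod.splits)
  also have "\<dots> = place \<Lambda> t"
    unfolding place_def by (rule lin_ext_cong) (auto split: prod.splits)
  finally show ?thesis by simp
qed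

lemma sum_list_map_uminus: "sum_list (map uminus qs) = - sum_list (qs :: int list)"
  by (induction qs) simp_all

text \<open>A tensor of functionals whose values are all 0 is 0 by multilinearity alone. Hence two
  tensors that represent the same functional yield the same class.\<close>

lemma place_in_relators:
  fixes M :: "('k::field_char_0, 'a::ab_group_add) opd"
  assumes \<Lambda>: "stable_graph \<Lambda>" "fst ` set (verts \<Lambda>) \<subseteq> Is" "genus \<Lambda> \<in> Js"
    and t: "\<And>qs \<alpha>s. (qs, \<alpha>s) \<in> Poly_Mapping.keys t \<Longrightarrow> decorates (dual M) (verts \<Lambda>) qs \<alpha>s \<and> sum_list qs = d"
    and ev: "\<And>rs xs. decorates M (verts \<Lambda>) rs xs \<Longrightarrow> sum_list rs = - d \<Longrightarrow> tensor_eval t rs xs = 0"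
  shows "place \<Lambda> t \<in> formal.span (relators tw Is Js C (dual M))"
proof -
  have "lin_ext (\<lambda>\<alpha>s. sing (\<Lambda>, qs, \<alpha>s)) (degree_part qs t) \<in> formal.span (relators tw Is Js C (dual M))"
    if "qs \<in> fst ` Poly_Mapping.keys t" for qs
  proof -
    from that obtain \<alpha>s0 where "(qs, \<alpha>s0) \<in> Poly_Mapping.keys t" by auto
    with t have len: "length qs = nverts \<Lambda>" and d: "sum_list qs = d" by (auto simp: decorates_def)
    let ?Vs = "map (\<lambda>(v, q). cell (dual M) (fst v) (snd v) q) (zip (verts \<Lambda>) qs)"
    have Vs: "\<alpha>s \<in> listset ?Vs \<longleftrightarrow> decorates (dual M) (verts \<Lambda>) qs \<alpha>s" for \<alpha>s
      using len by (auto simp: listset_iff list_all2_conv_all_nth decorates_def)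
    show ?thesis
    proof (rule tensor_value_injective[OF formal.subspace_span, of ?Vs])
      show "closed_functions V" if "V \<in> set ?Vs" for V using that by (auto simp: closed_functions_dual)
      show "multilinear_mod (formal.span (relators tw Is Js C (dual M))) ?Vs (\<lambda>\<alpha>s. sing (\<Lambda>, qs, \<alpha>s))"
        unfolding multilinear_mod_def
      proof (intro allI impI ballI)
        fix i \<alpha>s v w c assume i: "i < length ?Vs" "\<alpha>s \<in> listset ?Vs" "v \<in> ?Vs ! i" "w \<in> ?Vs ! i"
        then have "(\<Lambda>, qs, \<alpha>s[i := v]) \<in> gens Is Js (dual M)" "(\<Lambda>, qs, \<alpha>s[i := w]) \<in> gens Is Js (dual M)"
          using \<Lambda> len unfolding Vs by (auto simp: gens_iff intro!: decorates_update_same)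
        from relators.multilinear[OF this, of c tw C] i len
        have "sing (\<Lambda>, qs, \<alpha>s[i := \<lambda>x. c * v x + w x]) - Poly_Mapping.single (\<Lambda>, qs, \<alpha>s[i := v]) c - sing (\<Lambda>, qs, \<alpha>s[i := w])
            \<in> relators tw Is Js C (dual M)" by simp
        then show "sing (\<Lambda>, qs, \<alpha>s[i := \<lambda>x. c * v x + w x]) - fscale c (sing (\<Lambda>, qs, \<alpha>s[i := v])) - sing (\<Lambda>, qs, \<alpha>s[i := w])
            \<in> formal.span (relators tw Is Js C (dual M))" by (simp add: fscale_single formal.span_base)
      qed
      show k: "Poly_Mapping.keys (degree_part qs t) \<subseteq> listset ?Vs"
        unfolding degree_part_def by (rule keys_lin_ext) (use t Vs in \<open>auto split: if_splits\<close>)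
      show "tensor_value xs (degree_part qs t) = 0" if xs: "length xs = length ?Vs" for xs
      proof (cases "decorates M (verts \<Lambda>) (map uminus qs) xs")
        case True
        have "map uminus (map uminus qs) = qs" by (simp add: comp_def)
        then have "fscale (sg (tensor_sign qs)) (tensor_value xs (degree_part qs t)) = 0"
          using tensor_eval_eq[of t "map uminus qs" xs] ev[OF True] d by (simp add: sum_list_map_uminus)
        then show ?thesis by (simp add: sg_def split: if_splits)
      next
        \<comment> \<open>Some argument lies outside its cell, where functionals are 0 by
          convention, so these tuples impose no condition.\<close>
        case False
        with xs len obtain i where i: "i < nverts \<Lambda>" "xs ! i \<notin> cell M (fst (verts \<Lambda> ! i)) (snd (verts \<Lambda> ! i)) (- (qs ! i))"
          by (auto simp: decorates_def)
        have z: "(\<Prod>i < length xs. (\<alpha>s ! i) (xs ! i)) = 0" if "\<alpha>s \<in> Poly_Mapping.keys (degree_part qs t)" for \<alpha>s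
        proof -
          have "decorates (dual M) (verts \<Lambda>) qs \<alpha>s" using k that Vs by blast
          then have "(\<alpha>s ! i) (xs ! i) = 0" using i by (auto simp: decorates_def dual_cell)
          then show ?thesis using i xs len by auto
        qed
        then have "tensor_value xs (degree_part qs t) = lin_ext (\<lambda>_. 0) (degree_part qs t)"
          unfolding tensor_value_def by (intro lin_ext_cong) (simp only: z single_zero)
        then show ?thesis by simp
      qed
    qed
  qed
  then show ?thesis unfolding place_eq_sum by (intro formal.span_sum)
qed

lemma tensor_eval_diff:
  "tensor_eval (t - fscale c t' - t'') rs xs = tensor_eval t rs xs - c * tensor_eval t' rs xs - tensor_eval t'' rs xs"
proof -
  have *: "tensor_eval t rs xs = Poly_Mapping.lookup (fscale (sg (tensor_sign (map uminus rs)))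
      (tensor_value xs (degree_part (map uminus rs) t))) ()" for t :: "int list \<times> ('b \<Rightarrow> 'a) list \<Rightarrow>\<^sub>0 'a"
    by (metis lookup_single_eq tensor_eval_eq)
  show ?thesis
    unfolding * degree_part_def
    by (simp only: lin_ext_diff lin_ext_scale flinear_diff[OF flinear_tensor_value] flinear_scale[OF flinear_tensor_value]
        formal.scale_right_diff_distrib lookup_minus lookup_fscale) (simp add: ac_simps)
qed

lemma linear_cells_dual: "linear_cells Is (dual M)"
  using closed_functions_dual[of M] by (auto simp: linear_cells_def closed_functions_def)

text \<open>The legs of a permuted corolla are a permutation of its flags, and
  \<open>corolla_inv\<close> carries the inverse permutation.\<close>

lemma corolla_inv_props:
  assumes "\<Delta> \<in> permuted_corollas"
  shows "corolla_inv \<Delta> \<in> permuted_corollas" "verts (corolla_inv \<Delta>) = verts \<Delta>"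
    "arity (corolla_inv \<Delta>) = arity \<Delta>" "genus (corolla_inv \<Delta>) = genus \<Delta>" "edges (corolla_inv \<Delta>) = []"
    "graph_insert (corolla_inv \<Delta>) 0 \<Delta> = corolla (genus \<Delta>) (arity \<Delta>)"
    "graph_insert \<Delta> 0 (corolla_inv \<Delta>) = corolla (genus \<Delta>) (arity \<Delta>)"
proof -
  note pc = permuted_corolla[OF assms]
  let ?n = "arity \<Delta>"
  have d: "distinct (legs \<Delta>)" "set (legs \<Delta>) = flags \<Delta>"
    using pc(1,2) by (auto simp: stable_graph_def flag_list_def)
  have fl: "flags \<Delta> = Pair 0 ` {..<?n}" using pc(3) by (auto simp: flags_def)
  define \<pi> where "\<pi> k = (THE j. j < ?n \<and> legs \<Delta> ! j = (0, k))" for k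
  have \<pi>: "\<pi> k < ?n" "legs \<Delta> ! \<pi> k = (0, k)" if "k < ?n" for k
  proof -
    have "(0, k) \<in> set (legs \<Delta>)" using that d fl by auto
    then obtain j where j: "j < ?n" "legs \<Delta> ! j = (0, k)" by (auto simp: in_set_conv_nth arity_def)
    have "\<pi> k = j" unfolding \<pi>_def
    proof (rule the_equality)
      fix i assume "i < ?n \<and> legs \<Delta> ! i = (0, k)"
      then show "i = j" using j d(1) nth_eq_iff_index_eq[of "legs \<Delta>" i j] by (simp add: arity_def)
    qed (use j in simp)
    then show "\<pi> k < ?n" "legs \<Delta> ! \<pi> k = (0, k)" using j by auto
  qed
  have \<pi>': "\<pi> (snd (legs \<Delta> ! j)) = j" "fst (legs \<Delta> ! j) = 0" "snd (legs \<Delta> ! j) < ?n" if "j < ?n" for j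
  proof -
    have "legs \<Delta> ! j \<in> Pair 0 ` {..<?n}" using that d(2) fl by (metis arity_def nth_mem)
    then show f: "fst (legs \<Delta> ! j) = 0" and s: "snd (legs \<Delta> ! j) < ?n" by auto
    then show "\<pi> (snd (legs \<Delta> ! j)) = j"
      using \<pi>[OF s] that d(1) by (metis arity_def nth_eq_iff_index_eq prod.collapse)
  qed
  have inv: "legs (corolla_inv \<Delta>) = map (\<lambda>k. (0, \<pi> k)) [0..<?n]" by (simp add: corolla_inv_def \<pi>_def)
  show v: "verts (corolla_inv \<Delta>) = verts \<Delta>" and a: "arity (corolla_inv \<Delta>) = arity \<Delta>" and e: "edges (corolla_inv \<Delta>) = []"
    by (simp_all add: corolla_inv_def arity_def)
  show "genus (corolla_inv \<Delta>) = genus \<Delta>" using pc(2) by (simp add: genus_def v e)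
  have "\<pi> ` {..<?n} = {..<?n}"
  proof (intro equalityI subsetI)
    fix j assume "j \<in> {..<?n}"
    then show "j \<in> \<pi> ` {..<?n}" using \<pi>'[of j] by (intro image_eqI[of _ _ "snd (legs \<Delta> ! j)"]) auto
  qed (use \<pi> in auto)
  then have "set (legs (corolla_inv \<Delta>)) = flags \<Delta>"
    unfolding inv fl by (simp add: image_image[symmetric, of "Pair 0" \<pi>] lessThan_atLeast0)
  then have "set (flag_list (corolla_inv \<Delta>)) = flags (corolla_inv \<Delta>)" by (simp add: set_flag_list e flags_def v)
  moreover have "connected_graph (corolla_inv \<Delta>)" using pc(1,2) e v by (simp add: stable_graph_def connected_graph_def adjacent_def)
  ultimately show "corolla_inv \<Delta> \<in> permuted_corollas"
    using pc(1,2) v a e by (simp add: permuted_corollas_def stable_graph_iff)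
  show "graph_insert (corolla_inv \<Delta>) 0 \<Delta> = corolla (genus \<Delta>) (arity \<Delta>)"
  proof (rule graph_eqI)
    show "legs (graph_insert (corolla_inv \<Delta>) 0 \<Delta>) = legs (corolla (genus \<Delta>) (arity \<Delta>))"
      using \<pi> by (auto simp: inv outer_flag_def)
  qed (use pc v e in simp_all)
  show "graph_insert \<Delta> 0 (corolla_inv \<Delta>) = corolla (genus \<Delta>) (arity \<Delta>)"
  proof (rule graph_eqI)
    show "legs (graph_insert \<Delta> 0 (corolla_inv \<Delta>)) = legs (corolla (genus \<Delta>) (arity \<Delta>))"
      using \<pi>' by (intro nth_equalityI) (auto simp: inv outer_flag_def arity_def)
  qed (use pc v e in simp_all)
qed

text \<open>Relabelling the legs is invertible and leaves the vertices alone, so it permutes the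
  terms of the differential and preserves their weights.\<close>

lemma one_edge_graphs_insert:
  assumes "\<Delta> \<in> permuted_corollas" "\<Lambda> \<in> one_edge_graphs (genus \<Delta>) (arity \<Delta>)"
  shows "graph_insert \<Delta> 0 \<Lambda> \<in> one_edge_graphs (genus \<Delta>) (arity \<Delta>)" "verts (graph_insert \<Delta> 0 \<Lambda>) = verts \<Lambda>"
    "graph_insert (corolla_inv \<Delta>) 0 (graph_insert \<Delta> 0 \<Lambda>) = \<Lambda>" "graph_insert \<Delta> 0 (graph_insert (corolla_inv \<Delta>) 0 \<Lambda>) = \<Lambda>"
proof -
  note pc = permuted_corolla[OF assms(1)] and ci = corolla_inv_props[OF assms(1)]
  have L: "stable_graph \<Lambda>" "nedges \<Lambda> = 1" "genus \<Lambda> = genus \<Delta>" "arity \<Lambda> = arity \<Delta>"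
    using assms(2) by (auto simp: one_edge_graphs_def)
  show "verts (graph_insert \<Delta> 0 \<Lambda>) = verts \<Lambda>" using pc(3) by simp
  show "graph_insert \<Delta> 0 \<Lambda> \<in> one_edge_graphs (genus \<Delta>) (arity \<Delta>)"
    using stable_graph_insert[OF pc(1) L(1), of 0] genus_graph_insert[OF pc(1) L(1), of 0] pc L
    by (simp add: one_edge_graphs_def)
  have n: "graph_insert A 0 (graph_insert B 0 \<Lambda>) = graph_insert (graph_insert A 0 B) 0 \<Lambda>"
    if "A \<in> permuted_corollas" "B \<in> permuted_corollas" "arity A = arity B" for A B
    using graph_insert_nested[OF stable_imp_wf[OF permuted_corolla(1)[OF that(1)]], of 0 B 0 \<Lambda>]
      permuted_corolla(3)[OF that(1)] permuted_corolla(3)[OF that(2)] that(3) by simp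
  show "graph_insert (corolla_inv \<Delta>) 0 (graph_insert \<Delta> 0 \<Lambda>) = \<Lambda>"
    using n[OF ci(1) assms(1)] ci(3,6) L(4) by (simp add: corolla_graph_insert)
  show "graph_insert \<Delta> 0 (graph_insert (corolla_inv \<Delta>) 0 \<Lambda>) = \<Lambda>"
    using n[OF assms(1) ci(1)] ci(3,7) L(4) by (simp add: corolla_graph_insert)
qed

text \<open>Representability is asked for the functionals that occur in the differential. For an
  extension by zero it comes from duality in genus 0 and from vanishing in positive genus.\<close>

locale feynman_operad = operad tw UNIV M
  for tw :: bool and M :: "('k::field_char_0, 'a::ab_group_add) opd" +
  assumes representable: "\<And>g n p \<alpha> \<Lambda>. stable g n \<Longrightarrow> \<alpha> \<in> cell (dual M) g n p \<Longrightarrow> \<Lambda> \<in> one_edge_graphs g n \<Longrightarrow>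
    \<exists>t. represents M (verts \<Lambda>) (p + tdeg tw \<Lambda>) t (\<lambda>rs xs. \<alpha> (cmp M \<Lambda> rs xs))"
begin

definition chosen :: "int \<Rightarrow> ('a \<Rightarrow> 'k) \<Rightarrow> graph \<Rightarrow> (int list \<times> ('a \<Rightarrow> 'k) list \<Rightarrow>\<^sub>0 'k)" where
  "chosen p \<alpha> \<Lambda> = (SOME t. represents M (verts \<Lambda>) (p + tdeg tw \<Lambda>) t (\<lambda>rs xs. \<alpha> (cmp M \<Lambda> rs xs)))"

lemma feynman_gen_eq:
  "feynman_gen tw M g n p \<alpha> = sing (corolla g n, [p + 1], [dif (dual M) g n p \<alpha>]) +
     (\<Sum>\<Lambda> \<in> one_edge_graphs g n. fscale (weight \<Lambda> * sg (tdeg tw \<Lambda> * p)) (place \<Lambda> (chosen p \<alpha> \<Lambda>)))"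
  by (simp add: feynman_gen_def chosen_def place_def)

lemma chosen:
  assumes "stable g n" "\<alpha> \<in> cell (dual M) g n p" "\<Lambda> \<in> one_edge_graphs g n"
  shows "(qs, \<alpha>s) \<in> Poly_Mapping.keys (chosen p \<alpha> \<Lambda>) \<Longrightarrow> decorates (dual M) (verts \<Lambda>) qs \<alpha>s \<and> sum_list qs = p + tdeg tw \<Lambda>"
    "decorates M (verts \<Lambda>) rs xs \<Longrightarrow> sum_list rs = - (p + tdeg tw \<Lambda>) \<Longrightarrow> tensor_eval (chosen p \<alpha> \<Lambda>) rs xs = \<alpha> (cmp M \<Lambda> rs xs)"
proof -
  have "represents M (verts \<Lambda>) (p + tdeg tw \<Lambda>) (chosen p \<alpha> \<Lambda>) (\<lambda>rs xs. \<alpha> (cmp M \<Lambda> rs xs))"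
    unfolding chosen_def by (rule someI_ex[OF representable[OF assms]])
  then show "(qs, \<alpha>s) \<in> Poly_Mapping.keys (chosen p \<alpha> \<Lambda>) \<Longrightarrow> decorates (dual M) (verts \<Lambda>) qs \<alpha>s \<and> sum_list qs = p + tdeg tw \<Lambda>"
    "decorates M (verts \<Lambda>) rs xs \<Longrightarrow> sum_list rs = - (p + tdeg tw \<Lambda>) \<Longrightarrow> tensor_eval (chosen p \<alpha> \<Lambda>) rs xs = \<alpha> (cmp M \<Lambda> rs xs)"
    unfolding represents_def by auto
qed

lemma dif_dual_cell:
  assumes "stable g n" "\<alpha> \<in> cell (dual M) g n p"
  shows "dif (dual M) g n p \<alpha> \<in> cell (dual M) g n (p + 1)"
proof -
  interpret V: vector_space "scl M" by (rule ambient)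
  have sub: "V.subspace (cell M g n q)" for q using cell_subspace[of g n q] assms(1) by simp
  have d: "dif M g n (- p - 1) x \<in> cell M g n (- p)" if "x \<in> cell M g n (- p - 1)" for x
    using dif_cell[OF _ assms(1) that] by simp
  have lin: "\<alpha> (dif M g n (- p - 1) (scl M c x + y)) = c * \<alpha> (dif M g n (- p - 1) x) + \<alpha> (dif M g n (- p - 1) y)"
    if "x \<in> cell M g n (- p - 1)" "y \<in> cell M g n (- p - 1)" for c x y
    using dif_linear[OF _ assms(1) that, of c] d[OF that(1)] d[OF that(2)] assms(2) by (simp add: dual_cell)
  have cl: "scl M c x + y \<in> cell M g n (- p - 1)" if "x \<in> cell M g n (- p - 1)" "y \<in> cell M g n (- p - 1)" for c x y
    using sub[of "- p - 1"] that by (simp add: V.subspace_add V.subspace_scale)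
  have e: "- (p + 1) = - p - 1" by simp
  show ?thesis
    unfolding dual_cell e using lin cl by (simp add: dual_def algebra_simps)
qed

lemma in_graphs_UNIV: "\<Delta> \<in> graphs UNIV \<longleftrightarrow> stable_graph \<Delta>"
  by (simp add: graphs_def)

lemma keys_feynman_gen:
  assumes "stable g n" "\<alpha> \<in> cell (dual M) g n p" "k \<in> Poly_Mapping.keys (feynman_gen tw M g n p \<alpha>)"
  shows "k \<in> gens UNIV UNIV (dual M) \<and> vtype k = (g, n) \<and> gdeg (\<not> tw) k = p + 1"
proof -
  let ?A = "{k \<in> gens UNIV UNIV (dual M). vtype k = (g, n) \<and> gdeg (\<not> tw) k = p + 1}"
  have "feynman_gen tw M g n p \<alpha> \<in> {f. Poly_Mapping.keys f \<subseteq> ?A}"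
    unfolding feynman_gen_eq
  proof (intro formal.subspace_add[OF subspace_keys] formal.subspace_sum[OF subspace_keys] formal.subspace_scale[OF subspace_keys])
    show "sing (corolla g n, [p + 1], [dif (dual M) g n p \<alpha>]) \<in> {f. Poly_Mapping.keys f \<subseteq> ?A}"
      using assms(1) dif_dual_cell[OF assms(1,2)] by (simp add: gens_iff gdeg_eq)
    fix \<Lambda> assume L: "\<Lambda> \<in> one_edge_graphs g n"
    have "Poly_Mapping.keys (place \<Lambda> (chosen p \<alpha> \<Lambda>)) \<subseteq> ?A"
      unfolding place_def
    proof (rule keys_lin_ext)
      fix h assume h: "h \<in> Poly_Mapping.keys (chosen p \<alpha> \<Lambda>)"
      then have "decorates (dual M) (verts \<Lambda>) (fst h) (snd h)" "sum_list (fst h) = p + tdeg tw \<Lambda>"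
        using chosen(1)[OF assms(1,2) L, of "fst h" "snd h"] by simp_all
      \<comment> \<open>Exactly one of the two parities puts the single edge in degree 1, so the
        total degree is \<open>p + 1\<close> in either case.\<close>
      moreover have "tdeg tw \<Lambda> + tdeg (\<not> tw) \<Lambda> = 1" using L by (simp add: tdeg_def one_edge_graphs_def)
      ultimately show "Poly_Mapping.keys ((case h of (qs, \<alpha>s) \<Rightarrow> sing (\<Lambda>, qs, \<alpha>s)) :: _ \<Rightarrow>\<^sub>0 'k) \<subseteq> ?A"
        using L by (simp add: case_prod_beta gens_iff gdeg_eq one_edge_graphs_def)
    qed
    then show "place \<Lambda> (chosen p \<alpha> \<Lambda>) \<in> {f. Poly_Mapping.keys f \<subseteq> ?A}" by simp
  qed
  then show ?thesis using assms(3) by blast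
qed

abbreviation FRel where "FRel \<equiv> formal.span (relators (\<not> tw) UNIV UNIV permuted_corollas (dual M))"

text \<open>The chosen tensor of a linear combination need not be the combination of the chosen
  tensors, but the difference has all values 0.\<close>

lemma feynman_gen_linear:
  assumes "stable g n" "\<alpha> \<in> cell (dual M) g n p" "\<beta> \<in> cell (dual M) g n p"
  shows "feynman_gen tw M g n p (scl (dual M) c \<alpha> + \<beta>) - fscale c (feynman_gen tw M g n p \<alpha>) - feynman_gen tw M g n p \<beta> \<in> FRel"
proof -
  let ?\<gamma> = "scl (dual M) c \<alpha> + \<beta>"
  have \<gamma>: "?\<gamma> \<in> cell (dual M) g n p"
    using closed_functions_dual[of M g n p] assms(2,3) by (simp add: closed_functions_def)
  let ?s = "\<lambda>\<gamma>. sing (corolla g n, [p + 1], [dif (dual M) g n p \<gamma>])"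
  have d: "dif (dual M) g n p ?\<gamma> = scl (dual M) c (dif (dual M) g n p \<alpha>) + dif (dual M) g n p \<beta>"
    unfolding dual_simps by (auto simp: dual_def fun_eq_iff algebra_simps)
  \<comment> \<open>The entry \<open>undefined\<close> only provides a slot, since the multilinear
    relators are stated with updated lists.\<close>
  have "(corolla g n, [p + 1], [undefined][0 := dif (dual M) g n p x]) \<in> gens UNIV UNIV (dual M)"
    if "x \<in> cell (dual M) g n p" for x
    using dif_dual_cell[OF assms(1) that] assms(1) by (simp add: gens_iff)
  from relators.multilinear[OF this[OF assms(2)] this[OF assms(3)], of c "\<not> tw" permuted_corollas]
  have 1: "?s ?\<gamma> - fscale c (?s \<alpha>) - ?s \<beta> \<in> FRel"
    by (simp add: d fscale_single formal.span_base del: dual_simps)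
  have 2: "place \<Lambda> (chosen p ?\<gamma> \<Lambda>) - fscale c (place \<Lambda> (chosen p \<alpha> \<Lambda>)) - place \<Lambda> (chosen p \<beta> \<Lambda>) \<in> FRel"
    if L: "\<Lambda> \<in> one_edge_graphs g n" for \<Lambda>
  proof -
    let ?t = "chosen p ?\<gamma> \<Lambda> - fscale c (chosen p \<alpha> \<Lambda>) - chosen p \<beta> \<Lambda>"
    have "place \<Lambda> ?t \<in> FRel"
    proof (rule place_in_relators[where d = "p + tdeg tw \<Lambda>"])
      show "stable_graph \<Lambda>" using L by (simp add: one_edge_graphs_def)
      fix qs \<alpha>s assume "(qs, \<alpha>s) \<in> Poly_Mapping.keys ?t"
      then have "(qs, \<alpha>s) \<in> Poly_Mapping.keys (chosen p ?\<gamma> \<Lambda>) \<or> (qs, \<alpha>s) \<in> Poly_Mapping.keys (chosen p \<alpha> \<Lambda>) \<or>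
          (qs, \<alpha>s) \<in> Poly_Mapping.keys (chosen p \<beta> \<Lambda>)"
        by (auto simp: in_keys_iff lookup_minus lookup_fscale)
      then show "decorates (dual M) (verts \<Lambda>) qs \<alpha>s \<and> sum_list qs = p + tdeg tw \<Lambda>"
        using chosen(1)[OF assms(1) \<gamma> L] chosen(1)[OF assms(1,2) L] chosen(1)[OF assms(1,3) L] by blast
    next
      fix rs xs assume "decorates M (verts \<Lambda>) rs xs" "sum_list rs = - (p + tdeg tw \<Lambda>)"
      then show "tensor_eval ?t rs xs = 0"
        unfolding tensor_eval_diff
        using chosen(2)[OF assms(1) \<gamma> L] chosen(2)[OF assms(1,2) L] chosen(2)[OF assms(1,3) L] by simp
    qed simp_all
    then show ?thesis by (simp add: place_def lin_ext_diff lin_ext_scale)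
  qed
  have "(\<Sum>\<Lambda> \<in> one_edge_graphs g n. fscale (weight \<Lambda> * sg (tdeg tw \<Lambda> * p))
      (place \<Lambda> (chosen p ?\<gamma> \<Lambda>) - fscale c (place \<Lambda> (chosen p \<alpha> \<Lambda>)) - place \<Lambda> (chosen p \<beta> \<Lambda>))) \<in> FRel"
    using 2 by (intro formal.span_sum formal.span_scale)
  from formal.span_add[OF 1 this] show ?thesis
    unfolding feynman_gen_eq
    by (simp add: formal.scale_right_diff_distrib formal.scale_right_distrib sum_subtractf formal.scale_sum_right
        mult.commute mult.left_commute algebra_simps sum.distrib del: dual_simps)
qed

text \<open>The sum over presentations is reindexed by the action of \<open>\<Delta>\<close> on the
  legs; the internal term is covered by a contraction relation.\<close>

lemma feynman_gen_equivariant: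
  assumes \<Delta>: "\<Delta> \<in> permuted_corollas" and y: "y \<in> cell (dual M) (genus \<Delta>) (arity \<Delta>) p"
  shows "feynman_gen tw M (genus \<Delta>) (arity \<Delta>) p (cmp (dual M) \<Delta> [p] [y]) -
     lin_ext (graft_at (\<not> tw) (\<Delta>, [p], [y]) 0) (feynman_gen tw M (genus \<Delta>) (arity \<Delta>) p y) \<in> FRel"
proof -
  let ?g = "genus \<Delta>" and ?n = "arity \<Delta>" and ?D = "corolla_inv \<Delta>"
  note pc = permuted_corolla[OF \<Delta>] and ci = corolla_inv_props[OF \<Delta>]
  note pci = permuted_corolla[OF ci(1)]
  have st: "stable ?g ?n" using pc(1,3) by (simp add: stable_graph_def)
  have D: "?D \<in> graphs UNIV" using pci(1) by (simp add: in_graphs_UNIV)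
  interpret V: vector_space "scl M" by (rule ambient)
  have act: "cmp (dual M) \<Delta> [q] [z] x = (if x \<in> cell M ?g ?n (- q) then z (cmp M ?D [- q] [x]) else 0)" for q z x
    by (simp add: dual_def)
  have Dc: "cmp M ?D [q] [x] \<in> cell M ?g ?n q" if "x \<in> cell M ?g ?n q" for q x
    using cmp_cell[OF D, of "[q]" "[x]"] that ci(2-4) pc(3) pci(4)[of tw] by simp
  have dD: "dif M ?g ?n q (cmp M ?D [q] [x]) = cmp M ?D [q + 1] [dif M ?g ?n q x]" if "x \<in> cell M ?g ?n q" for q x
    using dif_cmp[OF D, of "[q]" "[x]"] that ci(2-4) pc(3) pci(4)[of tw] by simp
  let ?y' = "cmp (dual M) \<Delta> [p] [y]"
  have dy: "dif (dual M) ?g ?n p ?y' = cmp (dual M) \<Delta> [p + 1] [dif (dual M) ?g ?n p y]"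
  proof
    fix x
    show "dif (dual M) ?g ?n p ?y' x = cmp (dual M) \<Delta> [p + 1] [dif (dual M) ?g ?n p y] x"
    proof (cases "x \<in> cell M ?g ?n (- p - 1)")
      case True
      have "dif M ?g ?n (- p - 1) x \<in> cell M ?g ?n (- p)" using dif_cell[OF _ st True] by simp
      then show ?thesis
        using True Dc[OF True] dD[OF True] by (simp add: act) (simp add: dual_def)
    qed (simp add: act, simp add: dual_def)
  qed
  have y'c: "?y' \<in> cell (dual M) ?g ?n p"
  proof -
    have "cmp M ?D [- p] [scl M c x + z] = scl M c (cmp M ?D [- p] [x]) + cmp M ?D [- p] [z]"
      if "x \<in> cell M ?g ?n (- p)" "z \<in> cell M ?g ?n (- p)" for c x z
      using cmp_multilinear[OF D, of 0 "[- p]" "[undefined]" x z c] that ci(2-4) pc(3) by simp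
    moreover have "scl M c x + z \<in> cell M ?g ?n (- p)" if "x \<in> cell M ?g ?n (- p)" "z \<in> cell M ?g ?n (- p)" for c x z
      using cell_subspace[OF _ st, of "- p"] that by (simp add: V.subspace_add V.subspace_scale)
    ultimately show ?thesis using y Dc unfolding dual_cell act by simp
  qed
  let ?dy = "dif (dual M) ?g ?n p y"
  have dyc: "?dy \<in> cell (dual M) ?g ?n (p + 1)" by (rule dif_dual_cell[OF st y])
  have "sing (corolla ?g ?n, [p + 1], [cmp (dual M) \<Delta> [p + 1] [?dy]]) -
      Poly_Mapping.single (graph_insert (corolla ?g ?n) 0 \<Delta>, list_insert 0 [p + 1] [p + 1], list_insert 0 [?dy] [cmp (dual M) \<Delta> [p + 1] [?dy]])
        (sg (tdeg (\<not> tw) \<Delta> * sum_list (take 0 [p + 1]))) \<in> relators (\<not> tw) UNIV UNIV permuted_corollas (dual M)"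
    using \<Delta> pc st dyc dif_dual_cell[OF st y'c] dy by (intro relators.contract) (auto simp: gens_iff in_graphs_UNIV)
  then have 1: "sing (corolla ?g ?n, [p + 1], [dif (dual M) ?g ?n p ?y']) - sing (\<Delta>, [p + 1], [?dy]) \<in> FRel"
    by (simp add: dy corolla_graph_insert formal.span_base)
  have bij: "bij_betw (\<lambda>\<Lambda>. graph_insert \<Delta> 0 \<Lambda>) (one_edge_graphs ?g ?n) (one_edge_graphs ?g ?n)"
  proof (rule bij_betw_byWitness[of _ "\<lambda>\<Lambda>. graph_insert ?D 0 \<Lambda>"])
    show "(\<lambda>\<Lambda>. graph_insert ?D 0 \<Lambda>) ` one_edge_graphs ?g ?n \<subseteq> one_edge_graphs ?g ?n"
      using one_edge_graphs_insert(1)[OF ci(1)] ci(3,4) by auto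
  qed (use one_edge_graphs_insert[OF \<Delta>] in auto)
  \<comment> \<open>The predicates behind the two choices are equal, so \<open>SOME\<close> returns
    the same tensor.\<close>
  have ch: "chosen p ?y' (graph_insert \<Delta> 0 \<Lambda>) = chosen p y \<Lambda>" if L: "\<Lambda> \<in> one_edge_graphs ?g ?n" for \<Lambda>
  proof -
    note o = one_edge_graphs_insert[OF \<Delta> L]
    have st': "stable_graph (graph_insert \<Delta> 0 \<Lambda>)" "genus (graph_insert \<Delta> 0 \<Lambda>) = ?g" "arity (graph_insert \<Delta> 0 \<Lambda>) = ?n"
      using o(1) by (auto simp: one_edge_graphs_def)
    have "?y' (cmp M (graph_insert \<Delta> 0 \<Lambda>) rs xs) = y (cmp M \<Lambda> rs xs)"
      if dec: "decorates M (verts \<Lambda>) rs xs" and s: "sum_list rs = - (p + tdeg tw \<Lambda>)" for rs xs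
    proof -
      let ?c = "cmp M (graph_insert \<Delta> 0 \<Lambda>) rs xs"
      have td: "tdeg tw (graph_insert \<Delta> 0 \<Lambda>) = tdeg tw \<Lambda>" using pc(4)[of tw] by simp
      have c: "?c \<in> cell M ?g ?n (- p)"
        using cmp_cell[of "graph_insert \<Delta> 0 \<Lambda>" rs xs] dec o(2) st' s td by (simp add: in_graphs_UNIV del: graph_insert_simps tdeg_graph_insert)
      have "cmp M ?D [- p] [?c] = scl M (sg (tdeg tw (graph_insert \<Delta> 0 \<Lambda>) * sum_list (take 0 [- p])))
         (cmp M (graph_insert ?D 0 (graph_insert \<Delta> 0 \<Lambda>)) (list_insert 0 rs [- p]) (list_insert 0 xs [?c]))"
      proof (rule cmp_insert[OF D])
        show "graph_insert \<Delta> 0 \<Lambda> \<in> graphs UNIV" using st' by (simp add: in_graphs_UNIV)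
        show "decorates M (verts (graph_insert \<Delta> 0 \<Lambda>)) rs xs" using dec o(2) by simp
        show "[- p] ! 0 = sum_list rs + tdeg tw (graph_insert \<Delta> 0 \<Lambda>)" using s td by simp
        show "decorates M (verts ?D) [- p] [?c]" using c ci(2) pc(3) by simp
        show "verts ?D ! 0 = (genus (graph_insert \<Delta> 0 \<Lambda>), arity (graph_insert \<Delta> 0 \<Lambda>))"
          using ci(2) pc(3) st' by (simp del: graph_insert_simps)
      qed (use ci(2) pc(3) in simp_all)
      then have "cmp M ?D [- p] [?c] = cmp M \<Lambda> rs xs" using o(3) by simp
      then show ?thesis using c by (simp add: act)
    qed
    then have "represents M (verts (graph_insert \<Delta> 0 \<Lambda>)) (p + tdeg tw (graph_insert \<Delta> 0 \<Lambda>)) t (\<lambda>rs xs. ?y' (cmp M (graph_insert \<Delta> 0 \<Lambda>) rs xs)) =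
        represents M (verts \<Lambda>) (p + tdeg tw \<Lambda>) t (\<lambda>rs xs. y (cmp M \<Lambda> rs xs))" for t
      using o(2) pc(4)[of tw] by (auto simp: represents_def simp del: graph_insert_simps)
    then show ?thesis unfolding chosen_def by simp
  qed
  have gp: "lin_ext (graft_at (\<not> tw) (\<Delta>, [p], [y]) 0) (place \<Lambda> t) = place (graph_insert \<Delta> 0 \<Lambda>) t" for \<Lambda> and t :: "int list \<times> ('a \<Rightarrow> 'k) list \<Rightarrow>\<^sub>0 'k"
    unfolding place_def lin_ext_lin_ext by (intro lin_ext_cong) (simp add: graft_at_eq case_prod_beta)
  let ?w = "\<lambda>\<Lambda>. weight \<Lambda> * sg (tdeg tw \<Lambda> * p) :: 'k"
  have "(\<Sum>\<Lambda> \<in> one_edge_graphs ?g ?n. fscale (?w \<Lambda>) (place \<Lambda> (chosen p ?y' \<Lambda>))) =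
      (\<Sum>\<Lambda> \<in> one_edge_graphs ?g ?n. fscale (?w (graph_insert \<Delta> 0 \<Lambda>)) (place (graph_insert \<Delta> 0 \<Lambda>) (chosen p ?y' (graph_insert \<Delta> 0 \<Lambda>))))"
    by (rule sum.reindex_bij_betw[OF bij, symmetric])
  also have "\<dots> = (\<Sum>\<Lambda> \<in> one_edge_graphs ?g ?n. fscale (?w \<Lambda>) (place (graph_insert \<Delta> 0 \<Lambda>) (chosen p y \<Lambda>)))"
  proof (rule sum.cong)
    fix \<Lambda> assume L: "\<Lambda> \<in> one_edge_graphs ?g ?n"
    have "?w (graph_insert \<Delta> 0 \<Lambda>) = ?w \<Lambda>"
      using one_edge_graphs_insert(2)[OF \<Delta> L] pc(4)[of tw] by (simp add: weight_def del: graph_insert_simps)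
    then show "fscale (?w (graph_insert \<Delta> 0 \<Lambda>)) (place (graph_insert \<Delta> 0 \<Lambda>) (chosen p ?y' (graph_insert \<Delta> 0 \<Lambda>))) =
        fscale (?w \<Lambda>) (place (graph_insert \<Delta> 0 \<Lambda>) (chosen p y \<Lambda>))" by (simp only: ch[OF L])
  qed simp
  finally have 2: "(\<Sum>\<Lambda> \<in> one_edge_graphs ?g ?n. fscale (?w \<Lambda>) (place \<Lambda> (chosen p ?y' \<Lambda>))) =
      lin_ext (graft_at (\<not> tw) (\<Delta>, [p], [y]) 0) (\<Sum>\<Lambda> \<in> one_edge_graphs ?g ?n. fscale (?w \<Lambda>) (place \<Lambda> (chosen p y \<Lambda>)))"
    by (simp only: lin_ext_sum lin_ext_scale gp)
  have 3: "lin_ext (graft_at (\<not> tw) (\<Delta>, [p], [y]) 0) (sing (corolla ?g ?n, [p + 1], [?dy])) = sing (\<Delta>, [p + 1], [?dy])"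
    using graph_insert_corolla[OF stable_imp_wf[OF pc(1)], of 0 ?g ?n] pc(3) by (simp add: graft_at_eq)
  show ?thesis using 1 unfolding feynman_gen_eq lin_ext_add 2 3 by simp
qed

text \<open>Makes the Leibniz rule and the descent to classes available for the Feynman
  differential.\<close>

sublocale F: derivation_respects "\<not> tw" UNIV UNIV permuted_corollas "dual M" "feynman_gen tw M"
proof
  show "linear_cells UNIV (dual M)" by (rule linear_cells_dual)
qed (use keys_feynman_gen feynman_gen_linear feynman_gen_equivariant in auto)

end

section \<open>Extension by zero\<close>

lemma genus_0_graph:
  "genus \<Gamma> = 0 \<Longrightarrow> v \<in> set (verts \<Gamma>) \<Longrightarrow> fst v = 0"
  by (auto simp: genus_def)

lemma genus_0_in_graphs: "genus \<Gamma> = 0 \<Longrightarrow> stable_graph \<Gamma> \<Longrightarrow> \<Gamma> \<in> graphs {0}"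
  using genus_0_graph[of \<Gamma>] by (auto simp: graphs_def)

lemma extend_simps [simp]:
  "scl (extend_by_zero \<O>) = scl \<O>" "cell (extend_by_zero \<O>) 0 = cell \<O> 0" "dif (extend_by_zero \<O>) 0 = dif \<O> 0"
  "genus \<Gamma> = 0 \<Longrightarrow> cmp (extend_by_zero \<O>) \<Gamma> = cmp \<O> \<Gamma>" "genus \<Gamma> \<noteq> 0 \<Longrightarrow> cmp (extend_by_zero \<O>) \<Gamma> ps xs = 0"
  by (auto simp: extend_by_zero_def fun_eq_iff)

lemma extend_pos: "g \<noteq> 0 \<Longrightarrow> cell (extend_by_zero \<O>) g n p = {0}" "g \<noteq> 0 \<Longrightarrow> dif (extend_by_zero \<O>) g n p x = 0"
  by (auto simp: extend_by_zero_def)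

lemma decorates_cell_cong:
  "(\<And>v p. v \<in> set vs \<Longrightarrow> cell X (fst v) (snd v) p = cell Y (fst v) (snd v) p) \<Longrightarrow> decorates X vs ps xs = decorates Y vs ps xs"
  by (auto simp: decorates_def)

lemma decorates_extend:
  "(\<And>v. v \<in> set vs \<Longrightarrow> fst v = 0) \<Longrightarrow> decorates (extend_by_zero \<O>) vs ps xs = decorates \<O> vs ps xs"
  by (rule decorates_cell_cong) simp

text \<open>A graph of total genus 0 is a tree whose vertices have genus 0, and there each axiom is
  one of \<open>\<O>\<close>; in positive total genus all compositions vanish.\<close>

lemma operad_extend_by_zero:
  assumes "operad tw {0} \<O>"
  shows "operad tw UNIV (extend_by_zero \<O>)"
proof -
  interpret operad tw "{0}" \<O> by (rule assms)
  interpret V: vector_space "scl \<O>" by (rule ambient)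
  let ?E = "extend_by_zero \<O>"
  have G: "\<Gamma> \<in> graphs {0}" if "\<Gamma> \<in> graphs UNIV" "genus \<Gamma> = 0" for \<Gamma>
    using that genus_0_in_graphs by (auto simp: graphs_def)
  have dec: "decorates ?E (verts \<Gamma>) ps xs = decorates \<O> (verts \<Gamma>) ps xs" if "genus \<Gamma> = 0" for \<Gamma> ps xs
    using genus_0_graph[OF that] by (rule decorates_extend)
  have v0: "fst (verts \<Gamma> ! i) = 0" if "genus \<Gamma> = 0" "i < nverts \<Gamma>" for \<Gamma> i
    using genus_0_graph[OF that(1) nth_mem[OF that(2)]] .
  show ?thesis
  proof
    fix g n p assume st: "stable g n"
    show "module.subspace (scl ?E) (cell ?E g n p)"
      unfolding extend_simps using cell_subspace[OF _ st] by (cases "g = 0") (auto simp: extend_pos V.subspace_0 V.subspace_def)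
    show "dif ?E g n p x \<in> cell ?E g n (p + 1)" if "x \<in> cell ?E g n p" for x
      using dif_cell[OF _ st] that by (cases "g = 0") (auto simp: extend_pos)
    show "dif ?E g n p (scl ?E c x + y) = scl ?E c (dif ?E g n p x) + dif ?E g n p y"
      if "x \<in> cell ?E g n p" "y \<in> cell ?E g n p" for c x y
      using dif_linear[OF _ st] that by (cases "g = 0") (auto simp: extend_pos)
    show "dif ?E g n (p + 1) (dif ?E g n p x) = 0" if "x \<in> cell ?E g n p" for x
      using dif_dif[OF _ st] that by (cases "g = 0") (auto simp: extend_pos)
    show "cmp ?E (corolla g n) [p] [x] = x" if "x \<in> cell ?E g n p" for x
      using cmp_corolla[OF _ st] that by (cases "g = 0") (auto simp: extend_pos)
  next
    fix \<Gamma> ps xs assume \<Gamma>: "\<Gamma> \<in> graphs UNIV" and d: "decorates ?E (verts \<Gamma>) ps xs"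
    show "cmp ?E \<Gamma> ps xs \<in> cell ?E (genus \<Gamma>) (arity \<Gamma>) (sum_list ps + tdeg tw \<Gamma>)"
      using cmp_cell[OF G[OF \<Gamma>], of ps xs] dec[of \<Gamma>] d by (cases "genus \<Gamma> = 0") (auto simp: extend_pos)
    show "cmp ?E (swap_verts i \<Gamma>) (swap_at i ps) (swap_at i xs) = scl ?E (sg (ps ! i * ps ! Suc i)) (cmp ?E \<Gamma> ps xs)"
      if "Suc i < nverts \<Gamma>" for i
      using cmp_swap_verts[OF G[OF \<Gamma>], of ps xs] dec[of \<Gamma>] d that by (cases "genus \<Gamma> = 0") (auto simp: swap_verts_simps)
    show "cmp ?E (swap_edges i \<Gamma>) ps xs = scl ?E (if tw then - 1 else 1) (cmp ?E \<Gamma> ps xs)" if "Suc i < nedges \<Gamma>" for i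
      using cmp_swap_edges[OF G[OF \<Gamma>], of ps xs] dec[of \<Gamma>] d that by (cases "genus \<Gamma> = 0") auto
    show "cmp ?E (flip_edge i \<Gamma>) ps xs = cmp ?E \<Gamma> ps xs" if "i < nedges \<Gamma>" for i
      using cmp_flip_edge[OF G[OF \<Gamma>], of ps xs] dec[of \<Gamma>] d that by (cases "genus \<Gamma> = 0") auto
    show "dif ?E (genus \<Gamma>) (arity \<Gamma>) (sum_list ps + tdeg tw \<Gamma>) (cmp ?E \<Gamma> ps xs) =
        (\<Sum>i < nverts \<Gamma>. scl ?E (sg (tdeg tw \<Gamma> + sum_list (take i ps)))
          (cmp ?E \<Gamma> (ps[i := ps ! i + 1]) (xs[i := dif ?E (fst (verts \<Gamma> ! i)) (snd (verts \<Gamma> ! i)) (ps ! i) (xs ! i)])))"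
    proof (cases "genus \<Gamma> = 0")
      case True
      then show ?thesis using dif_cmp[OF G[OF \<Gamma> True], of ps xs] dec[OF True] d v0[OF True] by simp
    qed (simp add: extend_pos)
    fix i \<Delta> qs ys assume *: "\<Delta> \<in> graphs UNIV" "i < nverts \<Gamma>" "verts \<Gamma> ! i = (genus \<Delta>, arity \<Delta>)"
      "decorates ?E (verts \<Delta>) qs ys" "ps ! i = sum_list qs + tdeg tw \<Delta>" "xs ! i = cmp ?E \<Delta> qs ys"
    \<comment> \<open>Insertion preserves the total genus, so both sides are compositions in
      \<open>\<O>\<close> or both are 0.\<close>
    have gi: "genus (graph_insert \<Gamma> i \<Delta>) = genus \<Gamma>"
      using \<Gamma> * by (intro genus_graph_insert) (auto simp: graphs_def)
    show "cmp ?E \<Gamma> ps xs = scl ?E (sg (tdeg tw \<Delta> * sum_list (take i ps)))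
        (cmp ?E (graph_insert \<Gamma> i \<Delta>) (list_insert i qs ps) (list_insert i ys xs))"
    proof (cases "genus \<Gamma> = 0")
      case True
      then have g\<Delta>: "genus \<Delta> = 0" using v0[OF True *(2)] *(3) by simp
      show ?thesis
        using cmp_insert[OF G[OF \<Gamma> True] G[OF *(1) g\<Delta>] *(2,3)] * d dec[OF True] dec[OF g\<Delta>] True g\<Delta> gi by simp
    qed (simp add: gi)
  next
    fix \<Gamma> ps xs i c x y assume \<Gamma>: "\<Gamma> \<in> graphs UNIV" and i: "i < nverts \<Gamma>"
      and d: "decorates ?E (verts \<Gamma>) ps (xs[i := x])" "decorates ?E (verts \<Gamma>) ps (xs[i := y])"
    show "cmp ?E \<Gamma> ps (xs[i := scl ?E c x + y]) = scl ?E c (cmp ?E \<Gamma> ps (xs[i := x])) + cmp ?E \<Gamma> ps (xs[i := y])"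
      using cmp_multilinear[OF G[OF \<Gamma>] i, of ps xs x y c] dec[of \<Gamma>] d by (cases "genus \<Gamma> = 0") auto
  qed (simp_all add: V.scale_right_distrib V.scale_left_distrib)
qed

text \<open>A functional on the zero space vanishes there by linearity, and elsewhere by the
  convention for dual cells.\<close>

lemma dual_extend_pos:
  fixes \<O> :: "('k::field_char_0, 'a::ab_group_add) opd"
  assumes "g \<noteq> 0" "vector_space (scl \<O>)"
  shows "cell (dual (extend_by_zero \<O>)) g n p = {\<lambda>x. 0}"
proof -
  interpret V: vector_space "scl \<O>" by (rule assms(2))
  have "\<alpha> = (\<lambda>x. 0)" if \<alpha>: "\<alpha> \<in> cell (dual (extend_by_zero \<O>)) g n p" for \<alpha>
  proof
    fix x
    have "\<forall>c. \<alpha> (scl \<O> c 0 + 0) = c * \<alpha> 0 + \<alpha> 0"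
      using \<alpha> assms unfolding dual_cell by (simp add: extend_pos)
    then have "\<alpha> 0 = 1 * \<alpha> 0 + \<alpha> 0" by (metis V.scale_zero_right add.right_neutral)
    then show "\<alpha> x = 0" using \<alpha> assms unfolding dual_cell by (cases "x = 0") (simp_all add: extend_pos)
  qed
  moreover have "(\<lambda>x. 0) \<in> cell (dual (extend_by_zero \<O>)) g n p" by (simp add: dual_cell)
  ultimately show ?thesis by blast
qed

lemma dual_extend_0:
  "cell (dual (extend_by_zero \<O>)) 0 = cell (dual \<O>) 0" "dif (dual (extend_by_zero \<O>)) 0 = dif (dual \<O>) 0"
  "scl (dual (extend_by_zero \<O>)) = scl (dual \<O>)"
  "\<Delta> \<in> permuted_corollas \<Longrightarrow> genus \<Delta> = 0 \<Longrightarrow> cmp (dual (extend_by_zero \<O>)) \<Delta> = cmp (dual \<O>) \<Delta>"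
  using corolla_inv_props(4)[of \<Delta>] by (simp_all add: dual_def fun_eq_iff)

lemma decorates_dual_extend:
  "(\<And>v. v \<in> set vs \<Longrightarrow> fst v = 0) \<Longrightarrow> decorates (dual (extend_by_zero \<O>)) vs ps xs = decorates (dual \<O>) vs ps xs"
  by (rule decorates_cell_cong) (simp add: dual_extend_0)

lemma represents_extend:
  assumes "\<And>v. v \<in> set vs \<Longrightarrow> fst v = 0"
  shows "represents (extend_by_zero \<O>) vs d t F = represents \<O> vs d t F"
  by (simp add: represents_def decorates_extend decorates_dual_extend assms)

lemma feynman_operad_extend:
  fixes \<O> :: "('k::field_char_0, 'a::ab_group_add) opd"
  assumes "operad tw {0} \<O>" "duality_compatible {0} \<O>"
  shows "feynman_operad tw (extend_by_zero \<O>)"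
proof -
  interpret operad tw "{0}" \<O> by (rule assms(1))
  interpret E: operad tw UNIV "extend_by_zero \<O>" by (rule operad_extend_by_zero[OF assms(1)])
  show ?thesis
  proof
    fix g n p and \<alpha> :: "'a \<Rightarrow> 'k" and \<Lambda>
    assume st: "stable g n" and \<alpha>: "\<alpha> \<in> cell (dual (extend_by_zero \<O>)) g n p" and L: "\<Lambda> \<in> one_edge_graphs g n"
    let ?F = "\<lambda>rs xs. \<alpha> (cmp (extend_by_zero \<O>) \<Lambda> rs xs)"
    have \<Lambda>: "stable_graph \<Lambda>" "genus \<Lambda> = g" "arity \<Lambda> = n" using L by (auto simp: one_edge_graphs_def)
    show "\<exists>t. represents (extend_by_zero \<O>) (verts \<Lambda>) (p + tdeg tw \<Lambda>) t ?F"
    proof (cases "g = 0")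
      case False
      then have "\<alpha> = (\<lambda>x. 0)" using \<alpha> dual_extend_pos[OF False ambient] by simp
      then have "represents (extend_by_zero \<O>) (verts \<Lambda>) (p + tdeg tw \<Lambda>) 0 ?F"
        by (simp add: represents_def tensor_eval_def)
      then show ?thesis by blast
    next
      case True
      then have g0: "genus \<Lambda> = 0" using \<Lambda>(2) by simp
      note v0 = genus_0_graph[OF g0]
      have \<Lambda>0: "\<Lambda> \<in> graphs {0}" using genus_0_in_graphs[OF g0 \<Lambda>(1)] .
      have "graded_multilinear \<O> (verts \<Lambda>) (p + tdeg tw \<Lambda>) ?F"
        unfolding graded_multilinear_def
      proof (intro allI impI)
        fix rs xs i c x y
        assume *: "sum_list rs = - (p + tdeg tw \<Lambda>) \<and> i < nverts \<Lambda> \<and>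
          decorates \<O> (verts \<Lambda>) rs (xs[i := x]) \<and> decorates \<O> (verts \<Lambda>) rs (xs[i := y])"
        have "cmp \<O> \<Lambda> rs (xs[i := z]) \<in> cell \<O> 0 n (- p)" if "decorates \<O> (verts \<Lambda>) rs (xs[i := z])" for z
          using cmp_cell[OF \<Lambda>0 that] * \<Lambda> True by simp
        then show "?F rs (xs[i := scl \<O> c x + y]) = c * ?F rs (xs[i := x]) + ?F rs (xs[i := y])"
          using cmp_multilinear[OF \<Lambda>0, of i rs xs x y c] * \<alpha> True g0 by (simp add: dual_cell dual_extend_0)
      qed
      moreover have "\<forall>(g, n) \<in> set (verts \<Lambda>). g \<in> {0} \<and> stable g n"
        using v0 \<Lambda>(1) by (force simp: stable_graph_def)
      ultimately obtain t where "represents \<O> (verts \<Lambda>) (p + tdeg tw \<Lambda>) t ?F"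
        using assms(2) unfolding duality_compatible_def by blast
      then show ?thesis using represents_extend[OF v0] by blast
    qed
  qed
qed

text \<open>An equality of formal sums and not merely of classes: on graphs of genus 0 the
  predicates from which the tensors are chosen coincide.\<close>

lemma feynman_gen_extend: "feynman_gen tw (extend_by_zero \<O>) 0 n p \<alpha> = feynman_gen tw \<O> 0 n p \<alpha>"
proof -
  have "represents (extend_by_zero \<O>) (verts \<Lambda>) d t (\<lambda>rs xs. \<alpha> (cmp (extend_by_zero \<O>) \<Lambda> rs xs)) =
      represents \<O> (verts \<Lambda>) d t (\<lambda>rs xs. \<alpha> (cmp \<O> \<Lambda> rs xs))" if "\<Lambda> \<in> one_edge_graphs 0 n" for \<Lambda> d t
  proof -
    have "genus \<Lambda> = 0" using that by (simp add: one_edge_graphs_def)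
    then show ?thesis using represents_extend[OF genus_0_graph] by simp
  qed
  then show ?thesis unfolding feynman_gen_def dual_extend_0 by simp
qed

section \<open>Quotients\<close>

lemma quot_span:
  fixes S :: "('c \<Rightarrow>\<^sub>0 'k::field_char_0) set"
  shows "flinear (quot (formal.span S))" "x - quot (formal.span S) x \<in> formal.span S"
    "quot (formal.span S) x = quot (formal.span S) y \<longleftrightarrow> x - y \<in> formal.span S"
proof -
  note q = quot[OF formal.subspace_span[of S]]
  show l: "flinear (quot (formal.span S))" by (rule q(1))
  have "quot (formal.span S) (x - quot (formal.span S) x) = 0"
    using q(2) by (simp add: flinear_diff[OF l])
  then show "x - quot (formal.span S) x \<in> formal.span S" using q(3) by blast
  show "quot (formal.span S) x = quot (formal.span S) y \<longleftrightarrow> x - y \<in> formal.span S"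
    using q(3)[of "x - y"] by (simp add: flinear_diff[OF l])
qed

section \<open>Comparison of multilinear extensions\<close>

lemma ml_lin_ext_swap:
  "ml (as @ f # g # bs) G = ml (as @ g # f # bs) (\<lambda>hs. G (swap_at (length as) hs))"
proof -
  have "ml as (\<lambda>a. lin_ext (\<lambda>h. lin_ext (\<lambda>k. ml bs (\<lambda>b. G (a @ h # k # b))) g) f) =
      ml as (\<lambda>a. lin_ext (\<lambda>k. lin_ext (\<lambda>h. ml bs (\<lambda>b. G (swap_at (length as) (a @ k # h # b)))) f) g)"
  proof (rule ml_cong)
    fix a assume "in_keys a as"
    then have len: "length as = length a" by (simp add: list_all2_lengthD)
    show "lin_ext (\<lambda>h. lin_ext (\<lambda>k. ml bs (\<lambda>b. G (a @ h # k # b))) g) f =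
        lin_ext (\<lambda>k. lin_ext (\<lambda>h. ml bs (\<lambda>b. G (swap_at (length as) (a @ k # h # b)))) f) g"
      unfolding len swap_at_append using ml_lin_ext_commute[of "[f]" "\<lambda>k hs. ml bs (\<lambda>b. G (a @ hd hs # k # b))" g] by simp
  qed
  then show ?thesis by (simp add: ml_append)
qed

lemma ml_fun_diff: "ml fs (\<lambda>hs. G hs - K hs) = ml fs G - ml fs K"
  by (induction fs arbitrary: G K) (simp_all add: lin_ext_fun_diff)

lemma ml_diff_in:
  assumes "formal.subspace S" "\<And>hs. in_keys hs fs \<Longrightarrow> fscale c (G hs) - fscale d (K hs) \<in> S"
  shows "fscale c (ml fs G) - fscale d (ml fs K) \<in> S"
  using ml_in_subspace[OF assms(1), of fs "\<lambda>hs. fscale c (G hs) - fscale d (K hs)"] assms(2)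
  by (simp add: ml_fun_diff ml_fun_scale)

section \<open>The free objects, the envelope and their relations\<close>

locale corollary_setting =
  fixes tw :: bool and \<O> :: "('k::field_char_0, 'a::ab_group_add) opd"
  assumes cyclic: "operad tw {0} \<O>" and duality: "duality_compatible {0} \<O>"
begin

abbreviation "V \<equiv> dual \<O>"
abbreviation "V' \<equiv> dual (extend_by_zero \<O>)"
abbreviation "P \<equiv> feynman tw {0} \<O>"
abbreviation "L \<equiv> modular_envelope (\<not> tw) P"
abbreviation "R \<equiv> feynman tw UNIV (extend_by_zero \<O>)"
abbreviation "RelP \<equiv> formal.span (relators (\<not> tw) {0} {0} permuted_corollas V)"
abbreviation "RelL \<equiv> formal.span (relators (\<not> tw) {0} UNIV (graphs {0}) P)"
abbreviation "RelR \<equiv> formal.span (relators (\<not> tw) UNIV UNIV permuted_corollas V')"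
abbreviation "clsP \<equiv> quot RelP"
abbreviation "clsL \<equiv> quot RelL"
abbreviation "clsR \<equiv> quot RelR"
abbreviation "gensP \<equiv> gens {0} {0} V"
abbreviation "gensL \<equiv> gens {0} UNIV P"
abbreviation "gensR \<equiv> gens UNIV UNIV V'"

sublocale E: feynman_operad tw "extend_by_zero \<O>"
  by (rule feynman_operad_extend[OF cyclic duality])

lemma ambient_O: "vector_space (scl \<O>)"
  using operad.ambient[OF cyclic] .

definition "homP g n p = {f :: ('a \<Rightarrow> 'k) gen \<Rightarrow>\<^sub>0 'k. Poly_Mapping.keys f \<subseteq>
  {h \<in> gensP. vtype h = (g, n) \<and> gdeg (\<not> tw) h = p}}"

lemma P_simps:
  "scl P = fscale" "cell P g n p = clsP ` homP g n p" "dif P g n p f = clsP (lin_ext (derivation (\<not> tw) (feynman_gen tw \<O>)) f)"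
  "cmp P \<Gamma> ps fs = clsP (graft_sums (\<not> tw) \<Gamma> ps fs)"
  by (auto simp: feynman_def kan_extension_def Let_def homP_def subset_iff intro!: arg_cong[of _ _ "(`) clsP"] simp del: split_paired_All)

definition "homL g n p = {F. Poly_Mapping.keys F \<subseteq> {h \<in> gensL. vtype h = (g, n) \<and> gdeg (\<not> tw) h = p}}"
definition "homR g n p = {f. Poly_Mapping.keys f \<subseteq> {h \<in> gensR. vtype h = (g, n) \<and> gdeg (\<not> tw) h = p}}"

definition "dL = derivation (\<not> tw) (\<lambda>g n p x. Poly_Mapping.single (corolla g n, [p + 1], [dif P g n p x]) (1 :: 'k))"

lemma L_simps:
  "scl L = fscale" "cell L g n p = clsL ` homL g n p" "dif L g n p F = clsL (lin_ext dL F)"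
  "cmp L \<Gamma> ps Fs = clsL (graft_sums (\<not> tw) \<Gamma> ps Fs)"
  by (auto simp: modular_envelope_def kan_extension_def Let_def homL_def dL_def subset_iff intro!: arg_cong[of _ _ "(`) clsL"] simp del: split_paired_All)

lemma R_simps:
  "scl R = fscale" "cell R g n p = clsR ` homR g n p"
  "dif R g n p f = clsR (lin_ext (derivation (\<not> tw) (feynman_gen tw (extend_by_zero \<O>))) f)"
  "cmp R \<Gamma> ps fs = clsR (graft_sums (\<not> tw) \<Gamma> ps fs)"
  by (auto simp: feynman_def kan_extension_def Let_def homR_def subset_iff intro!: arg_cong[of _ _ "(`) clsR"] simp del: split_paired_All)

text \<open>Total genus 0 forces all vertex genera to be 0, where \<open>extend_by_zero\<close>
  changes nothing.\<close>

lemma gensP_iff: "h \<in> gensP \<longleftrightarrow> h \<in> gensR \<and> genus (fst h) = 0"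
proof (cases "genus (fst h) = 0")
  case True
  note v0 = genus_0_graph[OF True]
  have "decorates V' (verts (fst h)) (fst (snd h)) (snd (snd h)) = decorates V (verts (fst h)) (fst (snd h)) (snd (snd h))"
    by (rule decorates_dual_extend[OF v0])
  then show ?thesis using True v0 by (auto simp: gens_iff)
qed (simp add: gens_iff)

lemma gensP_R: "gensP \<subseteq> gensR" using gensP_iff by blast

text \<open>Trees are graphs with the same labels, so a relation in the cyclic free object is one in
  the modular free object; \<open>Phi\<close> may therefore ignore the choice of
  representatives.\<close>

lemma RelP_R: "RelP \<subseteq> RelR"
proof (rule formal.span_mono, rule subsetI)
  fix r assume "r \<in> relators (\<not> tw) {0} {0} permuted_corollas V"
  then show "r \<in> relators (\<not> tw) UNIV UNIV permuted_corollas V'"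
  proof cases
    case (multilinear \<Gamma> ps xs i x y c)
    have s: "scl V = scl V'" by (simp add: dual_extend_0(3))
    show ?thesis unfolding multilinear(1) s
      using multilinear gensP_R by (intro relators.multilinear) auto
  next
    case (verts \<Gamma> ps xs i)
    show ?thesis unfolding verts(1) using verts gensP_R by (intro relators.verts) auto
  next
    case (edges \<Gamma> ps xs i)
    show ?thesis unfolding edges(1) using edges gensP_R by (intro relators.edges) auto
  next
    case (flip \<Gamma> ps xs i)
    show ?thesis unfolding flip(1) using flip gensP_R by (intro relators.flip) auto
  next
    case (contract \<Gamma> ps xs i \<Delta> qs ys)
    have g: "genus \<Delta> = 0" "\<Delta> \<in> permuted_corollas" using contract(4) by (auto simp: graphs_def)
    have dec: "decorates V' (verts \<Delta>) qs ys = decorates V (verts \<Delta>) qs ys"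
      by (rule decorates_dual_extend[OF genus_0_graph[OF g(1)]])
    show ?thesis unfolding contract(1)
      using contract gensP_R dual_extend_0(4)[OF g(2,1), of \<O>] dec
      by (intro relators.contract) (auto simp: graphs_def)
  qed
qed

lemmas clsP = quot_span[where S = "relators (\<not> tw) {0} {0} permuted_corollas V"]
  and clsL = quot_span[where S = "relators (\<not> tw) {0} UNIV (graphs {0}) P"]
  and clsR = quot_span[where S = "relators (\<not> tw) UNIV UNIV permuted_corollas V'"]

lemma subspace_homP: "formal.subspace (homP g n p)"
  unfolding homP_def by (rule subspace_keys)

lemma linear_cells_P: "linear_cells {0} P"
proof -
  have "fscale c x + y \<in> clsP ` homP g n p" if xy: "x \<in> clsP ` homP g n p" "y \<in> clsP ` homP g n p" for c x y g n p
  proof -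
    obtain f f' where f: "x = clsP f" "f \<in> homP g n p" "y = clsP f'" "f' \<in> homP g n p" using xy by blast
    have "fscale c x + y = clsP (fscale c f + f')" by (simp add: f flinear_add[OF clsP(1)] flinear_scale[OF clsP(1)])
    moreover have "fscale c f + f' \<in> homP g n p"
      using f subspace_homP by (intro formal.subspace_add formal.subspace_scale)
    ultimately show ?thesis by blast
  qed
  then show ?thesis by (simp add: linear_cells_def P_simps)
qed

text \<open>The representative selected by \<open>quot\<close> is arbitrary, but it differs from
  \<open>f\<close> by relations, which are supported on generators.\<close>

lemma keys_clsP: "Poly_Mapping.keys f \<subseteq> gensP \<Longrightarrow> Poly_Mapping.keys (clsP f) \<subseteq> gensP"
proof -
  assume f: "Poly_Mapping.keys f \<subseteq> gensP"
  have "Poly_Mapping.keys (f - clsP f) \<subseteq> gensP" by (rule span_relators_keys[OF linear_cells_dual clsP(2)])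
  then show ?thesis using f Poly_Mapping.keys_diff[of f "f - clsP f"] by fastforce
qed

lemma cellP_keys: "x \<in> cell P g n p \<Longrightarrow> Poly_Mapping.keys x \<subseteq> gensP"
  unfolding P_simps using keys_clsP by (auto simp: homP_def)

lemma gensL_keys:
  assumes "h \<in> gensL" "f \<in> set (snd (snd h))"
  shows "Poly_Mapping.keys f \<subseteq> gensP"
proof -
  have dec: "decorates P (verts (fst h)) (fst (snd h)) (snd (snd h))" using assms(1) by (simp add: gens_iff)
  obtain i where i: "i < length (snd (snd h))" "snd (snd h) ! i = f" using assms(2) by (auto simp: in_set_conv_nth)
  then have "i < nverts (fst h)" using decorates_lengths[OF dec] by simp
  from decorates_nth[OF dec this] show ?thesis unfolding i(2) by (rule cellP_keys)
qed

end

section \<open>From the envelope to the Feynman transform\<close>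

lemma map_swap_at: "Suc i < length xs \<Longrightarrow> map f (swap_at i xs) = swap_at i (map f xs)"
  by (simp add: swap_at_def map_update)

lemma swap_at_eq_iff:
  "Suc i < length xs \<Longrightarrow> length xs = length ys \<Longrightarrow> swap_at i xs = swap_at i ys \<longleftrightarrow> xs = ys"
  by (metis swap_at_swap_at)

lemma fits_swap:
  assumes "Suc i < nverts \<Gamma>" "length ps = nverts \<Gamma>" "length hs = nverts \<Gamma>"
  shows "fits tw (swap_verts i \<Gamma>) (swap_at i ps) (swap_at i hs) \<longleftrightarrow> fits tw \<Gamma> ps hs"
proof -
  have "map (gdeg tw) (swap_at i hs) = swap_at i (map (gdeg tw) hs)" "map vtype (swap_at i hs) = swap_at i (map vtype hs)"
    using assms by (simp_all add: map_swap_at)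
  then show ?thesis using assms unfolding fits_iff swap_verts_simps(1)[OF assms(1)]
    by (simp only: swap_at_eq_iff length_map)
qed

text \<open>If the middle part of the tuple fits the inserted graph, then its graft has the type and
  degree of the slot; this separates the two conditions.\<close>

lemma fits_graph_insert:
  assumes "verts \<Gamma> = vs @ (genus \<Delta>, arity \<Delta>) # vs'" "length vs = length as" "length vs' = length bs"
    "length ps = length as" "length ps' = length bs" "length qs = nverts \<Delta>" "length ks = nverts \<Delta>"
    "p = sum_list qs + tdeg tw \<Delta>" "stable_graph \<Delta>" "set ks \<subseteq> gens Is UNIV X"
  shows "fits tw (graph_insert \<Gamma> (length as) \<Delta>) (ps @ qs @ ps') (as @ ks @ bs) \<longleftrightarrow>
    fits tw \<Delta> qs ks \<and> fits tw \<Gamma> (ps @ p # ps') (as @ graft_gen \<Delta> ks # bs)"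
proof -
  have v: "verts (graph_insert \<Gamma> (length as) \<Delta>) = vs @ verts \<Delta> @ vs'"
    using assms(1,2) by (simp add: list_insert_def)
  have "vtype (graft_gen \<Delta> ks) = (genus \<Delta>, arity \<Delta>) \<and> gdeg tw (graft_gen \<Delta> ks) = p" if "fits tw \<Delta> qs ks"
    using graft_gen_in_gens(2,3)[OF assms(9) UNIV_I _ assms(10)] that assms(8) by (simp add: fits_iff gsum_def)
  moreover have "fits tw (graph_insert \<Gamma> (length as) \<Delta>) (ps @ qs @ ps') (as @ ks @ bs) \<longleftrightarrow>
    fits tw \<Delta> qs ks \<and> ps = map (gdeg tw) as \<and> ps' = map (gdeg tw) bs \<and> vs = map vtype as \<and> vs' = map vtype bs"
    unfolding fits_iff v map_append using assms(2-7) by (auto simp: append_eq_append_conv)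
  ultimately show ?thesis using assms(2-5) unfolding fits_iff assms(1) by (auto simp: append_eq_append_conv)
qed

context corollary_setting
begin

text \<open>A label is a formal sum of trees, so inserting the labels means composing them by
  multilinear expansion.\<close>

definition Phi :: "(('a \<Rightarrow> 'k) gen \<Rightarrow>\<^sub>0 'k) gen \<Rightarrow> (('a \<Rightarrow> 'k) gen \<Rightarrow>\<^sub>0 'k)" where
  "Phi h = graft_sums (\<not> tw) (fst h) (fst (snd h)) (snd (snd h))"

lemma Phi_eq: "Phi (\<Gamma>, ps, fs) = ml fs (\<lambda>hs. if fits (\<not> tw) \<Gamma> ps hs then graft (\<not> tw) \<Gamma> hs else 0)"
  by (simp add: Phi_def graft_sums_eq_ml)

lemma keys_Phi:
  assumes "h \<in> gensL"
  shows "Poly_Mapping.keys (Phi h) \<subseteq> {k \<in> gensR. vtype k = vtype h \<and> gdeg (\<not> tw) k = gdeg (\<not> tw) h}"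
proof -
  have "Poly_Mapping.keys f \<subseteq> gensR" if "f \<in> set (snd (snd h))" for f
    using gensL_keys[OF assms that] gensP_R by blast
  from keys_graft_sums[where tw = "\<not> tw" and ps = "fst (snd h)", OF gens_stable[OF assms] UNIV_I this]
  show ?thesis by (simp add: Phi_def gdeg_eq)
qed

lemma subspace_RelR: "formal.subspace RelR" and subspace_RelL: "formal.subspace RelL" and subspace_RelP: "formal.subspace RelP"
  by (rule formal.subspace_span)+

lemma RelR_diff_sym: "x - y \<in> RelR \<Longrightarrow> y - x \<in> RelR"
  using formal.span_neg[of "x - y"] by fastforce

lemma RelR_trans: "x - y \<in> RelR \<Longrightarrow> y - z \<in> RelR \<Longrightarrow> x - z \<in> RelR"
  using formal.span_add[of "x - y" _ "y - z"] by fastforce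

text \<open>The label of the contracted vertex is the class of a composite in \<open>P\<close>.
  After passing to its representative, the claim is associativity of grafting for each tuple of
  trees.\<close>

lemma Phi_contract:
  assumes h: "(\<Gamma>, ps, xs) \<in> gensL" and i: "i < nverts \<Gamma>" and \<Delta>: "\<Delta> \<in> graphs {0}" "verts \<Gamma> ! i = (genus \<Delta>, arity \<Delta>)"
    and y: "decorates P (verts \<Delta>) qs ys" "ps ! i = sum_list qs + tdeg (\<not> tw) \<Delta>" "xs ! i = cmp P \<Delta> qs ys"
  shows "Phi (\<Gamma>, ps, xs) - fscale (sg (tdeg (\<not> tw) \<Delta> * sum_list (take i ps)))
    (Phi (graph_insert \<Gamma> i \<Delta>, list_insert i qs ps, list_insert i ys xs)) \<in> RelR"
proof -
  let ?t = "\<not> tw" and ?as = "take i xs" and ?bs = "drop (Suc i) xs"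
  let ?T = "\<lambda>hs. if fits ?t \<Gamma> ps hs then graft ?t \<Gamma> hs else (0 :: ('a \<Rightarrow> 'k) gen \<Rightarrow>\<^sub>0 'k)"
  let ?T' = "\<lambda>hs. if fits ?t (graph_insert \<Gamma> i \<Delta>) (list_insert i qs ps) hs then graft ?t (graph_insert \<Gamma> i \<Delta>) hs else (0 :: ('a \<Rightarrow> 'k) gen \<Rightarrow>\<^sub>0 'k)"
  have len: "length ps = nverts \<Gamma>" "length xs = nverts \<Gamma>" using gens_lengths[OF h] by simp_all
  have len\<Delta>: "length qs = nverts \<Delta>" "length ys = nverts \<Delta>" using decorates_lengths[OF y(1)] by simp_all
  have st: "stable_graph \<Gamma>" "stable_graph \<Delta>" using gens_stable[OF h] \<Delta>(1) by (simp_all add: graphs_def)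
  have kx: "Poly_Mapping.keys f \<subseteq> gensR" if "f \<in> set xs" for f
    using gensL_keys[OF h] that gensP_R by fastforce
  have kas: "Poly_Mapping.keys f \<subseteq> gensR" if "f \<in> set ?as \<union> set ?bs" for f
    using kx that set_take_subset[of i xs] set_drop_subset[of "Suc i" xs] by blast
  have ky: "Poly_Mapping.keys f \<subseteq> gensR" if f: "f \<in> set ys" for f
  proof -
    obtain j where "j < nverts \<Delta>" "ys ! j = f" using f len\<Delta> by (metis in_set_conv_nth)
    then show ?thesis using cellP_keys decorates_nth[OF y(1)] gensP_R by blast
  qed
  define w where "w = graft_sums ?t \<Delta> qs ys"
  have xs: "xs = ?as @ clsP w # ?bs"
    using id_take_nth_drop[of i xs] len i y(3) by (simp add: P_simps w_def)
  have ps: "ps = take i ps @ ps ! i # drop (Suc i) ps" using id_take_nth_drop[of i ps] len i by simp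
  have vs: "verts \<Gamma> = take i (verts \<Gamma>) @ (genus \<Delta>, arity \<Delta>) # drop (Suc i) (verts \<Gamma>)"
    using id_take_nth_drop[OF i] \<Delta>(2) by simp
  \<comment> \<open>The class may be replaced by \<open>w\<close>: relations among trees are
    relations among graphs, and grafting respects them.\<close>
  have "clsP w - w \<in> RelR" using clsP(2)[of w] RelP_R RelR_diff_sym by blast
  then have "graft_sums ?t \<Gamma> ps (?as @ clsP w # ?bs) - graft_sums ?t \<Gamma> ps (?as @ w # ?bs) \<in> RelR"
    using kas by (intro graft_sums_slot[OF st(1) UNIV_I linear_cells_dual]) auto
  then have 1: "Phi (\<Gamma>, ps, xs) - graft_sums ?t \<Gamma> ps (?as @ w # ?bs) \<in> RelR"
    using xs by (simp add: Phi_def)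
  have w: "lin_ext F w = ml ys (\<lambda>ks. if fits ?t \<Delta> qs ks then fscale (sg (gsign ?t ks)) (F (graft_gen \<Delta> ks)) else 0)"
    for F :: "('a \<Rightarrow> 'k) gen \<Rightarrow> (('a \<Rightarrow> 'k) gen \<Rightarrow>\<^sub>0 'k)"
    unfolding w_def graft_sums_eq_ml ml_linear_out[OF flinear_lin_ext]
    by (rule ml_cong) (simp add: graft_eq_gen lin_ext_single)
  \<comment> \<open>With \<open>w\<close> expanded too, both sides are sums over the same triples of
    tuples and can be compared termwise.\<close>
  have e1: "graft_sums ?t \<Gamma> ps (?as @ w # ?bs) = ml ?as (\<lambda>a. ml ys (\<lambda>ks. ml ?bs (\<lambda>b.
      if fits ?t \<Delta> qs ks then fscale (sg (gsign ?t ks)) (?T (a @ graft_gen \<Delta> ks # b)) else 0)))"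
    unfolding graft_sums_eq_ml ml_append ml.simps w
    by (intro ml_cong) (simp add: ml_fun_scale)
  have li: "list_insert i ys xs = ?as @ ys @ ?bs" by (simp add: list_insert_def)
  have e2: "Phi (graph_insert \<Gamma> i \<Delta>, list_insert i qs ps, list_insert i ys xs) =
      ml ?as (\<lambda>a. ml ys (\<lambda>ks. ml ?bs (\<lambda>b. ?T' (a @ ks @ b))))"
    unfolding Phi_eq li ml_append ..
  let ?d = "sg (tdeg ?t \<Delta> * sum_list (take i ps)) :: 'k"
  have "fscale 1 (ml ?as (\<lambda>a. ml ys (\<lambda>ks. ml ?bs (\<lambda>b.
      if fits ?t \<Delta> qs ks then fscale (sg (gsign ?t ks)) (?T (a @ graft_gen \<Delta> ks # b)) else 0))))
    - fscale ?d (ml ?as (\<lambda>a. ml ys (\<lambda>ks. ml ?bs (\<lambda>b. ?T' (a @ ks @ b))))) \<in> RelR"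
  proof (intro ml_diff_in[OF subspace_RelR])
    fix a ks b assume *: "in_keys a ?as" "in_keys ks ys" "in_keys b ?bs"
    have l: "length a = i" "length ks = nverts \<Delta>" "length b = nverts \<Gamma> - Suc i"
      using *[THEN list_all2_lengthD] len len\<Delta> i by simp_all
    have g: "set a \<subseteq> gensR" "set ks \<subseteq> gensR" "set b \<subseteq> gensR"
      by (rule in_keys_subset[OF *(1)], rule kas, simp) (rule in_keys_subset[OF *(2)], rule ky, simp, rule in_keys_subset[OF *(3)], rule kas, simp)
    have F: "fits ?t (graph_insert \<Gamma> i \<Delta>) (list_insert i qs ps) (a @ ks @ b) \<longleftrightarrow>
        fits ?t \<Delta> qs ks \<and> fits ?t \<Gamma> ps (a @ graft_gen \<Delta> ks # b)"
      unfolding list_insert_def l(1)[symmetric]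
      using fits_graph_insert[OF vs, of a b "take i ps" "drop (Suc i) ps" qs ks "ps ! i" ?t UNIV V'] ps len len\<Delta> l i y(2) st(2) g(2)
      by simp
    show "fscale 1 (if fits ?t \<Delta> qs ks then fscale (sg (gsign ?t ks)) (?T (a @ graft_gen \<Delta> ks # b)) else 0)
        - fscale ?d (?T' (a @ ks @ b)) \<in> RelR"
    proof (cases "fits ?t \<Delta> qs ks \<and> fits ?t \<Gamma> ps (a @ graft_gen \<Delta> ks # b)")
      case True
      have "sum_list (take i ps) = gsum ?t a" using True l by (auto simp: fits_iff gsum_def)
      moreover have "take i (verts \<Gamma>) = map vtype a" "drop (Suc i) (verts \<Gamma>) = map vtype b" "verts \<Delta> = map vtype ks"
        using True l by (auto simp: fits_iff)
      ultimately show ?thesis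
        using graft_contract[OF st(1) UNIV_I st(2) UNIV_I, of a b ks UNIV V' ?t permuted_corollas] vs g F True l by simp
    qed (use F in \<open>auto simp: formal.span_zero\<close>)
  qed
  then have "graft_sums ?t \<Gamma> ps (?as @ w # ?bs) - fscale ?d (Phi (graph_insert \<Gamma> i \<Delta>, list_insert i qs ps, list_insert i ys xs)) \<in> RelR"
    unfolding e1 e2 by simp
  then show ?thesis by (rule RelR_trans[OF 1])
qed

text \<open>Exchanging two vertices exchanges two slots of the expansion; termwise this is
  \<open>graft_swap_verts\<close>.\<close>

lemma Phi_verts:
  assumes h: "(\<Gamma>, ps, xs) \<in> gensL" and i: "Suc i < nverts \<Gamma>"
  shows "Phi (swap_verts i \<Gamma>, swap_at i ps, swap_at i xs) - fscale (sg (ps ! i * ps ! Suc i)) (Phi (\<Gamma>, ps, xs)) \<in> RelR"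
proof -
  let ?t = "\<not> tw"
  have len: "length ps = nverts \<Gamma>" "length xs = nverts \<Gamma>" using gens_lengths[OF h] by simp_all
  define as f g bs where "as = take i xs" "f = xs ! i" "g = xs ! Suc i" "bs = drop (Suc (Suc i)) xs"
  have xs: "xs = as @ f # g # bs" "length as = i"
    using i len by (simp_all add: as_f_g_bs_def Cons_nth_drop_Suc)
  have sw: "swap_at i xs = as @ g # f # bs" unfolding xs(1) xs(2)[symmetric] by (rule swap_at_append)
  have k: "Poly_Mapping.keys f \<subseteq> gensR" if "f \<in> set xs" for f
    using gensL_keys[OF h] that gensP_R by fastforce
  have "fscale 1 (ml xs (\<lambda>hs. if fits ?t (swap_verts i \<Gamma>) (swap_at i ps) (swap_at i hs) then graft ?t (swap_verts i \<Gamma>) (swap_at i hs) else 0))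
     - fscale (sg (ps ! i * ps ! Suc i)) (ml xs (\<lambda>hs. if fits ?t \<Gamma> ps hs then graft ?t \<Gamma> hs else 0)) \<in> RelR"
  proof (rule ml_diff_in[OF subspace_RelR])
    fix hs assume hs: "in_keys hs xs"
    have lh: "length hs = nverts \<Gamma>" using list_all2_lengthD[OF hs] len by simp
    have gh: "set hs \<subseteq> gensR" using in_keys_subset[OF hs k] by simp
    note F = fits_swap[OF i len(1) lh, of ?t]
    show "fscale 1 (if fits ?t (swap_verts i \<Gamma>) (swap_at i ps) (swap_at i hs) then graft ?t (swap_verts i \<Gamma>) (swap_at i hs) else 0)
     - fscale (sg (ps ! i * ps ! Suc i)) (if fits ?t \<Gamma> ps hs then graft ?t \<Gamma> hs else 0) \<in> RelR"
    proof (cases "fits ?t \<Gamma> ps hs")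
      case True
      define a h h' b where "a = take i hs" "h = hs ! i" "h' = hs ! Suc i" "b = drop (Suc (Suc i)) hs"
      have hs': "hs = a @ h # h' # b" "length a = i"
        using i lh by (simp_all add: a_h_h'_b_def Cons_nth_drop_Suc)
      have sw: "swap_at i hs = a @ h' # h # b" unfolding hs'(1) hs'(2)[symmetric] by (rule swap_at_append)
      have p: "ps = map (gdeg ?t) hs" and v: "verts \<Gamma> = map vtype hs" using True by (simp_all add: fits_iff)
      have "gdeg ?t h = ps ! i" "gdeg ?t h' = ps ! Suc i" using p i lh by (simp_all add: a_h_h'_b_def)
      then show ?thesis
        using graft_swap_verts[OF gens_stable[OF h, simplified] UNIV_I, of a h h' b UNIV V' ?t permuted_corollas] v gh F True sw hs'
        by simp
    qed (use F in \<open>simp add: formal.span_zero\<close>)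
  qed
  \<comment> \<open>Interchanging two neighbouring expansions rewrites the sum over the swapped
    labels as one over the labels in their original order.\<close>
  moreover have "Phi (swap_verts i \<Gamma>, swap_at i ps, swap_at i xs) =
      ml xs (\<lambda>hs. if fits ?t (swap_verts i \<Gamma>) (swap_at i ps) (swap_at i hs) then graft ?t (swap_verts i \<Gamma>) (swap_at i hs) else 0)"
    unfolding Phi_eq sw ml_lin_ext_swap[of as g f bs] unfolding xs by simp
  ultimately show ?thesis by (simp add: Phi_eq)
qed

text \<open>Multilinear relators are sent to 0 exactly, since labels enter by multilinear extension.
  The others reduce to the behaviour of \<open>graft\<close> under changes of the outer
  graph.\<close>

lemma Phi_relators:
  assumes "r \<in> relators (\<not> tw) {0} UNIV (graphs {0}) P"
  shows "lin_ext Phi r \<in> RelR"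
  using assms
proof cases
  case (multilinear \<Gamma> ps xs i x y c)
  have len: "i < length xs" using gens_lengths[OF multilinear(2)] multilinear(4) by simp
  have "flinear (\<lambda>z. Phi (\<Gamma>, ps, xs[i := z]))"
    unfolding Phi_eq upd_conv_take_nth_drop[OF len] by (rule ml_slot_linear)
  from flinear_add[OF this] flinear_scale[OF this] show ?thesis
    unfolding multilinear(1) by (simp add: lin_ext_diff lin_ext_single P_simps formal.span_zero)
next
  case (verts \<Gamma> ps xs i)
  then show ?thesis using Phi_verts[OF verts(2,3)] by (simp add: lin_ext_diff lin_ext_single)
next
  case (edges \<Gamma> ps xs i)
  let ?t = "\<not> tw"
  have k: "Poly_Mapping.keys f \<subseteq> gensR" if "f \<in> set xs" for f
    using gensL_keys[OF edges(2)] that gensP_R by fastforce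
  have "fscale 1 (Phi (swap_edges i \<Gamma>, ps, xs)) - fscale (if ?t then - 1 else 1) (Phi (\<Gamma>, ps, xs)) \<in> RelR"
    unfolding Phi_eq
  proof (rule ml_diff_in[OF subspace_RelR])
    fix hs assume hs: "in_keys hs xs"
    have gh: "set hs \<subseteq> gensR" using in_keys_subset[OF hs k] by simp
    have F: "fits ?t (swap_edges i \<Gamma>) ps hs = fits ?t \<Gamma> ps hs" by (simp add: fits_iff)
    show "fscale 1 (if fits ?t (swap_edges i \<Gamma>) ps hs then graft ?t (swap_edges i \<Gamma>) hs else 0)
      - fscale (if ?t then - 1 else 1) (if fits ?t \<Gamma> ps hs then graft ?t \<Gamma> hs else 0) \<in> RelR"
    proof (cases "fits ?t \<Gamma> ps hs")
      case True
      then have v: "verts \<Gamma> = map vtype hs" by (simp add: fits_iff)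
      show ?thesis
        using graft_swap_edges[OF gens_stable[OF edges(2), unfolded fst_conv] UNIV_I v gh edges(3), of ?t permuted_corollas] True F by simp
    qed (use F in \<open>simp add: formal.span_zero\<close>)
  qed
  then show ?thesis unfolding edges(1) by (simp add: lin_ext_diff lin_ext_single)
next
  case (flip \<Gamma> ps xs i)
  let ?t = "\<not> tw"
  have k: "Poly_Mapping.keys f \<subseteq> gensR" if "f \<in> set xs" for f
    using gensL_keys[OF flip(2)] that gensP_R by fastforce
  have "fscale 1 (Phi (flip_edge i \<Gamma>, ps, xs)) - fscale 1 (Phi (\<Gamma>, ps, xs)) \<in> RelR"
    unfolding Phi_eq
  proof (rule ml_diff_in[OF subspace_RelR])
    fix hs assume hs: "in_keys hs xs"
    have gh: "set hs \<subseteq> gensR" using in_keys_subset[OF hs k] by simp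
    have F: "fits ?t (flip_edge i \<Gamma>) ps hs = fits ?t \<Gamma> ps hs" by (simp add: fits_iff)
    show "fscale 1 (if fits ?t (flip_edge i \<Gamma>) ps hs then graft ?t (flip_edge i \<Gamma>) hs else 0)
      - fscale 1 (if fits ?t \<Gamma> ps hs then graft ?t \<Gamma> hs else 0) \<in> RelR"
    proof (cases "fits ?t \<Gamma> ps hs")
      case True
      then have v: "verts \<Gamma> = map vtype hs" by (simp add: fits_iff)
      show ?thesis
        using graft_flip_edge[OF gens_stable[OF flip(2), unfolded fst_conv] UNIV_I v gh flip(3), of ?t permuted_corollas] True F by simp
    qed (use F in \<open>simp add: formal.span_zero\<close>)
  qed
  then show ?thesis unfolding flip(1) by (simp add: lin_ext_diff)
next
  case (contract \<Gamma> ps xs i \<Delta> qs ys)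
  then show ?thesis
    using Phi_contract[OF contract(2,3) _ contract(5-8)] unfolding contract(1) by (simp add: lin_ext_diff lin_ext_single)
qed

lemma Phi_RelL: "x \<in> RelL \<Longrightarrow> lin_ext Phi x \<in> RelR"
  by (rule flinear_span_image[OF flinear_lin_ext Phi_relators])

end

section \<open>From the Feynman transform to the envelope\<close>

lemma cors_append:
  "length ps = length vs \<Longrightarrow> length xs = length vs \<Longrightarrow>
    cors (vs @ vs') (ps @ ps') (xs @ xs') = cors vs ps xs @ cors vs' ps' xs'"
  by (simp add: cors_def)

lemma cors_nth:
  "length ps = length vs \<Longrightarrow> length xs = length vs \<Longrightarrow> i < length vs \<Longrightarrow> cors vs ps xs ! i = cor (vs ! i) (ps ! i) (xs ! i)"
  by (simp add: cors_def)

lemma length_cors: "length ps = length vs \<Longrightarrow> length xs = length vs \<Longrightarrow> length (cors vs ps xs) = length vs"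
  by (simp add: cors_def)

lemma cors_update:
  assumes "length ps = length vs" "length xs = length vs"
  shows "cors vs ps (xs[i := x]) = (cors vs ps xs)[i := cor (vs ! i) (ps ! i) x]"
proof (rule nth_equalityI)
  fix j assume "j < length (cors vs ps (xs[i := x]))"
  then have "j < length vs" using assms by (simp add: length_cors)
  then show "cors vs ps (xs[i := x]) ! j = (cors vs ps xs)[i := cor (vs ! i) (ps ! i) x] ! j"
    using assms by (cases "j = i") (simp_all add: cors_nth length_cors)
qed (use assms in \<open>simp add: length_cors\<close>)

lemma cors_swap_at:
  assumes "length ps = length vs" "length xs = length vs" "Suc i < length vs"
  shows "cors (swap_at i vs) (swap_at i ps) (swap_at i xs) = swap_at i (cors vs ps xs)"
  using assms by (intro nth_equalityI) (simp_all add: length_cors length_swap_at cors_nth nth_swap_at)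

lemma graft_cors:
  assumes "wf_graph \<Gamma>" "length ps = nverts \<Gamma>" "length xs = nverts \<Gamma>"
  shows "graft tw \<Gamma> (cors (verts \<Gamma>) ps xs) = sing (\<Gamma>, ps, xs)" "fits tw \<Gamma> ps (cors (verts \<Gamma>) ps xs)"
proof -
  note c = cors_props[OF assms(2,3), of tw]
  have "graph_insert_all \<Gamma> (graphs_of (cors (verts \<Gamma>) ps xs)) = \<Gamma>"
    using c insert_from_corollas[OF assms(1), of "verts \<Gamma>" 0] by (simp add: graph_insert_all_eq)
  then show "graft tw \<Gamma> (cors (verts \<Gamma>) ps xs) = sing (\<Gamma>, ps, xs)"
    using c by (simp add: graft_eq_gen graft_gen_def)
  show "fits tw \<Gamma> ps (cors (verts \<Gamma>) ps xs)" using c by (simp add: fits_iff)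
qed

text \<open>Meant for the dependence of a generator on one of its labels, which is linear only
  through the multilinear relations. Induction on the support splits off one term at a time.\<close>

lemma linear_mod_lin_ext:
  assumes S: "formal.subspace S"
    and T: "\<And>c x y. Poly_Mapping.keys x \<subseteq> A \<Longrightarrow> Poly_Mapping.keys y \<subseteq> A \<Longrightarrow> T (fscale c x + y) - fscale c (T x) - T y \<in> S"
    and f: "Poly_Mapping.keys f \<subseteq> A"
  shows "T f - lin_ext (\<lambda>x. T (sing x)) f \<in> S"
proof -
  have T0: "T 0 \<in> S"
    using T[of 0 0 1] formal.subspace_neg[OF S] by fastforce
  have "Poly_Mapping.keys f \<subseteq> A \<longrightarrow> T f - lin_ext (\<lambda>x. T (sing x)) f \<in> S"
    if "finite K" "Poly_Mapping.keys f \<subseteq> K" for K f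
    using that
  proof (induction K arbitrary: f)
    case empty
    then have "f = 0" by simp
    then show ?case using T0 by simp
  next
    case (insert a K)
    show ?case
    proof (cases "a \<in> Poly_Mapping.keys f")
      case False
      then show ?thesis using insert by blast
    next
      case True
      define c where "c = Poly_Mapping.lookup f a"
      define r where "r = f - Poly_Mapping.single a c"
      have fr: "f = fscale c (sing a) + r" by (simp add: r_def fscale_single)
      have kr: "Poly_Mapping.keys r \<subseteq> Poly_Mapping.keys f - {a}"
        by (auto simp: r_def c_def in_keys_iff lookup_minus lookup_single when_def split: if_splits)
      show ?thesis
      proof
        assume kf: "Poly_Mapping.keys f \<subseteq> A"
        have "T r - lin_ext (\<lambda>x. T (sing x)) r \<in> S" using insert kr kf by blast
        moreover have "T f - fscale c (T (sing a)) - T r \<in> S"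
          unfolding fr using kr kf True by (intro T) auto
        ultimately have "(T f - fscale c (T (sing a)) - T r) + (T r - lin_ext (\<lambda>x. T (sing x)) r) \<in> S"
          by (intro formal.subspace_add[OF S])
        moreover have "lin_ext (\<lambda>x. T (sing x)) f = fscale c (T (sing a)) + lin_ext (\<lambda>x. T (sing x)) r"
          by (subst fr) (simp add: lin_ext_add lin_ext_scale)
        ultimately show "T f - lin_ext (\<lambda>x. T (sing x)) f \<in> S" by (simp add: algebra_simps)
      qed
    qed
  qed
  from this[OF finite_keys order_refl] f show ?thesis by blast
qed

context corollary_setting
begin

abbreviation cl :: "('a \<Rightarrow> 'k) gen \<Rightarrow> (('a \<Rightarrow> 'k) gen \<Rightarrow>\<^sub>0 'k)" where
  "cl k \<equiv> clsP (sing k)"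

definition Lab :: "('a \<Rightarrow> 'k) gen \<Rightarrow> (('a \<Rightarrow> 'k) gen \<Rightarrow>\<^sub>0 'k) list" where
  "Lab h = map cl (cors (verts (fst h)) (fst (snd h)) (snd (snd h)))"

definition psi :: "('a \<Rightarrow> 'k) gen \<Rightarrow> (('a \<Rightarrow> 'k) gen \<Rightarrow>\<^sub>0 'k) gen" where
  "psi h = (fst h, fst (snd h), Lab h)"

text \<open>Despite the name only the vertex genera are restricted; the graph itself may contain
  cycles.\<close>

abbreviation tree_like :: "'b gen \<Rightarrow> bool" where
  "tree_like h \<equiv> fst ` set (verts (fst h)) \<subseteq> {0}"

definition Psi :: "('a \<Rightarrow> 'k) gen \<Rightarrow> ((('a \<Rightarrow> 'k) gen \<Rightarrow>\<^sub>0 'k) gen \<Rightarrow>\<^sub>0 'k)" where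
  "Psi h = (if tree_like h then sing (psi h) else 0)"

lemma cor_gensP:
  assumes "fst v = 0" "stable (fst v) (snd v)" "x \<in> cell V (fst v) (snd v) p"
  shows "cor v p x \<in> gensP"
  using assms by (simp add: gens_iff cor_def)

lemma cl_cell:
  assumes "h \<in> gensP" "vtype h = (g, n)" "gdeg (\<not> tw) h = p"
  shows "cl h \<in> cell P g n p"
  unfolding P_simps homP_def using assms by (intro imageI) simp

lemma decorates_Lab:
  assumes h: "h \<in> gensR" "tree_like h"
  shows "decorates P (verts (fst h)) (fst (snd h)) (Lab h)"
    "set (cors (verts (fst h)) (fst (snd h)) (snd (snd h))) \<subseteq> gensP"
proof -
  let ?v = "verts (fst h)" and ?p = "fst (snd h)" and ?x = "snd (snd h)"
  have len: "length ?p = length ?v" "length ?x = length ?v" using gens_lengths[OF h(1)] by simp_all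
  have *: "cor (?v ! i) (?p ! i) (?x ! i) \<in> gensP" "fst (?v ! i) = 0" if i: "i < length ?v" for i
  proof -
    show 0: "fst (?v ! i) = 0" using h(2) nth_mem[OF i] by auto
    have "h = (fst h, ?p, ?x)" by simp
    then have "stable (fst (?v ! i)) (snd (?v ! i)) \<and> ?x ! i \<in> cell V' (fst (?v ! i)) (snd (?v ! i)) (?p ! i)"
      using gens_vertex[of "fst h" ?p ?x UNIV UNIV V' i] h(1) i by simp
    then show "cor (?v ! i) (?p ! i) (?x ! i) \<in> gensP" using 0 by (intro cor_gensP) (simp_all add: dual_extend_0)
  qed
  show "set (cors ?v ?p ?x) \<subseteq> gensP"
  proof
    fix c assume "c \<in> set (cors ?v ?p ?x)"
    then obtain i where "i < length ?v" "c = cors ?v ?p ?x ! i" using len by (metis in_set_conv_nth length_cors)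
    then show "c \<in> gensP" using *(1)[of i] len by (simp only: cors_nth)
  qed
  have "cl (cor (?v ! i) (?p ! i) (?x ! i)) \<in> cell P (fst (?v ! i)) (snd (?v ! i)) (?p ! i)" if "i < length ?v" for i
    by (rule cl_cell[OF *(1)[OF that]]) simp_all
  then show "decorates P ?v ?p (Lab h)"
    using len by (simp add: decorates_def Lab_def length_cors cors_nth)
qed

lemma psi_gens:
  assumes "h \<in> gensR" "tree_like h"
  shows "psi h \<in> gensL" "vtype (psi h) = vtype h" "gdeg (\<not> tw) (psi h) = gdeg (\<not> tw) h"
  using assms decorates_Lab(1)[OF assms] by (simp_all add: gens_iff psi_def gdeg_eq)

lemma keys_Psi:
  assumes "h \<in> gensR"
  shows "Poly_Mapping.keys (Psi h) \<subseteq> {k \<in> gensL. vtype k = vtype h \<and> gdeg (\<not> tw) k = gdeg (\<not> tw) h}"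
  using psi_gens[OF assms] by (auto simp: Psi_def)

lemma graft_sums_sing:
  "graft_sums t \<Gamma> ps (map sing hs) = (if fits t \<Gamma> ps hs then graft t \<Gamma> hs else 0)"
  by (simp add: graft_sums_eq_ml)

lemma clsP_RelP: "f - clsP f \<in> RelP" "clsP f - f \<in> RelP"
  using clsP(2)[of f] formal.span_neg[of "f - clsP f"] by auto

lemma clsP_RelR: "f - clsP f \<in> RelR" "clsP f - f \<in> RelR"
  using clsP_RelP RelP_R by blast+

text \<open>Grafting the corollas returns the graph, and replacing each corolla by the
  representative of its class changes the result by relations. In genus 0 these are already
  relations of the cyclic free object.\<close>

lemma graft_sums_Lab:
  assumes h: "h \<in> gensR" "tree_like h"
  shows "graft_sums (\<not> tw) (fst h) (fst (snd h)) (Lab h) - sing h \<in> RelR"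
    "genus (fst h) = 0 \<Longrightarrow> graft_sums (\<not> tw) (fst h) (fst (snd h)) (Lab h) - sing h \<in> RelP"
proof -
  let ?c = "cors (verts (fst h)) (fst (snd h)) (snd (snd h))"
  have st: "stable_graph (fst h)" by (rule gens_stable[OF h(1)])
  have s: "sing h = graft_sums (\<not> tw) (fst h) (fst (snd h)) (map sing ?c)"
    using graft_cors[OF stable_imp_wf[OF st], of "fst (snd h)" "snd (snd h)"] gens_lengths[OF h(1)]
    by (simp add: graft_sums_sing graft_cors(1)[OF stable_imp_wf[OF st]])
  have k: "Poly_Mapping.keys f \<subseteq> gensP" if f: "f \<in> set (Lab h) \<union> set (map sing ?c)" for f
  proof -
    obtain c where c: "c \<in> set ?c" "f = cl c \<or> f = sing c" using f unfolding Lab_def set_map by blast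
    then have "c \<in> gensP" using decorates_Lab(2)[OF h] by blast
    then have "Poly_Mapping.keys (sing c :: _ \<Rightarrow>\<^sub>0 'k) \<subseteq> gensP" by simp
    then show ?thesis using c(2) keys_clsP by blast
  qed
  then have k': "Poly_Mapping.keys f \<subseteq> gensR" if "f \<in> set (Lab h) \<union> set (map sing ?c)" for f
    using that gensP_R by blast
  have "list_all2 (\<lambda>f g. f - g \<in> RelP) (Lab h) (map sing ?c)"
    unfolding Lab_def by (simp add: list_all2_conv_all_nth clsP_RelP)
  moreover from this have "list_all2 (\<lambda>f g. f - g \<in> RelR) (Lab h) (map sing ?c)"
    using RelP_R by (auto elim: list_all2_mono)
  ultimately have l: "list_all2 (\<lambda>f g. f - g \<in> RelP) (Lab h) (map sing ?c)"
    "list_all2 (\<lambda>f g. f - g \<in> RelR) (Lab h) (map sing ?c)" by simp_all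
  show "graft_sums (\<not> tw) (fst h) (fst (snd h)) (Lab h) - sing h \<in> RelR"
    unfolding s by (rule graft_sums_cong[OF st UNIV_I linear_cells_dual l(2) k'])
  show "graft_sums (\<not> tw) (fst h) (fst (snd h)) (Lab h) - sing h \<in> RelP" if "genus (fst h) = 0"
    unfolding s using that by (intro graft_sums_cong[OF st _ linear_cells_dual l(1) k]) simp_all
qed

text \<open>Lets the contraction relation of the envelope apply to a vertex labelled by the class of
  a tree: the label is a composite of corolla classes along that tree.\<close>

lemma cl_eq_cmp: "h \<in> gensP \<Longrightarrow> cl h = cmp P (fst h) (fst (snd h)) (Lab h)"
proof -
  assume h: "h \<in> gensP"
  then have "tree_like h" "genus (fst h) = 0" by (simp_all add: gens_iff)
  moreover have "h \<in> gensR" using h gensP_R by blast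
  ultimately have "h \<in> gensR" "tree_like h" "genus (fst h) = 0" by simp_all
  from graft_sums_Lab(2)[OF this] show ?thesis by (simp add: P_simps clsP(3)[symmetric])
qed

lemma Phi_Psi:
  assumes h: "h \<in> gensR"
  shows "lin_ext Phi (Psi h) - sing h \<in> RelR"
proof (cases "tree_like h")
  case True
  then show ?thesis using graft_sums_Lab(1)[OF h True] by (simp add: Psi_def psi_def Phi_def)
next
  case False
  obtain \<Gamma> ps xs where h': "h = (\<Gamma>, ps, xs)" by (cases h)
  obtain i where i: "i < nverts \<Gamma>" "fst (verts \<Gamma> ! i) \<noteq> 0"
    using False by (metis h' fst_conv image_subset_iff in_set_conv_nth singletonI)
  have "xs ! i \<in> cell V' (fst (verts \<Gamma> ! i)) (snd (verts \<Gamma> ! i)) (ps ! i)"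
    using gens_vertex[of \<Gamma> ps xs UNIV UNIV V' i] h i by (simp add: h')
  then have 0: "xs ! i = (\<lambda>x. 0)" using dual_extend_pos[OF i(2) ambient_O] by simp
  have x: "xs[i := (\<lambda>x. 0)] = xs" using 0 by (metis list_update_id)
  \<comment> \<open>With the zero label all three terms of the multilinear relation at
    \<open>c = 1\<close> are the same generator, so this generator is a relation up to sign.\<close>
  have "sing (\<Gamma>, ps, xs[i := scl V' 1 (\<lambda>x. 0) + (\<lambda>x. 0)]) - Poly_Mapping.single (\<Gamma>, ps, xs[i := (\<lambda>x. 0)]) (1 :: 'k)
      - sing (\<Gamma>, ps, xs[i := (\<lambda>x. 0)]) \<in> RelR"
    using h x i unfolding h' by (intro formal.span_base relators.multilinear) simp_all
  then have "- sing h \<in> RelR" using x by (simp add: h')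
  then show ?thesis using False by (simp add: Psi_def)
qed

lemma cl_linear:
  assumes v: "fst v = 0" "stable (fst v) (snd v)" and x: "x \<in> cell V (fst v) (snd v) p" "y \<in> cell V (fst v) (snd v) p"
  shows "cl (cor v p (scl V c x + y)) = fscale c (cl (cor v p x)) + cl (cor v p y)"
proof -
  have "sing (corolla (fst v) (snd v), [p], [x][0 := scl V c x + y]) - Poly_Mapping.single (corolla (fst v) (snd v), [p], [x][0 := x]) c
      - sing (corolla (fst v) (snd v), [p], [x][0 := y]) \<in> RelP"
    using cor_gensP[OF v x(1)] cor_gensP[OF v x(2)]
    by (intro formal.span_base relators.multilinear) (simp_all add: cor_def)
  then have "sing (cor v p (scl V c x + y)) - (fscale c (sing (cor v p x)) + sing (cor v p y)) \<in> RelP"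
    by (simp add: cor_def fscale_single algebra_simps)
  then show ?thesis
    by (metis clsP(3) flinear_add[OF clsP(1)] flinear_scale[OF clsP(1)])
qed

text \<open>Labels are taken vertex by vertex, so relations of the graph carry over directly, and
  all terms of a relator are tree-like or none is. The action of a permuted corolla on a label has
  to be recognised as a composition in \<open>P\<close>.\<close>

lemma Psi_relators:
  assumes "r \<in> relators (\<not> tw) UNIV UNIV permuted_corollas V'"
  shows "lin_ext Psi r \<in> RelL"
  using assms
proof cases
  case (multilinear \<Gamma> ps xs i x y c)
  let ?g = "\<lambda>z. (\<Gamma>, ps, xs[i := z])"
  show ?thesis
  proof (cases "fst ` set (verts \<Gamma>) \<subseteq> {0}")
    case True
    have t: "tree_like (?g z)" for z using True by simp
    have len: "length ps = nverts \<Gamma>" "length xs = nverts \<Gamma>" using gens_lengths[OF multilinear(2)] by simp_all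
    let ?l = "\<lambda>z. cl (cor (verts \<Gamma> ! i) (ps ! i) z)"
    let ?ls = "map cl (cors (verts \<Gamma>) ps xs)"
    have P: "psi (?g z) = (\<Gamma>, ps, ?ls[i := ?l z])" for z
      using len by (simp add: psi_def Lab_def cors_update map_update)
    have v0: "fst (verts \<Gamma> ! i) = 0" using True nth_mem[OF multilinear(4)] by auto
    have st: "stable (fst (verts \<Gamma> ! i)) (snd (verts \<Gamma> ! i))"
      and x: "x \<in> cell V (fst (verts \<Gamma> ! i)) (snd (verts \<Gamma> ! i)) (ps ! i)"
      and y: "y \<in> cell V (fst (verts \<Gamma> ! i)) (snd (verts \<Gamma> ! i)) (ps ! i)"
      using gens_vertex[OF multilinear(2) multilinear(4)] gens_vertex[OF multilinear(3) multilinear(4)] multilinear(4) len v0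
      by (simp_all add: dual_extend_0)
    have "scl V' c x + y = scl V c x + y" by (simp add: dual_extend_0)
    then have l: "?l (scl V' c x + y) = scl P c (?l x) + ?l y" using cl_linear[OF v0 st x y] by (simp add: P_simps)
    have "sing (\<Gamma>, ps, ?ls[i := scl P c (?l x) + ?l y]) - Poly_Mapping.single (\<Gamma>, ps, ?ls[i := ?l x]) c
        - sing (\<Gamma>, ps, ?ls[i := ?l y]) \<in> RelL"
      using psi_gens(1)[OF multilinear(2) t] psi_gens(1)[OF multilinear(3) t] multilinear(4) unfolding P
      by (intro formal.span_base relators.multilinear)
    then show ?thesis unfolding multilinear(1)
      using True P[of x] P[of y] P[of "scl V' c x + y"] l by (simp add: lin_ext_diff lin_ext_single Psi_def fscale_single)
  next
    case False
    then show ?thesis unfolding multilinear(1) by (simp add: lin_ext_diff lin_ext_single Psi_def formal.span_zero)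
  qed
next
  case (verts \<Gamma> ps xs i)
  have tr: "tree_like (swap_verts i \<Gamma>, swap_at i ps, swap_at i xs) = tree_like (\<Gamma>, ps, xs)"
    using verts(3) by (simp add: swap_verts_simps set_swap_at)
  show ?thesis
  proof (cases "tree_like (\<Gamma>, ps, xs)")
    case True
    have len: "length ps = nverts \<Gamma>" "length xs = nverts \<Gamma>" using gens_lengths[OF verts(2)] by simp_all
    have P: "psi (swap_verts i \<Gamma>, swap_at i ps, swap_at i xs) = (swap_verts i \<Gamma>, swap_at i ps, swap_at i (Lab (\<Gamma>, ps, xs)))"
      using len verts(3) by (simp add: psi_def Lab_def swap_verts_simps cors_swap_at map_swap_at length_cors)
    have "sing (swap_verts i \<Gamma>, swap_at i ps, swap_at i (Lab (\<Gamma>, ps, xs))) -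
        Poly_Mapping.single (\<Gamma>, ps, Lab (\<Gamma>, ps, xs)) (sg (ps ! i * ps ! Suc i) :: 'k) \<in> RelL"
      using psi_gens(1)[OF verts(2) True] verts(3) by (intro formal.span_base relators.verts) (simp_all add: psi_def)
    then show ?thesis unfolding verts(1) using True tr P
      by (simp add: lin_ext_diff lin_ext_single Psi_def fscale_single) (simp add: psi_def)
  next
    case False
    then show ?thesis unfolding verts(1) using tr by (simp add: lin_ext_diff lin_ext_single Psi_def formal.span_zero)
  qed
next
  case (edges \<Gamma> ps xs i)
  show ?thesis
  proof (cases "tree_like (\<Gamma>, ps, xs)")
    case True
    have "sing (swap_edges i \<Gamma>, ps, Lab (\<Gamma>, ps, xs)) -
        Poly_Mapping.single (\<Gamma>, ps, Lab (\<Gamma>, ps, xs)) (if \<not> tw then - 1 else 1 :: 'k) \<in> RelL"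
      using psi_gens(1)[OF edges(2) True] edges(3) by (intro formal.span_base relators.edges) (simp_all add: psi_def)
    then show ?thesis unfolding edges(1) using True
      by (simp add: lin_ext_diff lin_ext_single Psi_def fscale_single psi_def Lab_def)
  next
    case False
    then show ?thesis unfolding edges(1) by (simp add: lin_ext_diff lin_ext_single Psi_def formal.span_zero)
  qed
next
  case (flip \<Gamma> ps xs i)
  show ?thesis
  proof (cases "tree_like (\<Gamma>, ps, xs)")
    case True
    have "sing (flip_edge i \<Gamma>, ps, Lab (\<Gamma>, ps, xs)) - sing (\<Gamma>, ps, Lab (\<Gamma>, ps, xs)) \<in> RelL"
      using psi_gens(1)[OF flip(2) True] flip(3) by (intro formal.span_base relators.flip) (simp_all add: psi_def)
    then show ?thesis unfolding flip(1) using True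
      by (simp add: lin_ext_diff Psi_def psi_def Lab_def)
  next
    case False
    then show ?thesis unfolding flip(1) by (simp add: lin_ext_diff Psi_def formal.span_zero)
  qed
next
  case (contract \<Gamma> ps xs i \<Delta> qs ys)
  let ?v = "verts \<Gamma> ! i" and ?h' = "(graph_insert \<Gamma> i \<Delta>, list_insert i qs ps, list_insert i ys xs)"
  have \<Delta>: "\<Delta> \<in> permuted_corollas" using contract(4) by simp
  note pc = permuted_corolla[OF \<Delta>]
  obtain q y where qy: "qs = [q]" "ys = [y]"
    using decorates_lengths[OF contract(6)] pc(3) by (auto simp: length_Suc_conv)
  have q: "q = ps ! i" using contract(7) by (simp add: qy pc(4))
  have len: "length ps = nverts \<Gamma>" "length xs = nverts \<Gamma>" using gens_lengths[OF contract(2)] by simp_all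
  have ins: "verts (graph_insert \<Gamma> i \<Delta>) = verts \<Gamma>" "list_insert i qs ps = ps" "list_insert i ys xs = xs[i := y]"
    using contract(3,5) pc(3) len q id_take_nth_drop[of i "verts \<Gamma>"]
    by (simp_all add: qy list_insert_def id_take_nth_drop[symmetric] upd_conv_take_nth_drop)
  show ?thesis
  proof (cases "tree_like (\<Gamma>, ps, xs)")
    case True
    have v0: "fst ?v = 0" using True nth_mem[OF contract(3)] by auto
    then have g0: "genus \<Delta> = 0" using contract(5) by simp
    have \<Delta>0: "\<Delta> \<in> graphs {0}" by (rule genus_0_in_graphs[OF g0 pc(1)])
    have y: "y \<in> cell V (fst ?v) (snd ?v) q" using contract(6) pc(3) g0 contract(5) by (simp add: qy dual_extend_0)
    have xi: "xs ! i = cmp V \<Delta> [q] [y]" using contract(8) dual_extend_0(4)[OF \<Delta> g0, of \<O>] by (simp add: qy)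
    have hi: "cor ?v q (xs ! i) \<in> gensP"
    proof -
      have "cors (verts \<Gamma>) ps xs ! i \<in> set (cors (verts \<Gamma>) ps xs)"
        using len contract(3) by (intro nth_mem) (simp add: length_cors)
      then have "cors (verts \<Gamma>) ps xs ! i \<in> gensP"
        using subsetD[OF decorates_Lab(2)[OF contract(2) True]] by simp
      then show ?thesis using len contract(3) q by (simp add: cors_nth)
    qed
    have h\<Delta>: "(\<Delta>, [q], [y]) \<in> gensP"
      using pc y g0 contract(5) by (simp add: gens_iff)
    have "sing (cor ?v q (xs ! i)) - Poly_Mapping.single (graph_insert (corolla (fst ?v) (snd ?v)) 0 \<Delta>, list_insert 0 [q] [q], list_insert 0 [y] [xs ! i])
        (sg (tdeg (\<not> tw) \<Delta> * sum_list (take 0 [q]))) \<in> RelP"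
      unfolding cor_def using hi \<Delta> \<Delta>0 contract(5) pc(3,4) y xi g0
      by (intro formal.span_base relators.contract) (simp_all add: cor_def)
    then have "sing (cor ?v q (xs ! i)) - sing (\<Delta>, [q], [y]) \<in> RelP"
      using corolla_graph_insert[of \<Delta> "snd ?v" "fst ?v"] contract(5) by simp
    \<comment> \<open>Moving the permutation from the label to the graph gives a tree with one
      vertex, whose class is a composite along \<open>\<Delta>\<close>.\<close>
    then have c: "cl (cor ?v q (xs ! i)) = cmp P \<Delta> [q] [cl (cor ?v q y)]"
      using cl_eq_cmp[OF h\<Delta>] pc(3) contract(5) by (simp add: clsP(3)[symmetric] Lab_def)
    let ?ls = "Lab (\<Gamma>, ps, xs)"
    have L': "list_insert i [cl (cor ?v q y)] ?ls = Lab ?h'"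
    proof -
      have "list_insert i [cl (cor ?v q y)] ?ls = ?ls[i := cl (cor ?v q y)]"
        using len contract(3) by (simp add: Lab_def list_insert_def upd_conv_take_nth_drop length_cors)
      also have "\<dots> = Lab ?h'"
        unfolding Lab_def fst_conv snd_conv ins cors_update[OF len] map_update q ..
      finally show ?thesis .
    qed
    have li: "?ls ! i = cl (cor ?v q (xs ! i))" using len contract(3) q by (simp add: Lab_def cors_nth length_cors)
    have "sing (\<Gamma>, ps, ?ls) - Poly_Mapping.single (graph_insert \<Gamma> i \<Delta>, list_insert i [q] ps, list_insert i [cl (cor ?v q y)] ?ls)
        (sg (tdeg (\<not> tw) \<Delta> * sum_list (take i ps)) :: 'k) \<in> RelL"
    proof (rule formal.span_base, rule relators.contract)
      show "(\<Gamma>, ps, ?ls) \<in> gensL" using psi_gens(1)[OF contract(2) True] by (simp add: psi_def)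
      show "decorates P (verts \<Delta>) [q] [cl (cor ?v q y)]"
      proof -
        have "cor ?v q y \<in> gensP" using y v0 gens_vertex[OF contract(2,3)] by (intro cor_gensP) simp_all
        from cl_cell[OF this, of "fst ?v" "snd ?v" q] show ?thesis using pc(3) contract(5) by simp
      qed
    qed (use contract(3,5) \<Delta>0 q pc(4) li c in simp_all)
    then show ?thesis unfolding contract(1) using True ins(1) L' pc(4)
      by (simp add: lin_ext_diff lin_ext_single Psi_def fscale_single) (simp add: psi_def qy)
  next
    case False
    then show ?thesis unfolding contract(1) using ins(1) by (simp add: lin_ext_diff lin_ext_single Psi_def formal.span_zero)
  qed
qed

lemma Psi_RelR: "x \<in> RelR \<Longrightarrow> lin_ext Psi x \<in> RelL"
  by (rule flinear_span_image[OF flinear_lin_ext Psi_relators])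

end

section \<open>\<open>Psi\<close> on grafted graphs and the composite of \<open>Phi\<close> with
  \<open>Psi\<close>\<close>

lemma cors_concat:
  "(\<And>h. h \<in> set hs \<Longrightarrow> length (fst (snd h)) = nverts (fst h) \<and> length (snd (snd h)) = nverts (fst h)) \<Longrightarrow>
    cors (concat (map verts (graphs_of hs))) (degrees_of hs) (labels_of hs) =
    concat (map (\<lambda>h. cors (verts (fst h)) (fst (snd h)) (snd (snd h))) hs)"
proof (induction hs)
  case (Cons h hs)
  have "cors (concat (map verts (graphs_of hs))) (degrees_of hs) (labels_of hs) =
    concat (map (\<lambda>h. cors (verts (fst h)) (fst (snd h)) (snd (snd h))) hs)"
    by (rule Cons.IH) (use Cons.prems in simp)
  then show ?case using Cons.prems[of h] by (simp add: cors_append)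
qed (simp add: cors_def)

lemma ml_zero: "0 \<in> set fs \<Longrightarrow> ml fs G = 0"
  by (induction fs arbitrary: G) auto

context corollary_setting
begin

lemma RelL_diff_sym: "x - y \<in> RelL \<Longrightarrow> y - x \<in> RelL"
  using formal.span_neg[of "x - y"] by fastforce

lemma RelL_trans: "x - y \<in> RelL \<Longrightarrow> y - z \<in> RelL \<Longrightarrow> x - z \<in> RelL"
  using formal.span_add[of "x - y" _ "y - z"] by fastforce

text \<open>Labels are attached vertex by vertex, and the vertices of a grafted graph are those of
  its parts in order. Degrees do not change, and hence neither do signs.\<close>

lemma psi_graft_gen:
  assumes hs: "set hs \<subseteq> gensR" and \<Gamma>: "stable_graph \<Gamma>" "verts \<Gamma> = map vtype hs"
  shows "psi (graft_gen \<Gamma> hs) = graft_gen \<Gamma> (map psi hs)" "gsign (\<not> tw) (map psi hs) = gsign (\<not> tw) hs"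
proof -
  have l: "length (fst (snd h)) = nverts (fst h) \<and> length (snd (snd h)) = nverts (fst h)" if "h \<in> set hs" for h
    using gens_lengths[of h UNIV UNIV V'] hs that by blast
  have "cors (concat (map verts (graphs_of hs))) (degrees_of hs) (labels_of hs) =
      concat (map (\<lambda>h. cors (verts (fst h)) (fst (snd h)) (snd (snd h))) hs)"
    by (rule cors_concat[OF l])
  then have "Lab (graft_gen \<Gamma> hs) = concat (map Lab hs)"
    using gens_graph_insert_all(2)[OF \<Gamma> hs] by (simp add: Lab_def[abs_def] graft_gen_def map_concat comp_def)
  then show "psi (graft_gen \<Gamma> hs) = graft_gen \<Gamma> (map psi hs)"
    by (simp add: psi_def graft_gen_def comp_def)
  show "gsign (\<not> tw) (map psi hs) = gsign (\<not> tw) hs"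
    by (induction hs) (simp_all add: psi_def gdeg_eq tsum_def comp_def)
qed

text \<open>Needs no relation. The grafted graph has a vertex of positive genus iff one of its parts
  has, and then both sides are 0.\<close>

lemma Psi_graft:
  assumes hs: "set hs \<subseteq> gensR" and \<Gamma>: "stable_graph \<Gamma>" "verts \<Gamma> = map vtype hs"
  shows "lin_ext Psi (graft (\<not> tw) \<Gamma> hs) = ml (map Psi hs) (graft (\<not> tw) \<Gamma>)"
proof -
  have v: "set (verts (fst (graft_gen \<Gamma> hs))) = (\<Union>h\<in>set hs. set (verts (fst h)))"
    using gens_graph_insert_all(2)[OF \<Gamma> hs] by (simp add: graft_gen_def)
  show ?thesis
  proof (cases "\<forall>h\<in>set hs. tree_like h")
    case True
    then have "map Psi hs = map sing (map psi hs)" by (simp add: Psi_def)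
    then have "ml (map Psi hs) (graft (\<not> tw) \<Gamma>) = graft (\<not> tw) \<Gamma> (map psi hs)" by (simp only: ml_sing)
    moreover have "tree_like (graft_gen \<Gamma> hs)" unfolding v image_UN UN_subset_iff by (rule True)
    ultimately show ?thesis
      using psi_graft_gen[OF hs \<Gamma>] by (simp add: graft_eq_gen lin_ext_single Psi_def fscale_single)
  next
    case False
    then obtain h where "h \<in> set hs" "Psi h = 0" unfolding Psi_def by meson
    then have "0 \<in> set (map Psi hs)" by (metis imageI list.set_map)
    moreover have "\<not> tree_like (graft_gen \<Gamma> hs)" unfolding v image_UN UN_subset_iff by (rule False)
    ultimately show ?thesis by (simp add: graft_eq_gen lin_ext_single Psi_def ml_zero)
  qed
qed

lemma gensP_props:
  assumes "h \<in> gensP"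
  shows "tree_like h" "genus (fst h) = 0" "fst h \<in> graphs {0}" "h \<in> gensR" "stable_graph (fst h)"
proof -
  show "tree_like h" "genus (fst h) = 0" "stable_graph (fst h)" using assms by (simp_all add: gens_iff)
  then show "fst h \<in> graphs {0}" by (simp add: graphs_def)
  show "h \<in> gensR" using assms gensP_R by blast
qed

text \<open>The contraction relation is used at one vertex after another, the last one first:
  vertices of \<open>as\<close> still carry classes of trees, those of \<open>bs\<close> are
  expanded into trees with corolla labels.\<close>

lemma contract_all:
  assumes "set (as @ bs) \<subseteq> gensP" and \<Gamma>: "stable_graph \<Gamma>" "verts \<Gamma> = map vtype (as @ bs)"
  defines "G \<equiv> (insert_from (length as) (graphs_of bs) \<Gamma>, map (gdeg (\<not> tw)) as @ degrees_of bs, map cl as @ concat (map Lab bs))"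
  shows "G \<in> gensL" "take (length as) (verts (fst G)) = map vtype as"
    "sing (\<Gamma>, map (gdeg (\<not> tw)) (as @ bs), map cl (as @ bs)) -
      Poly_Mapping.single G (sg (gsum (\<not> tw) as * tsum (\<not> tw) bs + gsign (\<not> tw) bs)) \<in> RelL"
proof -
  let ?t = "\<not> tw"
  have "set (as @ bs) \<subseteq> gensP \<Longrightarrow> verts \<Gamma> = map vtype (as @ bs) \<Longrightarrow>
    (let G = (insert_from (length as) (graphs_of bs) \<Gamma>, map (gdeg ?t) as @ degrees_of bs, map cl as @ concat (map Lab bs)) in
    G \<in> gensL \<and> take (length as) (verts (fst G)) = map vtype as \<and>
    sing (\<Gamma>, map (gdeg ?t) (as @ bs), map cl (as @ bs)) -
      Poly_Mapping.single G (sg (gsum ?t as * tsum ?t bs + gsign ?t bs)) \<in> RelL)"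
  proof (induction bs arbitrary: as)
    case Nil
    have g: "as ! i \<in> gensP" if "i < length as" for i
      using Nil.prems(1) nth_mem[OF that] by (metis append_Nil2 subsetD)
    have "cl (as ! i) \<in> cell P (genus (fst (as ! i))) (arity (fst (as ! i))) (gdeg ?t (as ! i))" if "i < length as" for i
      by (rule cl_cell[OF g[OF that]]) simp_all
    moreover have "fst ` set (verts \<Gamma>) \<subseteq> {0}"
      using Nil.prems gensP_props(2) by fastforce
    ultimately have "(\<Gamma>, map (gdeg ?t) as, map cl as) \<in> gensL"
      using \<Gamma>(1) Nil.prems(2) by (simp add: gens_iff decorates_def)
    then show ?case using Nil.prems(2) by (simp add: formal.span_zero)
  next
    case (Cons h bs)
    define \<Theta> where "\<Theta> = insert_from (Suc (length as)) (graphs_of bs) \<Gamma>"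
    define ps where "ps = (map (gdeg ?t) as @ [gdeg ?t h]) @ degrees_of bs"
    define xs where "xs = (map cl as @ [cl h]) @ concat (map Lab bs)"
    have h: "h \<in> gensP" using Cons.prems(1) by simp
    note hp = gensP_props[OF h]
    \<comment> \<open>The vertices behind \<open>h\<close> are expanded while \<open>h\<close> still
      counts as unexpanded.\<close>
    have IH: "(\<Theta>, ps, xs) \<in> gensL" "take (Suc (length as)) (verts \<Theta>) = map vtype as @ [vtype h]"
      "sing (\<Gamma>, map (gdeg ?t) (as @ h # bs), map cl (as @ h # bs)) -
        Poly_Mapping.single (\<Theta>, ps, xs) (sg (gsum ?t (as @ [h]) * tsum ?t bs + gsign ?t bs)) \<in> RelL"
      using Cons.IH[of "as @ [h]"] Cons.prems by (simp_all add: Let_def \<Theta>_def ps_def xs_def)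
    have n: "length as < nverts \<Theta>"
      using arg_cong[OF IH(2), of length] by simp
    have v: "verts \<Theta> ! length as = vtype h" "take (length as) (verts \<Theta>) = map vtype as"
    proof -
      have "take (Suc (length as)) (verts \<Theta>) ! length as = vtype h" unfolding IH(2) by (simp add: nth_append)
      then show "verts \<Theta> ! length as = vtype h" by simp
      have "take (length as) (take (Suc (length as)) (verts \<Theta>)) = map vtype as" unfolding IH(2) by simp
      then show "take (length as) (verts \<Theta>) = map vtype as" by (simp add: min_def)
    qed
    let ?G = "(graph_insert \<Theta> (length as) (fst h), list_insert (length as) (fst (snd h)) ps, list_insert (length as) (Lab h) xs)"
    have p: "ps ! length as = gdeg ?t h" "xs ! length as = cl h" "sum_list (take (length as) ps) = gsum ?t as"
      by (simp_all add: ps_def xs_def nth_append gsum_def)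
    have dec: "decorates P (verts (fst h)) (fst (snd h)) (Lab h)" by (rule decorates_Lab(1)[OF hp(4,1)])
    have G: "?G = (insert_from (length as) (graphs_of (h # bs)) \<Gamma>, map (gdeg ?t) as @ degrees_of (h # bs), map cl as @ concat (map Lab (h # bs)))"
      by (simp add: \<Theta>_def ps_def xs_def list_insert_def)
    have 1: "?G \<in> gensL"
      using gens_insert[OF IH(1) n hp(5,1) v(1) dec] .
    have 2: "take (length as) (verts (graph_insert \<Theta> (length as) (fst h))) = map vtype as"
      using n v(2) by (simp add: list_insert_def)
    have "sing (\<Theta>, ps, xs) - Poly_Mapping.single ?G (sg (tdeg ?t (fst h) * sum_list (take (length as) ps)) :: 'k) \<in> RelL"
      using hp(3) p v(1) dec cl_eq_cmp[OF h]
      by (intro formal.span_base relators.contract IH(1) n) (simp_all add: gdeg_eq)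
    from span_single_trans[OF IH(3) this]
    have 3: "sing (\<Gamma>, map (gdeg ?t) (as @ h # bs), map cl (as @ h # bs)) -
        Poly_Mapping.single ?G (sg (gsum ?t as * tsum ?t (h # bs) + gsign ?t (h # bs))) \<in> RelL"
      unfolding p(3) sg_add[symmetric] by (simp add: algebra_simps)
    show ?case unfolding Let_def G[symmetric] using 1 2 3 by simp
  qed
  then show "G \<in> gensL" "take (length as) (verts (fst G)) = map vtype as"
    "sing (\<Gamma>, map (gdeg ?t) (as @ bs), map cl (as @ bs)) -
      Poly_Mapping.single G (sg (gsum ?t as * tsum ?t bs + gsign ?t bs)) \<in> RelL"
    using assms(1,3) unfolding Let_def G_def by blast+
qed

lemma graft_psi:
  assumes hs: "set hs \<subseteq> gensP" and \<Gamma>: "stable_graph \<Gamma>" "verts \<Gamma> = map vtype hs"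
  shows "graft (\<not> tw) \<Gamma> (map psi hs) - sing (\<Gamma>, map (gdeg (\<not> tw)) hs, map cl hs) \<in> RelL"
proof -
  have hs': "set hs \<subseteq> gensR" using hs gensP_R by blast
  have "sing (\<Gamma>, map (gdeg (\<not> tw)) hs, map cl hs) - graft (\<not> tw) \<Gamma> (map psi hs) \<in> RelL"
    using contract_all(3)[of "[]" hs \<Gamma>] hs \<Gamma> psi_graft_gen(2)[OF hs' \<Gamma>]
    by (simp add: graft_eq_gen graft_gen_def psi_def graph_insert_all_eq comp_def)
  then show ?thesis by (rule RelL_diff_sym)
qed

text \<open>The multilinear relations of the envelope resolve a label that is the class of a formal
  sum into classes of single trees; \<open>as\<close> holds the labels of the slots already
  treated.\<close>

lemma expand_classes:
  assumes \<Gamma>: "stable_graph \<Gamma>" "fst ` set (verts \<Gamma>) \<subseteq> {0}" "length ps = nverts \<Gamma>"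
  shows "length as + length fs = nverts \<Gamma> \<Longrightarrow>
    (\<And>j. j < length as \<Longrightarrow> as ! j \<in> cell P (fst (verts \<Gamma> ! j)) (snd (verts \<Gamma> ! j)) (ps ! j)) \<Longrightarrow>
    (\<And>j. j < length fs \<Longrightarrow> fs ! j \<in> homP (fst (verts \<Gamma> ! (length as + j))) (snd (verts \<Gamma> ! (length as + j))) (ps ! (length as + j))) \<Longrightarrow>
    sing (\<Gamma>, ps, as @ map clsP fs) - ml fs (\<lambda>hs. sing (\<Gamma>, ps, as @ map cl hs)) \<in> RelL"
proof (induction fs arbitrary: as)
  case Nil
  then show ?case by (simp add: formal.span_zero)
next
  case (Cons f fs)
  let ?i = "length as"
  let ?v = "verts \<Gamma> ! ?i"
  define A where "A = {h \<in> gensP. vtype h = (fst ?v, snd ?v) \<and> gdeg (\<not> tw) h = ps ! ?i}"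
  have hom: "x \<in> homP (fst ?v) (snd ?v) (ps ! ?i) \<longleftrightarrow> Poly_Mapping.keys x \<subseteq> A" for x
    by (simp add: homP_def A_def)
  have f: "Poly_Mapping.keys f \<subseteq> A" using Cons.prems(3)[of 0] hom by simp
  have g: "(\<Gamma>, ps, as @ clsP x # map clsP fs) \<in> gensL" if x: "Poly_Mapping.keys x \<subseteq> A" for x
  proof -
    have "(as @ clsP x # map clsP fs) ! j \<in> cell P (fst (verts \<Gamma> ! j)) (snd (verts \<Gamma> ! j)) (ps ! j)" if j: "j < nverts \<Gamma>" for j
    proof -
      consider "j < ?i" | "j = ?i" | k where "j = ?i + Suc k" "k < length fs"
      proof (cases "?i < j")
        case True
        then obtain k where "j = Suc (?i + k)" using less_imp_Suc_add by blast
        then show thesis using that(3)[of k] j Cons.prems(1) by simp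
      qed (use that in linarith)
      then show ?thesis
      proof cases
        case 1 then show ?thesis using Cons.prems(2)[of j] by (simp add: nth_append)
      next
        case 2 then show ?thesis using x by (simp add: P_simps hom)
      next
        case (3 k) then show ?thesis using Cons.prems(3)[of "Suc k"] by (simp add: nth_append P_simps)
      qed
    qed
    then show ?thesis using \<Gamma> Cons.prems(1) by (simp add: gens_iff decorates_def)
  qed
  define T where "T x = (sing (\<Gamma>, ps, as @ clsP x # map clsP fs) :: _ \<Rightarrow>\<^sub>0 'k)" for x
  have "T (fscale c x + y) - fscale c (T x) - T y \<in> RelL"
    if xy: "Poly_Mapping.keys x \<subseteq> A" "Poly_Mapping.keys y \<subseteq> A" for c x y
  proof -
    let ?l = "as @ 0 # map clsP fs"
    have u: "?l[?i := z] = as @ z # map clsP fs" for z by simp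
    have "sing (\<Gamma>, ps, ?l[?i := scl P c (clsP x) + clsP y]) - Poly_Mapping.single (\<Gamma>, ps, ?l[?i := clsP x]) c
      - sing (\<Gamma>, ps, ?l[?i := clsP y]) \<in> RelL"
    proof (rule formal.span_base, rule relators.multilinear)
      show "(\<Gamma>, ps, ?l[?i := clsP x]) \<in> gensL" "(\<Gamma>, ps, ?l[?i := clsP y]) \<in> gensL"
        unfolding u by (rule g, rule xy)+
      show "?i < nverts \<Gamma>" using Cons.prems(1) by simp
    qed
    then show ?thesis
      by (simp add: T_def P_simps flinear_add[OF clsP(1)] flinear_scale[OF clsP(1)] fscale_single)
  qed
  from linear_mod_lin_ext[OF subspace_RelL this f]
  have 1: "T f - lin_ext (\<lambda>h. T (sing h)) f \<in> RelL" .
  have "fscale 1 (lin_ext (\<lambda>h. T (sing h)) f) - fscale 1 (lin_ext (\<lambda>h. ml fs (\<lambda>hs. sing (\<Gamma>, ps, as @ cl h # map cl hs))) f) \<in> RelL"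
  proof (rule lin_ext_combination_in[OF subspace_RelL])
    fix h assume "h \<in> Poly_Mapping.keys f"
    then have h: "cl h \<in> cell P (fst ?v) (snd ?v) (ps ! ?i)" using f by (auto simp: P_simps hom)
    have "sing (\<Gamma>, ps, (as @ [cl h]) @ map clsP fs) - ml fs (\<lambda>hs. sing (\<Gamma>, ps, (as @ [cl h]) @ map cl hs)) \<in> RelL"
    proof (rule Cons.IH)
      show "length (as @ [cl h]) + length fs = nverts \<Gamma>" using Cons.prems(1) by simp
      show "(as @ [cl h]) ! j \<in> cell P (fst (verts \<Gamma> ! j)) (snd (verts \<Gamma> ! j)) (ps ! j)" if "j < length (as @ [cl h])" for j
        using Cons.prems(2)[of j] h that by (cases "j < ?i") (auto simp: nth_append less_Suc_eq)
      show "fs ! j \<in> homP (fst (verts \<Gamma> ! (length (as @ [cl h]) + j))) (snd (verts \<Gamma> ! (length (as @ [cl h]) + j))) (ps ! (length (as @ [cl h]) + j))"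
        if "j < length fs" for j
        using Cons.prems(3)[of "Suc j"] that by simp
    qed
    then show "fscale 1 (T (sing h)) - fscale 1 (ml fs (\<lambda>hs. sing (\<Gamma>, ps, as @ cl h # map cl hs))) \<in> RelL"
      by (simp add: T_def)
  qed
  then have "T f - ml (f # fs) (\<lambda>hs. sing (\<Gamma>, ps, as @ map cl hs)) \<in> RelL"
    using RelL_trans[OF 1] by simp
  then show ?case by (simp add: T_def)
qed

text \<open>\<open>Phi\<close> forgets how the graph was divided into trees. Applied to
  representatives, \<open>Psi\<close> keeps the grafting, and the contraction relations restore
  vertices labelled by classes of trees, which then recombine linearly.\<close>

lemma Psi_Phi:
  assumes h: "h \<in> gensL"
  shows "lin_ext Psi (Phi h) - sing h \<in> RelL"
proof -
  obtain \<Gamma> ps fs where h': "h = (\<Gamma>, ps, fs)" by (cases h)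
  let ?t = "\<not> tw"
  have hL: "(\<Gamma>, ps, fs) \<in> gensL" using h h' by simp
  have st: "stable_graph \<Gamma>" and v0: "fst ` set (verts \<Gamma>) \<subseteq> {0}" and dec: "decorates P (verts \<Gamma>) ps fs"
    using hL by (simp_all add: gens_iff)
  have len: "length ps = nverts \<Gamma>" "length fs = nverts \<Gamma>" using decorates_lengths[OF dec] by simp_all
  have "\<exists>f. fs ! i = clsP f \<and> f \<in> homP (fst (verts \<Gamma> ! i)) (snd (verts \<Gamma> ! i)) (ps ! i)" if "i < nverts \<Gamma>" for i
    using decorates_nth[OF dec that] unfolding P_simps by blast
  \<comment> \<open>A representative of each label that is homogeneous of the prescribed type and
    degree, so that all tuples of its terms fit.\<close>
  then obtain F where F: "\<And>i. i < nverts \<Gamma> \<Longrightarrow> fs ! i = clsP (F i) \<and> F i \<in> homP (fst (verts \<Gamma> ! i)) (snd (verts \<Gamma> ! i)) (ps ! i)"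
    by metis
  define f0s where "f0s = map F [0..<nverts \<Gamma>]"
  have lf: "length f0s = nverts \<Gamma>" and f0: "\<And>i. i < nverts \<Gamma> \<Longrightarrow> f0s ! i = F i" by (simp_all add: f0s_def)
  have fs: "fs = map clsP f0s" using len lf f0 F by (intro nth_equalityI) simp_all
  have k: "Poly_Mapping.keys f \<subseteq> gensP" if f: "f \<in> set fs \<union> set f0s" for f
  proof -
    have "Poly_Mapping.keys (F i) \<subseteq> gensP" if "i < nverts \<Gamma>" for i using F[OF that] by (auto simp: homP_def)
    moreover have "f \<in> set fs \<or> (\<exists>i<nverts \<Gamma>. f = F i)" using f unfolding f0s_def by auto
    ultimately show ?thesis using gensL_keys[OF hL, unfolded snd_conv] by blast
  qed
  have "list_all2 (\<lambda>f g. f - g \<in> RelR) fs f0s"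
    using clsP_RelR lf by (simp add: fs list_all2_conv_all_nth)
  then have "graft_sums ?t \<Gamma> ps fs - graft_sums ?t \<Gamma> ps f0s \<in> RelR"
    using k gensP_R by (intro graft_sums_cong[OF st UNIV_I linear_cells_dual]) blast+
  then have 1: "lin_ext Psi (Phi h) - lin_ext Psi (graft_sums ?t \<Gamma> ps f0s) \<in> RelL"
    using Psi_RelR by (fastforce simp: h' Phi_def lin_ext_diff)
  have "fscale 1 (lin_ext Psi (graft_sums ?t \<Gamma> ps f0s)) - fscale 1 (ml f0s (\<lambda>hs. sing (\<Gamma>, ps, [] @ map cl hs))) \<in> RelL"
    unfolding graft_sums_eq_ml ml_linear_out[OF flinear_lin_ext]
  proof (rule ml_diff_in[OF subspace_RelL])
    fix hs assume hs: "in_keys hs f0s"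
    have g: "set hs \<subseteq> gensP" by (rule in_keys_subset[OF hs]) (use k in blast)
    then have gR: "set hs \<subseteq> gensR" using gensP_R by blast
    have "vtype (hs ! i) = verts \<Gamma> ! i \<and> gdeg ?t (hs ! i) = ps ! i" if i: "i < nverts \<Gamma>" for i
    proof -
      have "hs ! i \<in> Poly_Mapping.keys (F i)"
        using list_all2_nthD2[OF hs, of i] lf f0[OF i] i by simp
      moreover have "Poly_Mapping.keys (F i) \<subseteq>
          {h \<in> gensP. vtype h = (fst (verts \<Gamma> ! i), snd (verts \<Gamma> ! i)) \<and> gdeg ?t h = ps ! i}"
        using F[OF i] by (simp add: homP_def)
      ultimately have "hs ! i \<in> {h \<in> gensP. vtype h = (fst (verts \<Gamma> ! i), snd (verts \<Gamma> ! i)) \<and> gdeg ?t h = ps ! i}"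
        by (rule subsetD[rotated])
      then show ?thesis by simp
    qed
    moreover have lh: "length hs = nverts \<Gamma>" using list_all2_lengthD[OF hs] lf by simp
    ultimately have p: "ps = map (gdeg ?t) hs" and v: "verts \<Gamma> = map vtype hs"
      using len by (auto intro!: nth_equalityI)
    have "Psi k = sing (psi k)" if "k \<in> set hs" for k
      using gensP_props(1)[of k] g that by (simp add: Psi_def subsetD)
    then have "map Psi hs = map sing (map psi hs)" by simp
    then have "lin_ext Psi (graft ?t \<Gamma> hs) = graft ?t \<Gamma> (map psi hs)"
      unfolding Psi_graft[OF gR st v] by (simp only: ml_sing)
    then show "fscale 1 (lin_ext Psi (if fits ?t \<Gamma> ps hs then graft ?t \<Gamma> hs else 0)) - fscale 1 (sing (\<Gamma>, ps, [] @ map cl hs)) \<in> RelL"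
      using graft_psi[OF g st v] p v by (simp add: fits_iff)
  qed
  then have 2: "lin_ext Psi (Phi h) - ml f0s (\<lambda>hs. sing (\<Gamma>, ps, [] @ map cl hs)) \<in> RelL"
    using RelL_trans[OF 1] by simp
  have "sing (\<Gamma>, ps, [] @ map clsP f0s) - ml f0s (\<lambda>hs. sing (\<Gamma>, ps, [] @ map cl hs)) \<in> RelL"
    by (rule expand_classes[OF st v0 len(1)]) (use lf f0 F in simp_all)
  from RelL_trans[OF 2 RelL_diff_sym[OF this]] show ?thesis by (simp add: h' fs)
qed

end

section \<open>The isomorphism\<close>

text \<open>Moves a linear operation on one label inside the expansion, where it acts on single
  generators.\<close>

lemma ml_update_slot:
  "i < length fs \<Longrightarrow> ml (fs[i := lin_ext D (fs ! i)]) T = ml fs (\<lambda>hs. lin_ext (\<lambda>h'. T (hs[i := h'])) (D (hs ! i)))"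
proof (induction fs arbitrary: i T)
  case (Cons f fs)
  show ?case
  proof (cases i)
    case 0
    then show ?thesis by (simp add: lin_ext_lin_ext ml_lin_ext_commute)
  next
    case (Suc j)
    then show ?thesis using Cons by simp
  qed
qed simp

lemma list_insert_single_update: "i < length xs \<Longrightarrow> list_insert i [z] xs = xs[i := z]"
  by (simp add: list_insert_def upd_conv_take_nth_drop)

text \<open>The degree prescribed at the slot and the degree of the generator placed there both grow
  by 1.\<close>

lemma fits_update:
  assumes "i < length hs" "vtype h' = vtype (hs ! i)" "gdeg tw h' = gdeg tw (hs ! i) + 1" "i < length ps"
  shows "fits tw \<Gamma> (ps[i := ps ! i + 1]) (hs[i := h']) \<longleftrightarrow> fits tw \<Gamma> ps hs"
proof -
  have "map vtype (hs[i := h']) = map vtype hs"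
    unfolding map_update assms(2) using list_update_id[of "map vtype hs" i] assms(1) by simp
  moreover have "ps[i := ps ! i + 1] = map (gdeg tw) (hs[i := h']) \<longleftrightarrow> ps = map (gdeg tw) hs"
  proof
    assume *: "ps[i := ps ! i + 1] = map (gdeg tw) (hs[i := h'])"
    show "ps = map (gdeg tw) hs"
    proof (rule nth_equalityI)
      show l: "length ps = length (map (gdeg tw) hs)" using arg_cong[OF *, of length] by simp
      fix j assume "j < length ps"
      then show "ps ! j = map (gdeg tw) hs ! j"
        using arg_cong[OF *, of "\<lambda>xs. xs ! j"] l assms by (cases "j = i") simp_all
    qed
  qed (use assms in \<open>simp add: map_update\<close>)
  ultimately show ?thesis unfolding fits_iff by simp
qed

lemma derivation_triple:
  "derivation t \<delta> (\<Gamma>, ps, xs) = (\<Sum>i < length (verts \<Gamma>). fscale (sg (tdeg t \<Gamma> + sum_list (take i ps)))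
     (lin_ext (graft_at t (\<Gamma>, ps, xs) i) (\<delta> (fst (verts \<Gamma> ! i)) (snd (verts \<Gamma> ! i)) (ps ! i) (xs ! i))))"
  by (simp add: derivation_def)

context derivation_data
begin

lemma keys_derivation:
  assumes h: "h \<in> gens Is Js X"
  shows "Poly_Mapping.keys (derivation tw \<delta> h) \<subseteq> {k \<in> gens Is Js X. vtype k = vtype h \<and> gdeg tw k = gdeg tw h + 1}" (is "_ \<subseteq> ?A")
proof -
  have "Poly_Mapping.keys (D_at h i) \<subseteq> ?A" if i: "i < nverts (fst h)" for i
    unfolding D_at_def
  proof (rule keys_lin_ext)
    fix k assume k: "k \<in> Poly_Mapping.keys (\<delta> (fst (verts (fst h) ! i)) (snd (verts (fst h) ! i)) (fst (snd h) ! i) (snd (snd h) ! i))"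
    note kv = keys_vertex[OF h i k]
    have len: "length (fst (snd h)) = nverts (fst h)" using gens_lengths[OF h] by simp
    have "genus (graph_insert (fst h) i (fst k)) = genus (fst h)"
      using genus_graph_insert[OF gens_stable[OF h] kv(4) i] kv(2) by (metis fst_conv)
    moreover have "sum_list (list_insert i (fst (snd k)) (fst (snd h))) = sum_list (fst (snd h)) - fst (snd h) ! i + sum_list (fst (snd k))"
      using i len by (intro sum_list_list_insert) simp
    ultimately show "Poly_Mapping.keys (graft_at tw h i k) \<subseteq> ?A"
      using graft_at_gens[OF h i kv(1,2)] kv(9) unfolding graft_at_eq
      by (simp add: gdeg_eq arity_def)
  qed
  then have "derivation tw \<delta> h \<in> {f. Poly_Mapping.keys f \<subseteq> ?A}"
    unfolding derivation_eq
    by (intro formal.subspace_sum[OF subspace_keys] formal.subspace_scale[OF subspace_keys]) simp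
  then show ?thesis by simp
qed

end

context corollary_setting
begin

abbreviation "DR \<equiv> derivation (\<not> tw) (feynman_gen tw (extend_by_zero \<O>))"

lemma derivation_gensP:
  assumes "k \<in> gensP"
  shows "derivation (\<not> tw) (feynman_gen tw \<O>) k = DR k"
proof -
  have "fst (verts (fst k) ! i) = 0" if "i < nverts (fst k)" for i
    using gensP_props(1)[OF assms] nth_mem[OF that] by auto
  then show ?thesis
    unfolding derivation_def by (cases k) (auto intro!: sum.cong simp: feynman_gen_extend)
qed

lemma dif_P: "Poly_Mapping.keys f \<subseteq> gensP \<Longrightarrow> dif P g n p f = clsP (lin_ext DR f)"
  unfolding P_simps by (intro arg_cong[of _ _ clsP] lin_ext_cong derivation_gensP) blast

text \<open>The derivation of the envelope takes values in single corollas, and inserting a corolla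
  leaves the graph as it is; only the label and its degree change.\<close>

lemma dL_eq:
  assumes "(\<Gamma>, ps, fs) \<in> gensL"
  shows "dL (\<Gamma>, ps, fs) = (\<Sum>i<nverts \<Gamma>. fscale (sg (tdeg (\<not> tw) \<Gamma> + sum_list (take i ps)))
    (sing (\<Gamma>, ps[i := ps ! i + 1], fs[i := clsP (lin_ext DR (fs ! i))])))"
  unfolding dL_def derivation_triple
proof (rule sum.cong[OF HOL.refl], rule arg_cong[of _ _ "fscale _"])
  fix i assume "i \<in> {..<nverts \<Gamma>}"
  then have i: "i < nverts \<Gamma>" by simp
  have len: "length ps = nverts \<Gamma>" "length fs = nverts \<Gamma>" using gens_lengths[OF assms] by simp_all
  have "graph_insert \<Gamma> i (corolla (fst (verts \<Gamma> ! i)) (snd (verts \<Gamma> ! i))) = \<Gamma>"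
    using gens_stable[OF assms] by (intro graph_insert_corolla i stable_imp_wf) simp_all
  moreover have "dif P g n p (fs ! i) = clsP (lin_ext DR (fs ! i))" for g n p
    using i len gensL_keys[OF assms, of "fs ! i"] by (intro dif_P) simp
  ultimately show "lin_ext (graft_at (\<not> tw) (\<Gamma>, ps, fs) i)
      (sing (corolla (fst (verts \<Gamma> ! i)) (snd (verts \<Gamma> ! i)), [ps ! i + 1],
        [dif P (fst (verts \<Gamma> ! i)) (snd (verts \<Gamma> ! i)) (ps ! i) (fs ! i)])) =
      (sing (\<Gamma>, ps[i := ps ! i + 1], fs[i := clsP (lin_ext DR (fs ! i))]) :: _ \<Rightarrow>\<^sub>0 'k)"
    using i len by (simp add: graft_at_eq list_insert_single_update)
qed

text \<open>Both sides are compared with the signed sum of the terms \<open>Q i\<close>, in which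
  the differential acts on the \<open>i\<close>-th label before grafting: the envelope side differs
  by \<open>clsP\<close> on a label, the Feynman side by the Leibniz rule.\<close>

lemma Phi_dif:
  assumes h: "h \<in> gensL"
  shows "lin_ext Phi (dL h) - lin_ext DR (Phi h) \<in> RelR"
proof -
  obtain \<Gamma> ps fs where h': "h = (\<Gamma>, ps, fs)" by (cases h)
  let ?t = "\<not> tw"
  have hL: "(\<Gamma>, ps, fs) \<in> gensL" using h h' by simp
  have st: "stable_graph \<Gamma>" using gens_stable[OF hL] by simp
  have len: "length ps = nverts \<Gamma>" "length fs = nverts \<Gamma>" using gens_lengths[OF hL] by simp_all
  have k: "Poly_Mapping.keys f \<subseteq> gensR" if "f \<in> set fs" for f
    using gensL_keys[OF hL] that gensP_R by fastforce
  define s where "s i = (sg (tdeg ?t \<Gamma> + sum_list (take i ps)) :: 'k)" for i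
  define Q where "Q i = graft_sums ?t \<Gamma> (ps[i := ps ! i + 1]) (fs[i := lin_ext DR (fs ! i)])" for i
  have "Phi (\<Gamma>, ps[i := ps ! i + 1], fs[i := clsP (lin_ext DR (fs ! i))]) - Q i \<in> RelR" if i: "i < nverts \<Gamma>" for i
  proof -
    have i': "i < length fs" using i len by simp
    show ?thesis
      unfolding Phi_def Q_def fst_conv snd_conv upd_conv_take_nth_drop[OF i']
    proof (rule graft_sums_slot[OF st UNIV_I linear_cells_dual _ clsP_RelR(2)])
      fix f assume "f \<in> set (take i fs) \<union> set (drop (Suc i) fs)"
      then have "f \<in> set fs" using set_take_subset set_drop_subset by fast
      then show "Poly_Mapping.keys f \<subseteq> gensR" by (rule k)
    qed
  qed
  then have "(\<Sum>i<nverts \<Gamma>. fscale (s i) (Phi (\<Gamma>, ps[i := ps ! i + 1], fs[i := clsP (lin_ext DR (fs ! i))]) - Q i)) \<in> RelR"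
    by (intro formal.span_sum formal.span_scale) simp
  moreover have "(\<Sum>i<nverts \<Gamma>. fscale (s i) (Phi (\<Gamma>, ps[i := ps ! i + 1], fs[i := clsP (lin_ext DR (fs ! i))]) - Q i)) =
      lin_ext Phi (dL h) - (\<Sum>i<nverts \<Gamma>. fscale (s i) (Q i))"
    unfolding h' dL_eq[OF hL] lin_ext_sum lin_ext_scale lin_ext_sing s_def formal.scale_right_diff_distrib sum_subtractf ..
  ultimately have 1: "lin_ext Phi (dL h) - (\<Sum>i<nverts \<Gamma>. fscale (s i) (Q i)) \<in> RelR" by simp
  define W where "W hs i = lin_ext (\<lambda>h'. graft ?t \<Gamma> (hs[i := h'])) (DR (hs ! i))" for hs i
  have Q: "Q i = ml fs (\<lambda>hs. if fits ?t \<Gamma> ps hs then W hs i else 0)" if i: "i < nverts \<Gamma>" for i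
  proof -
    have i': "i < length fs" using i len by simp
    show ?thesis
      unfolding Q_def graft_sums_eq_ml ml_update_slot[OF i']
    proof (rule ml_cong)
      fix hs assume hs: "in_keys hs fs"
      have lh: "i < length hs" using list_all2_lengthD[OF hs] i len by simp
      have "hs ! i \<in> gensR" using in_keys_subset[OF hs k] lh nth_mem by blast
      note kd = E.F.keys_derivation[OF this]
      have F: "fits ?t \<Gamma> (ps[i := ps ! i + 1]) (hs[i := h']) = fits ?t \<Gamma> ps hs" if "h' \<in> Poly_Mapping.keys (DR (hs ! i))" for h'
        using kd that lh i len by (intro fits_update) auto
      have "lin_ext (\<lambda>h'. if fits ?t \<Gamma> (ps[i := ps ! i + 1]) (hs[i := h']) then graft ?t \<Gamma> (hs[i := h']) else 0) (DR (hs ! i)) =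
          lin_ext (\<lambda>h'. if fits ?t \<Gamma> ps hs then graft ?t \<Gamma> (hs[i := h']) else (0 :: ('a \<Rightarrow> 'k) gen \<Rightarrow>\<^sub>0 'k)) (DR (hs ! i))"
        by (rule lin_ext_cong) (simp only: F)
      then show "lin_ext (\<lambda>h'. if fits ?t \<Gamma> (ps[i := ps ! i + 1]) (hs[i := h']) then graft ?t \<Gamma> (hs[i := h']) else 0) (DR (hs ! i)) =
          (if fits ?t \<Gamma> ps hs then W hs i else 0)"
        by (simp add: W_def)
    qed
  qed
  \<comment> \<open>The Leibniz rule, applied to every fitting tuple of trees in the
    expansion.\<close>
  have "fscale 1 (lin_ext DR (Phi h)) - fscale 1 (ml fs (\<lambda>hs. if fits ?t \<Gamma> ps hs then (\<Sum>i<nverts \<Gamma>. fscale (s i) (W hs i)) else 0)) \<in> RelR"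
    unfolding h' Phi_eq ml_linear_out[OF flinear_lin_ext]
  proof (rule ml_diff_in[OF subspace_RelR])
    fix hs assume hs: "in_keys hs fs"
    have g: "set hs \<subseteq> gensR" using in_keys_subset[OF hs k] .
    have lh: "length hs = nverts \<Gamma>" using list_all2_lengthD[OF hs] len by simp
    show "fscale 1 (lin_ext DR (if fits ?t \<Gamma> ps hs then graft ?t \<Gamma> hs else 0)) -
        fscale 1 (if fits ?t \<Gamma> ps hs then (\<Sum>i<nverts \<Gamma>. fscale (s i) (W hs i)) else 0) \<in> RelR"
    proof (cases "fits ?t \<Gamma> ps hs")
      case True
      then have p: "ps = map (gdeg ?t) hs" and v: "verts \<Gamma> = map vtype hs" by (simp_all add: fits_iff)
      have "s i = sg (tdeg ?t \<Gamma> + gsum ?t (take i hs))" for i by (simp add: s_def p gsum_def take_map)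
      then show ?thesis
        using E.F.derivation_graft[OF st UNIV_I v g] True lh by (simp add: W_def)
    qed (simp add: formal.span_zero)
  qed
  moreover have "ml fs (\<lambda>hs. if fits ?t \<Gamma> ps hs then (\<Sum>i<nverts \<Gamma>. fscale (s i) (W hs i)) else 0) = (\<Sum>i<nverts \<Gamma>. fscale (s i) (Q i))"
  proof -
    have "ml fs (\<lambda>hs. if fits ?t \<Gamma> ps hs then (\<Sum>i<nverts \<Gamma>. fscale (s i) (W hs i)) else 0) =
      ml fs (\<lambda>hs. \<Sum>i<nverts \<Gamma>. fscale (s i) (if fits ?t \<Gamma> ps hs then W hs i else 0))"
      by (rule ml_cong) simp
    also have "\<dots> = (\<Sum>i<nverts \<Gamma>. fscale (s i) (Q i))"
      unfolding ml_fun_sum ml_fun_scale using Q by simp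
    finally show ?thesis .
  qed
  ultimately have "lin_ext DR (Phi h) - (\<Sum>i<nverts \<Gamma>. fscale (s i) (Q i)) \<in> RelR" by simp
  from RelR_trans[OF 1 RelR_diff_sym[OF this]] show ?thesis .
qed

section \<open>The maps between classes and their compatibility with the structure\<close>

definition phi where "phi F = clsR (lin_ext Phi F)"
definition phi_inv where "phi_inv Y = clsL (lin_ext Psi Y)"

lemma clsR_RelR: "clsR x - x \<in> RelR" and clsL_RelL: "clsL y - y \<in> RelL"
  using clsR(2)[of x] clsL(2)[of y] by (auto intro: RelR_diff_sym RelL_diff_sym)

lemma phi_clsL: "phi (clsL F) = clsR (lin_ext Phi F)"
  unfolding phi_def clsR(3) lin_ext_diff[symmetric] by (rule Phi_RelL[OF clsL_RelL])

lemma phi_inv_clsR: "phi_inv (clsR F) = clsL (lin_ext Psi F)"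
  unfolding phi_inv_def clsL(3) lin_ext_diff[symmetric] by (rule Psi_RelR[OF clsR_RelR])

lemma keys_clsR: "Poly_Mapping.keys f \<subseteq> gensR \<Longrightarrow> Poly_Mapping.keys (clsR f) \<subseteq> gensR"
  using span_relators_keys[OF linear_cells_dual clsR_RelR, of f] Poly_Mapping.keys_add[of f "clsR f - f"] by fastforce

lemma keys_clsL: "Poly_Mapping.keys f \<subseteq> gensL \<Longrightarrow> Poly_Mapping.keys (clsL f) \<subseteq> gensL"
  using span_relators_keys[OF linear_cells_P clsL_RelL, of f] Poly_Mapping.keys_add[of f "clsL f - f"] by fastforce

lemma keys_lin_ext_Phi: "F \<in> homL g n p \<Longrightarrow> lin_ext Phi F \<in> homR g n p"
  unfolding homL_def homR_def mem_Collect_eq using keys_Phi by (intro keys_lin_ext) fastforce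

lemma keys_lin_ext_Psi: "F \<in> homR g n p \<Longrightarrow> lin_ext Psi F \<in> homL g n p"
  unfolding homL_def homR_def mem_Collect_eq using keys_Psi by (intro keys_lin_ext) fastforce

lemma cellL_keys: "x \<in> cell L g n p \<Longrightarrow> Poly_Mapping.keys x \<subseteq> gensL"
  unfolding L_simps using keys_clsL by (auto simp: homL_def)

lemma cellR_keys: "x \<in> cell R g n p \<Longrightarrow> Poly_Mapping.keys x \<subseteq> gensR"
  unfolding R_simps using keys_clsR by (auto simp: homR_def)

lemma phi_inv_phi:
  assumes F: "Poly_Mapping.keys F \<subseteq> gensL"
  shows "phi_inv (phi (clsL F)) = clsL F"
proof -
  have "lin_ext (\<lambda>h. lin_ext Psi (Phi h) - sing h) F \<in> RelL"
    using F by (intro lin_ext_in_subspace[OF subspace_RelL] Psi_Phi) blast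
  then have "lin_ext Psi (lin_ext Phi F) - F \<in> RelL" by (simp add: lin_ext_fun_diff lin_ext_lin_ext)
  then show ?thesis unfolding phi_clsL phi_inv_clsR clsL(3) .
qed

lemma phi_phi_inv:
  assumes F: "Poly_Mapping.keys F \<subseteq> gensR"
  shows "phi (phi_inv (clsR F)) = clsR F"
proof -
  have "lin_ext (\<lambda>h. lin_ext Phi (Psi h) - sing h) F \<in> RelR"
    using F by (intro lin_ext_in_subspace[OF subspace_RelR] Phi_Psi) blast
  then have "lin_ext Phi (lin_ext Psi F) - F \<in> RelR" by (simp add: lin_ext_fun_diff lin_ext_lin_ext)
  then show ?thesis unfolding phi_clsL phi_inv_clsR clsR(3) .
qed

lemma homL_keys: "F \<in> homL g n p \<Longrightarrow> Poly_Mapping.keys F \<subseteq> gensL"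
  and homR_keys: "G \<in> homR g n p \<Longrightarrow> Poly_Mapping.keys G \<subseteq> gensR"
  by (auto simp: homL_def homR_def)

lemma bij_phi: "bij_betw phi (cell L g n p) (cell R g n p)"
proof (rule bij_betw_byWitness[where f' = phi_inv])
  show "\<forall>x\<in>cell L g n p. phi_inv (phi x) = x" unfolding L_simps using phi_inv_phi homL_keys by blast
  show "\<forall>x\<in>cell R g n p. phi (phi_inv x) = x" unfolding R_simps using phi_phi_inv homR_keys by blast
  show "phi ` cell L g n p \<subseteq> cell R g n p" unfolding L_simps R_simps using phi_clsL keys_lin_ext_Phi by auto
  show "phi_inv ` cell R g n p \<subseteq> cell L g n p" unfolding L_simps R_simps using phi_inv_clsR keys_lin_ext_Psi by auto
qed

text \<open>\<open>phi\<close> returns the representative selected by \<open>clsR\<close>, so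
  invariance of the Feynman differential under relations is used in addition to
  \<open>Phi_dif\<close>.\<close>

lemma phi_dif: "x \<in> cell L g n p \<Longrightarrow> phi (dif L g n p x) = dif R g n p (phi x)"
proof -
  assume x: "x \<in> cell L g n p"
  have "lin_ext (\<lambda>h. lin_ext Phi (dL h) - lin_ext DR (Phi h)) x \<in> RelR"
    using cellL_keys[OF x] by (intro lin_ext_in_subspace[OF subspace_RelR] Phi_dif) blast
  then have 1: "lin_ext Phi (lin_ext dL x) - lin_ext DR (lin_ext Phi x) \<in> RelR"
    by (simp add: lin_ext_fun_diff lin_ext_lin_ext)
  have "lin_ext DR (clsR (lin_ext Phi x) - lin_ext Phi x) \<in> RelR"
    by (rule E.F.derivation_relators[OF clsR_RelR])
  then have "lin_ext DR (lin_ext Phi x) - lin_ext DR (clsR (lin_ext Phi x)) \<in> RelR"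
    unfolding lin_ext_diff by (rule RelR_diff_sym)
  from RelR_trans[OF 1 this] show ?thesis
    unfolding L_simps R_simps phi_clsL phi_def[of x] clsR(3) .
qed

text \<open>\<open>Psi\<close> preserves type and degree of generators, so the same tuples fit
  before and after; on these \<open>Psi_graft\<close> applies.\<close>

lemma Psi_graft_sums:
  assumes \<Gamma>: "stable_graph \<Gamma>" and Y: "\<And>Y. Y \<in> set Ys \<Longrightarrow> Poly_Mapping.keys Y \<subseteq> gensR"
  shows "lin_ext Psi (graft_sums (\<not> tw) \<Gamma> ps Ys) = graft_sums (\<not> tw) \<Gamma> ps (map (lin_ext Psi) Ys)"
  unfolding graft_sums_eq_ml ml_linear_out[OF flinear_lin_ext] ml_map_lin_ext
proof (rule ml_cong)
  let ?t = "\<not> tw"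
  fix hs assume hs: "in_keys hs Ys"
  have g: "set hs \<subseteq> gensR" by (rule in_keys_subset[OF hs Y])
  have F: "fits ?t \<Gamma> ps ks = fits ?t \<Gamma> ps hs" if ks: "in_keys ks (map Psi hs)" for ks
  proof -
    have l: "length ks = length hs" using list_all2_lengthD[OF ks] by simp
    have "vtype (ks ! i) = vtype (hs ! i) \<and> gdeg ?t (ks ! i) = gdeg ?t (hs ! i)" if i: "i < length hs" for i
    proof -
      have "hs ! i \<in> gensR" using g nth_mem[OF i] by blast
      from keys_Psi[OF this] show ?thesis using list_all2_nthD2[OF ks, of i] i by auto
    qed
    then have "map vtype ks = map vtype hs" "map (gdeg ?t) ks = map (gdeg ?t) hs"
      using l by (simp_all add: list_eq_iff_nth_eq)
    then show ?thesis by (simp add: fits_iff)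
  qed
  have "ml (map Psi hs) (\<lambda>ks. if fits ?t \<Gamma> ps ks then graft ?t \<Gamma> ks else 0) =
      ml (map Psi hs) (\<lambda>ks. if fits ?t \<Gamma> ps hs then graft ?t \<Gamma> ks else (0 :: _ \<Rightarrow>\<^sub>0 'k))"
    by (rule ml_cong) (simp add: F)
  moreover have "lin_ext Psi (graft ?t \<Gamma> hs) = ml (map Psi hs) (graft ?t \<Gamma>)" if "fits ?t \<Gamma> ps hs"
    using that by (intro Psi_graft[OF g \<Gamma>]) (simp add: fits_iff)
  ultimately show "lin_ext Psi (if fits ?t \<Gamma> ps hs then graft ?t \<Gamma> hs else 0) =
      ml (map Psi hs) (\<lambda>ks. if fits ?t \<Gamma> ps ks then graft ?t \<Gamma> ks else 0)"
    by simp
qed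

text \<open>The only discrepancy is the projection \<open>clsL\<close> on each label, which grafting
  absorbs.\<close>

lemma phi_inv_cmp:
  assumes \<Gamma>: "stable_graph \<Gamma>" and Y: "\<And>Y. Y \<in> set Ys \<Longrightarrow> Poly_Mapping.keys Y \<subseteq> gensR"
  shows "phi_inv (cmp R \<Gamma> ps Ys) = cmp L \<Gamma> ps (map phi_inv Ys)"
proof -
  have k: "Poly_Mapping.keys (lin_ext Psi Y) \<subseteq> gensL" if "Y \<in> set Ys" for Y
    using Y[OF that] keys_Psi by (intro keys_lin_ext) blast
  have "graft_sums (\<not> tw) \<Gamma> ps (map phi_inv Ys) - graft_sums (\<not> tw) \<Gamma> ps (map (lin_ext Psi) Ys) \<in> RelL"
  proof (rule graft_sums_cong[OF \<Gamma> UNIV_I linear_cells_P])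
    show "list_all2 (\<lambda>f g. f - g \<in> RelL) (map phi_inv Ys) (map (lin_ext Psi) Ys)"
      by (simp add: list_all2_conv_all_nth phi_inv_def clsL_RelL)
    show "Poly_Mapping.keys f \<subseteq> gensL" if f: "f \<in> set (map phi_inv Ys) \<union> set (map (lin_ext Psi) Ys)" for f
    proof -
      obtain Y where "Y \<in> set Ys" "f = clsL (lin_ext Psi Y) \<or> f = lin_ext Psi Y"
        using f unfolding phi_inv_def set_map by blast
      then show ?thesis using k[of Y] keys_clsL[of "lin_ext Psi Y"] by blast
    qed
  qed
  then have "clsL (graft_sums (\<not> tw) \<Gamma> ps (map phi_inv Ys)) = clsL (graft_sums (\<not> tw) \<Gamma> ps (map (lin_ext Psi) Ys))"
    unfolding clsL(3) .
  moreover have "lin_ext Psi (graft_sums (\<not> tw) \<Gamma> ps Ys) = graft_sums (\<not> tw) \<Gamma> ps (map (lin_ext Psi) Ys)"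
    by (rule Psi_graft_sums[OF \<Gamma> Y])
  ultimately show ?thesis unfolding L_simps R_simps phi_inv_clsR by simp
qed

text \<open>Transferred from \<open>phi_inv\<close>: the labels and the composite lie where the two
  maps are mutually inverse.\<close>

lemma phi_cmp:
  assumes \<Gamma>: "stable_graph \<Gamma>" and dec: "decorates L (verts \<Gamma>) ps xs"
  shows "phi (cmp L \<Gamma> ps xs) = cmp R \<Gamma> ps (map phi xs)"
proof -
  have len: "length xs = nverts \<Gamma>" using decorates_lengths[OF dec] by simp
  have x: "phi_inv (phi x) = x \<and> Poly_Mapping.keys (phi x) \<subseteq> gensR" if x: "x \<in> set xs" for x
  proof -
    obtain i where i: "i < nverts \<Gamma>" "xs ! i = x" using x len by (metis in_set_conv_nth)
    then have c: "x \<in> cell L (fst (verts \<Gamma> ! i)) (snd (verts \<Gamma> ! i)) (ps ! i)" using decorates_nth[OF dec i(1)] by simp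
    then have "phi_inv (phi x) = x" unfolding L_simps using phi_inv_phi homL_keys by blast
    moreover have "phi x \<in> cell R (fst (verts \<Gamma> ! i)) (snd (verts \<Gamma> ! i)) (ps ! i)"
      using bij_betwE[OF bij_phi] c by blast
    ultimately show ?thesis using cellR_keys by blast
  qed
  have k: "Poly_Mapping.keys Y \<subseteq> gensR" if "Y \<in> set (map phi xs)" for Y using that x by auto
  have "map phi_inv (map phi xs) = xs" using x by (simp add: map_idI)
  moreover have "phi_inv (cmp R \<Gamma> ps (map phi xs)) = cmp L \<Gamma> ps (map phi_inv (map phi xs))"
    by (rule phi_inv_cmp[OF \<Gamma> k])
  ultimately have c: "cmp L \<Gamma> ps xs = phi_inv (cmp R \<Gamma> ps (map phi xs))" by simp
  have "Poly_Mapping.keys (graft_sums (\<not> tw) \<Gamma> ps (map phi xs)) \<subseteq> {h \<in> gensR. vtype h = (genus \<Gamma>, arity \<Gamma>) \<and>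
      gdeg (\<not> tw) h = sum_list ps + tdeg (\<not> tw) \<Gamma>}"
    by (rule keys_graft_sums[OF \<Gamma> UNIV_I k])
  then have "Poly_Mapping.keys (graft_sums (\<not> tw) \<Gamma> ps (map phi xs)) \<subseteq> gensR" by blast
  then show ?thesis unfolding c unfolding R_simps by (rule phi_phi_inv)
qed

lemma modular_iso_phi: "modular_iso (\<not> tw) L R (\<lambda>g n p. phi)"
  unfolding modular_iso_def
proof (intro conjI allI ballI impI)
  show "bij_betw phi (cell L g n p) (cell R g n p)" for g n p by (rule bij_phi)
  show "phi (scl L c x + y) = scl R c (phi x) + phi y" for c x y
    by (simp add: L_simps R_simps phi_def lin_ext_add lin_ext_scale flinear_add[OF clsR(1)] flinear_scale[OF clsR(1)])
  show "phi (dif L g n p x) = dif R g n p (phi x)" if "x \<in> cell L g n p" for g n p x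
    using that by (rule phi_dif)
  fix \<Gamma> ps xs assume *: "\<Gamma> \<in> graphs UNIV" "decorates L (verts \<Gamma>) ps xs"
  have "length xs = nverts \<Gamma>" using decorates_lengths[OF *(2)] by simp
  then have m: "map (\<lambda>i. phi (xs ! i)) [0..<nverts \<Gamma>] = map phi xs" by (intro nth_equalityI) simp_all
  show "phi (cmp L \<Gamma> ps xs) = cmp R \<Gamma> ps (map (\<lambda>i. phi (xs ! i)) [0..<nverts \<Gamma>])"
    unfolding m using *(1) by (intro phi_cmp *(2)) (simp add: graphs_def)
qed

end

theorem corollary1p3:
  fixes tw :: bool and \<O> :: "('k::field_char_0, 'a::ab_group_add) opd"
  assumes "cyclic_operad tw \<O>" and "duality_compatible {0} \<O>"
  shows "\<exists>\<phi>. modular_iso (\<not> tw)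
           (modular_envelope (\<not> tw) (cyclic_feynman tw \<O>))
           (modular_feynman tw (extend_by_zero \<O>)) \<phi>"
proof -
  interpret corollary_setting tw \<O> by (rule corollary_setting.intro[OF assms])
  show ?thesis using modular_iso_phi by blast
qed

end
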